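(* Let $\mathfrak g$ be the simple Lie algebra of type $G_2$ with the matrices $G[r]$ as in the context, and let $$S_2=\mathrm{tr}\, G[-1]^2,$$ $$S_6=\mathrm{tr}\, G[-1]^6+5\,\mathrm{tr}\, G[-2]G[-1]^4+14\,\mathrm{tr}\, G[-3]G[-1]^3+456\,\mathrm{tr}\, G[-3]^2-639\,\mathrm{tr}\, G[-2]^3+31\,\mathrm{tr}\, G[-2]^2G[-1]^2-312\,\mathrm{tr}\, G[-3]G[-2]G[-1].$$ Then $S_2$ and $S_6$ form a complete set of Segal--Sugawara vectors for $\mathfrak g$; that is, $S_2,S_6\in\mathfrak z(\widehat{\mathfrak g})$, all elements $D^kS_2$ and $D^kS_6$ with $k\geqslant 0$ are algebraically independent, and every element of $\mathfrak z(\widehat{\mathfrak g})$ is a polynomial in the $D^kS_2$ and $D^kS_6$.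
   Context: Realization of $\mathfrak g$. For $1\le i,j\le 7$ put $i'=8-i$ and $F_{ij}=E_{ij}-E_{j'i'}\in\mathfrak{gl}_7$, where the $E_{ij}$ are the matrix units; the $F_{ij}$ span $\mathfrak o_7$. Define elements $G_{ij}$, $1\le i,j\le 7$, by $G_{11}=2F_{11}-F_{22}-F_{33}$, $G_{22}=2F_{22}-F_{11}-F_{33}$, $G_{33}=2F_{33}-F_{11}-F_{22}$; $G_{ij}=3F_{ij}$ for $1\le i\ne j\le 3$; $G_{14}=2F_{14}-\sqrt2F_{3'2}$, $G_{24}=2F_{24}-\sqrt2F_{1'3}$, $G_{34}=2F_{34}-\sqrt2F_{2'1}$; $G_{41}=2F_{41}-\sqrt2F_{23'}$, $G_{42}=2F_{42}-\sqrt2F_{31'}$, $G_{43}=2F_{43}-\sqrt2F_{12'}$; the remaining $G_{ij}$ are determined by $G_{ij}+G_{j'i'}=0$ for all $i,j$ together with $G_{14}=-\sqrt2G_{3'2}$, $G_{24}=-\sqrt2G_{1'3}$, $G_{34}=-\sqrt2G_{2'1}$, $G_{41}=-\sqrt2G_{23'}$, $G_{42}=-\sqrt2G_{31'}$, $G_{43}=-\sqrt2G_{12'}$. The span $\mathfrak g$ of the $G_{ij}$ is a 14-dimensional Lie subalgebra of $\mathfrak o_7\subset\mathfrak{gl}_7$ over $\mathbb C$, simple of type $G_2$. Equip $\mathfrak g$ with the form $\langle X,Y\rangle=\frac16\mathrm{tr}\,XY$ (trace of $7\times7$ matrices). Affine algebra. $\widehat{\mathfrak g}=\mathfrak g[t,t^{-1}]\oplus\mathbb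 CK$ with $K$ central and $[X[r],Y[s]]=[X,Y][r+s]+r\,\delta_{r,-s}\langle X,Y\rangle K$, where $X[r]=X\,t^r$. With this form the critical level is $K=-12$. The vacuum module at the critical level $V(\mathfrak g)_{\mathrm{cri}}$ is the quotient of $\mathrm U(\widehat{\mathfrak g})$ by the left ideal generated by $K+12$ and $\mathfrak g[t]$; as a vector space it is identified with $\mathrm U(t^{-1}\mathfrak g[t^{-1}])$. The Feigin--Frenkel center is $\mathfrak z(\widehat{\mathfrak g})=\{v\in V(\mathfrak g)_{\mathrm{cri}}\mid \mathfrak g[t]\,v=0\}$; its elements are called Segal--Sugawara vectors. It is a commutative subalgebra of $\mathrm U(t^{-1}\mathfrak g[t^{-1}])$ under this identification, invariant under the derivation $D=-d/dt$ of $\mathrm U(t^{-1}\mathfrak g[t^{-1}])$, $D:X[r]\mapsto -rX[r-1]$ for $X\in\mathfrak g$, $r<0$. Matrices. $G[r]=\sum_{i,j=1}^7e_{ji}\otimes G_{ij}[r]\in\mathrm{End}\,\mathbb C^7\otimes\mathrm U(\widehat{\mathfrak g})$, where $e_{ij}$ are the matrix units of $\mathrm{End}\,\mathbb C^7$. Products are taken in $\mathrm{End}\,\mathbb C^7\otimes\mathrm U(\widehat{\mathfrak g})$ and $\mathrm{tr}$ is the trace over $\mathrm{End}\,\mathbb C^7$, so traces of products of $G[r]$ with $r<0$ lie in $\mathrm U(t^{-1}\mathfrak g[t^{-1}])$. *)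

theory Defs
  imports "HOL-Analysis.Analysis" "HOL-Library.Poly_Mapping"
begin

section \<open>Complex Lie algebras\<close>

class complex_lie_algebra = ab_group_add +
  fixes cscale :: "complex \<Rightarrow> 'a \<Rightarrow> 'a" (infixr \<open>\<cdot>\<close> 75)
    and bracket :: "'a \<Rightarrow> 'a \<Rightarrow> 'a"
  assumes cscale_add_right: "c \<cdot> (x + y) = c \<cdot> x + c \<cdot> y"
    and cscale_add_left: "(c + d) \<cdot> x = c \<cdot> x + d \<cdot> x"
    and cscale_cscale: "c \<cdot> d \<cdot> x = (c * d) \<cdot> x"
    and cscale_one: "1 \<cdot> x = x"
    and bracket_add_left: "bracket (x + y) z = bracket x z + bracket y z"
    and bracket_add_right: "bracket x (y + z) = bracket x y + bracket x z"
    and bracket_cscale_left: "bracket (c \<cdot> x) y = c \<cdot> bracket x y"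
    and bracket_cscale_right: "bracket x (c \<cdot> y) = c \<cdot> bracket x y"
    and bracket_self: "bracket x x = 0"
    and jacobi: "bracket x (bracket y z) + bracket y (bracket z x) + bracket z (bracket x y) = 0"
begin

lemma cscale_zero_right [simp]: "c \<cdot> 0 = 0"
  using cscale_add_right [of c 0 0] by simp

lemma cscale_zero_left [simp]: "0 \<cdot> x = 0"
  using cscale_add_left [of 0 0 x] by simp

lemma bracket_zero_left [simp]: "bracket 0 y = 0"
  using bracket_add_left [of 0 0 y] by simp

lemma bracket_zero_right [simp]: "bracket x 0 = 0"
  using bracket_add_right [of x 0 0] by simp

lemma bracket_antisym: "bracket x y = - bracket y x"
proof -
  have "bracket (x + y) (x + y) = bracket x y + bracket y x"
    by (subst bracket_add_left) (simp add: bracket_add_right bracket_self)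
  then have "bracket x y + bracket y x = 0" by (simp only: bracket_self)
  then show ?thesis by (simp add: eq_neg_iff_add_eq_0)
qed

end


section \<open>Universal enveloping algebras\<close>

datatype 'a free_monoid = FM (word: "'a list")

instantiation free_monoid :: (type) monoid_add
begin
definition zero_free_monoid :: "'a free_monoid" where "0 = FM []"
definition plus_free_monoid :: "'a free_monoid \<Rightarrow> 'a free_monoid \<Rightarrow> 'a free_monoid"
  where "v + w = FM (word v @ word w)"
instance
  by standard (simp_all add: zero_free_monoid_def plus_free_monoid_def)
end

text \<open>With concatenation as the addition of exponents, the convolution product of
  \<^theory>\<open>HOL-Library.Poly_Mapping\<close> makes this the free associative unital algebra
  on the set of all elements of \<open>'a\<close>.\<close>

type_synonym 'a free_algebra = "'a free_monoid \<Rightarrow>\<^sub>0 complex"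

definition letter :: "'a \<Rightarrow> 'a free_algebra"
  where "letter x = Poly_Mapping.single (FM [x]) 1"

definition scalar :: "complex \<Rightarrow> 'a free_algebra"
  where "scalar c = Poly_Mapping.single 0 c"

inductive_set enveloping_ideal :: "'a::complex_lie_algebra free_algebra set" where
  add_rel: "letter (x + y) - letter x - letter y \<in> enveloping_ideal"
| cscale_rel: "letter (c \<cdot> x) - scalar c * letter x \<in> enveloping_ideal"
| bracket_rel: "letter x * letter y - letter y * letter x - letter (bracket x y) \<in> enveloping_ideal"
| zero: "0 \<in> enveloping_ideal"
| add: "p \<in> enveloping_ideal \<Longrightarrow> q \<in> enveloping_ideal \<Longrightarrow> p + q \<in> enveloping_ideal"
| mult_left: "p \<in> enveloping_ideal \<Longrightarrow> a * p \<in> enveloping_ideal"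
| mult_right: "p \<in> enveloping_ideal \<Longrightarrow> p * a \<in> enveloping_ideal"

lemma enveloping_ideal_uminus: "p \<in> enveloping_ideal \<Longrightarrow> - p \<in> enveloping_ideal"
  using enveloping_ideal.mult_left [of p "- 1"] by simp

lemma enveloping_ideal_diff:
  "p \<in> enveloping_ideal \<Longrightarrow> q \<in> enveloping_ideal \<Longrightarrow> p - q \<in> enveloping_ideal"
  using enveloping_ideal.add [of p "- q"] enveloping_ideal_uminus [of q] by simp

lemma poly_mapping_additive_induct:
  assumes "\<And>k c. P (Poly_Mapping.single k c)" and "\<And>p q. P p \<Longrightarrow> P q \<Longrightarrow> P (p + q)"
  shows "P (p :: 'k \<Rightarrow>\<^sub>0 'b::comm_monoid_add)"
proof -
  have 1: "p = (\<Sum>k\<in>Poly_Mapping.keys p. Poly_Mapping.single k (Poly_Mapping.lookup p k))"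
    by (rule poly_mapping_eqI)
      (auto simp: lookup_sum lookup_single when_def in_keys_iff)
  have "P (\<Sum>k\<in>A. Poly_Mapping.single k (Poly_Mapping.lookup p k))" if "finite A" for A
    using that
  proof induction
    case empty
    show ?case using assms(1) [of undefined 0] by simp
  next
    case (insert k A)
    then show ?case by (simp add: assms)
  qed
  from this [OF finite_keys, of p] show ?thesis
    by (subst 1)
qed

lemma free_monoid_add_eq_0_iff: "v + w = 0 \<longleftrightarrow> v = 0 \<and> w = (0 :: 'a free_monoid)"
  by (cases v; cases w) (simp add: zero_free_monoid_def plus_free_monoid_def)

lemma lookup_mult_0:
  "Poly_Mapping.lookup (p * q) 0 = Poly_Mapping.lookup p 0 * Poly_Mapping.lookup q 0"
  for p q :: "'a free_algebra"
proof (induction p rule: poly_mapping_additive_induct)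
  case (1 v c)
  show ?case
    by (induction q rule: poly_mapping_additive_induct)
      (simp_all add: mult_single lookup_single when_def free_monoid_add_eq_0_iff distrib_left lookup_add)
next
  case (2 p p')
  then show ?case by (simp add: distrib_right lookup_add)
qed

lemma lookup_letter_0: "Poly_Mapping.lookup (letter x) 0 = 0"
  by (simp add: letter_def lookup_single zero_free_monoid_def)

lemma enveloping_ideal_lookup_0: "p \<in> enveloping_ideal \<Longrightarrow> Poly_Mapping.lookup p 0 = 0"
  by (induction rule: enveloping_ideal.induct)
    (simp_all add: lookup_mult_0 lookup_add lookup_minus lookup_letter_0)

lemma one_notin_enveloping_ideal: "1 \<notin> enveloping_ideal"
  using enveloping_ideal_lookup_0 [of 1] by auto

quotient_type (overloaded) 'a uenv = "'a::complex_lie_algebra free_algebra"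
  / "\<lambda>p q. p - q \<in> enveloping_ideal"
proof (rule equivpI)
  show "reflp (\<lambda>p q. p - q \<in> (enveloping_ideal :: 'a free_algebra set))"
    by (simp add: reflp_def enveloping_ideal.zero)
  show "symp (\<lambda>p q. p - q \<in> (enveloping_ideal :: 'a free_algebra set))"
  proof (rule sympI)
    fix p q :: "'a free_algebra"
    assume "p - q \<in> enveloping_ideal"
    from enveloping_ideal_uminus [OF this] show "q - p \<in> enveloping_ideal" by simp
  qed
  show "transp (\<lambda>p q. p - q \<in> (enveloping_ideal :: 'a free_algebra set))"
  proof (rule transpI)
    fix p q r :: "'a free_algebra"
    assume "p - q \<in> enveloping_ideal" "q - r \<in> enveloping_ideal"
    from enveloping_ideal.add [OF this] show "p - r \<in> enveloping_ideal" by simp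
  qed
qed

instantiation uenv :: (complex_lie_algebra) ring_1
begin
lift_definition zero_uenv :: "'a uenv" is 0 .
lift_definition one_uenv :: "'a uenv" is 1 .
lift_definition plus_uenv :: "'a uenv \<Rightarrow> 'a uenv \<Rightarrow> 'a uenv" is "(+)"
proof -
  fix p p' q q' :: "'a free_algebra"
  assume "p - p' \<in> enveloping_ideal" "q - q' \<in> enveloping_ideal"
  then have "(p - p') + (q - q') \<in> enveloping_ideal" by (rule enveloping_ideal.add)
  then show "p + q - (p' + q') \<in> enveloping_ideal" by (simp add: algebra_simps)
qed
lift_definition uminus_uenv :: "'a uenv \<Rightarrow> 'a uenv" is uminus
proof -
  fix p p' :: "'a free_algebra"
  assume "p - p' \<in> enveloping_ideal"
  then have "- (p - p') \<in> enveloping_ideal" by (rule enveloping_ideal_uminus)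
  then show "- p - - p' \<in> enveloping_ideal" by (simp add: algebra_simps)
qed
lift_definition minus_uenv :: "'a uenv \<Rightarrow> 'a uenv \<Rightarrow> 'a uenv" is "(-)"
proof -
  fix p p' q q' :: "'a free_algebra"
  assume "p - p' \<in> enveloping_ideal" "q - q' \<in> enveloping_ideal"
  then have "(p - p') - (q - q') \<in> enveloping_ideal" by (rule enveloping_ideal_diff)
  then show "p - q - (p' - q') \<in> enveloping_ideal" by (simp add: algebra_simps)
qed
lift_definition times_uenv :: "'a uenv \<Rightarrow> 'a uenv \<Rightarrow> 'a uenv" is "(*)"
proof -
  fix p p' q q' :: "'a free_algebra"
  assume "p - p' \<in> enveloping_ideal" "q - q' \<in> enveloping_ideal"
  then have "(p - p') * q + p' * (q - q') \<in> enveloping_ideal"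
    by (intro enveloping_ideal.intros)
  then show "p * q - p' * q' \<in> enveloping_ideal" by (simp add: algebra_simps)
qed
instance
proof
  show "(0 :: 'a uenv) \<noteq> 1"
    by transfer (use one_notin_enveloping_ideal enveloping_ideal_uminus [of "- 1"] in auto)
qed (transfer; simp add: algebra_simps enveloping_ideal.zero)+
end

lift_definition uscalar :: "complex \<Rightarrow> 'a::complex_lie_algebra uenv" is scalar .

lift_definition uembed :: "'a::complex_lie_algebra \<Rightarrow> 'a uenv" is letter .

lemma uembed_add: "uembed (x + y) = uembed x + uembed y"
  by transfer (use enveloping_ideal.add_rel in \<open>simp add: algebra_simps\<close>)

lemma uembed_cscale: "uembed (c \<cdot> x) = uscalar c * uembed x"
  by transfer (rule enveloping_ideal.cscale_rel)

lemma uembed_bracket: "uembed (bracket x y) = uembed x * uembed y - uembed y * uembed x"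
proof transfer
  fix x y :: 'a
  show "letter (bracket x y) - (letter x * letter y - letter y * letter x) \<in> enveloping_ideal"
    using enveloping_ideal_uminus [OF enveloping_ideal.bracket_rel [of x y]] by simp
qed

inductive_set generated_subalgebra :: "'a::complex_lie_algebra set \<Rightarrow> 'a uenv set"
  for A :: "'a set" where
  embed: "x \<in> A \<Longrightarrow> uembed x \<in> generated_subalgebra A"
| scalar: "uscalar c \<in> generated_subalgebra A"
| add: "u \<in> generated_subalgebra A \<Longrightarrow> v \<in> generated_subalgebra A \<Longrightarrow> u + v \<in> generated_subalgebra A"
| mult: "u \<in> generated_subalgebra A \<Longrightarrow> v \<in> generated_subalgebra A \<Longrightarrow> u * v \<in> generated_subalgebra A"


subsection \<open>Extension of a Lie algebra derivation\<close>

primrec word_deriv :: "('a \<Rightarrow> 'a) \<Rightarrow> 'a list \<Rightarrow> 'a free_algebra" where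
  "word_deriv d [] = 0"
| "word_deriv d (x # w) =
    letter (d x) * Poly_Mapping.single (FM w) 1 + letter x * word_deriv d w"

definition free_deriv :: "('a \<Rightarrow> 'a) \<Rightarrow> 'a free_algebra \<Rightarrow> 'a free_algebra"
  where "free_deriv d p =
    (\<Sum>w\<in>Poly_Mapping.keys p. scalar (Poly_Mapping.lookup p w) * word_deriv d (word w))"

lemma scalar_0 [simp]: "scalar 0 = 0"
  and scalar_1 [simp]: "scalar 1 = 1"
  and scalar_add: "scalar (c + e) = scalar c + scalar e"
  and scalar_mult: "scalar (c * e) = scalar c * scalar e"
  and scalar_uminus: "scalar (- c) = - scalar c"
  by (simp_all add: scalar_def single_add mult_single single_uminus)

lemma scalar_commute: "scalar c * p = p * scalar c"
  by (induction p rule: poly_mapping_additive_induct)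
    (simp_all add: scalar_def mult_single mult.commute distrib_left distrib_right)

lemma single_conv_scalar: "Poly_Mapping.single w c = scalar c * Poly_Mapping.single w 1"
  by (simp add: scalar_def mult_single)

lemma free_deriv_add: "free_deriv d (p + q) = free_deriv d p + free_deriv d q"
  unfolding free_deriv_def
  by (rule setsum_keys_plus_distrib) (simp_all add: scalar_add distrib_right)

lemma free_deriv_0 [simp]: "free_deriv d 0 = 0"
  by (simp add: free_deriv_def)

lemma free_deriv_uminus: "free_deriv d (- p) = - free_deriv d p"
  using free_deriv_add [of d p "- p"] by (simp add: eq_neg_iff_add_eq_0 add.commute)

lemma free_deriv_diff: "free_deriv d (p - q) = free_deriv d p - free_deriv d q"
  using free_deriv_add [of d p "- q"] by (simp add: free_deriv_uminus)

lemma free_deriv_single: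
  "free_deriv d (Poly_Mapping.single w c) = scalar c * word_deriv d (word w)"
  by (simp add: free_deriv_def)

lemma free_deriv_letter [simp]: "free_deriv d (letter x) = letter (d x)"
  by (simp add: free_deriv_single letter_def mult_single flip: zero_free_monoid_def)

lemma free_deriv_scalar [simp]: "free_deriv d (scalar c) = 0"
  by (simp add: free_deriv_single zero_free_monoid_def scalar_def)

lemma word_deriv_append:
  "word_deriv d (v @ w) = word_deriv d v * Poly_Mapping.single (FM w) 1
    + Poly_Mapping.single (FM v) 1 * word_deriv d w"
proof (induction v)
  case Nil
  show ?case by (simp flip: zero_free_monoid_def)
next
  case (Cons x v)
  have "Poly_Mapping.single (FM (v @ w)) (1::complex) =
      Poly_Mapping.single (FM v) 1 * Poly_Mapping.single (FM w) 1"
    and "Poly_Mapping.single (FM (x # v)) (1::complex) = letter x * Poly_Mapping.single (FM v) 1"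
    by (simp_all add: mult_single plus_free_monoid_def letter_def)
  with Cons show ?case by (simp add: distrib_left distrib_right mult.assoc)
qed

lemma free_deriv_mult: "free_deriv d (p * q) = free_deriv d p * q + p * free_deriv d q"
proof (induction p rule: poly_mapping_additive_induct)
  case (1 v c)
  show ?case
  proof (induction q rule: poly_mapping_additive_induct)
    case (1 w e)
    have "free_deriv d (Poly_Mapping.single v c * Poly_Mapping.single w e) =
        scalar (c * e) * word_deriv d (word v @ word w)"
      by (simp add: mult_single free_deriv_single plus_free_monoid_def)
    also have "\<dots> = scalar c * word_deriv d (word v) * (scalar e * Poly_Mapping.single w 1)
        + scalar c * Poly_Mapping.single v 1 * (scalar e * word_deriv d (word w))"
      by (simp add: word_deriv_append scalar_mult distrib_left mult.assoc scalar_commute [of e])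
    finally show ?case
      by (simp add: free_deriv_single flip: single_conv_scalar)
  next
    case (2 q q')
    then show ?case by (simp add: distrib_left free_deriv_add)
  qed
next
  case (2 p p')
  then show ?case by (simp add: distrib_right free_deriv_add)
qed

definition lie_derivation :: "('a::complex_lie_algebra \<Rightarrow> 'a) \<Rightarrow> bool"
  where "lie_derivation d \<longleftrightarrow>
    (\<forall>x y. d (x + y) = d x + d y) \<and> (\<forall>c x. d (c \<cdot> x) = c \<cdot> d x) \<and>
    (\<forall>x y. d (bracket x y) = bracket (d x) y + bracket x (d y))"

lemma free_deriv_enveloping_ideal:
  assumes "lie_derivation d" and "p \<in> enveloping_ideal"
  shows "free_deriv d p \<in> enveloping_ideal"
  using assms(2)
proof induction
  case (add_rel x y)
  then show ?case
    using assms(1) enveloping_ideal.add_rel [of "d x" "d y"]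
    by (simp add: free_deriv_diff lie_derivation_def)
next
  case (cscale_rel c x)
  then show ?case
    using assms(1) enveloping_ideal.cscale_rel [of c "d x"]
    by (simp add: free_deriv_diff free_deriv_mult lie_derivation_def)
next
  case (bracket_rel x y)
  have d: "d (bracket x y) = bracket (d x) y + bracket x (d y)"
    using assms(1) by (simp add: lie_derivation_def)
  have "(letter (d x) * letter y - letter y * letter (d x) - letter (bracket (d x) y))
      + (letter x * letter (d y) - letter (d y) * letter x - letter (bracket x (d y)))
      - (letter (bracket (d x) y + bracket x (d y)) - letter (bracket (d x) y) - letter (bracket x (d y)))
      \<in> enveloping_ideal" (is "?p \<in> _")
    by (intro enveloping_ideal_diff enveloping_ideal.intros)
  also have "?p = free_deriv d (letter x * letter y - letter y * letter x - letter (bracket x y))"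
    by (simp only: free_deriv_diff free_deriv_mult free_deriv_letter d) (simp add: algebra_simps)
  finally show ?case .
qed (simp_all add: free_deriv_add free_deriv_mult enveloping_ideal.intros)


section \<open>The Lie algebra of type \<open>G\<^sub>2\<close>\<close>

text \<open>Rows and columns are indexed by the type \<^typ>\<open>7\<close>, that is by the integers modulo 7
  with representatives \<open>1, \<dots>, 7\<close> (so \<open>7 = 0\<close>, which the simplifier uses as normal form).
  The involution \<open>i' = 8 - i\<close> of these representatives is also \<open>8 - i\<close> modulo 7.\<close>

type_synonym mat7 = "complex^7^7"

definition Emat :: "7 \<Rightarrow> 7 \<Rightarrow> mat7"
  where "Emat i j = (\<chi> a b. if a = i \<and> b = j then 1 else 0)"

definition Fmat :: "7 \<Rightarrow> 7 \<Rightarrow> mat7"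
  where "Fmat i j = Emat i j - Emat (8 - j) (8 - i)"

definition Gmat_upper :: "7 \<Rightarrow> 7 \<Rightarrow> mat7" where
  "Gmat_upper i j =
    (if (i, j) = (1, 1) then 2 *\<^sub>R Fmat 1 1 - Fmat 2 2 - Fmat 3 3
     else if (i, j) = (2, 2) then 2 *\<^sub>R Fmat 2 2 - Fmat 1 1 - Fmat 3 3
     else if (i, j) = (3, 3) then 2 *\<^sub>R Fmat 3 3 - Fmat 1 1 - Fmat 2 2
     else if i \<in> {1, 2, 3} \<and> j \<in> {1, 2, 3} then 3 *\<^sub>R Fmat i j
     else if (i, j) = (1, 4) then 2 *\<^sub>R Fmat 1 4 - sqrt 2 *\<^sub>R Fmat 5 2
     else if (i, j) = (2, 4) then 2 *\<^sub>R Fmat 2 4 - sqrt 2 *\<^sub>R Fmat 7 3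
     else if (i, j) = (3, 4) then 2 *\<^sub>R Fmat 3 4 - sqrt 2 *\<^sub>R Fmat 6 1
     else if (i, j) = (4, 1) then 2 *\<^sub>R Fmat 4 1 - sqrt 2 *\<^sub>R Fmat 2 5
     else if (i, j) = (4, 2) then 2 *\<^sub>R Fmat 4 2 - sqrt 2 *\<^sub>R Fmat 3 7
     else if (i, j) = (4, 3) then 2 *\<^sub>R Fmat 4 3 - sqrt 2 *\<^sub>R Fmat 1 6
     else 0)"

text \<open>The remaining values are the solution of the relations \<open>Gmat_skew\<close> and
  \<open>Gmat_sqrt2\<close> below.\<close>

definition Gmat :: "7 \<Rightarrow> 7 \<Rightarrow> mat7" where
  "Gmat i j =
    (if i \<in> {1, 2, 3, 4} \<and> j \<in> {1, 2, 3, 4} then Gmat_upper i j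
     else if i \<in> {4, 5, 6, 7} \<and> j \<in> {4, 5, 6, 7} then - Gmat_upper (8 - j) (8 - i)
     else if (i, j) = (5, 2) then - (1 / sqrt 2) *\<^sub>R Gmat_upper 1 4
     else if (i, j) = (6, 3) then (1 / sqrt 2) *\<^sub>R Gmat_upper 1 4
     else if (i, j) = (7, 3) then - (1 / sqrt 2) *\<^sub>R Gmat_upper 2 4
     else if (i, j) = (5, 1) then (1 / sqrt 2) *\<^sub>R Gmat_upper 2 4
     else if (i, j) = (6, 1) then - (1 / sqrt 2) *\<^sub>R Gmat_upper 3 4
     else if (i, j) = (7, 2) then (1 / sqrt 2) *\<^sub>R Gmat_upper 3 4
     else if (i, j) = (2, 5) then - (1 / sqrt 2) *\<^sub>R Gmat_upper 4 1
     else if (i, j) = (3, 6) then (1 / sqrt 2) *\<^sub>R Gmat_upper 4 1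
     else if (i, j) = (3, 7) then - (1 / sqrt 2) *\<^sub>R Gmat_upper 4 2
     else if (i, j) = (1, 5) then (1 / sqrt 2) *\<^sub>R Gmat_upper 4 2
     else if (i, j) = (1, 6) then - (1 / sqrt 2) *\<^sub>R Gmat_upper 4 3
     else if (i, j) = (2, 7) then (1 / sqrt 2) *\<^sub>R Gmat_upper 4 3
     else 0)"

lemma UNIV_7: "(UNIV :: 7 set) = {1, 2, 3, 4, 5, 6, 7}"
  by (rule sym, rule card_subset_eq) simp_all

lemma all_7: "(\<forall>i::7. P i) \<longleftrightarrow> P 1 \<and> P 2 \<and> P 3 \<and> P 4 \<and> P 5 \<and> P 6 \<and> P 7"
proof -
  have "(\<forall>i::7. P i) \<longleftrightarrow> (\<forall>i\<in>{1, 2, 3, 4, 5, 6, 7::7}. P i)" by (metis UNIV_7 UNIV_I)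
  then show ?thesis by simp
qed

lemma sum_7: "sum f (UNIV :: 7 set) = f 1 + f 2 + f 3 + f 4 + f 5 + f 6 + f 7"
  unfolding UNIV_7 by (simp add: add.assoc)

lemma Gmat_skew: "Gmat i j + Gmat (8 - j) (8 - i) = 0"
proof -
  have "\<forall>i j. Gmat i j + Gmat (8 - j) (8 - i) = 0"
    unfolding all_7
    by (intro conjI; simp add: Gmat_def Gmat_upper_def [of 4 4])
  from this [rule_format, of i j] show ?thesis .
qed

lemma Gmat_sqrt2:
  "Gmat 1 4 = - sqrt 2 *\<^sub>R Gmat 5 2" "Gmat 2 4 = - sqrt 2 *\<^sub>R Gmat 7 3"
  "Gmat 3 4 = - sqrt 2 *\<^sub>R Gmat 6 1" "Gmat 4 1 = - sqrt 2 *\<^sub>R Gmat 2 5"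
  "Gmat 4 2 = - sqrt 2 *\<^sub>R Gmat 3 7" "Gmat 4 3 = - sqrt 2 *\<^sub>R Gmat 1 6"
  by (simp_all add: Gmat_def)

definition mscale :: "complex \<Rightarrow> mat7 \<Rightarrow> mat7"
  where "mscale c M = (\<chi> a b. c * M $ a $ b)"

definition g2_matrices :: "mat7 set"
  where "g2_matrices = range (\<lambda>c. \<Sum>i\<in>UNIV. \<Sum>j\<in>UNIV. mscale (c i j) (Gmat i j))"

subsection \<open>Closure under commutators\<close>

definition skew_entries :: "mat7 \<Rightarrow> bool"
  where "skew_entries M \<longleftrightarrow> (\<forall>i j. M $ i $ j = - M $ (8 - j) $ (8 - i))"

definition g2_relations :: "mat7 \<Rightarrow> bool" where
  "g2_relations M \<longleftrightarrow>
    M $ 1 $ 1 + M $ 2 $ 2 + M $ 3 $ 3 = 0 \<and>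
    M $ 1 $ 4 = - complex_of_real (sqrt 2) * M $ 5 $ 2 \<and>
    M $ 2 $ 4 = - complex_of_real (sqrt 2) * M $ 7 $ 3 \<and>
    M $ 3 $ 4 = - complex_of_real (sqrt 2) * M $ 6 $ 1 \<and>
    M $ 4 $ 1 = - complex_of_real (sqrt 2) * M $ 2 $ 5 \<and>
    M $ 4 $ 2 = - complex_of_real (sqrt 2) * M $ 3 $ 7 \<and>
    M $ 4 $ 3 = - complex_of_real (sqrt 2) * M $ 1 $ 6"

definition g2_entries :: "mat7 \<Rightarrow> bool"
  where "g2_entries M \<longleftrightarrow> skew_entries M \<and> g2_relations M"

lemma skew_entriesD: "skew_entries M \<Longrightarrow> M $ i $ j = - M $ (8 - j) $ (8 - i)"
  unfolding skew_entries_def by (elim allE)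

lemma skew_entriesI: "(\<And>i j. M $ i $ j = - M $ (8 - j) $ (8 - i)) \<Longrightarrow> skew_entries M"
  unfolding skew_entries_def by (intro allI)

lemma sqrt2_sqrt2: "complex_of_real (sqrt 2) * complex_of_real (sqrt 2) = 2"
  by (simp flip: of_real_mult)

lemma mscale_nth [simp]: "mscale c M $ a $ b = c * M $ a $ b"
  by (simp add: mscale_def)

lemma scaleR_eq_mscale: "r *\<^sub>R M = mscale (complex_of_real r) M"
  by (simp add: vec_eq_iff scaleR_conv_of_real [where 'a = complex])

lemma skew_entries_add:
  assumes "skew_entries M" "skew_entries N"
  shows "skew_entries (M + N)"
proof (rule skew_entriesI)
  fix i j
  show "(M + N) $ i $ j = - (M + N) $ (8 - j) $ (8 - i)"
    unfolding vector_add_component skew_entriesD [OF assms(1), of i j]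
      skew_entriesD [OF assms(2), of i j]
    by (rule minus_add_distrib [symmetric])
qed

lemma skew_entries_mscale:
  assumes "skew_entries M"
  shows "skew_entries (mscale c M)"
proof (rule skew_entriesI)
  fix i j
  show "mscale c M $ i $ j = - mscale c M $ (8 - j) $ (8 - i)"
    unfolding mscale_nth skew_entriesD [OF assms, of i j]
    by (rule mult_minus_right)
qed

lemma g2_relations_add:
  assumes "g2_relations M" "g2_relations N"
  shows "g2_relations (M + N)"
proof -
  have "(M $ 1 $ 1 + M $ 2 $ 2 + M $ 3 $ 3) + (N $ 1 $ 1 + N $ 2 $ 2 + N $ 3 $ 3) = 0"
    using assms by (simp only: g2_relations_def add_0_left)
  then have "M $ 1 $ 1 + N $ 1 $ 1 + (M $ 2 $ 2 + N $ 2 $ 2) + (M $ 3 $ 3 + N $ 3 $ 3) = 0"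
    by (simp only: add_ac)
  with assms show ?thesis
    by (simp only: g2_relations_def vector_add_component distrib_left simp_thms)
qed

lemma g2_relations_mscale:
  assumes "g2_relations M"
  shows "g2_relations (mscale c M)"
  using assms
  by (simp only: g2_relations_def mscale_nth mult.left_commute [of c] mult_zero_right simp_thms
    flip: distrib_left)

lemma g2_entries_0: "g2_entries 0"
  by (simp add: g2_entries_def skew_entries_def g2_relations_def)

lemma g2_entries_add: "g2_entries M \<Longrightarrow> g2_entries N \<Longrightarrow> g2_entries (M + N)"
  by (simp add: g2_entries_def skew_entries_add g2_relations_add)

lemma g2_entries_mscale: "g2_entries M \<Longrightarrow> g2_entries (mscale c M)"
  by (simp add: g2_entries_def skew_entries_mscale g2_relations_mscale)

lemma g2_entries_scaleR: "g2_entries M \<Longrightarrow> g2_entries (r *\<^sub>R M)"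
  by (simp add: scaleR_eq_mscale g2_entries_mscale)

lemma g2_entries_uminus: "g2_entries M \<Longrightarrow> g2_entries (- M)"
  using g2_entries_scaleR [of M "- 1"] by simp

lemma g2_entries_diff: "g2_entries M \<Longrightarrow> g2_entries N \<Longrightarrow> g2_entries (M - N)"
  using g2_entries_add [of M "- N"] g2_entries_uminus [of N] by simp

lemma g2_entries_sum: "(\<And>k. k \<in> A \<Longrightarrow> g2_entries (f k)) \<Longrightarrow> g2_entries (sum f A)"
  by (induction A rule: infinite_finite_induct) (auto simp: g2_entries_0 g2_entries_add)

lemma Fmat_nth:
  "Fmat i j $ a $ b = (if a = i \<and> b = j then 1 else 0) - (if a = 8 - j \<and> b = 8 - i then 1 else 0)"
  by (simp add: Fmat_def Emat_def)

lemma skew_entries_Fmat: "skew_entries (Fmat i j)"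
proof (rule skew_entriesI)
  fix a b
  have "8 - b = i \<longleftrightarrow> b = 8 - i" "8 - a = j \<longleftrightarrow> a = 8 - j"
    "8 - b = 8 - j \<longleftrightarrow> b = j" "8 - a = 8 - i \<longleftrightarrow> a = i"
    by (auto simp: algebra_simps)
  note eqs = this conj_commute [of "b = j"] conj_commute [of "b = 8 - i"]
  show "Fmat i j $ a $ b = - Fmat i j $ (8 - b) $ (8 - a)"
    by (simp only: Fmat_nth eqs minus_diff_eq)
qed

lemma g2_entries_Gmat_upper: "g2_entries (Gmat_upper i j)"
proof -
  have *: "skew_entries (r *\<^sub>R Fmat i j)" for r i j
    unfolding scaleR_eq_mscale by (intro skew_entries_mscale skew_entries_Fmat)
  have "skew_entries (r *\<^sub>R Fmat i j - s *\<^sub>R Fmat k l)" for r s i j k l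
    using skew_entries_add [OF * *, of r i j "- s" k l] by simp
  moreover have "skew_entries (r *\<^sub>R Fmat i j - Fmat k l - Fmat k' l')" for r i j k l k' l'
    using skew_entries_add [OF skew_entries_add [OF * *] *, of r i j "- 1" k l "- 1" k' l'] by simp
  moreover have "skew_entries 0" by (simp add: skew_entries_def)
  ultimately have "skew_entries (Gmat_upper i j)"
    unfolding Gmat_upper_def by (simp only: * if_split simp_thms)
  moreover have "\<forall>i j. g2_relations (Gmat_upper i j)"
    unfolding all_7
    by (intro conjI; simp add: g2_relations_def Gmat_upper_def Fmat_nth
      scaleR_conv_of_real [where 'a = complex] sqrt2_sqrt2)
  ultimately show ?thesis by (simp add: g2_entries_def)
qed

lemma g2_entries_Gmat: "g2_entries (Gmat i j)"
  unfolding Gmat_def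
  by (simp only: g2_entries_scaleR g2_entries_uminus g2_entries_Gmat_upper g2_entries_0
    if_split simp_thms)

lemma g2_entries_eq_0:
  assumes "g2_entries M"
    and "\<And>i j. i \<in> {1, 2, 3} \<Longrightarrow> j \<in> {1, 2, 3} \<Longrightarrow> M $ i $ j = 0"
    and "\<And>i. i \<in> {1, 2, 3} \<Longrightarrow> M $ i $ 4 = 0" "\<And>i. i \<in> {1, 2, 3} \<Longrightarrow> M $ 4 $ i = 0"
  shows "M = 0"
proof -
  have s: "M $ i $ j = - M $ (8 - j) $ (8 - i)" for i j
    using assms(1) unfolding g2_entries_def by (intro skew_entriesD) (elim conjE)
  have s0: "M $ i $ j = 0" if "M $ (8 - j) $ (8 - i) = 0" for i j
    using s [of i j] that by simp
  have d: "M $ i $ j = 0" if "8 - i = j" for i j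
    using s [of i j] that by auto
  have b:
      "M $ 1 $ 1 = 0" "M $ 1 $ 2 = 0" "M $ 1 $ 3 = 0" "M $ 2 $ 1 = 0" "M $ 2 $ 2 = 0" "M $ 2 $ 3 = 0" "M $ 3 $ 1 = 0" "M $ 3 $ 2 = 0"
      "M $ 3 $ 3 = 0" "M $ 1 $ 4 = 0" "M $ 2 $ 4 = 0" "M $ 3 $ 4 = 0" "M $ 4 $ 1 = 0" "M $ 4 $ 2 = 0" "M $ 4 $ 3 = 0"
    by (rule assms(2-4); simp)+
  have g2_relations: "g2_relations M" using assms(1) by (simp add: g2_entries_def)
  have c:
      "M $ 5 $ 2 = 0" "M $ 7 $ 3 = 0" "M $ 6 $ 1 = 0" "M $ 2 $ 5 = 0" "M $ 3 $ 7 = 0" "M $ 1 $ 6 = 0"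
    using g2_relations unfolding g2_relations_def by (simp_all add: b)
  have e:
      "M $ 4 $ 4 = 0" "M $ 1 $ 7 = 0" "M $ 2 $ 6 = 0" "M $ 3 $ 5 = 0" "M $ 5 $ 3 = 0" "M $ 6 $ 2 = 0" "M $ 7 $ 1 = 0"
    by (rule d; simp)+
  have f:
      "M $ 1 $ 5 = 0" "M $ 2 $ 7 = 0" "M $ 3 $ 6 = 0" "M $ 4 $ 5 = 0" "M $ 4 $ 6 = 0" "M $ 4 $ 7 = 0" "M $ 5 $ 1 = 0" "M $ 5 $ 4 = 0"
      "M $ 5 $ 5 = 0" "M $ 5 $ 6 = 0" "M $ 5 $ 7 = 0" "M $ 6 $ 3 = 0" "M $ 6 $ 4 = 0" "M $ 6 $ 5 = 0" "M $ 6 $ 6 = 0" "M $ 6 $ 7 = 0"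
      "M $ 7 $ 2 = 0" "M $ 7 $ 4 = 0" "M $ 7 $ 5 = 0" "M $ 7 $ 6 = 0" "M $ 7 $ 7 = 0"
    by (rule s0, simp add: b c)+
  have "\<forall>i j. M $ i $ j = 0"
    unfolding all_7 by (simp only: b c e f simp_thms)
  then show ?thesis by (simp add: vec_eq_iff)
qed

lemma g2_matrices_iff: "M \<in> g2_matrices \<longleftrightarrow> g2_entries M"
proof
  assume "M \<in> g2_matrices"
  then show "g2_entries M"
    by (auto simp: g2_matrices_def intro!: g2_entries_sum g2_entries_mscale g2_entries_Gmat)
next
  assume M: "g2_entries M"
  define c where "c i j =
    (if i \<in> {1, 2, 3} \<and> j \<in> {1, 2, 3} then M $ i $ j / 3
     else if i \<in> {1, 2, 3} \<and> j = 4 \<or> i = 4 \<and> j \<in> {1, 2, 3} then M $ i $ j / 2 else 0)" for i j :: 7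
  define N where "N = (\<Sum>i\<in>UNIV. \<Sum>j\<in>UNIV. mscale (c i j) (Gmat i j))"
  have N: "N $ a $ b = (\<Sum>i\<in>UNIV. \<Sum>j\<in>UNIV. c i j * Gmat i j $ a $ b)" for a b
    by (simp add: N_def)
  have M33: "M $ 3 $ 3 = - M $ 1 $ 1 - M $ 2 $ 2"
    using M unfolding g2_entries_def g2_relations_def
    by (simp add: algebra_simps eq_neg_iff_add_eq_0)
  have c0:
      "c 1 5 = 0" "c 1 6 = 0" "c 1 7 = 0" "c 2 5 = 0" "c 2 6 = 0" "c 2 7 = 0" "c 3 5 = 0"
      "c 3 6 = 0" "c 3 7 = 0" "c 4 4 = 0" "c 4 5 = 0" "c 4 6 = 0" "c 4 7 = 0" "c 5 1 = 0"
      "c 5 2 = 0" "c 5 3 = 0" "c 5 4 = 0" "c 5 5 = 0" "c 5 6 = 0" "c 5 7 = 0" "c 6 1 = 0"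
      "c 6 2 = 0" "c 6 3 = 0" "c 6 4 = 0" "c 6 5 = 0" "c 6 6 = 0" "c 6 7 = 0" "c 7 1 = 0"
      "c 7 2 = 0" "c 7 3 = 0" "c 7 4 = 0" "c 7 5 = 0" "c 7 6 = 0" "c 7 7 = 0"
    by (simp_all add: c_def)
  have c1:
      "c 1 1 = M $ 1 $ 1 / 3" "c 1 2 = M $ 1 $ 2 / 3" "c 1 3 = M $ 1 $ 3 / 3"
      "c 2 1 = M $ 2 $ 1 / 3" "c 2 2 = M $ 2 $ 2 / 3" "c 2 3 = M $ 2 $ 3 / 3"
      "c 3 1 = M $ 3 $ 1 / 3" "c 3 2 = M $ 3 $ 2 / 3" "c 3 3 = M $ 3 $ 3 / 3"
      "c 1 4 = M $ 1 $ 4 / 2" "c 2 4 = M $ 2 $ 4 / 2" "c 3 4 = M $ 3 $ 4 / 2"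
      "c 4 1 = M $ 4 $ 1 / 2" "c 4 2 = M $ 4 $ 2 / 2" "c 4 3 = M $ 4 $ 3 / 2"
    by (simp_all add: c_def)
  have G:
      "Gmat 1 1 = 2 *\<^sub>R Fmat 1 1 - Fmat 2 2 - Fmat 3 3"
      "Gmat 1 2 = 3 *\<^sub>R Fmat 1 2"
      "Gmat 1 3 = 3 *\<^sub>R Fmat 1 3"
      "Gmat 2 1 = 3 *\<^sub>R Fmat 2 1"
      "Gmat 2 2 = 2 *\<^sub>R Fmat 2 2 - Fmat 1 1 - Fmat 3 3"
      "Gmat 2 3 = 3 *\<^sub>R Fmat 2 3"
      "Gmat 3 1 = 3 *\<^sub>R Fmat 3 1"
      "Gmat 3 2 = 3 *\<^sub>R Fmat 3 2"
      "Gmat 3 3 = 2 *\<^sub>R Fmat 3 3 - Fmat 1 1 - Fmat 2 2"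
      "Gmat 1 4 = 2 *\<^sub>R Fmat 1 4 - sqrt 2 *\<^sub>R Fmat 5 2"
      "Gmat 2 4 = 2 *\<^sub>R Fmat 2 4 - sqrt 2 *\<^sub>R Fmat 7 3"
      "Gmat 3 4 = 2 *\<^sub>R Fmat 3 4 - sqrt 2 *\<^sub>R Fmat 6 1"
      "Gmat 4 1 = 2 *\<^sub>R Fmat 4 1 - sqrt 2 *\<^sub>R Fmat 2 5"
      "Gmat 4 2 = 2 *\<^sub>R Fmat 4 2 - sqrt 2 *\<^sub>R Fmat 3 7"
      "Gmat 4 3 = 2 *\<^sub>R Fmat 4 3 - sqrt 2 *\<^sub>R Fmat 1 6"
    by (simp_all add: Gmat_def Gmat_upper_def)
  have N': "N $ a $ b = c 1 1 * Gmat 1 1 $ a $ b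
      + c 1 2 * Gmat 1 2 $ a $ b
      + c 1 3 * Gmat 1 3 $ a $ b
      + c 1 4 * Gmat 1 4 $ a $ b
      + c 2 1 * Gmat 2 1 $ a $ b
      + c 2 2 * Gmat 2 2 $ a $ b
      + c 2 3 * Gmat 2 3 $ a $ b
      + c 2 4 * Gmat 2 4 $ a $ b
      + c 3 1 * Gmat 3 1 $ a $ b
      + c 3 2 * Gmat 3 2 $ a $ b
      + c 3 3 * Gmat 3 3 $ a $ b
      + c 3 4 * Gmat 3 4 $ a $ b
      + c 4 1 * Gmat 4 1 $ a $ b
      + c 4 2 * Gmat 4 2 $ a $ b
      + c 4 3 * Gmat 4 3 $ a $ b" for a b
    unfolding N sum_7
    by (simp only: c0, simp only: mult_zero_left, simp only: add_0_left add_0_right,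
        simp only: add.assoc)
  have entries:
      "(M - N) $ 1 $ 1 = 0" "(M - N) $ 1 $ 2 = 0" "(M - N) $ 1 $ 3 = 0" "(M - N) $ 2 $ 1 = 0"
      "(M - N) $ 2 $ 2 = 0" "(M - N) $ 2 $ 3 = 0" "(M - N) $ 3 $ 1 = 0" "(M - N) $ 3 $ 2 = 0"
      "(M - N) $ 3 $ 3 = 0" "(M - N) $ 1 $ 4 = 0" "(M - N) $ 2 $ 4 = 0" "(M - N) $ 3 $ 4 = 0"
      "(M - N) $ 4 $ 1 = 0" "(M - N) $ 4 $ 2 = 0" "(M - N) $ 4 $ 3 = 0"
    by (simp_all only: vector_minus_component N' c1 G,
        simp_all add: Fmat_nth M33 diff_divide_distrib scaleR_conv_of_real [where 'a = complex]
        split del: if_split)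
  have "M - N = 0"
  proof (rule g2_entries_eq_0)
    show "g2_entries (M - N)"
      unfolding N_def using M
      by (intro g2_entries_diff g2_entries_sum g2_entries_mscale g2_entries_Gmat)
  qed (auto simp only: entries insert_iff empty_iff)
  then show "M \<in> g2_matrices" by (auto simp: g2_matrices_def N_def)
qed

lemma g2_matrices_0: "0 \<in> g2_matrices"
  and g2_matrices_add: "M \<in> g2_matrices \<Longrightarrow> N \<in> g2_matrices \<Longrightarrow> M + N \<in> g2_matrices"
  and g2_matrices_uminus: "M \<in> g2_matrices \<Longrightarrow> - M \<in> g2_matrices"
  and g2_matrices_diff: "M \<in> g2_matrices \<Longrightarrow> N \<in> g2_matrices \<Longrightarrow> M - N \<in> g2_matrices"
  and g2_matrices_mscale: "M \<in> g2_matrices \<Longrightarrow> mscale c M \<in> g2_matrices"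
  and g2_matrices_Gmat: "Gmat i j \<in> g2_matrices"
  by (simp_all add: g2_matrices_iff g2_entries_0 g2_entries_add g2_entries_uminus g2_entries_diff
    g2_entries_mscale g2_entries_Gmat)

lemma g2_entries_commutator:
  assumes M: "g2_entries M" and N: "g2_entries N"
  shows "g2_entries (M ** N - N ** M)"
proof -
  obtain s :: complex where s: "s = complex_of_real (sqrt 2)" and ss: "s * s = 2"
    using sqrt2_sqrt2 by blast
  have ss': "s * (s * x) = 2 * x" for x
    using ss by (simp flip: mult.assoc)
  have skew: "(M ** N) $ i $ j = (N ** M) $ (8 - j) $ (8 - i)"
    if "g2_entries M" "g2_entries N" for M N i j
  proof -
    have "(N ** M) $ (8 - j) $ (8 - i) = (\<Sum>k\<in>UNIV. N $ (8 - j) $ k * M $ k $ (8 - i))"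
      by (simp add: matrix_matrix_mult_def)
    also have "\<dots> = (\<Sum>k\<in>UNIV. N $ (8 - j) $ (8 - k) * M $ (8 - k) $ (8 - i))"
      by (rule sum.reindex_bij_witness [of _ "\<lambda>k. 8 - k" "\<lambda>k. 8 - k"]) simp_all
    also have "\<dots> = (\<Sum>k\<in>UNIV. M $ i $ k * N $ k $ j)"
    proof (rule sum.cong)
      fix k :: 7
      have skews: "skew_entries M" "skew_entries N" using that by (simp_all add: g2_entries_def)
      have "M $ i $ k = - M $ (8 - k) $ (8 - i)" "N $ k $ j = - N $ (8 - j) $ (8 - k)"
        by (rule skew_entriesD, rule skews)+
      then show "N $ (8 - j) $ (8 - k) * M $ (8 - k) $ (8 - i) = M $ i $ k * N $ k $ j"
        by (simp add: mult.commute)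
    qed simp
    finally show ?thesis by (simp add: matrix_matrix_mult_def)
  qed
  have entries:
    "X $ 4 $ 4 = 0" "X $ 1 $ 7 = 0" "X $ 2 $ 6 = 0" "X $ 3 $ 5 = 0"
    "X $ 5 $ 3 = 0" "X $ 6 $ 2 = 0" "X $ 7 $ 1 = 0"
    "X $ 3 $ 3 = - X $ 1 $ 1 - X $ 2 $ 2"
    "X $ 5 $ 5 = X $ 1 $ 1 + X $ 2 $ 2" "X $ 6 $ 6 = - X $ 2 $ 2" "X $ 7 $ 7 = - X $ 1 $ 1"
    "X $ 5 $ 6 = - X $ 2 $ 3" "X $ 5 $ 7 = - X $ 1 $ 3" "X $ 6 $ 7 = - X $ 1 $ 2"
    "X $ 6 $ 5 = - X $ 3 $ 2" "X $ 7 $ 5 = - X $ 3 $ 1" "X $ 7 $ 6 = - X $ 2 $ 1"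
    "X $ 1 $ 4 = - (s * X $ 5 $ 2)" "X $ 2 $ 4 = - (s * X $ 7 $ 3)" "X $ 3 $ 4 = - (s * X $ 6 $ 1)"
    "X $ 4 $ 1 = - (s * X $ 2 $ 5)" "X $ 4 $ 2 = - (s * X $ 3 $ 7)" "X $ 4 $ 3 = - (s * X $ 1 $ 6)"
    "X $ 4 $ 7 = s * X $ 5 $ 2" "X $ 4 $ 6 = s * X $ 7 $ 3" "X $ 4 $ 5 = s * X $ 6 $ 1"
    "X $ 7 $ 4 = s * X $ 2 $ 5" "X $ 6 $ 4 = s * X $ 3 $ 7" "X $ 5 $ 4 = s * X $ 1 $ 6"
    "X $ 6 $ 3 = - X $ 5 $ 2" "X $ 5 $ 1 = - X $ 7 $ 3" "X $ 7 $ 2 = - X $ 6 $ 1"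
    "X $ 3 $ 6 = - X $ 2 $ 5" "X $ 1 $ 5 = - X $ 3 $ 7" "X $ 2 $ 7 = - X $ 1 $ 6"
    if X: "g2_entries X" for X
  proof -
    have t: "X $ i $ j = - X $ (8 - j) $ (8 - i)" for i j
      using X unfolding g2_entries_def by (intro skew_entriesD) (elim conjE)
    have d: "X $ i $ (8 - i) = 0" for i
      using t [of i "8 - i"] by simp
    show "X $ 4 $ 4 = 0" "X $ 1 $ 7 = 0" "X $ 2 $ 6 = 0" "X $ 3 $ 5 = 0"
      "X $ 5 $ 3 = 0" "X $ 6 $ 2 = 0" "X $ 7 $ 1 = 0"
      using d [of 1] d [of 2] d [of 3] d [of 4] d [of 5] d [of 6] d [of 7] by simp_all
    have e: "X $ 1 $ 1 + X $ 2 $ 2 + X $ 3 $ 3 = 0"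
      and f: "X $ 1 $ 4 = - (s * X $ 5 $ 2)" "X $ 2 $ 4 = - (s * X $ 7 $ 3)"
        "X $ 3 $ 4 = - (s * X $ 6 $ 1)" "X $ 4 $ 1 = - (s * X $ 2 $ 5)"
        "X $ 4 $ 2 = - (s * X $ 3 $ 7)" "X $ 4 $ 3 = - (s * X $ 1 $ 6)"
      using X unfolding g2_entries_def g2_relations_def s by simp_all
    show 33: "X $ 3 $ 3 = - X $ 1 $ 1 - X $ 2 $ 2"
      using e by (simp add: algebra_simps eq_neg_iff_add_eq_0)
    show "X $ 5 $ 5 = X $ 1 $ 1 + X $ 2 $ 2" "X $ 6 $ 6 = - X $ 2 $ 2" "X $ 7 $ 7 = - X $ 1 $ 1"
      using t [of 5 5] t [of 6 6] t [of 7 7] 33 by simp_all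
    show "X $ 5 $ 6 = - X $ 2 $ 3" "X $ 5 $ 7 = - X $ 1 $ 3" "X $ 6 $ 7 = - X $ 1 $ 2"
      "X $ 6 $ 5 = - X $ 3 $ 2" "X $ 7 $ 5 = - X $ 3 $ 1" "X $ 7 $ 6 = - X $ 2 $ 1"
      using t [of 5 6] t [of 5 7] t [of 6 7] t [of 6 5] t [of 7 5] t [of 7 6] by simp_all
    show "X $ 1 $ 4 = - (s * X $ 5 $ 2)" "X $ 2 $ 4 = - (s * X $ 7 $ 3)" "X $ 3 $ 4 = - (s * X $ 6 $ 1)"
      "X $ 4 $ 1 = - (s * X $ 2 $ 5)" "X $ 4 $ 2 = - (s * X $ 3 $ 7)" "X $ 4 $ 3 = - (s * X $ 1 $ 6)"
      by (fact f)+
    show "X $ 4 $ 7 = s * X $ 5 $ 2" "X $ 4 $ 6 = s * X $ 7 $ 3" "X $ 4 $ 5 = s * X $ 6 $ 1"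
      "X $ 7 $ 4 = s * X $ 2 $ 5" "X $ 6 $ 4 = s * X $ 3 $ 7" "X $ 5 $ 4 = s * X $ 1 $ 6"
      using t [of 4 7] t [of 4 6] t [of 4 5] t [of 7 4] t [of 6 4] t [of 5 4] f by simp_all
    show "X $ 6 $ 3 = - X $ 5 $ 2" "X $ 5 $ 1 = - X $ 7 $ 3" "X $ 7 $ 2 = - X $ 6 $ 1"
      "X $ 3 $ 6 = - X $ 2 $ 5" "X $ 1 $ 5 = - X $ 3 $ 7" "X $ 2 $ 7 = - X $ 1 $ 6"
      using t [of 6 3] t [of 5 1] t [of 7 2] t [of 3 6] t [of 1 5] t [of 2 7] by simp_all
  qed
  have prod: "(X ** Y) $ i $ j = X $ i $ 1 * Y $ 1 $ j + X $ i $ 2 * Y $ 2 $ j + X $ i $ 3 * Y $ 3 $ j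
      + X $ i $ 4 * Y $ 4 $ j + X $ i $ 5 * Y $ 5 $ j + X $ i $ 6 * Y $ 6 $ j + X $ i $ 7 * Y $ 7 $ j"
    for X Y :: mat7 and i j
    by (simp add: matrix_matrix_mult_def sum_7)
  have "skew_entries (M ** N - N ** M)"
  proof (rule skew_entriesI)
    fix i j :: 7
    show "(M ** N - N ** M) $ i $ j = - (M ** N - N ** M) $ (8 - j) $ (8 - i)"
      using skew [OF M N, of i j] skew [OF N M, of i j] by simp
  qed
  moreover have "g2_relations (M ** N - N ** M)"
    unfolding g2_relations_def s [symmetric]
    by (intro conjI; simp only: prod vector_minus_component entries [OF M] entries [OF N];
      simp add: algebra_simps ss ss')
  ultimately show ?thesis by (simp add: g2_entries_def)
qed


typedef g2 = g2_matrices
  morphisms mat_of_g2 Abs_g2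
  using g2_matrices_0 by blast

setup_lifting type_definition_g2

lemma matrix_add_rdistrib: "(B + C) ** A = B ** A + C ** A"
  for A B C :: mat7
  by (simp add: vec_eq_iff matrix_matrix_mult_def sum.distrib distrib_right)

instantiation g2 :: complex_lie_algebra
begin
lift_definition zero_g2 :: g2 is 0 by (rule g2_matrices_0)
lift_definition plus_g2 :: "g2 \<Rightarrow> g2 \<Rightarrow> g2" is "(+)" by (rule g2_matrices_add)
lift_definition uminus_g2 :: "g2 \<Rightarrow> g2" is uminus by (rule g2_matrices_uminus)
lift_definition minus_g2 :: "g2 \<Rightarrow> g2 \<Rightarrow> g2" is "(-)" by (rule g2_matrices_diff)
lift_definition cscale_g2 :: "complex \<Rightarrow> g2 \<Rightarrow> g2" is mscale by (rule g2_matrices_mscale)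
lift_definition bracket_g2 :: "g2 \<Rightarrow> g2 \<Rightarrow> g2" is "\<lambda>M N. M ** N - N ** M"
  by (simp add: g2_matrices_iff g2_entries_commutator)
instance
proof
  fix X Y Z :: g2 and c d :: complex
  show "X + Y + Z = X + (Y + Z)" "X + Y = Y + X" "0 + X = X" "- X + X = 0" "X - Y = X + - Y"
    by (transfer; simp)+
  show "c \<cdot> (X + Y) = c \<cdot> X + c \<cdot> Y" "(c + d) \<cdot> X = c \<cdot> X + d \<cdot> X"
    "c \<cdot> d \<cdot> X = (c * d) \<cdot> X" "1 \<cdot> X = X"
    by (transfer; simp add: vec_eq_iff algebra_simps)+
  show "bracket (X + Y) Z = bracket X Z + bracket Y Z"
    by transfer (simp add: matrix_add_ldistrib matrix_add_rdistrib)
  show "bracket X (Y + Z) = bracket X Y + bracket X Z"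
    by transfer (simp add: matrix_add_ldistrib matrix_add_rdistrib)
  show "bracket (c \<cdot> X) Y = c \<cdot> bracket X Y" "bracket X (c \<cdot> Y) = c \<cdot> bracket X Y"
    by (transfer; simp add: vec_eq_iff matrix_matrix_mult_def sum_distrib_left algebra_simps)+
  show "bracket X X = 0" by transfer simp
  have "A ** (B - C) = A ** B - A ** C" "(B - C) ** A = B ** A - C ** A" for A B C :: mat7
    by (simp_all add: vec_eq_iff matrix_matrix_mult_def sum_subtractf algebra_simps)
  then show "bracket X (bracket Y Z) + bracket Y (bracket Z X) + bracket Z (bracket X Y) = 0"
    by transfer (simp add: matrix_mul_assoc)
qed
end

lift_definition G :: "7 \<Rightarrow> 7 \<Rightarrow> g2" is Gmat by (rule g2_matrices_Gmat)

definition g2_form :: "g2 \<Rightarrow> g2 \<Rightarrow> complex"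
  where "g2_form X Y = trace (mat_of_g2 X ** mat_of_g2 Y) / 6"

lemma g2_form_add_left: "g2_form (X + Y) Z = g2_form X Z + g2_form Y Z"
  by (simp add: g2_form_def plus_g2.rep_eq matrix_add_rdistrib trace_add add_divide_distrib)

lemma g2_form_commute: "g2_form X Y = g2_form Y X"
  by (simp add: g2_form_def trace_mul_sym [of "mat_of_g2 X"])

lemma g2_form_add_right: "g2_form X (Y + Z) = g2_form X Y + g2_form X Z"
  by (metis g2_form_add_left g2_form_commute)

lemma g2_form_cscale_left: "g2_form (c \<cdot> X) Y = c * g2_form X Y"
  by (simp add: g2_form_def cscale_g2.rep_eq trace_def matrix_matrix_mult_def sum_distrib_left
    sum_divide_distrib mult.assoc)

lemma g2_form_cscale_right: "g2_form X (c \<cdot> Y) = c * g2_form X Y"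
  by (metis g2_form_cscale_left g2_form_commute)

lemma g2_form_0 [simp]: "g2_form 0 X = 0" "g2_form X 0 = 0"
  using g2_form_cscale_left [of 0 X] g2_form_cscale_right [of _ 0 X]
    g2_form_cscale_left [of 0 _ X] g2_form_cscale_right [of X 0] by simp_all

lemma g2_form_invariant: "g2_form X (bracket Y Z) = g2_form Y (bracket Z X)"
proof -
  let ?X = "mat_of_g2 X" and ?Y = "mat_of_g2 Y" and ?Z = "mat_of_g2 Z"
  have dist: "A ** (B - C) = A ** B - A ** C" for A B C :: mat7
    by (simp add: vec_eq_iff matrix_matrix_mult_def sum_subtractf algebra_simps)
  have "trace (?X ** (?Y ** ?Z)) = trace (?Y ** (?Z ** ?X))"
    using trace_mul_sym [of ?X "?Y ** ?Z"] by (simp add: matrix_mul_assoc)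
  moreover have "trace (?X ** (?Z ** ?Y)) = trace (?Y ** (?X ** ?Z))"
    using trace_mul_sym [of "?X ** ?Z" ?Y] by (simp add: matrix_mul_assoc)
  ultimately show ?thesis
    by (simp add: g2_form_def bracket_g2.rep_eq dist trace_sub)
qed


section \<open>The affine Lie algebra\<close>

text \<open>\<open>Affine p a\<close> stands for \<open>(\<Sum>\<^sub>r p\<^sub>r t\<^sup>r) + a K\<close>.\<close>

datatype affine = Affine (loop_part: "int \<Rightarrow>\<^sub>0 g2") (central_part: complex)

definition loop_bracket :: "(int \<Rightarrow>\<^sub>0 g2) \<Rightarrow> (int \<Rightarrow>\<^sub>0 g2) \<Rightarrow> (int \<Rightarrow>\<^sub>0 g2)" where
  "loop_bracket p q = (\<Sum>r\<in>Poly_Mapping.keys p. \<Sum>s\<in>Poly_Mapping.keys q.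
    Poly_Mapping.single (r + s) (bracket (Poly_Mapping.lookup p r) (Poly_Mapping.lookup q s)))"

definition cocycle :: "(int \<Rightarrow>\<^sub>0 g2) \<Rightarrow> (int \<Rightarrow>\<^sub>0 g2) \<Rightarrow> complex" where
  "cocycle p q = (\<Sum>r\<in>Poly_Mapping.keys p. \<Sum>s\<in>Poly_Mapping.keys q.
    of_int r * of_bool (r = - s) * g2_form (Poly_Mapping.lookup p r) (Poly_Mapping.lookup q s))"

definition loop_cscale :: "complex \<Rightarrow> (int \<Rightarrow>\<^sub>0 g2) \<Rightarrow> (int \<Rightarrow>\<^sub>0 g2)" where
  "loop_cscale c = Poly_Mapping.map (cscale c)"

definition loop_D :: "(int \<Rightarrow>\<^sub>0 g2) \<Rightarrow> (int \<Rightarrow>\<^sub>0 g2)" where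
  "loop_D p = (\<Sum>r\<in>Poly_Mapping.keys p.
    Poly_Mapping.single (r - 1) ((- of_int r) \<cdot> Poly_Mapping.lookup p r))"

lemma loop_bracket_add_left: "loop_bracket (p + p') q = loop_bracket p q + loop_bracket p' q"
  unfolding loop_bracket_def
  by (rule setsum_keys_plus_distrib)
    (simp_all add: bracket_add_left single_add sum.distrib)

lemma loop_bracket_add_right: "loop_bracket p (q + q') = loop_bracket p q + loop_bracket p q'"
proof -
  have "(\<Sum>s\<in>Poly_Mapping.keys (q + q').
        Poly_Mapping.single (r + s) (bracket X (Poly_Mapping.lookup (q + q') s))) =
      (\<Sum>s\<in>Poly_Mapping.keys q. Poly_Mapping.single (r + s) (bracket X (Poly_Mapping.lookup q s))) +
      (\<Sum>s\<in>Poly_Mapping.keys q'. Poly_Mapping.single (r + s) (bracket X (Poly_Mapping.lookup q' s)))"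
    for r X
    by (rule setsum_keys_plus_distrib) (simp_all add: bracket_add_right single_add)
  then show ?thesis by (simp add: loop_bracket_def sum.distrib)
qed

lemma cocycle_add_left: "cocycle (p + p') q = cocycle p q + cocycle p' q"
  unfolding cocycle_def
  by (rule setsum_keys_plus_distrib) (simp_all add: g2_form_add_left distrib_left sum.distrib)

lemma cocycle_add_right: "cocycle p (q + q') = cocycle p q + cocycle p q'"
proof -
  have "(\<Sum>s\<in>Poly_Mapping.keys (q + q').
        of_int r * of_bool (r = - s) * g2_form X (Poly_Mapping.lookup (q + q') s)) =
      (\<Sum>s\<in>Poly_Mapping.keys q. of_int r * of_bool (r = - s) * g2_form X (Poly_Mapping.lookup q s)) +
      (\<Sum>s\<in>Poly_Mapping.keys q'. of_int r * of_bool (r = - s) * g2_form X (Poly_Mapping.lookup q' s))"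
    for r X
    by (rule setsum_keys_plus_distrib) (simp_all add: g2_form_add_right distrib_left)
  then show ?thesis by (simp only: cocycle_def sum.distrib)
qed

lemma loop_cscale_lookup: "Poly_Mapping.lookup (loop_cscale c p) r = c \<cdot> Poly_Mapping.lookup p r"
  unfolding loop_cscale_def by (simp add: Poly_Mapping.map.rep_eq when_def)

lemma loop_cscale_add: "loop_cscale c (p + q) = loop_cscale c p + loop_cscale c q"
  by (rule poly_mapping_eqI) (simp add: loop_cscale_lookup lookup_add cscale_add_right)

lemma loop_cscale_0 [simp]: "loop_cscale c 0 = 0"
  by (rule poly_mapping_eqI) (simp add: loop_cscale_lookup)

lemma loop_cscale_single [simp]:
  "loop_cscale c (Poly_Mapping.single r X) = Poly_Mapping.single r (c \<cdot> X)"
  by (simp add: loop_cscale_def)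

lemma loop_D_add: "loop_D (p + q) = loop_D p + loop_D q"
  unfolding loop_D_def
  by (rule setsum_keys_plus_distrib)
    (simp_all only: cscale_add_right single_add cscale_zero_right single_zero)

lemma loop_bracket_single [simp]:
  "loop_bracket (Poly_Mapping.single r X) (Poly_Mapping.single s Y) =
    Poly_Mapping.single (r + s) (bracket X Y)"
  by (simp add: loop_bracket_def)

lemma cocycle_single [simp]:
  "cocycle (Poly_Mapping.single r X) (Poly_Mapping.single s Y) =
    of_int r * of_bool (r = - s) * g2_form X Y"
  by (simp add: cocycle_def)

lemma loop_D_single [simp]:
  "loop_D (Poly_Mapping.single r X) = Poly_Mapping.single (r - 1) ((- of_int r) \<cdot> X)"
  by (simp add: loop_D_def)

lemmas loop_add_simps =
  loop_bracket_add_left loop_bracket_add_right cocycle_add_left cocycle_add_right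
  loop_cscale_add loop_D_add

lemma loop_induct2:
  assumes "\<And>r X s Y. P (Poly_Mapping.single r X) (Poly_Mapping.single s Y)"
    and "\<And>p p' q. P p q \<Longrightarrow> P p' q \<Longrightarrow> P (p + p') q"
    and "\<And>p q q'. P p q \<Longrightarrow> P p q' \<Longrightarrow> P p (q + q')"
  shows "P (p :: int \<Rightarrow>\<^sub>0 g2) (q :: int \<Rightarrow>\<^sub>0 g2)"
proof (induction p rule: poly_mapping_additive_induct)
  case (1 r X)
  show ?case
    by (induction q rule: poly_mapping_additive_induct) (simp_all add: assms)
qed (simp add: assms)

lemma loop_induct3:
  assumes "\<And>r X s Y t Z. P (Poly_Mapping.single r X) (Poly_Mapping.single s Y) (Poly_Mapping.single t Z)"
    and "\<And>p p' q k. P p q k \<Longrightarrow> P p' q k \<Longrightarrow> P (p + p') q k"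
    and "\<And>p q q' k. P p q k \<Longrightarrow> P p q' k \<Longrightarrow> P p (q + q') k"
    and "\<And>p q k k'. P p q k \<Longrightarrow> P p q k' \<Longrightarrow> P p q (k + k')"
  shows "P (p :: int \<Rightarrow>\<^sub>0 g2) (q :: int \<Rightarrow>\<^sub>0 g2) (k :: int \<Rightarrow>\<^sub>0 g2)"
proof (induction p rule: poly_mapping_additive_induct)
  case (1 r X)
  show ?case by (induction q k rule: loop_induct2) (simp_all add: assms)
qed (simp add: assms)

lemma loop_bracket_cscale_left: "loop_bracket (loop_cscale c p) q = loop_cscale c (loop_bracket p q)"
  by (induction p q rule: loop_induct2) (simp_all add: loop_add_simps bracket_cscale_left)

lemma loop_bracket_cscale_right: "loop_bracket p (loop_cscale c q) = loop_cscale c (loop_bracket p q)"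
  by (induction p q rule: loop_induct2) (simp_all add: loop_add_simps bracket_cscale_right)

lemma cocycle_cscale_left: "cocycle (loop_cscale c p) q = c * cocycle p q"
  by (induction p q rule: loop_induct2)
    (simp_all add: loop_add_simps g2_form_cscale_left distrib_left)

lemma cocycle_cscale_right: "cocycle p (loop_cscale c q) = c * cocycle p q"
  by (induction p q rule: loop_induct2)
    (simp_all add: loop_add_simps g2_form_cscale_right distrib_left)

lemma loop_bracket_antisym: "loop_bracket p q = - loop_bracket q p"
proof (induction p q rule: loop_induct2)
  case (1 r X s Y)
  show ?case using bracket_antisym [of X Y] by (simp add: add.commute flip: single_uminus)
qed (simp_all add: loop_add_simps)

lemma cocycle_antisym: "cocycle p q = - cocycle q p"
proof (induction p q rule: loop_induct2)
  case (1 r X s Y)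
  show ?case using g2_form_commute [of X Y] by auto
qed (simp_all add: loop_add_simps)

lemma loop_bracket_self: "loop_bracket p p = 0"
proof (rule poly_mapping_eqI)
  fix r
  let ?Y = "Poly_Mapping.lookup (loop_bracket p p) r"
  have "?Y = - ?Y"
    using loop_bracket_antisym [of p p] by (metis lookup_uminus)
  then have "?Y + ?Y = 0" by (metis add.right_inverse)
  then have "2 \<cdot> ?Y = 0"
    using cscale_add_left [of 1 1 ?Y] by (simp add: cscale_one)
  then have "(1 / 2) \<cdot> 2 \<cdot> ?Y = 0" by simp
  then show "?Y = Poly_Mapping.lookup 0 r" by (simp add: cscale_cscale cscale_one)
qed

lemma cocycle_self: "cocycle p p = 0"
  using cocycle_antisym [of p p] by simp

lemma loop_jacobi:
  "loop_bracket p (loop_bracket q k) + loop_bracket q (loop_bracket k p)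
    + loop_bracket k (loop_bracket p q) = 0"
proof (induction p q k rule: loop_induct3)
  case (1 r X s Y t Z)
  have "s + (t + r) = r + (s + t)" "t + (r + s) = r + (s + t)" by simp_all
  then show ?case
    by (simp only: loop_bracket_single single_add [symmetric] jacobi single_zero)
qed (simp_all add: loop_add_simps algebra_simps,
    (simp only: add.assoc [symmetric] add_eq_0_iff, simp add: algebra_simps)+)

lemma cocycle_jacobi:
  "cocycle p (loop_bracket q k) + cocycle q (loop_bracket k p) + cocycle k (loop_bracket p q) = 0"
proof (induction p q k rule: loop_induct3)
  case (1 r X s Y t Z)
  have "g2_form Y (bracket Z X) = g2_form X (bracket Y Z)"
    "g2_form Z (bracket X Y) = g2_form X (bracket Y Z)"
    by (metis g2_form_invariant)+
  note form = this
  show ?case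
  proof (cases "t = - r - s")
    case True
    show ?thesis
      unfolding True by (simp add: form algebra_simps)
  qed auto
qed (simp_all add: loop_add_simps algebra_simps,
    (simp only: add.assoc [symmetric] add_eq_0_iff, simp add: algebra_simps)+)

lemma loop_D_cscale: "loop_D (loop_cscale c p) = loop_cscale c (loop_D p)"
  by (induction p rule: poly_mapping_additive_induct)
    (simp_all add: loop_add_simps cscale_cscale mult.commute)

lemma loop_D_bracket: "loop_D (loop_bracket p q) = loop_bracket (loop_D p) q + loop_bracket p (loop_D q)"
proof (induction p q rule: loop_induct2)
  case (1 r X s Y)
  have "r - 1 + s = r + s - 1" "r + (s - 1) = r + s - 1"
    "- of_int (r + s) = - of_int r + - complex_of_int s" by simp_all
  then show ?case
    by (simp only: loop_D_single loop_bracket_single bracket_cscale_left bracket_cscale_right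
      single_add [symmetric] cscale_add_left)
qed (simp_all add: loop_add_simps)

lemma cocycle_D: "cocycle (loop_D p) q = - cocycle p (loop_D q)"
proof (induction p q rule: loop_induct2)
  case (1 r X s Y)
  show ?case
  proof (cases "s = 1 - r")
    case True
    show ?thesis
      unfolding True by (simp add: g2_form_cscale_left g2_form_cscale_right algebra_simps)
  qed auto
qed (simp_all add: loop_add_simps)

instantiation affine :: complex_lie_algebra
begin
definition "0 = Affine 0 0"
definition "x + y = Affine (loop_part x + loop_part y) (central_part x + central_part y)"
definition "- x = Affine (- loop_part x) (- central_part x)"
definition "x - y = Affine (loop_part x - loop_part y) (central_part x - central_part y)"
definition "c \<cdot> x = Affine (loop_cscale c (loop_part x)) (c * central_part x)"
definition "bracket x y =
  Affine (loop_bracket (loop_part x) (loop_part y)) (cocycle (loop_part x) (loop_part y))"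
instance
proof
  fix x y z :: affine and c d :: complex
  note defs = zero_affine_def plus_affine_def uminus_affine_def minus_affine_def
    cscale_affine_def bracket_affine_def
  show "x + y + z = x + (y + z)" "x + y = y + x" "0 + x = x" "- x + x = 0" "x - y = x + - y"
    by (cases x; simp add: defs algebra_simps)+
  have "loop_cscale (c + d) p = loop_cscale c p + loop_cscale d p"
    "loop_cscale c (loop_cscale d p) = loop_cscale (c * d) p" "loop_cscale 1 p = p" for p
    by (rule poly_mapping_eqI;
      simp add: loop_cscale_lookup lookup_add cscale_add_left cscale_cscale cscale_one)+
  then show "c \<cdot> (x + y) = c \<cdot> x + c \<cdot> y" "(c + d) \<cdot> x = c \<cdot> x + d \<cdot> x"
    "c \<cdot> d \<cdot> x = (c * d) \<cdot> x" "1 \<cdot> x = x"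
    by (cases x; simp add: defs loop_add_simps distrib_left distrib_right)+
  show "bracket (x + y) z = bracket x z + bracket y z"
    "bracket x (y + z) = bracket x y + bracket x z"
    by (simp_all add: defs loop_add_simps)
  show "bracket (c \<cdot> x) y = c \<cdot> bracket x y" "bracket x (c \<cdot> y) = c \<cdot> bracket x y"
    by (simp_all add: defs loop_bracket_cscale_left loop_bracket_cscale_right
      cocycle_cscale_left cocycle_cscale_right)
  show "bracket x x = 0"
    by (simp add: defs loop_bracket_self cocycle_self)
  show "bracket x (bracket y z) + bracket y (bracket z x) + bracket z (bracket x y) = 0"
    by (simp add: defs loop_jacobi cocycle_jacobi)
qed
end

definition loop :: "g2 \<Rightarrow> int \<Rightarrow> affine"
  where "loop X r = Affine (Poly_Mapping.single r X) 0"

definition central :: affine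
  where "central = Affine 0 1"

lemma bracket_loop:
  "bracket (loop X r) (loop Y s) =
    loop (bracket X Y) (r + s) + (of_int r * of_bool (r = - s) * g2_form X Y) \<cdot> central"
  by (simp add: loop_def central_def bracket_affine_def plus_affine_def cscale_affine_def)

lemma bracket_central: "bracket central x = 0"
  by (simp add: central_def bracket_affine_def zero_affine_def loop_bracket_def cocycle_def)

definition loops_nonneg :: "affine set"  \<comment> \<open>\<open>g[t]\<close>\<close>
  where "loops_nonneg = {Affine p 0 | p. \<forall>r\<in>Poly_Mapping.keys p. 0 \<le> r}"

definition loops_neg :: "affine set"  \<comment> \<open>\<open>t\<inverse> g[t\<inverse>]\<close>\<close>
  where "loops_neg = {Affine p 0 | p. \<forall>r\<in>Poly_Mapping.keys p. r < 0}"

definition affine_D :: "affine \<Rightarrow> affine"  \<comment> \<open>\<open>- d/dt\<close>\<close>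
  where "affine_D x = Affine (loop_D (loop_part x)) 0"

lemma affine_D_loop: "affine_D (loop X r) = (- of_int r) \<cdot> loop X (r - 1)"
  by (simp add: affine_D_def loop_def cscale_affine_def)

lemma lie_derivation_affine_D: "lie_derivation affine_D"
  by (simp add: lie_derivation_def affine_D_def plus_affine_def cscale_affine_def
    bracket_affine_def loop_add_simps loop_D_cscale loop_D_bracket cocycle_D)

text \<open>\<open>- d/dt\<close> extends to the whole affine algebra with \<open>K \<mapsto> 0\<close>. The derivation
  of the enveloping algebra induced by it preserves the subalgebra generated by \<open>loops_neg\<close>.\<close>

lift_definition uenv_D :: "affine uenv \<Rightarrow> affine uenv" is "free_deriv affine_D"
proof -
  fix p q :: "affine free_algebra"
  assume "p - q \<in> enveloping_ideal"
  from free_deriv_enveloping_ideal [OF lie_derivation_affine_D this]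
  show "free_deriv affine_D p - free_deriv affine_D q \<in> enveloping_ideal"
    by (simp add: free_deriv_diff)
qed

lemma uenv_D_add: "uenv_D (u + v) = uenv_D u + uenv_D v"
  by transfer (simp add: free_deriv_add enveloping_ideal.zero)

lemma uenv_D_mult: "uenv_D (u * v) = uenv_D u * v + u * uenv_D v"
  by transfer (simp add: free_deriv_mult enveloping_ideal.zero)

lemma uenv_D_uscalar: "uenv_D (uscalar c) = 0"
  by transfer (simp add: enveloping_ideal.zero)

lemma uenv_D_uembed: "uenv_D (uembed x) = uembed (affine_D x)"
  by transfer (simp add: enveloping_ideal.zero)


section \<open>The vacuum module at the critical level and the Feigin--Frenkel center\<close>

inductive_set vacuum_ideal :: "affine uenv set" where
  level: "uembed central + 12 \<in> vacuum_ideal"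
| annihilate: "x \<in> loops_nonneg \<Longrightarrow> uembed x \<in> vacuum_ideal"
| zero: "0 \<in> vacuum_ideal"
| add: "u \<in> vacuum_ideal \<Longrightarrow> v \<in> vacuum_ideal \<Longrightarrow> u + v \<in> vacuum_ideal"
| mult_left: "u \<in> vacuum_ideal \<Longrightarrow> a * u \<in> vacuum_ideal"

lemma vacuum_ideal_uminus: "u \<in> vacuum_ideal \<Longrightarrow> - u \<in> vacuum_ideal"
  using vacuum_ideal.mult_left [of u "- 1"] by simp

lemma vacuum_ideal_diff: "u \<in> vacuum_ideal \<Longrightarrow> v \<in> vacuum_ideal \<Longrightarrow> u - v \<in> vacuum_ideal"
  using vacuum_ideal.add [of u "- v"] vacuum_ideal_uminus [of v] by simp

lifting_forget uenv.lifting

quotient_type vacuum = "affine uenv" / "\<lambda>u v. u - v \<in> vacuum_ideal"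
proof (rule equivpI)
  show "reflp (\<lambda>u v. u - v \<in> vacuum_ideal)"
    by (simp add: reflp_def vacuum_ideal.zero)
  show "symp (\<lambda>u v. u - v \<in> vacuum_ideal)"
  proof (rule sympI)
    fix u v :: "affine uenv"
    assume "u - v \<in> vacuum_ideal"
    from vacuum_ideal_uminus [OF this] show "v - u \<in> vacuum_ideal" by simp
  qed
  show "transp (\<lambda>u v. u - v \<in> vacuum_ideal)"
  proof (rule transpI)
    fix u v w :: "affine uenv"
    assume "u - v \<in> vacuum_ideal" "v - w \<in> vacuum_ideal"
    from vacuum_ideal.add [OF this] show "u - w \<in> vacuum_ideal" by simp
  qed
qed

instantiation vacuum :: ab_group_add
begin
lift_definition zero_vacuum :: vacuum is 0 .
lift_definition plus_vacuum :: "vacuum \<Rightarrow> vacuum \<Rightarrow> vacuum" is "(+)"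
proof -
  fix u u' v v' :: "affine uenv"
  assume "u - u' \<in> vacuum_ideal" "v - v' \<in> vacuum_ideal"
  then have "(u - u') + (v - v') \<in> vacuum_ideal" by (rule vacuum_ideal.add)
  then show "u + v - (u' + v') \<in> vacuum_ideal" by (simp add: algebra_simps)
qed
lift_definition uminus_vacuum :: "vacuum \<Rightarrow> vacuum" is uminus
proof -
  fix u u' :: "affine uenv"
  assume "u - u' \<in> vacuum_ideal"
  then have "- (u - u') \<in> vacuum_ideal" by (rule vacuum_ideal_uminus)
  then show "- u - - u' \<in> vacuum_ideal" by (simp add: algebra_simps)
qed
lift_definition minus_vacuum :: "vacuum \<Rightarrow> vacuum \<Rightarrow> vacuum" is "(-)"
proof -
  fix u u' v v' :: "affine uenv"
  assume "u - u' \<in> vacuum_ideal" "v - v' \<in> vacuum_ideal"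
  then have "(u - u') - (v - v') \<in> vacuum_ideal" by (rule vacuum_ideal_diff)
  then show "u - v - (u' - v') \<in> vacuum_ideal" by (simp add: algebra_simps)
qed
instance
  by standard (transfer; simp add: algebra_simps vacuum_ideal.zero)+
end

lift_definition vacuum_act :: "affine uenv \<Rightarrow> vacuum \<Rightarrow> vacuum" (infixr \<open>\<bullet>\<^sub>V\<close> 73) is "(*)"
proof -
  fix a u u' :: "affine uenv"
  assume "u - u' \<in> vacuum_ideal"
  then have "a * (u - u') \<in> vacuum_ideal" by (rule vacuum_ideal.mult_left)
  then show "a * u - a * u' \<in> vacuum_ideal" by (simp add: algebra_simps)
qed

lift_definition vacuum_class :: "affine uenv \<Rightarrow> vacuum" is "\<lambda>u. u" .

lemma vacuum_act_class: "a \<bullet>\<^sub>V vacuum_class u = vacuum_class (a * u)"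
  by transfer (simp add: vacuum_ideal.zero)

definition segal_sugawara :: "vacuum set"
  where "segal_sugawara = {v. \<forall>x\<in>loops_nonneg. uembed x \<bullet>\<^sub>V v = 0}"

text \<open>\<open>vacuum_class\<close> restricts to the identification of the enveloping algebra of \<open>loops_neg\<close>
  (as a subalgebra of the one of the affine algebra) with the vacuum module. The Feigin--Frenkel
  center is taken on the algebra side of this identification, where its products live.\<close>

definition feigin_frenkel_center :: "affine uenv set"
  where "feigin_frenkel_center =
    {u \<in> generated_subalgebra loops_neg. vacuum_class u \<in> segal_sugawara}"


section \<open>Polynomials in commuting elements\<close>

text \<open>A polynomial over the variables \<open>'v\<close> is a finitely supported map from exponents
  \<open>'v \<Rightarrow>\<^sub>0 nat\<close> to coefficients. As the algebra is not commutative as a type, the product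
  over the variables of a monomial is a fold; it is independent of the order, and hence
  meaningful, for pairwise commuting families, which \<open>alg_independent\<close> requires.\<close>

definition monomial_eval :: "('v \<Rightarrow> affine uenv) \<Rightarrow> ('v \<Rightarrow>\<^sub>0 nat) \<Rightarrow> affine uenv" where
  "monomial_eval f m =
    Finite_Set.fold (\<lambda>v u. f v ^ Poly_Mapping.lookup m v * u) 1 (Poly_Mapping.keys m)"

definition polynomial_eval :: "('v \<Rightarrow> affine uenv) \<Rightarrow> (('v \<Rightarrow>\<^sub>0 nat) \<Rightarrow>\<^sub>0 complex) \<Rightarrow> affine uenv" where
  "polynomial_eval f P =
    (\<Sum>m\<in>Poly_Mapping.keys P. uscalar (Poly_Mapping.lookup P m) * monomial_eval f m)"

definition alg_independent :: "('v \<Rightarrow> affine uenv) \<Rightarrow> bool" where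
  "alg_independent f \<longleftrightarrow>
    (\<forall>v w. f v * f w = f w * f v) \<and> (\<forall>P. polynomial_eval f P = 0 \<longrightarrow> P = 0)"


section \<open>The vectors \<open>S\<^sub>2\<close> and \<open>S\<^sub>6\<close>\<close>

text \<open>\<open>G[r] = \<Sum>\<^sub>i\<^sub>j e\<^sub>j\<^sub>i \<otimes> G\<^sub>i\<^sub>j[r]\<close>: the entry in row \<open>j\<close> and column \<open>i\<close> is \<open>G\<^sub>i\<^sub>j[r]\<close>.\<close>

definition Gseries :: "int \<Rightarrow> affine uenv^7^7"
  where "Gseries r = (\<chi> j i. uembed (loop (G i j) r))"

definition trG :: "int list \<Rightarrow> affine uenv"
  where "trG rs = trace (foldr (\<lambda>r M. Gseries r ** M) rs (mat 1))"

definition S2 :: "affine uenv"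
  where "S2 = trG [-1, -1]"

definition S6 :: "affine uenv"
  where "S6 = trG [-1, -1, -1, -1, -1, -1] + 5 * trG [-2, -1, -1, -1, -1]
    + 14 * trG [-3, -1, -1, -1] + 456 * trG [-3, -3] - 639 * trG [-2, -2, -2]
    + 31 * trG [-2, -2, -1, -1] - 312 * trG [-3, -2, -1]"

definition sugawara_family :: "nat + nat \<Rightarrow> affine uenv"
  where "sugawara_family = case_sum (\<lambda>k. (uenv_D ^^ k) S2) (\<lambda>k. (uenv_D ^^ k) S6)"

end

theory Submission
  imports Defs "HOL-Library.Multiset"
begin

text \<open>The vacuum module is realised on the polynomials in the letters \<open>X[-r-1]\<close> (an induced module version of the
  PBW theorem), so that elements of the enveloping algebra of \<open>t\<inverse> g[t\<inverse>]\<close> have leading symbols, and the symbol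
  of a Segal--Sugawara vector is invariant under \<open>g[t]\<close>. Restriction of polynomial functions on arcs to a slice
  \<open>e + a(t) f + b(t) g\<close> is injective on invariants, and the symbols of \<open>S2\<close> and \<open>S6\<close> restrict to \<open>4 a\<close> and
  \<open>24 b + 4 a^3\<close>. Hence the symbols of all \<open>D^k S2\<close> and \<open>D^k S6\<close> freely generate the invariants, and both independence
  and generation follow by comparing leading symbols.

  All invariants have even degree, so an element of the center on which the antipode acts by \<open>-1\<close> vanishes. The antipode
  fixes \<open>S2\<close> and \<open>S6\<close>; it therefore acts by \<open>-1\<close> on the commutators of their derivatives, which must be zero.

  That \<open>S2\<close> and \<open>S6\<close> are annihilated by \<open>g[t]\<close> reduces, by equivariance, to the single element \<open>E12[1]\<close>. There it is
  a finite computation in normally ordered words, as is the invariance of \<open>S6\<close> under the antipode.\<close>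


text \<open>The slice bounds the center from above. The brackets with \<open>transversal i\<close>
  move the twelve remaining coordinates independently at \<open>e\<close>, in every mode, so a
  nonzero invariant, expanded at \<open>e\<close>, has a lowest term in slice coordinates alone. As
  \<open>S2\<close> and \<open>S6\<close> restrict to coordinates of the slice up to a triangular
  change of variables, there is no room for further invariants. Commutativity must come before any
  statement about polynomials in the family, because the products live in a noncommutative algebra.
  The antipode suits this purpose: it is an anti-automorphism, it acts on symbols of degree
  \<open>d\<close> by the sign of \<open>d\<close>, and the degrees 2 and 6 of the basic invariants
  are even. Invariance of the traces under \<open>X[0]\<close> is formal. The reduction to
  \<open>E12[1]\<close> rests on two facts: the annihilators of a vector form a Lie algebra, and
  \<open>E12\<close> generates the adjoint module, with [H1[1], E12[r]] = 3 E12[r+1]. The remaining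
  computation involves words of length up to six in fourteen noncommuting letters. Rescaling the
  fourth basis vector of C^7 removes the square root of 2, so that integer arithmetic
  suffices.\<close>

section \<open>Matrix entries and the trace form\<close>

lemma trace_Emat_mult: "trace (Emat i j ** Z) = Z $ j $ i" for Z :: mat7
proof -
  have "(Emat i j ** Z) $ a $ a = (if a = i then Z $ j $ a else 0)" for a
    by (simp add: matrix_matrix_mult_def Emat_def if_distrib [of "\<lambda>x. x * _"] cong: if_cong)
  then show ?thesis by (simp add: trace_def)
qed

text \<open>The form with a fixed second argument, on all 7 by 7 matrices, because the summands
  \<open>Fmat i j\<close> of \<open>Gmat\<close> need not lie in the subalgebra.\<close>

definition tform :: "mat7 \<Rightarrow> mat7 \<Rightarrow> complex" where "tform Z M = trace (M ** Z) / 6"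

lemma tform_add: "tform Z (M + N) = tform Z M + tform Z N"
  by (simp add: tform_def matrix_add_rdistrib trace_add add_divide_distrib)
lemma tform_0: "tform Z 0 = 0" using tform_add [of Z 0 0] by simp
lemma tform_uminus: "tform Z (- M) = - tform Z M"
  using tform_add [of Z M "- M"] by (simp add: tform_0 eq_neg_iff_add_eq_0 add.commute)
lemma tform_diff: "tform Z (M - N) = tform Z M - tform Z N"
  using tform_add [of Z M "- N"] by (simp add: tform_uminus)
lemma tform_scaleR: "tform Z (r *\<^sub>R M) = complex_of_real r * tform Z M"
  by (simp add: tform_def trace_def matrix_matrix_mult_def scaleR_conv_of_real [where 'a = complex] sum_distrib_left mult.assoc
      sum_divide_distrib)

text \<open>The two matrix units of \<open>Fmat i j\<close> contribute the same entry of the skew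
  matrix \<open>Z\<close>, which gives the factor 2/6.\<close>

lemma tform_Fmat:
  assumes "g2_entries Z"
  shows "tform Z (Fmat i j) = Z $ j $ i / 3"
proof -
  have "Z $ (8 - i) $ (8 - j) = - Z $ j $ i"
    using assms skew_entriesD [of Z "8 - i" "8 - j"] by (simp add: g2_entries_def)
  moreover have "Emat i j ** Z - Emat (8 - j) (8 - i) ** Z = Fmat i j ** Z"
    by (simp add: Fmat_def vec_eq_iff matrix_matrix_mult_def sum_subtractf left_diff_distrib)
  then have "trace (Fmat i j ** Z) = Z $ j $ i - Z $ (8 - i) $ (8 - j)"
    by (metis trace_sub trace_Emat_mult)
  ultimately show ?thesis by (simp add: tform_def)
qed

lemma sqrt2_facts: "complex_of_real (sqrt 2) * complex_of_real (sqrt 2) = 2"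
  "complex_of_real (sqrt 2) * (complex_of_real (sqrt 2) * x) = 2 * x"
  "complex_of_real (sqrt 2) \<noteq> 0"
  using sqrt2_sqrt2 by (simp_all flip: mult.assoc)

text \<open>Read as rewrite rules, these 35 equations express every entry through the fourteen
  entries that \<open>crd\<close> reads off below.\<close>

lemma g2_entries_relations:
  fixes Z :: mat7 and s :: complex
  defines "s \<equiv> complex_of_real (sqrt 2)"
  assumes "g2_entries Z"
  shows "Z $ 4 $ 4 = 0" "Z $ 1 $ 7 = 0" "Z $ 2 $ 6 = 0" "Z $ 3 $ 5 = 0"
    "Z $ 5 $ 3 = 0" "Z $ 6 $ 2 = 0" "Z $ 7 $ 1 = 0"
    "Z $ 3 $ 3 = - Z $ 1 $ 1 - Z $ 2 $ 2"
    "Z $ 5 $ 5 = Z $ 1 $ 1 + Z $ 2 $ 2" "Z $ 6 $ 6 = - Z $ 2 $ 2" "Z $ 7 $ 7 = - Z $ 1 $ 1"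
    "Z $ 1 $ 4 = - (s * Z $ 5 $ 2)" "Z $ 2 $ 4 = - (s * Z $ 7 $ 3)" "Z $ 3 $ 4 = - (s * Z $ 6 $ 1)"
    "Z $ 4 $ 1 = - (s * Z $ 2 $ 5)" "Z $ 4 $ 2 = - (s * Z $ 3 $ 7)" "Z $ 4 $ 3 = - (s * Z $ 1 $ 6)"
    "Z $ 4 $ 7 = s * Z $ 5 $ 2" "Z $ 4 $ 6 = s * Z $ 7 $ 3" "Z $ 4 $ 5 = s * Z $ 6 $ 1"
    "Z $ 7 $ 4 = s * Z $ 2 $ 5" "Z $ 6 $ 4 = s * Z $ 3 $ 7" "Z $ 5 $ 4 = s * Z $ 1 $ 6"
    "Z $ 6 $ 3 = - Z $ 5 $ 2" "Z $ 5 $ 1 = - Z $ 7 $ 3" "Z $ 7 $ 2 = - Z $ 6 $ 1"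
    "Z $ 3 $ 6 = - Z $ 2 $ 5" "Z $ 1 $ 5 = - Z $ 3 $ 7" "Z $ 2 $ 7 = - Z $ 1 $ 6"
    "Z $ 5 $ 6 = - Z $ 2 $ 3" "Z $ 5 $ 7 = - Z $ 1 $ 3" "Z $ 6 $ 7 = - Z $ 1 $ 2"
    "Z $ 6 $ 5 = - Z $ 3 $ 2" "Z $ 7 $ 5 = - Z $ 3 $ 1" "Z $ 7 $ 6 = - Z $ 2 $ 1"
proof -
  have t: "Z $ i $ j = - Z $ (8 - j) $ (8 - i)" for i j
    using assms by (intro skew_entriesD) (simp add: g2_entries_def)
  have d: "Z $ i $ (8 - i) = 0" for i
    using t [of i "8 - i"] by simp
  show "Z $ 4 $ 4 = 0" "Z $ 1 $ 7 = 0" "Z $ 2 $ 6 = 0" "Z $ 3 $ 5 = 0"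
      "Z $ 5 $ 3 = 0" "Z $ 6 $ 2 = 0" "Z $ 7 $ 1 = 0"
    using d [of 1] d [of 2] d [of 3] d [of 4] d [of 5] d [of 6] d [of 7] by simp_all
  show r: "Z $ 3 $ 3 = - Z $ 1 $ 1 - Z $ 2 $ 2"
    and f: "Z $ 1 $ 4 = - (s * Z $ 5 $ 2)" "Z $ 2 $ 4 = - (s * Z $ 7 $ 3)"
        "Z $ 3 $ 4 = - (s * Z $ 6 $ 1)" "Z $ 4 $ 1 = - (s * Z $ 2 $ 5)"
        "Z $ 4 $ 2 = - (s * Z $ 3 $ 7)" "Z $ 4 $ 3 = - (s * Z $ 1 $ 6)"
    using assms unfolding g2_entries_def g2_relations_def s_def
    by (simp_all add: algebra_simps eq_neg_iff_add_eq_0)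
  show "Z $ 4 $ 7 = s * Z $ 5 $ 2" "Z $ 4 $ 6 = s * Z $ 7 $ 3" "Z $ 4 $ 5 = s * Z $ 6 $ 1"
      "Z $ 7 $ 4 = s * Z $ 2 $ 5" "Z $ 6 $ 4 = s * Z $ 3 $ 7" "Z $ 5 $ 4 = s * Z $ 1 $ 6"
    using t [of 4 7] t [of 4 6] t [of 4 5] t [of 7 4] t [of 6 4] t [of 5 4] f by simp_all
  show "Z $ 6 $ 3 = - Z $ 5 $ 2" "Z $ 5 $ 1 = - Z $ 7 $ 3" "Z $ 7 $ 2 = - Z $ 6 $ 1"
      "Z $ 3 $ 6 = - Z $ 2 $ 5" "Z $ 1 $ 5 = - Z $ 3 $ 7" "Z $ 2 $ 7 = - Z $ 1 $ 6"
    using t [of 6 3] t [of 5 1] t [of 7 2] t [of 3 6] t [of 1 5] t [of 2 7] by simp_all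
  show "Z $ 5 $ 5 = Z $ 1 $ 1 + Z $ 2 $ 2" "Z $ 6 $ 6 = - Z $ 2 $ 2" "Z $ 7 $ 7 = - Z $ 1 $ 1"
    using t [of 5 5] t [of 6 6] t [of 7 7] r by simp_all
  show "Z $ 5 $ 6 = - Z $ 2 $ 3" "Z $ 5 $ 7 = - Z $ 1 $ 3" "Z $ 6 $ 7 = - Z $ 1 $ 2"
      "Z $ 6 $ 5 = - Z $ 3 $ 2" "Z $ 7 $ 5 = - Z $ 3 $ 1" "Z $ 7 $ 6 = - Z $ 2 $ 1"
    using t [of 5 6] t [of 5 7] t [of 6 7] t [of 6 5] t [of 7 5] t [of 7 6] by simp_all
qed

text \<open>The coefficients of \<open>Gmat\<close> are made for this: the relations on
  \<open>Z\<close> turn the correction terms into the missing third of the entry. For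
  \<open>Gmat 1 4\<close>, two thirds of the entry (4, 1) come from \<open>Fmat 1 4\<close> and one
  third from \<open>Fmat 5 2\<close>.\<close>

lemma tform_Gmat:
  assumes "g2_entries Z"
  shows "tform Z (Gmat i j) = Z $ j $ i"
proof -
  obtain s :: complex where s: "s = complex_of_real (sqrt 2)" and ss: "s * s = 2"
    using sqrt2_sqrt2 by blast
  have s0: "s \<noteq> 0" using ss by auto
  have ss': "s * (s * x) = 2 * x" for x using ss by (simp flip: mult.assoc)
  note rels = g2_entries_relations [OF assms, folded s]
  have u: "tform Z (Gmat_upper i j) = Z $ j $ i" if "i \<in> {1, 2, 3, 4}" "j \<in> {1, 2, 3, 4}" for i j
    using that
    by (elim insertE emptyE; simp add: Gmat_upper_def tform_add tform_diff tform_scaleR tform_0 tform_Fmat [OF assms] rels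
        ss ss' s [symmetric] field_simps)
  have "\<forall>i j. tform Z (Gmat i j) = Z $ j $ i"
    unfolding all_7
    by (intro conjI; simp add: Gmat_def u tform_uminus tform_scaleR tform_0 rels ss ss' s0 s [symmetric] of_real_divide field_simps)
  then show ?thesis by blast
qed

lemma g2_entries_mat: "g2_entries (mat_of_g2 Z)"
  using mat_of_g2 [of Z] by (simp add: g2_matrices_iff)

lemmas mat_relations = g2_entries_relations [OF g2_entries_mat]

lemma form_G: "g2_form (G i j) Z = mat_of_g2 Z $ j $ i"
proof -
  show ?thesis using tform_Gmat [OF g2_entries_mat, where i = i and j = j]
    by (simp add: g2_form_def tform_def G.rep_eq)
qed

lemma g2_eqI: "(\<And>i j. mat_of_g2 X $ i $ j = mat_of_g2 Y $ i $ j) \<Longrightarrow> X = Y"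
  by (simp add: mat_of_g2_inject [symmetric] vec_eq_iff)

text \<open>The method for identities in \<open>g2\<close>: after pairing with an arbitrary
  \<open>Z\<close>, \<open>form_G\<close> turns both sides into entries of \<open>Z\<close>.\<close>

lemma g2_form_nondegenerate: "(\<And>Z. g2_form X Z = g2_form Y Z) \<Longrightarrow> X = Y"
  by (rule g2_eqI) (metis form_G g2_form_commute)

lemma g2_form_sum_left: "g2_form (sum f A) Z = (\<Sum>a\<in>A. g2_form (f a) Z)"
  by (induction A rule: infinite_finite_induct) (simp_all add: g2_form_add_left)

lemma g2_form_diff_left: "g2_form (X - Y) Z = g2_form X Z - g2_form Y Z"
  using g2_form_add_left [of "X - Y" Y Z] by simp

text \<open>\<open>G i j\<close> is, up to a scalar, the orthogonal projection of the matrix unit, hence the family is equivariant.\<close>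

lemma bracket_G:
  "bracket Y (G i j) = (\<Sum>a\<in>UNIV. mat_of_g2 Y $ a $ i \<cdot> G a j) - (\<Sum>b\<in>UNIV. mat_of_g2 Y $ j $ b \<cdot> G i b)"
proof (rule g2_form_nondegenerate)
  fix Z
  have "g2_form (bracket Y (G i j)) Z = g2_form (G i j) (bracket Z Y)"
    using g2_form_invariant [of Z Y "G i j"] g2_form_invariant [of Y "G i j" Z] by (simp add: g2_form_commute)
  also have "\<dots> = (\<Sum>a\<in>UNIV. mat_of_g2 Z $ j $ a * mat_of_g2 Y $ a $ i) - (\<Sum>a\<in>UNIV. mat_of_g2 Y $ j $ a * mat_of_g2 Z $ a $ i)"
    by (simp add: form_G bracket_g2.rep_eq matrix_matrix_mult_def)
  also have "\<dots> = g2_form ((\<Sum>a\<in>UNIV. mat_of_g2 Y $ a $ i \<cdot> G a j) - (\<Sum>b\<in>UNIV. mat_of_g2 Y $ j $ b \<cdot> G i b)) Z"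
    by (simp add: g2_form_diff_left g2_form_sum_left g2_form_cscale_left form_G mult.commute)
  finally show "g2_form (bracket Y (G i j)) Z = \<dots>" .
qed

subsection \<open>A basis with integral structure constants\<close>

datatype idx = H1 | H2 | E12 | E13 | E21 | E23 | E31 | E32 | P1 | P2 | P3 | Q1 | Q2 | Q3

text \<open>The \<open>H\<close> and \<open>E\<close> span the long root subalgebra sl_3; the
  \<open>P\<close> and \<open>Q\<close> are the short root vectors, dual to each other under the
  form. Taking \<open>G 5 2\<close> instead of \<open>G 1 4\<close>, and likewise for the others,
  keeps the square root of 2 out of the brackets.\<close>

primrec bas :: "idx \<Rightarrow> g2" where
  "bas H1 = G 1 1"
| "bas H2 = G 2 2"
| "bas E12 = G 1 2"
| "bas E13 = G 1 3"
| "bas E21 = G 2 1"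
| "bas E23 = G 2 3"
| "bas E31 = G 3 1"
| "bas E32 = G 3 2"
| "bas P1 = G 5 2"
| "bas P2 = G 7 3"
| "bas P3 = G 6 1"
| "bas Q1 = G 2 5"
| "bas Q2 = G 3 7"
| "bas Q3 = G 1 6"

text \<open>The first two lines invert the diagonal part: c H1 + d H2 has the entries 2c - d and 2d
  - c in the positions (1, 1) and (2, 2).\<close>

primrec crd :: "idx \<Rightarrow> g2 \<Rightarrow> complex" where
  "crd H1 X = (2 * mat_of_g2 X $ 1 $ 1 + mat_of_g2 X $ 2 $ 2) / 3"
| "crd H2 X = (mat_of_g2 X $ 1 $ 1 + 2 * mat_of_g2 X $ 2 $ 2) / 3"
| "crd E12 X = mat_of_g2 X $ 1 $ 2 / 3"
| "crd E13 X = mat_of_g2 X $ 1 $ 3 / 3"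
| "crd E21 X = mat_of_g2 X $ 2 $ 1 / 3"
| "crd E23 X = mat_of_g2 X $ 2 $ 3 / 3"
| "crd E31 X = mat_of_g2 X $ 3 $ 1 / 3"
| "crd E32 X = mat_of_g2 X $ 3 $ 2 / 3"
| "crd P1 X = mat_of_g2 X $ 5 $ 2"
| "crd P2 X = mat_of_g2 X $ 7 $ 3"
| "crd P3 X = mat_of_g2 X $ 6 $ 1"
| "crd Q1 X = mat_of_g2 X $ 2 $ 5"
| "crd Q2 X = mat_of_g2 X $ 3 $ 7"
| "crd Q3 X = mat_of_g2 X $ 1 $ 6"

definition idxs :: "idx list" where "idxs = [H1, H2, E12, E13, E21, E23, E31, E32, P1, P2, P3, Q1, Q2, Q3]"

text \<open>The structure constants, confirmed in \<open>cmb_bracket\<close>. Association lists with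
  integer coefficients are the form in which the normal ordering program consumes them.\<close>

primrec br :: "idx \<Rightarrow> idx \<Rightarrow> (idx \<times> int) list" where
  "br H1 j = (case j of E12 \<Rightarrow> [(E12, 3)] | E13 \<Rightarrow> [(E13, 3)] | E21 \<Rightarrow> [(E21, -3)] | E31 \<Rightarrow> [(E31, -3)] | P1 \<Rightarrow> [(P1, 2)] | P2 \<Rightarrow> [(P2, -1)] | P3 \<Rightarrow> [(P3, -1)] | Q1 \<Rightarrow> [(Q1, -2)] | Q2 \<Rightarrow> [(Q2, 1)] | Q3 \<Rightarrow> [(Q3, 1)] | _ \<Rightarrow> [])"
| "br H2 j = (case j of E12 \<Rightarrow> [(E12, -3)] | E21 \<Rightarrow> [(E21, 3)] | E23 \<Rightarrow> [(E23, 3)] | E32 \<Rightarrow> [(E32, -3)] | P1 \<Rightarrow> [(P1, -1)] | P2 \<Rightarrow> [(P2, 2)] | P3 \<Rightarrow> [(P3, -1)] | Q1 \<Rightarrow> [(Q1, 1)] | Q2 \<Rightarrow> [(Q2, -2)] | Q3 \<Rightarrow> [(Q3, 1)] | _ \<Rightarrow> [])"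
| "br E12 j = (case j of H1 \<Rightarrow> [(E12, -3)] | H2 \<Rightarrow> [(E12, 3)] | E21 \<Rightarrow> [(H1, 3), (H2, -3)] | E23 \<Rightarrow> [(E13, 3)] | E31 \<Rightarrow> [(E32, -3)] | P2 \<Rightarrow> [(P1, 3)] | Q1 \<Rightarrow> [(Q2, -3)] | _ \<Rightarrow> [])"
| "br E13 j = (case j of H1 \<Rightarrow> [(E13, -3)] | E21 \<Rightarrow> [(E23, -3)] | E31 \<Rightarrow> [(H1, 6), (H2, 3)] | E32 \<Rightarrow> [(E12, 3)] | P3 \<Rightarrow> [(P1, 3)] | Q1 \<Rightarrow> [(Q3, -3)] | _ \<Rightarrow> [])"
| "br E21 j = (case j of H1 \<Rightarrow> [(E21, 3)] | H2 \<Rightarrow> [(E21, -3)] | E12 \<Rightarrow> [(H1, -3), (H2, 3)] | E13 \<Rightarrow> [(E23, 3)] | E32 \<Rightarrow> [(E31, -3)] | P1 \<Rightarrow> [(P2, 3)] | Q2 \<Rightarrow> [(Q1, -3)] | _ \<Rightarrow> [])"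
| "br E23 j = (case j of H2 \<Rightarrow> [(E23, -3)] | E12 \<Rightarrow> [(E13, -3)] | E31 \<Rightarrow> [(E21, 3)] | E32 \<Rightarrow> [(H1, 3), (H2, 6)] | P3 \<Rightarrow> [(P2, 3)] | Q2 \<Rightarrow> [(Q3, -3)] | _ \<Rightarrow> [])"
| "br E31 j = (case j of H1 \<Rightarrow> [(E31, 3)] | E12 \<Rightarrow> [(E32, 3)] | E13 \<Rightarrow> [(H1, -6), (H2, -3)] | E23 \<Rightarrow> [(E21, -3)] | P1 \<Rightarrow> [(P3, 3)] | Q3 \<Rightarrow> [(Q1, -3)] | _ \<Rightarrow> [])"
| "br E32 j = (case j of H2 \<Rightarrow> [(E32, 3)] | E13 \<Rightarrow> [(E12, -3)] | E21 \<Rightarrow> [(E31, 3)] | E23 \<Rightarrow> [(H1, -3), (H2, -6)] | P2 \<Rightarrow> [(P3, 3)] | Q3 \<Rightarrow> [(Q2, -3)] | _ \<Rightarrow> [])"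
| "br P1 j = (case j of H1 \<Rightarrow> [(P1, -2)] | H2 \<Rightarrow> [(P1, 1)] | E21 \<Rightarrow> [(P2, -3)] | E31 \<Rightarrow> [(P3, -3)] | P2 \<Rightarrow> [(Q3, -2)] | P3 \<Rightarrow> [(Q2, 2)] | Q1 \<Rightarrow> [(H1, 1)] | Q2 \<Rightarrow> [(E12, 1)] | Q3 \<Rightarrow> [(E13, 1)] | _ \<Rightarrow> [])"
| "br P2 j = (case j of H1 \<Rightarrow> [(P2, 1)] | H2 \<Rightarrow> [(P2, -2)] | E12 \<Rightarrow> [(P1, -3)] | E32 \<Rightarrow> [(P3, -3)] | P1 \<Rightarrow> [(Q3, 2)] | P3 \<Rightarrow> [(Q1, -2)] | Q1 \<Rightarrow> [(E21, 1)] | Q2 \<Rightarrow> [(H2, 1)] | Q3 \<Rightarrow> [(E23, 1)] | _ \<Rightarrow> [])"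
| "br P3 j = (case j of H1 \<Rightarrow> [(P3, 1)] | H2 \<Rightarrow> [(P3, 1)] | E13 \<Rightarrow> [(P1, -3)] | E23 \<Rightarrow> [(P2, -3)] | P1 \<Rightarrow> [(Q2, -2)] | P2 \<Rightarrow> [(Q1, 2)] | Q1 \<Rightarrow> [(E31, 1)] | Q2 \<Rightarrow> [(E32, 1)] | Q3 \<Rightarrow> [(H1, -1), (H2, -1)] | _ \<Rightarrow> [])"
| "br Q1 j = (case j of H1 \<Rightarrow> [(Q1, 2)] | H2 \<Rightarrow> [(Q1, -1)] | E12 \<Rightarrow> [(Q2, 3)] | E13 \<Rightarrow> [(Q3, 3)] | P1 \<Rightarrow> [(H1, -1)] | P2 \<Rightarrow> [(E21, -1)] | P3 \<Rightarrow> [(E31, -1)] | Q2 \<Rightarrow> [(P3, 2)] | Q3 \<Rightarrow> [(P2, -2)] | _ \<Rightarrow> [])"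
| "br Q2 j = (case j of H1 \<Rightarrow> [(Q2, -1)] | H2 \<Rightarrow> [(Q2, 2)] | E21 \<Rightarrow> [(Q1, 3)] | E23 \<Rightarrow> [(Q3, 3)] | P1 \<Rightarrow> [(E12, -1)] | P2 \<Rightarrow> [(H2, -1)] | P3 \<Rightarrow> [(E32, -1)] | Q1 \<Rightarrow> [(P3, -2)] | Q3 \<Rightarrow> [(P1, 2)] | _ \<Rightarrow> [])"
| "br Q3 j = (case j of H1 \<Rightarrow> [(Q3, -1)] | H2 \<Rightarrow> [(Q3, -1)] | E31 \<Rightarrow> [(Q1, 3)] | E32 \<Rightarrow> [(Q2, 3)] | P1 \<Rightarrow> [(E13, -1)] | P2 \<Rightarrow> [(E23, -1)] | P3 \<Rightarrow> [(H1, 1), (H2, 1)] | Q1 \<Rightarrow> [(P2, 2)] | Q2 \<Rightarrow> [(P1, -2)] | _ \<Rightarrow> [])"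

primrec cmb :: "(idx \<times> int) list \<Rightarrow> g2" where
  "cmb [] = 0"
| "cmb (e # es) = of_int (snd e) \<cdot> bas (fst e) + cmb es"

text \<open>The quotient of the diagonal entries \<open>a\<close> and \<open>b\<close> of diag(1, 1,
  1, sqrt 2, 1, 1, 1). Once it is split off, all coefficients in \<open>G_table\<close> are
  integers.\<close>

definition gam :: "7 \<Rightarrow> 7 \<Rightarrow> complex"
  where "gam a b = (if a = b then 1 else if a = 4 then complex_of_real (sqrt 2) else if b = 4 then 1 / complex_of_real (sqrt 2) else 1)"

lemma G_table:

  "G 1 1 = gam 1 1 \<cdot> cmb [(H1, 1)]" "G 1 2 = gam 1 2 \<cdot> cmb [(E12, 1)]" "G 1 3 = gam 1 3 \<cdot> cmb [(E13, 1)]" "G 1 4 = gam 1 4 \<cdot> cmb [(P1, -2)]" "G 1 5 = gam 1 5 \<cdot> cmb [(Q2, -1)]" "G 1 6 = gam 1 6 \<cdot> cmb [(Q3, 1)]" "G 1 7 = gam 1 7 \<cdot> cmb []"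
  "G 2 1 = gam 2 1 \<cdot> cmb [(E21, 1)]" "G 2 2 = gam 2 2 \<cdot> cmb [(H2, 1)]" "G 2 3 = gam 2 3 \<cdot> cmb [(E23, 1)]" "G 2 4 = gam 2 4 \<cdot> cmb [(P2, -2)]" "G 2 5 = gam 2 5 \<cdot> cmb [(Q1, 1)]" "G 2 6 = gam 2 6 \<cdot> cmb []" "G 2 7 = gam 2 7 \<cdot> cmb [(Q3, -1)]"
  "G 3 1 = gam 3 1 \<cdot> cmb [(E31, 1)]" "G 3 2 = gam 3 2 \<cdot> cmb [(E32, 1)]" "G 3 3 = gam 3 3 \<cdot> cmb [(H1, -1), (H2, -1)]" "G 3 4 = gam 3 4 \<cdot> cmb [(P3, -2)]" "G 3 5 = gam 3 5 \<cdot> cmb []" "G 3 6 = gam 3 6 \<cdot> cmb [(Q1, -1)]" "G 3 7 = gam 3 7 \<cdot> cmb [(Q2, 1)]"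
  "G 4 1 = gam 4 1 \<cdot> cmb [(Q1, -1)]" "G 4 2 = gam 4 2 \<cdot> cmb [(Q2, -1)]" "G 4 3 = gam 4 3 \<cdot> cmb [(Q3, -1)]" "G 4 4 = gam 4 4 \<cdot> cmb []" "G 4 5 = gam 4 5 \<cdot> cmb [(P3, 1)]" "G 4 6 = gam 4 6 \<cdot> cmb [(P2, 1)]" "G 4 7 = gam 4 7 \<cdot> cmb [(P1, 1)]"
  "G 5 1 = gam 5 1 \<cdot> cmb [(P2, -1)]" "G 5 2 = gam 5 2 \<cdot> cmb [(P1, 1)]" "G 5 3 = gam 5 3 \<cdot> cmb []" "G 5 4 = gam 5 4 \<cdot> cmb [(Q3, 2)]" "G 5 5 = gam 5 5 \<cdot> cmb [(H1, 1), (H2, 1)]" "G 5 6 = gam 5 6 \<cdot> cmb [(E23, -1)]" "G 5 7 = gam 5 7 \<cdot> cmb [(E13, -1)]"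
  "G 6 1 = gam 6 1 \<cdot> cmb [(P3, 1)]" "G 6 2 = gam 6 2 \<cdot> cmb []" "G 6 3 = gam 6 3 \<cdot> cmb [(P1, -1)]" "G 6 4 = gam 6 4 \<cdot> cmb [(Q2, 2)]" "G 6 5 = gam 6 5 \<cdot> cmb [(E32, -1)]" "G 6 6 = gam 6 6 \<cdot> cmb [(H2, -1)]" "G 6 7 = gam 6 7 \<cdot> cmb [(E12, -1)]"
  "G 7 1 = gam 7 1 \<cdot> cmb []" "G 7 2 = gam 7 2 \<cdot> cmb [(P3, -1)]" "G 7 3 = gam 7 3 \<cdot> cmb [(P2, 1)]" "G 7 4 = gam 7 4 \<cdot> cmb [(Q1, 2)]" "G 7 5 = gam 7 5 \<cdot> cmb [(E31, -1)]" "G 7 6 = gam 7 6 \<cdot> cmb [(E21, -1)]" "G 7 7 = gam 7 7 \<cdot> cmb [(H1, -1)]"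
  by (rule g2_form_nondegenerate; simp add: form_G mat_relations g2_form_cscale_left g2_form_add_left gam_def sqrt2_facts field_simps)+

lemma crd_add: "crd i (X + Y) = crd i X + crd i Y"
  by (cases i) (simp_all add: plus_g2.rep_eq add_divide_distrib distrib_left)

lemma crd_cscale: "crd i (c \<cdot> X) = c * crd i X"
  by (cases i) (simp_all add: cscale_g2.rep_eq field_simps)

lemma crd_0: "crd i 0 = 0"
  using crd_cscale [of i 0 0] by simp

lemma crd_diff: "crd i (X - Y) = crd i X - crd i Y"
  using crd_add [of i "X - Y" Y] by simp

lemma crd_eqI:
  assumes "\<And>i. crd i X = crd i Y"
  shows "X = Y"
proof -
  define D where "D = mat_of_g2 (X - Y)"
  have c: "crd i (X - Y) = 0" for i using assms by (simp add: crd_diff)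
  have e: "D $ 1 $ 2 = 0" "D $ 1 $ 3 = 0" "D $ 2 $ 1 = 0" "D $ 2 $ 3 = 0" "D $ 3 $ 1 = 0" "D $ 3 $ 2 = 0"
    "D $ 5 $ 2 = 0" "D $ 7 $ 3 = 0" "D $ 6 $ 1 = 0" "D $ 2 $ 5 = 0" "D $ 3 $ 7 = 0" "D $ 1 $ 6 = 0"
    using c [of E12] c [of E13] c [of E21] c [of E23] c [of E31] c [of E32] c [of P1] c [of P2] c [of P3]
      c [of Q1] c [of Q2] c [of Q3] by (simp_all add: D_def)
  have "2 * D $ 1 $ 1 + D $ 2 $ 2 = 0" "D $ 1 $ 1 + 2 * D $ 2 $ 2 = 0"
    using c [of H1] c [of H2] by (simp_all add: D_def)
  then have "3 * D $ 1 $ 1 = 0" "D $ 2 $ 2 = - 2 * D $ 1 $ 1"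
    by (simp_all add: algebra_simps eq_neg_iff_add_eq_0) algebra
  then have d: "D $ 1 $ 1 = 0" "D $ 2 $ 2 = 0" by auto
  have "D = 0"
  proof (rule g2_entries_eq_0)
    show "g2_entries D" unfolding D_def by (rule g2_entries_mat)
  qed (auto simp: e d mat_relations [of "X - Y", folded D_def])
  then have "mat_of_g2 (X - Y) = mat_of_g2 0" by (simp add: D_def zero_g2.rep_eq)
  then show ?thesis by (simp add: mat_of_g2_inject)
qed

lemma crd_bas: "crd i (bas j) = (if i = j then 1 else 0)"
  by (cases j; cases i; simp add: G.rep_eq Gmat_def Gmat_upper_def Fmat_nth scaleR_conv_of_real [where 'a = complex])

lemma g2_expand: "X = (\<Sum>i\<leftarrow>idxs. crd i X \<cdot> bas i)"
  by (rule crd_eqI, rename_tac i, case_tac i; simp add: idxs_def crd_add crd_0 crd_cscale crd_bas del: crd.simps bas.simps)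

lemma crd_cmb: "crd i (cmb es) = (\<Sum>e\<leftarrow>es. if fst e = i then of_int (snd e) else 0)"
  by (induction es) (auto simp: crd_0 crd_add crd_cscale crd_bas)

abbreviation gx :: "7 \<Rightarrow> 7 \<Rightarrow> 7 \<Rightarrow> 7 \<Rightarrow> complex" where "gx i j a b \<equiv> mat_of_g2 (G i j) $ a $ b"

text \<open>The fourteen independent entries of each basis vector; \<open>mat_relations\<close>
  supplies the others.\<close>

lemma bas_core:
  "gx 1 1 1 1 = 2" "gx 1 1 2 2 = -1" "gx 1 1 1 2 = 0" "gx 1 1 1 3 = 0" "gx 1 1 2 1 = 0" "gx 1 1 2 3 = 0" "gx 1 1 3 1 = 0" "gx 1 1 3 2 = 0" "gx 1 1 5 2 = 0" "gx 1 1 7 3 = 0" "gx 1 1 6 1 = 0" "gx 1 1 2 5 = 0" "gx 1 1 3 7 = 0" "gx 1 1 1 6 = 0"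
  "gx 2 2 1 1 = -1" "gx 2 2 2 2 = 2" "gx 2 2 1 2 = 0" "gx 2 2 1 3 = 0" "gx 2 2 2 1 = 0" "gx 2 2 2 3 = 0" "gx 2 2 3 1 = 0" "gx 2 2 3 2 = 0" "gx 2 2 5 2 = 0" "gx 2 2 7 3 = 0" "gx 2 2 6 1 = 0" "gx 2 2 2 5 = 0" "gx 2 2 3 7 = 0" "gx 2 2 1 6 = 0"
  "gx 1 2 1 1 = 0" "gx 1 2 2 2 = 0" "gx 1 2 1 2 = 3" "gx 1 2 1 3 = 0" "gx 1 2 2 1 = 0" "gx 1 2 2 3 = 0" "gx 1 2 3 1 = 0" "gx 1 2 3 2 = 0" "gx 1 2 5 2 = 0" "gx 1 2 7 3 = 0" "gx 1 2 6 1 = 0" "gx 1 2 2 5 = 0" "gx 1 2 3 7 = 0" "gx 1 2 1 6 = 0"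
  "gx 1 3 1 1 = 0" "gx 1 3 2 2 = 0" "gx 1 3 1 2 = 0" "gx 1 3 1 3 = 3" "gx 1 3 2 1 = 0" "gx 1 3 2 3 = 0" "gx 1 3 3 1 = 0" "gx 1 3 3 2 = 0" "gx 1 3 5 2 = 0" "gx 1 3 7 3 = 0" "gx 1 3 6 1 = 0" "gx 1 3 2 5 = 0" "gx 1 3 3 7 = 0" "gx 1 3 1 6 = 0"
  "gx 2 1 1 1 = 0" "gx 2 1 2 2 = 0" "gx 2 1 1 2 = 0" "gx 2 1 1 3 = 0" "gx 2 1 2 1 = 3" "gx 2 1 2 3 = 0" "gx 2 1 3 1 = 0" "gx 2 1 3 2 = 0" "gx 2 1 5 2 = 0" "gx 2 1 7 3 = 0" "gx 2 1 6 1 = 0" "gx 2 1 2 5 = 0" "gx 2 1 3 7 = 0" "gx 2 1 1 6 = 0"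
  "gx 2 3 1 1 = 0" "gx 2 3 2 2 = 0" "gx 2 3 1 2 = 0" "gx 2 3 1 3 = 0" "gx 2 3 2 1 = 0" "gx 2 3 2 3 = 3" "gx 2 3 3 1 = 0" "gx 2 3 3 2 = 0" "gx 2 3 5 2 = 0" "gx 2 3 7 3 = 0" "gx 2 3 6 1 = 0" "gx 2 3 2 5 = 0" "gx 2 3 3 7 = 0" "gx 2 3 1 6 = 0"
  "gx 3 1 1 1 = 0" "gx 3 1 2 2 = 0" "gx 3 1 1 2 = 0" "gx 3 1 1 3 = 0" "gx 3 1 2 1 = 0" "gx 3 1 2 3 = 0" "gx 3 1 3 1 = 3" "gx 3 1 3 2 = 0" "gx 3 1 5 2 = 0" "gx 3 1 7 3 = 0" "gx 3 1 6 1 = 0" "gx 3 1 2 5 = 0" "gx 3 1 3 7 = 0" "gx 3 1 1 6 = 0"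
  "gx 3 2 1 1 = 0" "gx 3 2 2 2 = 0" "gx 3 2 1 2 = 0" "gx 3 2 1 3 = 0" "gx 3 2 2 1 = 0" "gx 3 2 2 3 = 0" "gx 3 2 3 1 = 0" "gx 3 2 3 2 = 3" "gx 3 2 5 2 = 0" "gx 3 2 7 3 = 0" "gx 3 2 6 1 = 0" "gx 3 2 2 5 = 0" "gx 3 2 3 7 = 0" "gx 3 2 1 6 = 0"
  "gx 5 2 1 1 = 0" "gx 5 2 2 2 = 0" "gx 5 2 1 2 = 0" "gx 5 2 1 3 = 0" "gx 5 2 2 1 = 0" "gx 5 2 2 3 = 0" "gx 5 2 3 1 = 0" "gx 5 2 3 2 = 0" "gx 5 2 5 2 = 1" "gx 5 2 7 3 = 0" "gx 5 2 6 1 = 0" "gx 5 2 2 5 = 0" "gx 5 2 3 7 = 0" "gx 5 2 1 6 = 0"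
  "gx 7 3 1 1 = 0" "gx 7 3 2 2 = 0" "gx 7 3 1 2 = 0" "gx 7 3 1 3 = 0" "gx 7 3 2 1 = 0" "gx 7 3 2 3 = 0" "gx 7 3 3 1 = 0" "gx 7 3 3 2 = 0" "gx 7 3 5 2 = 0" "gx 7 3 7 3 = 1" "gx 7 3 6 1 = 0" "gx 7 3 2 5 = 0" "gx 7 3 3 7 = 0" "gx 7 3 1 6 = 0"
  "gx 6 1 1 1 = 0" "gx 6 1 2 2 = 0" "gx 6 1 1 2 = 0" "gx 6 1 1 3 = 0" "gx 6 1 2 1 = 0" "gx 6 1 2 3 = 0" "gx 6 1 3 1 = 0" "gx 6 1 3 2 = 0" "gx 6 1 5 2 = 0" "gx 6 1 7 3 = 0" "gx 6 1 6 1 = 1" "gx 6 1 2 5 = 0" "gx 6 1 3 7 = 0" "gx 6 1 1 6 = 0"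
  "gx 2 5 1 1 = 0" "gx 2 5 2 2 = 0" "gx 2 5 1 2 = 0" "gx 2 5 1 3 = 0" "gx 2 5 2 1 = 0" "gx 2 5 2 3 = 0" "gx 2 5 3 1 = 0" "gx 2 5 3 2 = 0" "gx 2 5 5 2 = 0" "gx 2 5 7 3 = 0" "gx 2 5 6 1 = 0" "gx 2 5 2 5 = 1" "gx 2 5 3 7 = 0" "gx 2 5 1 6 = 0"
  "gx 3 7 1 1 = 0" "gx 3 7 2 2 = 0" "gx 3 7 1 2 = 0" "gx 3 7 1 3 = 0" "gx 3 7 2 1 = 0" "gx 3 7 2 3 = 0" "gx 3 7 3 1 = 0" "gx 3 7 3 2 = 0" "gx 3 7 5 2 = 0" "gx 3 7 7 3 = 0" "gx 3 7 6 1 = 0" "gx 3 7 2 5 = 0" "gx 3 7 3 7 = 1" "gx 3 7 1 6 = 0"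
  "gx 1 6 1 1 = 0" "gx 1 6 2 2 = 0" "gx 1 6 1 2 = 0" "gx 1 6 1 3 = 0" "gx 1 6 2 1 = 0" "gx 1 6 2 3 = 0" "gx 1 6 3 1 = 0" "gx 1 6 3 2 = 0" "gx 1 6 5 2 = 0" "gx 1 6 7 3 = 0" "gx 1 6 6 1 = 0" "gx 1 6 2 5 = 0" "gx 1 6 3 7 = 0" "gx 1 6 1 6 = 1"
  by (simp_all add: G.rep_eq Gmat_def Gmat_upper_def Fmat_nth scaleR_conv_of_real [where 'a = complex])

section \<open>Polynomials\<close>

text \<open>Monomials are multisets, so that convolution is the polynomial product and the smallest
  letter of a monomial can be split off by \<open>Min_mset\<close>.\<close>

type_synonym 'v mpoly = "'v multiset \<Rightarrow>\<^sub>0 complex"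

definition cst :: "complex \<Rightarrow> 'v mpoly" where "cst c = Poly_Mapping.single {#} c"
definition mon :: "'v multiset \<Rightarrow> 'v mpoly" where "mon M = Poly_Mapping.single M 1"
abbreviation var :: "'v \<Rightarrow> 'v mpoly" where "var v \<equiv> mon {#v#}"

lemma cst_simps: "cst 0 = 0" "cst 1 = 1" "cst (a + b) = cst a + cst b" "cst (a * b) = cst a * cst b"
  "cst (- a) = - cst a" "cst (a - b) = cst a - cst b"
  by (simp_all add: cst_def single_add single_uminus single_diff mult_single zero_multiset_def [symmetric]
      single_one [symmetric] del: single_one)

lemma cst_eq_0_iff [simp]: "cst c = 0 \<longleftrightarrow> c = 0"
  unfolding cst_def by (metis lookup_single_eq lookup_zero single_zero)

lemma cst_of_nat: "cst (of_nat n) = of_nat n"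
  by (induction n) (simp_all add: cst_simps)

lemma mon_0: "mon {#} = 1"
  by (simp add: mon_def zero_multiset_def [symmetric])

lemma mon_plus: "mon (M + N) = mon M * mon N"
  by (simp add: mon_def mult_single)

lemma mon_add_mset: "mon (add_mset v M) = var v * mon M"
  using mon_plus [of "{#v#}" M] by simp

lemma single_eq: "Poly_Mapping.single M c = cst c * mon M"
  by (simp add: cst_def mon_def mult_single zero_multiset_def [symmetric])

lemma lookup_cst_mult [simp]: "Poly_Mapping.lookup (cst c * p) M = c * Poly_Mapping.lookup p M"
proof (induction p rule: poly_mapping_additive_induct)
  case (1 k d)
  then show ?case by (simp add: cst_def mult_single lookup_single when_def)
qed (simp add: distrib_left lookup_add)

lemma keys_cst_mult: "Poly_Mapping.keys (cst c * p) \<subseteq> Poly_Mapping.keys p"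
  by (auto simp: in_keys_iff)

lemma mpoly_expand: "p = (\<Sum>M\<in>Poly_Mapping.keys p. cst (Poly_Mapping.lookup p M) * mon M)"
proof (rule poly_mapping_eqI)
  fix K
  have "Poly_Mapping.lookup (\<Sum>M\<in>Poly_Mapping.keys p. cst (Poly_Mapping.lookup p M) * mon M) K
     = (\<Sum>M\<in>Poly_Mapping.keys p. if M = K then Poly_Mapping.lookup p M else 0)"
    by (simp add: lookup_sum mon_def lookup_single when_def if_distrib cong: if_cong)
  then show "Poly_Mapping.lookup p K = Poly_Mapping.lookup (\<Sum>M\<in>Poly_Mapping.keys p. cst (Poly_Mapping.lookup p M) * mon M) K"
    by (auto simp: in_keys_iff)
qed

definition linop :: "('v mpoly \<Rightarrow> 'w mpoly) \<Rightarrow> bool"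
  where "linop T \<longleftrightarrow> (\<forall>p q. T (p + q) = T p + T q) \<and> (\<forall>c p. T (cst c * p) = cst c * T p)"

lemma linopD: "linop T \<Longrightarrow> T (p + q) = T p + T q" "linop T \<Longrightarrow> T (cst c * p) = cst c * T p"
  by (auto simp: linop_def)

lemma linop_0: "linop T \<Longrightarrow> T 0 = 0"
  using linopD(2) [of T 0 0] by (simp add: cst_simps)

lemma linop_diff: "linop T \<Longrightarrow> T (p - q) = T p - T q"
  using linopD(1) [of T "p - q" q] by simp

lemma linop_sum: "linop T \<Longrightarrow> T (sum f A) = (\<Sum>a\<in>A. T (f a))"
  by (induction A rule: infinite_finite_induct) (simp_all add: linop_0 linopD)

lemma linop_expand:
  "linop T \<Longrightarrow> T p = (\<Sum>M\<in>Poly_Mapping.keys p. cst (Poly_Mapping.lookup p M) * T (mon M))"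
  by (subst mpoly_expand [of p]) (simp add: linop_sum linopD)

lemma linop_eqI:
  assumes "linop T" "linop T'" "\<And>M. M \<in> Poly_Mapping.keys p \<Longrightarrow> T (mon M) = T' (mon M)"
  shows "T p = T' p"
  using assms by (simp add: linop_expand [of T p] linop_expand [of T' p])

definition lin :: "('v multiset \<Rightarrow> 'w mpoly) \<Rightarrow> 'v mpoly \<Rightarrow> 'w mpoly"
  where "lin f p = (\<Sum>M\<in>Poly_Mapping.keys p. cst (Poly_Mapping.lookup p M) * f M)"

lemma lin_add: "lin f (p + q) = lin f p + lin f q"
  unfolding lin_def by (rule setsum_keys_plus_distrib) (simp_all add: cst_simps distrib_right)

lemma lin_mon [simp]: "lin f (mon M) = f M"
  by (simp add: lin_def mon_def cst_simps)

lemma lin_single: "lin f (Poly_Mapping.single M c) = cst c * f M"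
  by (simp add: lin_def cst_simps)

lemma linop_lin: "linop (lin f)"
  unfolding linop_def
proof (intro conjI allI)
  show "lin f (cst c * p) = cst c * lin f p" for c p
  proof (induction p rule: poly_mapping_additive_induct)
    case (1 M d)
    have "cst c * Poly_Mapping.single M d = Poly_Mapping.single M (c * d)"
      by (simp add: single_eq cst_simps mult.assoc)
    then show ?case by (simp add: lin_single cst_simps mult.assoc)
  qed (simp add: distrib_left lin_add)
qed (rule lin_add)

lemma linop_comp: "linop S \<Longrightarrow> linop T \<Longrightarrow> linop (\<lambda>p. S (T p))"
  by (simp add: linop_def)

lemma linop_plus: "linop S \<Longrightarrow> linop T \<Longrightarrow> linop (\<lambda>p. S p + T p)"
  by (simp add: linop_def distrib_left)

lemma linop_minus: "linop S \<Longrightarrow> linop T \<Longrightarrow> linop (\<lambda>p. S p - T p)"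
  by (simp add: linop_def right_diff_distrib)

lemma linop_id: "linop (\<lambda>p. p)"
  by (simp add: linop_def)

lemma linop_mult: "linop (\<lambda>p. q * p)"
  by (simp add: linop_def algebra_simps)

subsection \<open>Degrees\<close>

definition bdd :: "nat \<Rightarrow> 'v mpoly \<Rightarrow> bool"
  where "bdd d p \<longleftrightarrow> (\<forall>M\<in>Poly_Mapping.keys p. size M \<le> d)"

lemma bdd_0 [simp]: "bdd d 0" by (simp add: bdd_def)
lemma bdd_mono: "bdd d p \<Longrightarrow> d \<le> d' \<Longrightarrow> bdd d' p" by (fastforce simp: bdd_def)
lemma bdd_add: "bdd d p \<Longrightarrow> bdd d q \<Longrightarrow> bdd d (p + q)"
  using Poly_Mapping.keys_add [of p q] by (fastforce simp: bdd_def)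
lemma bdd_sum: "(\<And>a. a \<in> A \<Longrightarrow> bdd d (f a)) \<Longrightarrow> bdd d (sum f A)"
  by (induction A rule: infinite_finite_induct) (simp_all add: bdd_add)
lemma bdd_mult: "bdd d p \<Longrightarrow> bdd d' q \<Longrightarrow> bdd (d + d') (p * q)"
  using keys_mult [of p q] unfolding bdd_def by (fastforce intro: add_mono)
lemma bdd_mon: "bdd (size M) (mon M)" by (simp add: bdd_def mon_def)
lemma bdd_cst: "bdd d (cst c)" by (simp add: bdd_def cst_def)
lemma bdd_cst_mult: "bdd d p \<Longrightarrow> bdd d (cst c * p)"
  using keys_cst_mult [of c p] by (auto simp: bdd_def)
lemma bdd_lin: "(\<And>M. M \<in> Poly_Mapping.keys p \<Longrightarrow> bdd d (f M)) \<Longrightarrow> bdd d (lin f p)"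
  unfolding lin_def by (intro bdd_sum bdd_cst_mult)
section \<open>The induced module\<close>

text \<open>The Lie algebra is the direct sum of the span of the \<open>e k\<close> and the
  subalgebra \<open>range bp\<close>, on which \<open>chi\<close> is a character. The module induced
  from \<open>chi\<close> is built on polynomials in the letters \<open>k\<close>. No basis of the
  subalgebra enters, and the span of the \<open>e k\<close> is only a vector space
  complement.\<close>

locale pbw =
  fixes e :: "nat \<Rightarrow> 'a::complex_lie_algebra" and co :: "'a \<Rightarrow> nat \<Rightarrow>\<^sub>0 complex"
    and bp :: "'a \<Rightarrow> 'a" and chi :: "'a \<Rightarrow> complex"
  assumes decomp: "x = (\<Sum>k\<in>Poly_Mapping.keys (co x). Poly_Mapping.lookup (co x) k \<cdot> e k) + bp x"
    and co_add: "co (x + y) = co x + co y"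
    and co_scale: "Poly_Mapping.lookup (co (c \<cdot> x)) k = c * Poly_Mapping.lookup (co x) k"
    and co_e: "co (e k) = Poly_Mapping.single k 1"
    and co_bp: "co (bp x) = 0"
    and bp_add: "bp (x + y) = bp x + bp y"
    and bp_scale: "bp (c \<cdot> x) = c \<cdot> bp x"
    and chi_add: "chi (x + y) = chi x + chi y"
    and chi_scale: "chi (c \<cdot> x) = c * chi x"
    and co_bracket: "co (bracket (bp x) (bp y)) = 0"
    and chi_bracket: "chi (bracket (bp x) (bp y)) = 0"
begin

definition lead :: "'a \<Rightarrow> nat mpoly"
  where "lead x = (\<Sum>k\<in>Poly_Mapping.keys (co x). cst (Poly_Mapping.lookup (co x) k) * var k)"

definition lo :: "nat \<Rightarrow> 'a \<Rightarrow> 'a"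
  where "lo j x = (\<Sum>k\<le>j. Poly_Mapping.lookup (co x) k \<cdot> e k)"

text \<open>The part that has to be moved past \<open>e j\<close>: the basis vectors above
  \<open>j\<close> together with the component in the subalgebra.\<close>

definition hi :: "nat \<Rightarrow> 'a \<Rightarrow> 'a" where "hi j x = x - lo j x"

lemma cscale_minus1: "(- 1) \<cdot> x = - (x :: 'a)"
  using cscale_add_left [of 1 "- 1" x] by (simp add: cscale_one eq_neg_iff_add_eq_0 add.commute)

lemma cscale_right_sum: "c \<cdot> sum f A = (\<Sum>a\<in>A. c \<cdot> (f a :: 'a))"
  by (induction A rule: infinite_finite_induct) (simp_all add: cscale_add_right)

lemma co_0: "co 0 = 0" using co_add [of 0 0] by simp
lemma chi_0: "chi 0 = 0" using chi_add [of 0 0] by simp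
lemma co_uminus: "co (- x) = - co x"
  using co_add [of x "- x"] by (simp add: co_0 eq_neg_iff_add_eq_0 add.commute)
lemma co_diff: "co (x - y) = co x - co y"
  using co_add [of x "- y"] by (simp add: co_uminus)
lemma co_sum: "co (sum f A) = (\<Sum>a\<in>A. co (f a))"
  by (induction A rule: infinite_finite_induct) (simp_all add: co_0 co_add)

lemma bp_e: "bp (e k) = 0"
  using decomp [of "e k"] by (simp add: co_e cscale_one)

lemma lead_add: "lead (x + y) = lead x + lead y"
  unfolding lead_def co_add by (rule setsum_keys_plus_distrib) (simp_all add: cst_simps distrib_right)

lemma lead_scale: "lead (c \<cdot> x) = cst c * lead x"
proof (cases "c = 0")
  case True
  then show ?thesis by (simp add: lead_def co_0 cst_simps)
next
  case False
  then have "Poly_Mapping.keys (co (c \<cdot> x)) = Poly_Mapping.keys (co x)"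
    by (auto simp: in_keys_iff co_scale)
  then show ?thesis by (simp add: lead_def co_scale cst_simps sum_distrib_left mult.assoc)
qed

lemma lead_0: "lead 0 = 0"
  by (simp add: lead_def co_0)

lemma lead_e: "lead (e k) = var k"
  by (simp add: lead_def co_e cst_simps)

lemma lead_bp: "lead (bp x) = 0"
  by (simp add: lead_def co_bp)

lemma bdd_lead: "bdd 1 (lead x)"
  unfolding lead_def by (intro bdd_sum bdd_cst_mult) (metis bdd_mon size_single)

lemma bdd_lead_mon: "bdd (Suc (size M)) (lead x * mon M)"
  using bdd_mult [OF bdd_lead bdd_mon] by simp

lemma keys_lead_mon:
  assumes "K \<in> Poly_Mapping.keys (lead y * mon N)"
  obtains l where "l \<in> Poly_Mapping.keys (co y)" "K = add_mset l N"
proof -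
  obtain A where A: "A \<in> Poly_Mapping.keys (lead y)" "K = A + N"
    using assms keys_mult [of "lead y" "mon N"] by (auto simp: mon_def)
  have "A \<in> (\<Union>l\<in>Poly_Mapping.keys (co y). Poly_Mapping.keys (cst (Poly_Mapping.lookup (co y) l) * var l))"
    using A(1) Poly_Mapping.keys_sum [of "\<lambda>l. cst (Poly_Mapping.lookup (co y) l) * var l" "Poly_Mapping.keys (co y)"]
    unfolding lead_def by blast
  then obtain l where "l \<in> Poly_Mapping.keys (co y)" "A = {#l#}"
    using keys_cst_mult by (fastforce simp: mon_def)
  then show thesis using that A(2) by simp
qed

lemma lo_add: "lo j (x + y) = lo j x + lo j y"
  by (simp add: lo_def co_add lookup_add cscale_add_left sum.distrib)

lemma lo_scale: "lo j (c \<cdot> x) = c \<cdot> lo j x"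
  by (simp add: lo_def co_scale cscale_right_sum cscale_cscale)

lemma hi_add: "hi j (x + y) = hi j x + hi j y"
  by (simp add: hi_def lo_add)

lemma cscale_diff_right: "c \<cdot> (x - y) = c \<cdot> x - c \<cdot> (y :: 'a)"
  using cscale_add_right [of c "x - y" y] by simp

lemma hi_scale: "hi j (c \<cdot> x) = c \<cdot> hi j x"
  by (simp add: hi_def lo_scale cscale_diff_right)

lemma co_lo: "Poly_Mapping.lookup (co (lo j x)) k = (if k \<le> j then Poly_Mapping.lookup (co x) k else 0)"
  by (simp add: lo_def co_sum lookup_sum co_scale co_e lookup_single when_def if_distrib cong: if_cong)

lemma co_hi: "k \<le> j \<Longrightarrow> Poly_Mapping.lookup (co (hi j x)) k = 0"
  by (simp add: hi_def co_diff lookup_minus co_lo)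

lemma lo_eq_0: "(\<And>k. k \<le> j \<Longrightarrow> Poly_Mapping.lookup (co x) k = 0) \<Longrightarrow> lo j x = 0"
  by (simp add: lo_def)

lemma hi_e: "i \<le> j \<Longrightarrow> hi j (e i) = 0"
  by (simp add: hi_def lo_def co_e lookup_single when_def if_distrib [of "\<lambda>c. c \<cdot> _"] cscale_one cong: if_cong)

text \<open>Let \<open>j\<close> be the smallest letter of \<open>M\<close> and y = hi j x. Then y
  e_j N = e_j (y N) + [y, e_j] N, and e_j times the leading part of y N is already ordered. All
  leading parts together give \<open>lead x * mon M\<close>, and \<open>e j\<close> still has to act
  on the remainder of y N. That this remainder is no longer than \<open>N\<close> is a property of
  the function being defined, hence the fuel \<open>n\<close>, which must be at least the size of
  \<open>M\<close>.\<close>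

primrec act_upto :: "nat \<Rightarrow> 'a \<Rightarrow> nat multiset \<Rightarrow> nat mpoly" where
  "act_upto 0 x M = lead x + cst (chi (bp x))"
| "act_upto (Suc n) x M = (if M = {#} then lead x + cst (chi (bp x)) else
    let j = Min_mset M; N = M - {#j#}; y = hi j x in
      lead x * mon M + lin (act_upto n (e j)) (act_upto n y N - lead y * mon N)
      + act_upto n (bracket y (e j)) N)"

text \<open>Degree bound and independence of the fuel need each other: the inner call has enough
  fuel only because of the bound on its argument.\<close>

lemma act_upto_stable:
  "size M \<le> n \<Longrightarrow> bdd (size M) (act_upto n x M - lead x * mon M) \<and> act_upto (Suc n) x M = act_upto n x M"
proof (induction n arbitrary: x M)
  case 0
  then show ?case by (simp add: mon_0 bdd_cst)
next
  case (Suc n)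
  show ?case
  proof (cases "M = {#}")
    case True
    then show ?thesis by (simp add: mon_0 bdd_cst)
  next
    case False
    define j where "j = Min_mset M"
    define N where "N = M - {#j#}"
    have "j \<in># M" using False by (simp add: j_def)
    then have sz: "size M = Suc (size N)" by (metis N_def insert_DiffM size_add_mset)
    then have N: "size N \<le> n" using Suc.prems by simp
    note IH = Suc.IH [OF N]
    define q where "q = act_upto n (hi j x) N - lead (hi j x) * mon N"
    have q: "bdd (size N) q" using IH by (simp add: q_def)
    \<comment> \<open>The monomials of \<open>q\<close> are shorter than \<open>M\<close>, so the
      fuel \<open>n\<close> already suffices for them.\<close>
    have eq: "act_upto n (e j) K = act_upto (Suc n) (e j) K" and
      bd: "bdd (size M) (act_upto n (e j) K)" if "K \<in> Poly_Mapping.keys q" for K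
    proof -
      have K: "size K \<le> size N" using q that by (simp add: bdd_def)
      with N have "size K \<le> n" by simp
      note K' = Suc.IH [OF this, of "e j"]
      then show "act_upto n (e j) K = act_upto (Suc n) (e j) K" by simp
      have "bdd (size M) (act_upto n (e j) K - lead (e j) * mon K)"
        using conjunct1 [OF K'] by (rule bdd_mono) (use K sz in simp)
      moreover have "bdd (size M) (lead (e j) * mon K)"
        using bdd_lead_mon [where x = "e j" and M = K] K sz by (auto elim: bdd_mono)
      ultimately show "bdd (size M) (act_upto n (e j) K)"
        using bdd_add by fastforce
    qed
    have E: "act_upto (Suc m) x M = lead x * mon M + lin (act_upto m (e j)) (act_upto m (hi j x) N - lead (hi j x) * mon N)
      + act_upto m (bracket (hi j x) (e j)) N" for m
      using False by (simp add: j_def N_def Let_def)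
    have "lin (act_upto (Suc n) (e j)) q = lin (act_upto n (e j)) q"
      unfolding lin_def by (rule sum.cong) (use eq in auto)
    then have "act_upto (Suc (Suc n)) x M = act_upto (Suc n) x M"
      unfolding E using IH by (simp add: q_def [symmetric] del: act_upto.simps)
    moreover have "bdd (size M) (act_upto (Suc n) x M - lead x * mon M)"
    proof -
      have "bdd (size M) (act_upto n y N)" for y
      proof -
        have "bdd (size N) (act_upto n y N - lead y * mon N)" using IH by blast
        then have "bdd (size M) (act_upto n y N - lead y * mon N)" by (rule bdd_mono) (simp add: sz)
        moreover have "bdd (size M) (lead y * mon N)"
          using bdd_lead_mon [where x = y and M = N] sz by (auto elim: bdd_mono)
        ultimately show ?thesis using bdd_add by fastforce
      qed
      moreover have "bdd (size M) (lin (act_upto n (e j)) q)" by (rule bdd_lin) (rule bd)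
      ultimately show ?thesis unfolding E by (simp add: q_def [symmetric] bdd_add)
    qed
    ultimately show ?thesis by blast
  qed
qed

definition act :: "'a \<Rightarrow> nat mpoly \<Rightarrow> nat mpoly"
  where "act x = lin (\<lambda>M. act_upto (size M) x M)"

lemma act_upto: "size M \<le> n \<Longrightarrow> act_upto n x M = act x (mon M)"
proof (induction n)
  case (Suc n)
  then show ?case
    by (cases "size M = Suc n") (use act_upto_stable in \<open>auto simp: act_def le_Suc_eq simp del: act_upto.simps\<close>)
qed (simp add: act_def)

lemma linop_act: "linop (act x)"
  by (simp add: act_def linop_lin)

lemmas act_simps = linopD [OF linop_act] linop_0 [OF linop_act] linop_diff [OF linop_act] linop_sum [OF linop_act]

lemma act_empty: "act x 1 = lead x + cst (chi (bp x))"
  by (simp add: act_def flip: mon_0)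

lemma act_degree: "bdd (size M) (act x (mon M) - lead x * mon M)"
  using act_upto_stable [of M "size M" x] by (simp add: act_upto)

lemma act_upto_add: "act_upto n (x + y) M = act_upto n x M + act_upto n y M"
proof (induction n arbitrary: x y M)
  case 0
  then show ?case by (simp add: lead_add bp_add chi_add cst_simps)
next
  case (Suc n)
  have "lin f (p + p' - (a + a') * m) = lin f (p - a * m) + lin f (p' - a' * m)"
    for f :: "nat multiset \<Rightarrow> nat mpoly" and p p' a a' m
    by (simp add: algebra_simps flip: lin_add)
  then show ?case
    by (simp add: Let_def Suc hi_add lead_add bracket_add_left bp_add chi_add cst_simps)
      (simp add: distrib_right)
qed

lemma act_upto_scale: "act_upto n (c \<cdot> x) M = cst c * act_upto n x M"
proof (induction n arbitrary: x M)
  case 0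
  then show ?case by (simp add: lead_scale bp_scale chi_scale cst_simps distrib_left)
next
  case (Suc n)
  have "lin f (cst c * p - cst c * a * m) = cst c * lin f (p - a * m)" for f :: "nat multiset \<Rightarrow> nat mpoly" and p a m
    using linopD(2) [OF linop_lin, of f c "p - a * m"] by (simp add: algebra_simps)
  then show ?case
    by (simp add: Let_def Suc hi_scale lead_scale bracket_cscale_left bp_scale chi_scale cst_simps distrib_left mult.assoc)
qed

lemma act_add: "act (x + y) p = act x p + act y p"
  by (simp add: act_def lin_def act_upto_add distrib_left sum.distrib)

lemma act_scale: "act (c \<cdot> x) p = cst c * act x p"
  by (simp add: act_def lin_def act_upto_scale sum_distrib_left mult.left_commute)

lemma act_0: "act 0 p = 0"
  using act_scale [of 0 0 p] by (simp add: cst_simps)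

lemma act_uminus: "act (- x) p = - act x p"
  using act_add [of x "- x" p] by (simp add: act_0 eq_neg_iff_add_eq_0 add.commute)

lemma Min_add_mset: "(\<And>k. k \<in># N \<Longrightarrow> j \<le> k) \<Longrightarrow> Min_mset (add_mset j N) = (j :: nat)"
  by (auto intro!: Min_eqI)

lemma act_add_mset:
  assumes "\<And>k. k \<in># N \<Longrightarrow> j \<le> k"
  shows "act x (mon (add_mset j N)) = lead x * mon (add_mset j N)
    + act (e j) (act (hi j x) (mon N) - lead (hi j x) * mon N) + act (bracket (hi j x) (e j)) (mon N)"
proof -
  define q where "q = act (hi j x) (mon N) - lead (hi j x) * mon N"
  have q: "bdd (size N) q" unfolding q_def by (rule act_degree)
  have "lin (act_upto (size N) (e j)) q = act (e j) q"
    unfolding lin_def linop_expand [OF linop_act [of "e j"], of q]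
    by (rule sum.cong) (use q act_upto in \<open>auto simp: bdd_def\<close>)
  moreover have "act x (mon (add_mset j N)) = act_upto (Suc (size N)) x (add_mset j N)"
    by (simp add: act_def)
  moreover have "Min_mset (add_mset j N) = j" by (rule Min_add_mset) (rule assms)
  ultimately show ?thesis
    by (simp add: Let_def act_upto q_def del: set_mset_add_mset_insert)
qed

lemma act_e: "(\<And>k. k \<in># M \<Longrightarrow> i \<le> k) \<Longrightarrow> act (e i) (mon M) = mon (add_mset i M)"
proof (cases "M = {#}")
  case True
  then show ?thesis by (simp add: mon_0 act_empty lead_e bp_e chi_0 cst_simps)
next
  case False
  assume M: "\<And>k. k \<in># M \<Longrightarrow> i \<le> k"
  define j where "j = Min_mset M"
  have j: "j \<in># M" using False by (simp add: j_def)
  then obtain N where N: "M = add_mset j N" by (metis insert_DiffM)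
  have "\<And>k. k \<in># N \<Longrightarrow> j \<le> k" using N by (metis Min_le j_def finite_set_mset union_iff add_mset_add_single)
  moreover have "hi j (e i) = 0" using j M by (simp add: hi_e)
  ultimately have "act (e i) (mon M) = var i * mon M"
    using act_add_mset [of N j "e i"] by (simp add: N lead_e act_0 lead_0 act_simps)
  then show ?thesis by (simp add: mon_add_mset [of i M])
qed

lemma act_lead:
  assumes "\<And>k. k \<in># N \<Longrightarrow> j \<le> k" "\<And>k. k \<le> j \<Longrightarrow> Poly_Mapping.lookup (co x) k = 0"
  shows "act (e j) (lead x * mon N) = lead x * mon (add_mset j N)"
proof -
  have "act (e j) (var k * mon N) = var k * mon (add_mset j N)" if "k \<in> Poly_Mapping.keys (co x)" for k
  proof -
    have "j \<le> k" using that assms(2) [of k] by (force simp: in_keys_iff)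
    then have "act (e j) (mon (add_mset k N)) = mon (add_mset j (add_mset k N))"
      using assms(1) by (intro act_e) auto
    then show ?thesis by (simp add: mon_add_mset [of k N] mon_add_mset [of j N] mon_add_mset [of j "add_mset k N"] mult.left_commute)
  qed
  then show ?thesis
    by (simp add: lead_def sum_distrib_right act_simps mult.assoc)
qed

text \<open>The commutation rule with the smallest letter is built into the definition; the leading
  part that is treated separately there is restored by \<open>act_lead\<close>.\<close>

lemma act_hi:
  assumes "\<And>k. k \<in># N \<Longrightarrow> j \<le> k" "\<And>k. k \<le> j \<Longrightarrow> Poly_Mapping.lookup (co x) k = 0"
  shows "act x (mon (add_mset j N)) = act (e j) (act x (mon N)) + act (bracket x (e j)) (mon N)"
proof -
  have "hi j x = x" using assms(2) by (simp add: hi_def lo_eq_0)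
  then show ?thesis
    using act_add_mset [of N j x, OF assms(1)] act_lead [of N j x, OF assms] by (simp add: act_simps)
qed

lemma bp_bp: "bp (bp x) = bp x"
  using decomp [of "bp x"] by (simp add: co_bp)

lemma act_bp_1: "act (bp x) 1 = cst (chi (bp x))"
  by (simp add: act_empty lead_bp bp_bp)

lemma act_cst: "act x (cst c) = cst c * act x 1"
  using linopD(2) [OF linop_act, of x c 1] by simp

lemma act_bracket_bp: "act (bracket (bp x) (bp y)) 1 = 0"
  using decomp [of "bracket (bp x) (bp y)"]
  by (simp add: act_empty lead_def co_bracket chi_bracket cst_simps)

lemma bracket_uminus_right: "bracket x (- y) = - bracket x (y :: 'a)"
  using bracket_add_right [of x y "- y"] by (simp add: eq_neg_iff_add_eq_0 add.commute)

text \<open>Stated for a single polynomial, so that an induction on the degree can treat its leading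
  and its lower part by different arguments.\<close>

definition comm :: "'a \<Rightarrow> 'a \<Rightarrow> nat mpoly \<Rightarrow> bool"
  where "comm x y p \<longleftrightarrow> act x (act y p) = act y (act x p) + act (bracket x y) p"

lemma comm_swap: "comm y x p \<Longrightarrow> comm x y p"
  by (simp add: comm_def bracket_antisym [of x y] act_uminus)

lemma comm_add: "comm x z p \<Longrightarrow> comm y z p \<Longrightarrow> comm (x + y) z p"
  by (simp add: comm_def act_add act_simps bracket_add_left)

lemma comm_scale: "comm x z p \<Longrightarrow> comm (c \<cdot> x) z p"
  by (simp add: comm_def act_scale act_simps bracket_cscale_left distrib_left)

lemma comm_0: "comm 0 z p"
  by (simp add: comm_def act_0 act_simps)

lemma comm_sum: "(\<And>a. a \<in> A \<Longrightarrow> comm (f a) z p) \<Longrightarrow> comm (sum f A) z p"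
  by (induction A rule: infinite_finite_induct) (simp_all add: comm_0 comm_add)

lemma comm_poly: "(\<And>M. M \<in> Poly_Mapping.keys p \<Longrightarrow> comm x y (mon M)) \<Longrightarrow> comm x y p"
  unfolding comm_def
  by (rule linop_eqI [of "\<lambda>p. act x (act y p)" "\<lambda>p. act y (act x p) + act (bracket x y) p"])
    (simp_all add: linop_comp linop_plus linop_act)

text \<open>The component above \<open>j\<close> and in the subalgebra commutes correctly by
  \<open>act_hi\<close>; each \<open>e k\<close> with \<open>k\<close> at most \<open>j\<close> is
  treated separately.\<close>

lemma comm_min:
  assumes "\<And>k. k \<in># N \<Longrightarrow> j \<le> k"
  shows "comm x (e j) (mon N)"
proof -
  have "comm (hi j x) (e j) (mon N)"
    using act_hi [of N j "hi j x", OF assms co_hi] by (simp add: comm_def act_e [OF assms])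
  moreover have "comm (e k) (e j) (mon N)" if "k \<le> j" for k
  proof (cases "k = j")
    case True
    then show ?thesis by (simp add: comm_def bracket_self act_0)
  next
    case False
    then have k: "k < j" and N: "\<And>l. l \<in># N \<Longrightarrow> k \<le> l" using that assms by (auto intro: order_trans)
    \<comment> \<open>Here \<open>k\<close> is the smaller letter, so it is \<open>e j\<close> that
      is moved past \<open>e k\<close>.\<close>
    have "act (e j) (mon (add_mset k N)) = act (e k) (act (e j) (mon N)) + act (bracket (e j) (e k)) (mon N)"
      using N k by (intro act_hi) (auto simp: co_e lookup_single)
    then have "comm (e j) (e k) (mon N)" by (simp add: comm_def act_e [OF N])
    then show ?thesis by (rule comm_swap)
  qed
  then have "comm (lo j x) (e j) (mon N)"
    unfolding lo_def by (intro comm_sum comm_scale) auto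
  moreover have "x = lo j x + hi j x" by (simp add: hi_def)
  ultimately show ?thesis using comm_add by metis
qed

text \<open>The consistency behind the PBW theorem. Relative to the smallest letter \<open>k\<close>
  of \<open>M\<close>, the low components are settled by \<open>comm_min\<close>. Two high
  components are both moved past \<open>e k\<close>; the induction hypothesis and the Jacobi
  identity then match the terms.\<close>

theorem act_bracket: "act (bracket x y) p = act x (act y p) - act y (act x p)"
proof -
  have "comm x y (mon M)" for x y M
  proof (induction "size M" arbitrary: x y M rule: less_induct)
    case less
    show ?case
    proof (cases "M = {#}")
      case True
      have e: "comm x (e k) (mon M)" for x k
        by (rule comm_min) (simp add: True)
      have E: "comm x (\<Sum>k\<in>A. c k \<cdot> e k) (mon M)" for x A c
        by (rule comm_swap, rule comm_sum, rule comm_scale, rule comm_swap, rule e)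
      \<comment> \<open>On the vacuum both operators are scalars, and the bracket acts by zero since
        \<open>chi\<close> is a character.\<close>
      have b: "comm (bp x) (bp y) (mon M)"
        by (simp add: comm_def True mon_0 act_bp_1 act_cst act_bracket_bp mult.commute)
      show ?thesis
      proof -
        have "comm y (bp x) (mon M)"
          by (subst decomp [of y], rule comm_add [OF comm_swap [OF E] comm_swap [OF b]])
        moreover have "comm y (\<Sum>k\<in>Poly_Mapping.keys (co x). Poly_Mapping.lookup (co x) k \<cdot> e k) (mon M)"
          by (rule E)
        ultimately show ?thesis
          by (subst decomp [of x]) (rule comm_add [OF comm_swap comm_swap])
      qed
    next
      case False
      define k where "k = Min_mset M"
      obtain N where M: "M = add_mset k N" using False by (metis k_def insert_DiffM Min_in finite_set_mset set_mset_eq_empty_iff)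
      have kM: "k \<le> l" if "l \<in># M" for l using that by (simp add: k_def)
      then have kN: "k \<le> l" if "l \<in># N" for l using that M by auto
      have e: "comm x (e l) (mon M)" if "l \<le> k" for x l
        by (rule comm_min) (use that kM in force)
      have E: "comm x (lo k y) (mon M)" for x y
        unfolding lo_def by (rule comm_swap, rule comm_sum, rule comm_scale, rule comm_swap, rule e) simp
      have H: "act x (act y (mon M)) = act (e k) (act x (act y (mon N))) + act (bracket x (e k)) (act y (mon N))
          + (act (bracket y (e k)) (act x (mon N)) + act (bracket x (bracket y (e k))) (mon N))"
        if y: "\<And>l. l \<le> k \<Longrightarrow> Poly_Mapping.lookup (co y) l = 0" for x y
      proof -
        \<comment> \<open>This polynomial may reach the size of \<open>M\<close>, out of reach of
          the induction. Its leading part contains no letter below \<open>k\<close>, so there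
          \<open>comm_min\<close> applies.\<close>
        have "comm x (e k) (act y (mon N))"
        proof -
          have "comm x (e k) (act y (mon N) - lead y * mon N)"
          proof (rule comm_poly)
            fix K assume "K \<in> Poly_Mapping.keys (act y (mon N) - lead y * mon N)"
            then have "size K \<le> size N" using act_degree [of N y] by (simp add: bdd_def)
            then show "comm x (e k) (mon K)" by (intro less) (simp add: M)
          qed
          moreover have "comm x (e k) (lead y * mon N)"
          proof (rule comm_poly)
            fix K assume "K \<in> Poly_Mapping.keys (lead y * mon N)"
            then obtain l where l: "l \<in> Poly_Mapping.keys (co y)" "K = add_mset l N"
              by (rule keys_lead_mon)
            then have "k \<le> l" using y [of l] by (force simp: in_keys_iff)
            then show "comm x (e k) (mon K)" using kN by (intro comm_min) (auto simp: l)
          qed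
          ultimately show ?thesis by (simp add: comm_def act_simps algebra_simps)
        qed
        moreover have "comm x (bracket y (e k)) (mon N)" by (rule less) (simp add: M)
        moreover have "act y (mon M) = act (e k) (act y (mon N)) + act (bracket y (e k)) (mon N)"
          unfolding M using kN y by (rule act_hi)
        ultimately show ?thesis by (simp add: comm_def act_simps algebra_simps)
      qed
      have "comm (hi k x) (hi k y) (mon M)"
      proof -
        define u v where "u = hi k x" and "v = hi k y"
        have u: "Poly_Mapping.lookup (co u) l = 0" and v: "Poly_Mapping.lookup (co v) l = 0" if "l \<le> k" for l
          using co_hi that by (simp_all add: u_def v_def)
        have 1: "act u (act v (mon N)) = act v (act u (mon N)) + act (bracket u v) (mon N)"
          using less [of N u v] by (simp add: comm_def M)
        have 2: "act (bracket u v) (act (e k) (mon N)) = act (e k) (act (bracket u v) (mon N)) + act (bracket (bracket u v) (e k)) (mon N)"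
          using less [of N "bracket u v" "e k"] by (simp add: comm_def M)
        \<comment> \<open>The Jacobi identity accounts for the terms in which both factors have met
          \<open>e k\<close>.\<close>
        have "bracket u (bracket v (e k)) = bracket v (bracket u (e k)) + bracket (bracket u v) (e k)"
          using jacobi [of u v "e k"]
          by (simp add: bracket_antisym [of "e k"] bracket_uminus_right algebra_simps eq_neg_iff_add_eq_0)
        then have 3: "act (bracket u (bracket v (e k))) (mon N) = act (bracket v (bracket u (e k))) (mon N) + act (bracket (bracket u v) (e k)) (mon N)"
          by (simp add: act_add)
        show ?thesis
          unfolding comm_def u_def [symmetric] v_def [symmetric]
          using 2 H [OF v, of u] H [OF u, of v] act_e [of N k] kN
          by (simp add: 1 3 act_simps flip: M)
      qed
      then have "comm (hi k y) (lo k x + hi k x) (mon M)"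
        by (intro comm_swap [OF comm_add] comm_swap [OF E]) (simp add: comm_swap)
      then have "comm (lo k y + hi k y) (lo k x + hi k x) (mon M)"
        by (intro comm_add comm_swap [OF E])
      then show ?thesis by (simp add: hi_def comm_swap)
    qed
  qed
  then have "comm x y p" by (rule comm_poly)
  then show ?thesis by (simp add: comm_def)
qed

end

section \<open>Enveloping algebras\<close>

lemma cscale_diff_left: "(c - d) \<cdot> x = c \<cdot> x - d \<cdot> (x :: 'a::complex_lie_algebra)"
  using cscale_add_left [of "c - d" d x] by simp
lemma cscale_uminus_left: "(- c) \<cdot> x = - (c \<cdot> (x :: 'a::complex_lie_algebra))"
  using cscale_add_left [of "- c" c x] by (simp add: eq_neg_iff_add_eq_0)
lemma cscale_uminus_right: "c \<cdot> (- x) = - (c \<cdot> (x :: 'a::complex_lie_algebra))"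
  using cscale_add_right [of c "- x" x] by (simp add: eq_neg_iff_add_eq_0)

text \<open>Equivariance replaces the matrix products: by \<open>bracket_G\<close> each bracket is a
  combination of the \<open>G i j\<close> whose coefficients are entries of basis vectors.\<close>

lemma cmb_bracket: "bracket (bas i) (bas j) = cmb (br i j)"
  apply (cases i; cases j; simp only: bas.simps bracket_G sum_7 mat_relations bas_core;
    simp only: mult_zero_right mult_zero_left add_0_left add_0_right minus_zero diff_0_right cscale_zero_left;
    simp add: G_table gam_def sqrt2_facts cscale_cscale cscale_add_right del: bas.simps)
  apply (simp_all add: cscale_uminus_right del: bas.simps flip: cscale_diff_left cscale_add_left cscale_uminus_left)
  apply (rule crd_eqI, simp add: crd_diff crd_add crd_cscale algebra_simps del: bas.simps crd.simps)+
  done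

lemma uenv_abs_cases: obtains p where "u = abs_uenv p"
  by (metis Quotient3_abs_rep Quotient3_uenv)

lemma uscalar_commute: "uscalar c * u = u * uscalar c"
  by (cases u rule: uenv_abs_cases) (simp add: uscalar.abs_eq times_uenv.abs_eq scalar_commute)

lemma uscalar_simps: "uscalar 0 = 0" "uscalar 1 = 1" "uscalar (c + d) = uscalar c + uscalar d"
  "uscalar (c * d) = uscalar c * uscalar d" "uscalar (- c) = - uscalar c"
  by (simp_all add: uscalar.abs_eq times_uenv.abs_eq plus_uenv.abs_eq uminus_uenv.abs_eq
      scalar_add scalar_mult scalar_uminus zero_uenv_def one_uenv_def)

lemma uscalar_of_nat: "uscalar (of_nat n) = of_nat n"
  by (induction n) (simp_all add: uscalar_simps)
lemma uscalar_numeral: "uscalar (numeral n) = numeral n"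
  using uscalar_of_nat [of "numeral n"] by simp
lemma uscalar_of_int: "uscalar (of_int n) = of_int n"
  by (cases n rule: int_cases2) (simp_all add: uscalar_simps uscalar_of_nat)

lemma uembed_0: "uembed 0 = 0"
  using uembed_add [of 0 0] by simp
lemma uenv_induct [case_names scalar mult add]:
  fixes u :: "'a::complex_lie_algebra uenv"
  assumes "\<And>c. P (uscalar c)" "\<And>x u. P u \<Longrightarrow> P (uembed x * u)" "\<And>u v. P u \<Longrightarrow> P v \<Longrightarrow> P (u + v)"
  shows "P u"
proof -
  have w: "P (abs_uenv (Poly_Mapping.single (FM w) c))" for w :: "'a list" and c
  proof (induction w)
    case Nil
    have "Poly_Mapping.single (FM []) c = (scalar c :: 'a free_algebra)"
      by (simp add: scalar_def zero_free_monoid_def)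
    then show ?case using assms(1) [of c] by (simp add: uscalar.abs_eq)
  next
    case (Cons x w)
    have "Poly_Mapping.single (FM (x # w)) c = letter x * Poly_Mapping.single (FM w) c"
      by (simp add: letter_def mult_single plus_free_monoid_def)
    then have "abs_uenv (Poly_Mapping.single (FM (x # w)) c) = uembed x * abs_uenv (Poly_Mapping.single (FM w) c)"
      by (simp add: uembed.abs_eq times_uenv.abs_eq)
    then show ?case using assms(2) [OF Cons] by simp
  qed
  have "P (abs_uenv p)" for p :: "'a free_algebra"
  proof (induction p rule: poly_mapping_additive_induct)
    case (1 k c)
    then show ?case using w [of "word k" c] by simp
  next
    case (2 p q)
    then show ?case using assms(3) by (simp flip: plus_uenv.abs_eq)
  qed
  then show ?thesis by (metis uenv_abs_cases)
qed

text \<open>The scalar multiplication is a parameter because the locale serves two modules: the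
  polynomials above and the enveloping algebra itself, on which right multiplication yields the
  antipode.\<close>

locale lie_rep =
  fixes sc :: "complex \<Rightarrow> 'm::ab_group_add \<Rightarrow> 'm" and rho :: "'a::complex_lie_algebra \<Rightarrow> 'm \<Rightarrow> 'm"
  assumes sc_add_right: "sc c (m + n) = sc c m + sc c n"
    and sc_add_left: "sc (c + d) m = sc c m + sc d m"
    and sc_sc: "sc (c * d) m = sc c (sc d m)"
    and sc_one: "sc 1 m = m"
    and rho_add_right: "rho x (m + n) = rho x m + rho x n"
    and rho_sc: "rho x (sc c m) = sc c (rho x m)"
    and rho_add_left: "rho (x + y) m = rho x m + rho y m"
    and rho_cscale: "rho (c \<cdot> x) m = sc c (rho x m)"
    and rho_bracket: "rho (bracket x y) m = rho x (rho y m) - rho y (rho x m)"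
begin

lemma sc_0_left: "sc 0 m = 0" and sc_0_right: "sc c 0 = 0" and rho_0: "rho x 0 = 0"
  using sc_add_left [of 0 0 m] sc_add_right [of c 0 0] rho_add_right [of x 0 0] by simp_all

definition free_act :: "'a free_algebra \<Rightarrow> 'm \<Rightarrow> 'm"
  where "free_act p m = (\<Sum>w\<in>Poly_Mapping.keys p. sc (Poly_Mapping.lookup p w) (foldr rho (word w) m))"

lemma free_act_add: "free_act (p + q) m = free_act p m + free_act q m"
  unfolding free_act_def by (rule setsum_keys_plus_distrib) (simp_all add: sc_0_left sc_add_left)

lemma free_act_0: "free_act 0 m = 0"
  by (simp add: free_act_def)

lemma free_act_diff: "free_act (p - q) m = free_act p m - free_act q m"
  using free_act_add [of "p - q" q m] by simp

lemma free_act_single: "free_act (Poly_Mapping.single w c) m = sc c (foldr rho (word w) m)"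
  by (simp add: free_act_def sc_0_left)

lemma free_act_letter: "free_act (letter x) m = rho x m"
  by (simp add: letter_def free_act_single sc_one)

lemma free_act_scalar: "free_act (scalar c) m = sc c m"
  by (simp add: scalar_def free_act_single zero_free_monoid_def)

lemma foldr_rho: "foldr rho w (sc c m) = sc c (foldr rho w m)" "foldr rho w (m + n) = foldr rho w m + foldr rho w n"
  by (induction w) (simp_all add: rho_sc rho_add_right)

lemma free_act_add_right: "free_act p (m + n) = free_act p m + free_act p n"
  by (simp add: free_act_def foldr_rho sc_add_right sum.distrib)

lemma free_act_0_right: "free_act p 0 = 0"
  using free_act_add_right [of p 0 0] by simp

lemma sc_sum: "sc c (sum f A) = (\<Sum>a\<in>A. sc c (f a))"
  by (induction A rule: infinite_finite_induct) (simp_all add: sc_0_right sc_add_right)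

lemma free_act_sc: "free_act p (sc c m) = sc c (free_act p m)"
  by (simp add: free_act_def foldr_rho sc_sum mult.commute flip: sc_sc)

lemma free_act_mult: "free_act (p * q) m = free_act p (free_act q m)"
proof (induction p rule: poly_mapping_additive_induct)
  case (1 v c)
  show ?case
  proof (induction q rule: poly_mapping_additive_induct)
    case (1 w d)
    show ?case by (simp add: mult_single free_act_single plus_free_monoid_def sc_sc foldr_rho)
  next
    case (2 q q')
    then show ?case by (simp add: distrib_left free_act_add free_act_add_right)
  qed
next
  case (2 p p')
  then show ?case by (simp add: distrib_right free_act_add)
qed

lemma free_act_ideal: "p \<in> enveloping_ideal \<Longrightarrow> free_act p m = 0"
  by (induction arbitrary: m rule: enveloping_ideal.induct)
    (simp_all add: free_act_diff free_act_add free_act_mult free_act_letter free_act_scalar free_act_0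
      rho_add_left rho_cscale rho_bracket free_act_0_right)

definition uact :: "'a uenv \<Rightarrow> 'm \<Rightarrow> 'm"
  where "uact u = free_act (rep_uenv u)"

lemma uact_abs: "uact (abs_uenv p) m = free_act p m"
proof -
  have "abs_uenv (rep_uenv (abs_uenv p)) = abs_uenv p"
    by (meson Quotient3_abs_rep Quotient3_uenv)
  then have "rep_uenv (abs_uenv p) - p \<in> enveloping_ideal"
    by (simp add: uenv.abs_eq_iff)
  from free_act_ideal [OF this] show ?thesis by (simp add: uact_def free_act_diff)
qed

lemma uact_add: "uact (u + v) m = uact u m + uact v m"
  by (cases u rule: uenv_abs_cases; cases v rule: uenv_abs_cases)
    (simp add: plus_uenv.abs_eq uact_abs free_act_add)

lemma uact_mult: "uact (u * v) m = uact u (uact v m)"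
  by (cases u rule: uenv_abs_cases; cases v rule: uenv_abs_cases)
    (simp add: times_uenv.abs_eq uact_abs free_act_mult)

lemma uact_embed: "uact (uembed x) m = rho x m"
  by (simp add: uembed.abs_eq uact_abs free_act_letter)

lemma uact_scalar: "uact (uscalar c) m = sc c m"
  by (simp add: uscalar.abs_eq uact_abs free_act_scalar)

lemma uact_0: "uact 0 m = 0"
  using uact_scalar [of 0] by (simp add: uscalar_simps sc_0_left)

lemma uact_diff: "uact (u - v) m = uact u m - uact v m"
  using uact_add [of "u - v" v m] by simp

lemma uact_add_right: "uact u (m + n) = uact u m + uact u n"
  by (simp add: uact_def free_act_add_right)

lemma uact_sc: "uact u (sc c m) = sc c (uact u m)"
  by (simp add: uact_def free_act_sc)

end

sublocale pbw \<subseteq> lie_rep "\<lambda>c p. cst c * p" act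
  by unfold_locales (simp_all add: cst_simps distrib_left distrib_right mult.assoc act_simps act_add act_scale act_bracket)

context pbw
begin

lemma linop_uact: "linop (uact u)"
  by (simp add: linop_def uact_add_right uact_sc)

definition Phi :: "'a uenv \<Rightarrow> nat mpoly" where "Phi u = uact u 1"

definition ordered :: "nat multiset \<Rightarrow> 'a uenv"
  where "ordered M = prod_list (map (\<lambda>k. uembed (e k)) (sorted_list_of_multiset M))"

definition Psi :: "nat mpoly \<Rightarrow> 'a uenv"
  where "Psi p = (\<Sum>M\<in>Poly_Mapping.keys p. uscalar (Poly_Mapping.lookup p M) * ordered M)"

lemma Psi_add: "Psi (p + q) = Psi p + Psi q"
  unfolding Psi_def by (rule setsum_keys_plus_distrib) (simp_all add: uscalar_simps distrib_right)

lemma Psi_0: "Psi 0 = 0"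
  by (simp add: Psi_def)

lemma Psi_mon: "Psi (mon M) = ordered M"
  by (simp add: Psi_def mon_def uscalar_simps)

lemma Psi_scale: "Psi (cst c * p) = uscalar c * Psi p"
proof (induction p rule: poly_mapping_additive_induct)
  case (1 M d)
  have "cst c * Poly_Mapping.single M d = Poly_Mapping.single M (c * d)"
    by (simp add: single_eq cst_simps mult.assoc)
  moreover have "Psi (Poly_Mapping.single M d) = uscalar d * ordered M" for d
    by (simp add: Psi_def uscalar_simps)
  ultimately show ?case by (simp add: uscalar_simps mult.assoc)
qed (simp add: distrib_left Psi_add)

lemma Psi_cst: "Psi (cst c) = uscalar c"
  using Psi_scale [of c 1] Psi_mon [of "{#}"] by (simp add: mon_0 ordered_def)

lemma ordered_add_mset: "(\<And>k. k \<in># N \<Longrightarrow> j \<le> k) \<Longrightarrow> ordered (add_mset j N) = uembed (e j) * ordered N"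
proof -
  assume "\<And>k. k \<in># N \<Longrightarrow> j \<le> k"
  then have "insort j (sorted_list_of_multiset N) = j # sorted_list_of_multiset N"
    by (intro insort_is_Cons) auto
  then show ?thesis by (simp add: ordered_def)
qed

lemma ex_add_Min:
  assumes "M \<noteq> {#}"
  obtains j N where "M = add_mset j (N :: nat multiset)" "\<And>k. k \<in># N \<Longrightarrow> j \<le> k"
proof -
  obtain N where "M = add_mset (Min_mset M) N"
    using assms by (metis insert_DiffM Min_in finite_set_mset set_mset_eq_empty_iff)
  moreover from this have "\<And>k. k \<in># N \<Longrightarrow> Min_mset M \<le> k"
    by (metis Min_le finite_set_mset union_iff add_mset_add_single)
  ultimately show thesis using that by blast
qed

lemma Phi_add: "Phi (u + v) = Phi u + Phi v" by (simp add: Phi_def uact_add)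
lemma Phi_0: "Phi 0 = 0" by (simp add: Phi_def uact_0)
lemma Phi_uscalar: "Phi (uscalar c) = cst c" by (simp add: Phi_def uact_scalar)
lemma Phi_uscalar_mult: "Phi (uscalar c * u) = cst c * Phi u" by (simp add: Phi_def uact_scalar uact_mult)
text \<open>\<open>Psi\<close> intertwines the two actions of \<open>c\<close> modulo any left ideal
  \<open>J\<close> in which \<open>bp x\<close> and its scalar agree. The proof follows the
  recursion of \<open>act\<close>.\<close>

lemma Psi_act:
  assumes c: "\<And>x y. x \<in> c \<Longrightarrow> y \<in> c \<Longrightarrow> x + y \<in> c" "\<And>x a. x \<in> c \<Longrightarrow> a \<cdot> x \<in> c"
      "\<And>x y. x \<in> c \<Longrightarrow> y \<in> c \<Longrightarrow> bracket x y \<in> c" "\<And>k. e k \<in> c"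
    and J: "0 \<in> J" "\<And>u v. u \<in> J \<Longrightarrow> v \<in> J \<Longrightarrow> u + v \<in> J" "\<And>u a. u \<in> J \<Longrightarrow> a * u \<in> J"
    and chi: "\<And>x. x \<in> c \<Longrightarrow> uembed (bp x) - uscalar (chi (bp x)) \<in> J"
    and x: "x \<in> c"
  shows "uembed x * Psi p - Psi (act x p) \<in> J"
proof -
  define Q where "Q x p \<longleftrightarrow> uembed x * Psi p - Psi (act x p) \<in> J" for x p
  have J0: "u = 0 \<Longrightarrow> u \<in> J" for u using J(1) by simp
  have Qp: "Q x (p + q)" if "Q x p" "Q x q" for x p q
    using J(2) [OF that [unfolded Q_def]] by (simp add: Q_def Psi_add act_simps algebra_simps)
  have Qs: "Q x (cst a * p)" if "Q x p" for x p a
  proof -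
    have "uembed x * Psi (cst a * p) - Psi (act x (cst a * p)) = uscalar a * (uembed x * Psi p - Psi (act x p))"
      unfolding Psi_scale act_simps right_diff_distrib by (metis mult.assoc uscalar_commute)
    then show ?thesis using J(3) that by (simp add: Q_def)
  qed
  have Q0: "Q x 0" for x using J(1) by (simp add: Q_def Psi_0 act_simps)
  have QP: "Q x p" if "\<And>M. M \<in> Poly_Mapping.keys p \<Longrightarrow> Q x (mon M)" for x p
  proof -
    have "Q x (\<Sum>M\<in>A. cst (Poly_Mapping.lookup p M) * mon M)" if "finite A" "A \<subseteq> Poly_Mapping.keys p" for A
      using that \<open>\<And>M. M \<in> Poly_Mapping.keys p \<Longrightarrow> Q x (mon M)\<close>
      by (induction) (auto simp: Q0 intro!: Qp Qs)
    from this [of "Poly_Mapping.keys p"] show ?thesis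
      by (simp flip: mpoly_expand)
  qed
  have Qa: "Q (x + y) p" if "Q x p" "Q y p" for x y p
    using J(2) [OF that [unfolded Q_def]] by (simp add: Q_def uembed_add Psi_add act_add algebra_simps)
  have Qc: "Q (a \<cdot> x) p" if "Q x p" for x p a
    using J(3) [OF that [unfolded Q_def], of "uscalar a"]
    by (simp add: Q_def uembed_cscale Psi_scale act_scale algebra_simps)
  have Qz: "Q 0 p" for p using Qc [of 0] J(1) by (simp add: Q_def uembed_0 act_0 Psi_0)
  have Qsum: "Q (sum f A) p" if "\<And>a. a \<in> A \<Longrightarrow> Q (f a) p" for f p and A :: "nat set"
    using that by (induction A rule: infinite_finite_induct) (auto simp: Qz intro: Qa)
  have Qe: "Q (e j) (mon N)" if "\<And>k. k \<in># N \<Longrightarrow> j \<le> k" for j N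
    unfolding Q_def using that by (intro J0) (simp add: Psi_mon act_e ordered_add_mset)
  have csum: "sum f A \<in> c" if "\<And>a. a \<in> A \<Longrightarrow> f a \<in> c" "finite A" for f and A :: "nat set"
    using that(2,1) c(2) [OF x, of 0] by (induction A) (auto intro: c)
  have main: "Q x (mon M)" if "x \<in> c" for x M
    using that
  proof (induction "size M" arbitrary: x M rule: less_induct)
    case less
    show ?case
    proof (cases "M = {#}")
      case True
      have "Q (bp x) (mon {#})"
        using chi [OF less(2)] by (simp add: Q_def mon_0 act_bp_1 Psi_cst Psi_mon [of "{#}", unfolded mon_0] ordered_def)
      then show ?thesis
        unfolding True by (subst decomp [of x]) (intro Qa Qsum Qc Qe; simp)
    next
      case False
      obtain k N where M: "M = add_mset k N" and kN: "\<And>l. l \<in># N \<Longrightarrow> k \<le> l"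
        using ex_add_Min [OF False] by blast
      define y where "y = hi k x"
      have lo: "lo k x \<in> c" unfolding lo_def by (intro csum c) auto
      have "y = x + (- 1) \<cdot> lo k x" by (simp add: y_def hi_def cscale_minus1)
      then have y: "y \<in> c" using c lo less(2) by metis
      have y0: "Poly_Mapping.lookup (co y) l = 0" if "l \<le> k" for l using that by (simp add: y_def co_hi)
      have 1: "Q y (mon N)" by (rule less) (simp_all add: M y)
      have 2: "Q (bracket y (e k)) (mon N)" by (rule less) (simp_all add: M y c)
      have 3: "Q (e k) (act y (mon N))"
      proof -
        have "Q (e k) (act y (mon N) - lead y * mon N)"
        proof (rule QP)
          fix K assume "K \<in> Poly_Mapping.keys (act y (mon N) - lead y * mon N)"
          then have "size K \<le> size N" using act_degree [of N y] by (simp add: bdd_def)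
          then show "Q (e k) (mon K)" by (intro less) (simp_all add: M c)
        qed
        moreover have "Q (e k) (lead y * mon N)"
        proof (rule QP)
          fix K assume "K \<in> Poly_Mapping.keys (lead y * mon N)"
          then obtain l where "l \<in> Poly_Mapping.keys (co y)" "K = add_mset l N"
            by (rule keys_lead_mon)
          then have "k \<le> l" using y0 [of l] by (force simp: in_keys_iff)
          then show "Q (e k) (mon K)" using kN by (intro Qe) (auto simp: \<open>K = _\<close>)
        qed
        ultimately show ?thesis using Qp by fastforce
      qed
      \<comment> \<open>The defect for \<open>M\<close> is a combination of three defects, two for
        the shorter word \<open>N\<close> and one for \<open>e k\<close>; a left ideal absorbs the
        factor \<open>e k\<close>.\<close>
      have "Q y (mon M)"
      proof -
        have "uembed y * (uembed (e k) * ordered N) =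
          uembed (e k) * (uembed y * ordered N) + uembed (bracket y (e k)) * ordered N"
          by (simp add: uembed_bracket algebra_simps flip: mult.assoc)
        then have "uembed y * Psi (mon M) - Psi (act y (mon M)) =
          uembed (e k) * (uembed y * Psi (mon N) - Psi (act y (mon N)))
          + (uembed (e k) * Psi (act y (mon N)) - Psi (act (e k) (act y (mon N))))
          + (uembed (bracket y (e k)) * Psi (mon N) - Psi (act (bracket y (e k)) (mon N)))"
          by (simp add: M act_hi [OF kN y0] Psi_add Psi_mon ordered_add_mset [OF kN] algebra_simps)
        then show ?thesis using 1 2 3 by (simp add: Q_def J)
      qed
      moreover have "Q (lo k x) (mon M)"
        unfolding lo_def by (intro Qsum Qc Qe) (use kN M in force)
      ultimately have "Q (lo k x + y) (mon M)" by (intro Qa)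
      then show ?thesis by (simp add: y_def hi_def)
    qed
  qed
  have "Q x p" by (rule QP) (rule main [OF x])
  then show ?thesis by (simp add: Q_def)
qed

end

section \<open>The vacuum module\<close>

definition ltr :: "nat \<Rightarrow> idx \<Rightarrow> affine"
  where "ltr r i = loop (bas i) (- int r - 1)"

text \<open>Letter \<open>k\<close> is basis vector number \<open>k mod 14\<close> in mode -(k div
  14) - 1. Thus the first fourteen letters have mode -1, and adding 14 lowers the mode by
  one.\<close>

definition ea :: "nat \<Rightarrow> affine"
  where "ea k = ltr (k div 14) (idxs ! (k mod 14))"

definition cf :: "affine \<Rightarrow> nat \<Rightarrow> complex"
  where "cf x k = crd (idxs ! (k mod 14)) (Poly_Mapping.lookup (loop_part x) (- int (k div 14) - 1))"

definition coa :: "affine \<Rightarrow> nat \<Rightarrow>\<^sub>0 complex" where "coa x = Abs_poly_mapping (cf x)"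

lemma finite_cf: "finite {k. cf x k \<noteq> 0}"
proof -
  define K where "K = (\<lambda>r. nat (- r - 1)) ` Poly_Mapping.keys (loop_part x)"
  have "finite K" by (simp add: K_def)
  then obtain B where B: "\<And>r. r \<in> K \<Longrightarrow> r < B" by (metis finite_nat_set_iff_bounded)
  have "{k. cf x k \<noteq> 0} \<subseteq> {..<14 * B}"
  proof
    fix k assume "k \<in> {k. cf x k \<noteq> 0}"
    then have "- int (k div 14) - 1 \<in> Poly_Mapping.keys (loop_part x)"
      by (auto simp: cf_def in_keys_iff crd_0)
    then have "nat (- (- int (k div 14) - 1) - 1) \<in> K" unfolding K_def by (rule imageI)
    then have "k div 14 < B" using B by simp
    then show "k \<in> {..<14 * B}" by (simp add: div_less_iff_less_mult mult.commute)
  qed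
  then show ?thesis by (rule finite_subset) simp
qed

lemma lookup_coa: "Poly_Mapping.lookup (coa x) k = cf x k"
  by (simp add: coa_def finite_cf)

lemma affine_simps: "loop_part (x + y) = loop_part x + loop_part y" "central_part (x + y) = central_part x + central_part y"
  "loop_part (c \<cdot> x) = loop_cscale c (loop_part x)" "central_part (c \<cdot> x) = c * central_part x"
  "loop_part (x - y) = loop_part x - loop_part y" "central_part (x - y) = central_part x - central_part y"
  "loop_part 0 = 0" "central_part 0 = 0"
  "loop_part (bracket x y) = loop_bracket (loop_part x) (loop_part y)" "central_part (bracket x y) = cocycle (loop_part x) (loop_part y)"
  "loop_part (loop X r) = Poly_Mapping.single r X" "central_part (loop X r) = 0"
  by (simp_all add: plus_affine_def cscale_affine_def minus_affine_def zero_affine_def bracket_affine_def loop_def)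

lemma cf_add: "cf (x + y) k = cf x k + cf y k"
  by (simp add: cf_def affine_simps lookup_add crd_add)
lemma cf_cscale: "cf (c \<cdot> x) k = c * cf x k"
  by (simp add: cf_def affine_simps loop_cscale_lookup crd_cscale)
lemma cf_diff: "cf (x - y) k = cf x k - cf y k"
  by (simp add: cf_def affine_simps lookup_minus crd_diff)

lemma length_idxs: "length idxs = 14" and distinct_idxs: "distinct idxs" and set_idxs: "i \<in> set idxs"
  by (simp_all add: idxs_def) (cases i; simp)

lemma cf_ea: "cf (ea j) k = (if k = j then 1 else 0)"
proof -
  have "k = j \<longleftrightarrow> k div 14 = j div 14 \<and> k mod 14 = j mod 14"
    by (metis div_mult_mod_eq)
  moreover have "idxs ! (k mod 14) = idxs ! (j mod 14) \<longleftrightarrow> k mod 14 = j mod 14"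
    by (simp add: nth_eq_iff_index_eq distinct_idxs length_idxs)
  ultimately show ?thesis
    by (auto simp: cf_def ea_def ltr_def affine_simps lookup_single when_def crd_bas crd_0)
qed

definition negsum :: "(nat \<Rightarrow>\<^sub>0 complex) \<Rightarrow> affine"
  where "negsum q = (\<Sum>k\<in>Poly_Mapping.keys q. Poly_Mapping.lookup q k \<cdot> ea k)"

text \<open>The projection onto g[t] + C K along the negative modes.\<close>

definition bpa :: "affine \<Rightarrow> affine" where "bpa x = x - negsum (coa x)"

lemma negsum_add: "negsum (p + q) = negsum p + negsum q"
  unfolding negsum_def by (rule setsum_keys_plus_distrib) (simp_all add: cscale_add_left)

lemma coa_add: "coa (x + y) = coa x + coa y"
  by (rule poly_mapping_eqI) (simp add: lookup_coa lookup_add cf_add)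

lemma cscale_right_sum: "c \<cdot> sum f A = (\<Sum>a\<in>A. c \<cdot> (f a :: 'a::complex_lie_algebra))"
  by (induction A rule: infinite_finite_induct) (simp_all add: cscale_add_right)

lemma cscale_diff_right: "c \<cdot> (x - y) = c \<cdot> x - c \<cdot> (y :: 'a::complex_lie_algebra)"
  using cscale_add_right [of c "x - y" y] by simp

lemma negsum_cscale: "negsum (coa (c \<cdot> x)) = c \<cdot> negsum (coa x)"
proof (cases "c = 0")
  case True
  then show ?thesis by (simp add: negsum_def in_keys_iff lookup_coa cf_def affine_simps crd_0)
next
  case False
  then have "Poly_Mapping.keys (coa (c \<cdot> x)) = Poly_Mapping.keys (coa x)"
    by (auto simp: in_keys_iff lookup_coa cf_cscale)
  then show ?thesis by (simp add: negsum_def lookup_coa cf_cscale cscale_right_sum cscale_cscale)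
qed

lemma sum_parts:
  "loop_part (sum f A) = (\<Sum>a\<in>A. loop_part (f a))" "central_part (sum f A) = (\<Sum>a\<in>A. central_part (f a))"
  by (induction A rule: infinite_finite_induct; simp add: affine_simps)+

lemma cf_sum: "cf (sum f A) k = (\<Sum>a\<in>A. cf (f a) k)"
  by (induction A rule: infinite_finite_induct) (simp_all add: cf_add, simp_all add: cf_def affine_simps crd_0)

lemma cf_negsum: "cf (negsum q) k = Poly_Mapping.lookup q k"
  by (simp add: negsum_def cf_sum cf_cscale cf_ea if_distrib in_keys_iff cong: if_cong)

lemma cf_bpa: "cf (bpa x) k = 0"
  by (simp add: bpa_def cf_diff cf_negsum lookup_coa)

lemma central_bpa: "central_part (bpa x) = central_part x"
  by (simp add: bpa_def affine_simps negsum_def sum_parts ea_def ltr_def)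

lemma loop_bpa: "Poly_Mapping.lookup (loop_part (bpa x)) r = (if r < 0 then 0 else Poly_Mapping.lookup (loop_part x) r)"
proof (cases "r < 0")
  case True
  have "Poly_Mapping.lookup (loop_part (bpa x)) r = 0"
  proof (rule crd_eqI)
    fix i
    obtain j where j: "j < 14" "idxs ! j = i"
      using set_idxs [of i] by (auto simp: in_set_conv_nth length_idxs)
    define k where "k = 14 * nat (- r - 1) + j"
    have "k div 14 = nat (- r - 1)" "k mod 14 = j" using j by (simp_all add: k_def)
    then show "crd i (Poly_Mapping.lookup (loop_part (bpa x)) r) = crd i 0"
      using cf_bpa [of x k] True j by (simp add: cf_def crd_0)
  qed
  with True show ?thesis by simp
next
  case False
  then show ?thesis
    by (simp add: bpa_def affine_simps lookup_minus negsum_def sum_parts lookup_sum loop_cscale_lookup ea_def ltr_def lookup_single when_def)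
qed

lemma loop_bracket_keys:
  assumes "r \<in> Poly_Mapping.keys (loop_bracket p q)"
  obtains s t where "r = s + t" "s \<in> Poly_Mapping.keys p" "t \<in> Poly_Mapping.keys q"
proof -
  let ?f = "\<lambda>s t. Poly_Mapping.single (s + t) (bracket (Poly_Mapping.lookup p s) (Poly_Mapping.lookup q t))"
  have "r \<in> (\<Union>s\<in>Poly_Mapping.keys p. Poly_Mapping.keys (\<Sum>t\<in>Poly_Mapping.keys q. ?f s t))"
    using assms unfolding loop_bracket_def by (rule subsetD [OF Poly_Mapping.keys_sum])
  then obtain s where s: "s \<in> Poly_Mapping.keys p" "r \<in> Poly_Mapping.keys (\<Sum>t\<in>Poly_Mapping.keys q. ?f s t)" by blast
  have "r \<in> (\<Union>t\<in>Poly_Mapping.keys q. Poly_Mapping.keys (?f s t))"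
    using s(2) by (rule subsetD [OF Poly_Mapping.keys_sum])
  then obtain t where "t \<in> Poly_Mapping.keys q" "r \<in> Poly_Mapping.keys (?f s t)" by blast
  with s show thesis using that by (auto split: if_splits)
qed

lemma cocycle_eq_0:
  "(\<And>s t. s \<in> Poly_Mapping.keys p \<Longrightarrow> t \<in> Poly_Mapping.keys q \<Longrightarrow> s = - t \<Longrightarrow> s = 0) \<Longrightarrow> cocycle p q = 0"
  unfolding cocycle_def by (intro sum.neutral ballI) (auto simp: of_bool_def)

lemma bpa_keys: "r \<in> Poly_Mapping.keys (loop_part (bpa x)) \<Longrightarrow> 0 \<le> r"
  by (simp add: in_keys_iff loop_bpa split: if_splits)

definition chia :: "affine \<Rightarrow> complex" where "chia x = - 12 * central_part x"

text \<open>The vacuum module at the critical level: it is induced from g[t] + C K with g[t] acting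
  by zero and K by -12.\<close>

interpretation V: pbw ea coa bpa chia
proof
  fix x y :: affine and c :: complex and k
  show "x = (\<Sum>k\<in>Poly_Mapping.keys (coa x). Poly_Mapping.lookup (coa x) k \<cdot> ea k) + bpa x"
    by (simp add: bpa_def negsum_def)
  show "coa (x + y) = coa x + coa y" by (rule coa_add)
  show "Poly_Mapping.lookup (coa (c \<cdot> x)) k = c * Poly_Mapping.lookup (coa x) k"
    by (simp add: lookup_coa cf_cscale)
  show "coa (ea k) = Poly_Mapping.single k 1"
    by (rule poly_mapping_eqI) (simp add: lookup_coa cf_ea lookup_single when_def)
  show "coa (bpa x) = 0" by (rule poly_mapping_eqI) (simp add: lookup_coa cf_bpa)
  show "bpa (x + y) = bpa x + bpa y" by (simp add: bpa_def coa_add negsum_add)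
  show "bpa (c \<cdot> x) = c \<cdot> bpa x" by (simp add: bpa_def negsum_cscale cscale_diff_right)
  show "chia (x + y) = chia x + chia y" "chia (c \<cdot> x) = c * chia x"
    by (simp_all add: chia_def affine_simps)
  have "Poly_Mapping.lookup (loop_bracket (loop_part (bpa x)) (loop_part (bpa y))) r = 0" if "r < 0" for r
  proof (rule ccontr)
    assume "Poly_Mapping.lookup (loop_bracket (loop_part (bpa x)) (loop_part (bpa y))) r \<noteq> 0"
    then have "r \<in> Poly_Mapping.keys (loop_bracket (loop_part (bpa x)) (loop_part (bpa y)))" by (simp add: in_keys_iff)
    then show False using that by (elim loop_bracket_keys) (auto dest!: bpa_keys)
  qed
  then show "coa (bracket (bpa x) (bpa y)) = 0"
    by (intro poly_mapping_eqI) (simp add: lookup_coa cf_def affine_simps crd_0)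
  \<comment> \<open>Nonnegative modes with sum zero are both zero, and the cocycle carries the mode
    as a factor.\<close>
  have "cocycle (loop_part (bpa x)) (loop_part (bpa y)) = 0"
    by (rule cocycle_eq_0) (auto dest!: bpa_keys)
  then show "chia (bracket (bpa x) (bpa y)) = 0" by (simp add: chia_def affine_simps)
qed

subsection \<open>Identification with polynomials\<close>

lemma loops_negI: "(\<And>r. r \<in> Poly_Mapping.keys (loop_part x) \<Longrightarrow> r < 0) \<Longrightarrow> central_part x = 0 \<Longrightarrow> x \<in> loops_neg"
  by (cases x) (auto simp: loops_neg_def)

lemma loops_negD: "x \<in> loops_neg \<Longrightarrow> r \<in> Poly_Mapping.keys (loop_part x) \<Longrightarrow> r < 0" "x \<in> loops_neg \<Longrightarrow> central_part x = 0"
  by (auto simp: loops_neg_def)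

lemma loops_neg_closed:
  assumes "x \<in> loops_neg"
  shows "y \<in> loops_neg \<Longrightarrow> x + y \<in> loops_neg" "c \<cdot> x \<in> loops_neg" "y \<in> loops_neg \<Longrightarrow> bracket x y \<in> loops_neg"
proof -
  show "c \<cdot> x \<in> loops_neg"
    using loops_negD [OF assms]
    by (intro loops_negI) (auto simp: affine_simps in_keys_iff loop_cscale_lookup, metis cscale_zero_right)
  assume y: "y \<in> loops_neg"
  show "x + y \<in> loops_neg"
    using loops_negD [OF assms] loops_negD [OF y] Poly_Mapping.keys_add [of "loop_part x" "loop_part y"]
    by (intro loops_negI) (auto simp: affine_simps)
  have "cocycle (loop_part x) (loop_part y) = 0"
    by (rule cocycle_eq_0) (use loops_negD [OF assms] loops_negD [OF y] in fastforce)
  then show "bracket x y \<in> loops_neg"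
    using loops_negD [OF assms] loops_negD [OF y]
    by (intro loops_negI) (auto simp: affine_simps elim!: loop_bracket_keys, fastforce)
qed

lemma loop_neg: "r < 0 \<Longrightarrow> loop X r \<in> loops_neg"
  by (rule loops_negI) (auto simp: affine_simps split: if_splits)

lemma ea_neg: "ea k \<in> loops_neg" and ltr_neg: "ltr r i \<in> loops_neg"
  by (simp_all add: ea_def ltr_def loop_neg)

lemma bpa_neg: "x \<in> loops_neg \<Longrightarrow> bpa x = 0"
proof -
  assume x: "x \<in> loops_neg"
  have "loop_part (bpa x) = 0"
    using loops_negD(1) [OF x] bpa_keys [of _ x]
    by (intro poly_mapping_eqI) (auto simp: loop_bpa in_keys_iff)
  then show ?thesis
    using central_bpa [of x] loops_negD(2) [OF x] by (cases "bpa x") (simp add: zero_affine_def)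
qed

text \<open>\<open>Psi_act\<close> with the zero ideal, as negative loops have no component in the
  inducing subalgebra.\<close>

lemma Psi_act_neg: "x \<in> loops_neg \<Longrightarrow> uembed x * V.Psi p = V.Psi (V.act x p)"
  using V.Psi_act [of loops_neg "{0}" x p]
  by (auto simp: loops_neg_closed ea_neg bpa_neg uembed_0 uscalar_simps affine_simps chia_def)

text \<open>Hence \<open>V.Phi\<close> factors through the vacuum module, and vanishing of a vacuum
  class becomes an equation between polynomials.\<close>

lemma Phi_vacuum_ideal: "u \<in> vacuum_ideal \<Longrightarrow> V.Phi u = 0"
proof (induction rule: vacuum_ideal.induct)
  case level
  have "bpa central = central"
  proof -
    have "coa central = 0" by (rule poly_mapping_eqI) (simp add: lookup_coa cf_def central_def crd_0)
    then show ?thesis by (simp add: bpa_def negsum_def)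
  qed
  then have "V.Phi (uembed central) = cst (- 12)"
    using V.act_bp_1 [of central] by (simp add: V.Phi_def V.uact_embed chia_def) (simp add: central_def)
  moreover have "V.Phi 12 = cst 12"
    using V.Phi_uscalar [of 12] by (simp add: uscalar_numeral)
  ultimately show ?case by (simp add: V.Phi_add flip: cst_simps)
next
  case (annihilate x)
  then have x: "0 \<le> r" if "r \<in> Poly_Mapping.keys (loop_part x)" for r
    using that by (auto simp: loops_nonneg_def)
  have c: "central_part x = 0" using annihilate by (auto simp: loops_nonneg_def)
  have "coa x = 0"
  proof (rule poly_mapping_eqI)
    fix k
    have "Poly_Mapping.lookup (loop_part x) (- int (k div 14) - 1) = 0"
      using x [of "- int (k div 14) - 1"] by (auto simp: in_keys_iff)
    then show "Poly_Mapping.lookup (coa x) k = Poly_Mapping.lookup 0 k"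
      by (simp add: lookup_coa cf_def crd_0)
  qed
  then have "bpa x = x" by (simp add: bpa_def negsum_def)
  moreover have "chia x = 0" by (simp add: chia_def c)
  ultimately show ?case using V.act_bp_1 [of x] by (simp add: V.Phi_def V.uact_embed cst_simps)
qed (simp_all add: V.Phi_0 V.Phi_add, simp add: V.Phi_def V.uact_mult linop_0 [OF V.linop_uact])

lemma uact_generated: "u \<in> generated_subalgebra loops_neg \<Longrightarrow> u * V.Psi p = V.Psi (V.uact u p)"
proof (induction arbitrary: p rule: generated_subalgebra.induct)
  case (embed x)
  then show ?case by (simp add: Psi_act_neg V.uact_embed)
next
  case (scalar c)
  then show ?case by (simp add: V.uact_scalar V.Psi_scale)
next
  case (add u v)
  then show ?case by (simp add: V.uact_add V.Psi_add distrib_right)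
next
  case (mult u v)
  then show ?case by (simp add: V.uact_mult mult.assoc)
qed

text \<open>The PBW theorem in the form used here: \<open>V.Phi\<close> is injective on the negative
  subalgebra, so elements there are determined by their polynomials.\<close>

lemma Psi_Phi: "u \<in> generated_subalgebra loops_neg \<Longrightarrow> V.Psi (V.Phi u) = u"
  using uact_generated [of u 1] V.Psi_cst [of 1] by (simp add: V.Phi_def cst_simps uscalar_simps)

lemma generated_sum: "(\<And>a. a \<in> A \<Longrightarrow> f a \<in> generated_subalgebra S) \<Longrightarrow> sum f A \<in> generated_subalgebra S"
  using generated_subalgebra.scalar [of 0 S]
  by (induction A rule: infinite_finite_induct) (auto simp: uscalar_simps intro: generated_subalgebra.add)

lemma vacuum_class_eq_0_iff: "vacuum_class u = 0 \<longleftrightarrow> u \<in> vacuum_ideal"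
  by (simp add: vacuum_class.abs_eq zero_vacuum_def vacuum.abs_eq_iff)

lemma ff_center_iff: "u \<in> feigin_frenkel_center \<longleftrightarrow>
  u \<in> generated_subalgebra loops_neg \<and> (\<forall>x\<in>loops_nonneg. uembed x * u \<in> vacuum_ideal)"
  by (simp add: feigin_frenkel_center_def segal_sugawara_def vacuum_act_class vacuum_class_eq_0_iff)

lemma ff_center_act: "u \<in> feigin_frenkel_center \<Longrightarrow> x \<in> loops_nonneg \<Longrightarrow> V.act x (V.Phi u) = 0"
  using Phi_vacuum_ideal [of "uembed x * u"]
  by (simp add: ff_center_iff V.Phi_def V.uact_mult V.uact_embed)

section \<open>Symbols\<close>

definition below :: "nat \<Rightarrow> 'v mpoly \<Rightarrow> bool"
  where "below d p \<longleftrightarrow> (\<forall>M\<in>Poly_Mapping.keys p. size M < d)"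
definition homog :: "nat \<Rightarrow> 'v mpoly \<Rightarrow> bool"
  where "homog d p \<longleftrightarrow> (\<forall>M\<in>Poly_Mapping.keys p. size M = d)"

lemma below_0 [simp]: "below d 0" and homog_0 [simp]: "homog d 0"
  by (simp_all add: below_def homog_def)
lemma below_iff_bdd: "below (Suc d) p \<longleftrightarrow> bdd d p"
  by (simp add: below_def bdd_def less_Suc_eq_le)
lemma homog_below: "homog d p \<Longrightarrow> d < d' \<Longrightarrow> below d' p"
  by (auto simp: below_def homog_def)
lemma below_mono: "below d p \<Longrightarrow> d \<le> d' \<Longrightarrow> below d' p"
  by (fastforce simp: below_def)
lemma below_add: "below d p \<Longrightarrow> below d q \<Longrightarrow> below d (p + q)"
  using Poly_Mapping.keys_add [of p q] by (fastforce simp: below_def)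
lemma homog_add: "homog d p \<Longrightarrow> homog d q \<Longrightarrow> homog d (p + q)"
  using Poly_Mapping.keys_add [of p q] by (fastforce simp: homog_def)
lemma below_cst_mult: "below d p \<Longrightarrow> below d (cst c * p)"
  using keys_cst_mult [of c p] by (auto simp: below_def)
lemma homog_cst_mult: "homog d p \<Longrightarrow> homog d (cst c * p)"
  using keys_cst_mult [of c p] by (auto simp: homog_def)
lemma below_diff: "below d p \<Longrightarrow> below d q \<Longrightarrow> below d (p - q)"
  using below_add [of d p "cst (- 1) * q"] below_cst_mult [of d q "- 1"] by (simp add: cst_simps)
lemma homog_diff: "homog d p \<Longrightarrow> homog d q \<Longrightarrow> homog d (p - q)"
  using homog_add [of d p "cst (- 1) * q"] homog_cst_mult [of d q "- 1"] by (simp add: cst_simps)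
lemma below_sum: "(\<And>a. a \<in> A \<Longrightarrow> below d (f a)) \<Longrightarrow> below d (sum f A)"
  by (induction A rule: infinite_finite_induct) (simp_all add: below_add)
lemma homog_sum: "(\<And>a. a \<in> A \<Longrightarrow> homog d (f a)) \<Longrightarrow> homog d (sum f A)"
  by (induction A rule: infinite_finite_induct) (simp_all add: homog_add)
lemma below_linop: "linop T \<Longrightarrow> (\<And>M. M \<in> Poly_Mapping.keys p \<Longrightarrow> below d (T (mon M))) \<Longrightarrow> below d (T p)"
  by (subst linop_expand) (auto intro: below_sum below_cst_mult)
lemma homog_linop: "linop T \<Longrightarrow> (\<And>M. M \<in> Poly_Mapping.keys p \<Longrightarrow> homog d (T (mon M))) \<Longrightarrow> homog d (T p)"
  by (subst linop_expand) (auto intro: homog_sum homog_cst_mult)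
lemma homog_mult: "homog d p \<Longrightarrow> homog d' q \<Longrightarrow> homog (d + d') (p * q)"
  using keys_mult [of p q] unfolding homog_def by fastforce
lemma homog_mon: "homog (size M) (mon M)" by (simp add: homog_def mon_def)
lemma homog_cst: "homog 0 (cst c)" by (simp add: homog_def cst_def)
lemma homog_eq_0: "homog d p \<Longrightarrow> below d p \<Longrightarrow> p = 0"
  unfolding homog_def below_def by (metis all_not_in_conv keys_eq_empty less_irrefl)
lemma below_zero_eq: "below 0 p \<Longrightarrow> p = 0"
  unfolding below_def by (metis all_not_in_conv keys_eq_empty not_less0)

definition hc :: "nat \<Rightarrow> 'v mpoly \<Rightarrow> 'v mpoly"
  where "hc d = lin (\<lambda>M. if size M = d then mon M else 0)"

lemma linop_hc: "linop (hc d)" by (simp add: hc_def linop_lin)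
lemma hc_mon: "hc d (mon M) = (if size M = d then mon M else 0)" by (simp add: hc_def)
lemma homog_hc: "homog d (hc d p)"
  by (rule homog_linop [OF linop_hc]) (auto simp: hc_mon homog_mon)
lemma below_diff_hc: "bdd d p \<Longrightarrow> below d (p - hc d p)"
  by (rule below_linop [OF linop_minus [OF linop_id linop_hc]])
    (auto simp: hc_mon bdd_def order_le_less intro!: homog_below [OF homog_mon])
lemma ex_bdd: "\<exists>d. bdd d p"
  unfolding bdd_def by (metis finite_keys finite_imageI finite_nat_set_iff_bounded_le imageI)

subsection \<open>Derivations\<close>

definition der :: "('v \<Rightarrow> 'v mpoly) \<Rightarrow> 'v mpoly \<Rightarrow> 'v mpoly"
  where "der f = lin (\<lambda>M. \<Sum>\<^sub># (image_mset (\<lambda>k. f k * mon (M - {#k#})) M))"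

lemma linop_der: "linop (der f)" by (simp add: der_def linop_lin)
lemmas der_simps = linopD [OF linop_der] linop_0 [OF linop_der] linop_diff [OF linop_der] linop_sum [OF linop_der]

lemma der_1: "der f 1 = 0"
  by (simp add: der_def flip: mon_0)

lemma der_cst: "der f (cst c) = 0"
  using linopD(2) [OF linop_der, of f c 1] by (simp add: der_1)

lemma der_add_mset: "der f (mon (add_mset k M)) = f k * mon M + var k * der f (mon M)"
proof -
  have "image_mset (\<lambda>l. f l * mon (add_mset k M - {#l#})) M = image_mset (\<lambda>l. var k * (f l * mon (M - {#l#}))) M"
  proof (rule image_mset_cong)
    fix l assume "l \<in># M"
    then have "add_mset k M - {#l#} = add_mset k (M - {#l#})" 
      using diff_union_single_conv [of l M "{#k#}"] by simp
    then have "mon (add_mset k M - {#l#}) = (var k * mon (M - {#l#}) :: 'a mpoly)"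
      by (simp only: mon_add_mset [of k "M - {#l#}"])
    then show "f l * mon (add_mset k M - {#l#}) = var k * (f l * mon (M - {#l#}))"
      by (simp only: mult.left_commute)
  qed
  then show ?thesis by (simp only: der_def lin_mon image_mset_add_mset sum_mset.add_mset sum_mset_distrib_left) simp
qed

lemma der_var: "der f (var k) = f k"
  using der_add_mset [of f k "{#}"] by (simp add: mon_0 der_1)

lemma der_mult: "der f (p * q) = der f p * q + p * der f q"
proof -
  have *: "der f (mon M * q) = der f (mon M) * q + mon M * der f q" for M q
  proof -
    have **: "der f (var k * q) = f k * q + var k * der f q" for k q
      by (rule linop_eqI [of "\<lambda>q. der f (var k * q)" "\<lambda>q. f k * q + var k * der f q"])
        (simp_all add: linop_comp [OF linop_der linop_mult] linop_plus linop_mult linop_comp [OF linop_mult linop_der]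
          der_add_mset flip: mon_add_mset)
    show ?thesis
    proof (induction M arbitrary: q)
      case empty
      then show ?case by (simp add: mon_0 der_1)
    next
      case (add k M)
      have "der f (mon (add_mset k M) * q) = der f (var k * (mon M * q))" by (simp add: mon_add_mset [of k M] mult.assoc)
      also have "\<dots> = f k * (mon M * q) + var k * (der f (mon M) * q + mon M * der f q)" unfolding ** add ..
      also have "\<dots> = (f k * mon M + var k * der f (mon M)) * q + (var k * mon M) * der f q"
        by (simp only: distrib_left distrib_right mult.assoc add.assoc)
      finally show ?case unfolding der_add_mset mon_add_mset [symmetric] .
    qed
  qed
  show ?thesis
    by (rule linop_eqI [of "\<lambda>p. der f (p * q)" "\<lambda>p. der f p * q + p * der f q"])
      (simp_all add: * linop_def der_simps distrib_left distrib_right mult.assoc add_ac)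
qed

lemma homog_der: "(\<And>k. homog 1 (f k)) \<Longrightarrow> homog (size M) (der f (mon M))"
proof (induction M)
  case (add k M)
  have "homog (1 + size M) (f k * mon M)" by (rule homog_mult) (rule add.prems, rule homog_mon)
  moreover have "homog (1 + size M) (var k * der f (mon M))"
  proof (rule homog_mult)
    show "homog 1 (var k)" using homog_mon [of "{#k#}"] by simp
    show "homog (size M) (der f (mon M))" by (rule add.IH) (rule add.prems)
  qed
  ultimately show ?case by (simp add: der_add_mset homog_add)
qed (simp add: mon_0 der_1)

context pbw
begin

lemma homog_lead: "homog 1 (lead x)"
  unfolding lead_def by (intro homog_sum homog_cst_mult) (metis homog_mon size_single)

lemma below_act_mon: "below (Suc (size M)) (act x (mon M) - lead x * mon M)"
  using act_degree by (simp add: below_iff_bdd)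

lemma below_act_lead:
  assumes "below d p"
  shows "below d (act x p - lead x * p)"
proof (rule below_linop [of "\<lambda>p. act x p - lead x * p"])
  show "linop (\<lambda>p. act x p - lead x * p)" by (rule linop_minus [OF linop_act linop_mult])
  fix M assume "M \<in> Poly_Mapping.keys p"
  then have "size M < d" using assms by (simp add: below_def)
  then show "below d (act x (mon M) - lead x * mon M)"
    by (intro below_mono [OF below_act_mon]) simp
qed

lemma below_act: "below d p \<Longrightarrow> below (Suc d) (act x p)"
proof -
  assume p: "below d p"
  have "below (Suc d) (lead x * p)"
    using keys_mult [of "lead x" p] homog_lead [of x] p by (fastforce simp: below_def homog_def)
  then show ?thesis
    using below_add [OF below_mono [OF below_act_lead [OF p, of x], of "Suc d"], of "lead x * p"] by simp
qed

text \<open>Moving \<open>x\<close> to the right produces one bracket for each letter, and finally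
  \<open>x\<close> annihilates the vacuum. Every reordering on the way costs a degree, so the
  leading part is the coadjoint derivation.\<close>

lemma act_derivation:
  assumes "co x = 0" "chi (bp x) = 0"
  shows "below (size M) (act x (mon M) - der (\<lambda>k. lead (bracket x (e k))) (mon M))"
proof (induction "size M" arbitrary: M rule: less_induct)
  case less
  show ?case
  proof (cases "M = {#}")
    case True
    then show ?thesis using assms by (simp add: mon_0 act_empty der_1 lead_def cst_simps)
  next
    case False
    obtain k N where M: "M = add_mset k N" and kN: "\<And>l. l \<in># N \<Longrightarrow> k \<le> l"
      using ex_add_Min [OF False] by blast
    let ?D = "der (\<lambda>k. lead (bracket x (e k)))"
    have IH: "below (size N) (act x (mon N) - ?D (mon N))" by (rule less) (simp add: M)
    have 1: "below (Suc (size N)) (act (e k) (act x (mon N) - ?D (mon N)))" by (rule below_act) (rule IH)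
    have "homog (size N) (?D (mon N))" by (rule homog_der) (rule homog_lead)
    then have 2: "below (Suc (size N)) (act (e k) (?D (mon N)) - lead (e k) * ?D (mon N))"
      by (intro below_act_lead) (simp add: homog_below)
    have 3: "below (Suc (size N)) (act (bracket x (e k)) (mon N) - lead (bracket x (e k)) * mon N)"
      by (rule below_act_mon)
    have "act x (mon M) = act (e k) (act x (mon N)) + act (bracket x (e k)) (mon N)"
      unfolding M by (rule act_hi) (simp_all add: kN assms(1))
    then have "act x (mon M) - ?D (mon M) = act (e k) (act x (mon N) - ?D (mon N))
       + (act (e k) (?D (mon N)) - lead (e k) * ?D (mon N)) + (act (bracket x (e k)) (mon N) - lead (bracket x (e k)) * mon N)"
      by (simp add: M der_add_mset lead_e act_simps)
    then show ?thesis using 1 2 3 by (simp add: M below_add)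
  qed
qed

end

text \<open>\<open>q\<close> is the component of degree exactly \<open>d\<close> and may be zero,
  namely when \<open>u\<close> has smaller degree. This makes the relation additive for fixed
  \<open>d\<close>.\<close>

definition symb :: "nat \<Rightarrow> affine uenv \<Rightarrow> nat mpoly \<Rightarrow> bool"
  where "symb d u q \<longleftrightarrow> u \<in> generated_subalgebra loops_neg \<and> homog d q \<and> below d (V.Phi u - q)"

lemma symb_ex:
  assumes "u \<in> generated_subalgebra loops_neg" "bdd d (V.Phi u)"
  shows "symb d u (hc d (V.Phi u))"
  using assms by (simp add: symb_def homog_hc below_diff_hc)

lemma symb_add: "symb d u p \<Longrightarrow> symb d v q \<Longrightarrow> symb d (u + v) (p + q)"
  using below_add [of d "V.Phi u - p" "V.Phi v - q"]
  by (auto simp: symb_def V.Phi_add intro: generated_subalgebra.add homog_add) (simp add: algebra_simps)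

lemma symb_uscalar: "symb 0 (uscalar c) (cst c)"
  by (simp add: symb_def V.Phi_uscalar homog_cst generated_subalgebra.scalar)

lemma symb_cscale: "symb d u p \<Longrightarrow> symb d (uscalar c * u) (cst c * p)"
  using below_cst_mult [of d "V.Phi u - p" c]
  by (auto simp: symb_def V.Phi_uscalar_mult right_diff_distrib intro: generated_subalgebra.intros homog_cst_mult)

lemma symb_uminus: "symb d u p \<Longrightarrow> symb d (- u) (- p)"
  using symb_cscale [of d u p "- 1"] by (simp add: uscalar_simps cst_simps)

lemma symb_diff: "symb d u p \<Longrightarrow> symb d v q \<Longrightarrow> symb d (u - v) (p - q)"
  using symb_add [OF _ symb_uminus] by fastforce

lemma symb_0: "symb d 0 0"
  using generated_subalgebra.scalar [of 0 loops_neg] by (simp add: symb_def V.Phi_0 uscalar_simps)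

lemma symb_sum: "(\<And>a. a \<in> A \<Longrightarrow> symb d (f a) (g a)) \<Longrightarrow> symb d (sum f A) (sum g A)"
  by (induction A rule: infinite_finite_induct) (simp_all add: symb_0 symb_add)

lemma symb_raise: "symb d u q \<Longrightarrow> d < d' \<Longrightarrow> symb d' u 0"
  using below_add [of d' "V.Phi u - q" q] below_mono [of d "V.Phi u - q" d'] homog_below [of d q d']
  by (simp add: symb_def)

lemma symb_unique: "symb d u q \<Longrightarrow> symb d u q' \<Longrightarrow> q = q'"
  using homog_eq_0 [of d "q - q'"] below_diff [of d "V.Phi u - q'" "V.Phi u - q"] homog_diff [of d q q']
  by (simp add: symb_def)

lemma symb_embed_mult:
  assumes "x \<in> loops_neg" "symb d u q"
  shows "symb (Suc d) (uembed x * u) (V.lead x * q)"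
proof -
  have 1: "below (Suc d) (V.act x (V.Phi u - q))" using assms by (intro V.below_act) (simp add: symb_def)
  have 2: "below (Suc d) (V.act x q - V.lead x * q)"
    using assms homog_below [of d q "Suc d"] by (intro V.below_act_lead) (simp add: symb_def)
  have "below (Suc d) (V.act x (V.Phi u) - V.lead x * q)"
    using below_add [OF 1 2] by (simp add: V.act_simps)
  moreover have "homog (1 + d) (V.lead x * q)"
    using assms by (intro homog_mult V.homog_lead) (simp add: symb_def)
  ultimately show ?thesis
    using assms by (auto simp: symb_def V.Phi_def V.uact_mult V.uact_embed intro: generated_subalgebra.intros)
qed

lemma symb_ordered_mult: "symb d v q \<Longrightarrow> symb (size M + d) (V.ordered M * v) (mon M * q)"
proof (induction "size M" arbitrary: M rule: less_induct)
  case less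
  show ?case
  proof (cases "M = {#}")
    case True
    then show ?thesis using less(2) by (simp add: V.ordered_def mon_0)
  next
    case False
    obtain k N where M: "M = add_mset k N" and kN: "\<And>l. l \<in># N \<Longrightarrow> k \<le> l"
      using V.ex_add_Min [OF False] by blast
    have "symb (size N + d) (V.ordered N * v) (mon N * q)" by (rule less) (simp_all add: M less)
    from symb_embed_mult [OF ea_neg this, of k] show ?thesis
      by (simp add: M V.ordered_add_mset [OF kN] V.lead_e mon_add_mset [of k N] mult.assoc)
  qed
qed

text \<open>The associated graded algebra is the polynomial ring: the left factor is expanded into
  ordered monomials, for which \<open>symb_ordered_mult\<close> gives the claim, and its lower part
  stays below the total degree.\<close>

lemma symb_mult:
  assumes u: "symb d u p" and v: "symb d' v q"
  shows "symb (d + d') (u * v) (p * q)"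
proof -
  define T where "T p = V.Phi (V.Psi p * v)" for p
  have T: "linop T"
    by (simp add: linop_def T_def V.Psi_add V.Psi_scale distrib_right V.Phi_add mult.assoc V.Phi_uscalar_mult)
  have Tm: "below (size M + d') (T (mon M) - mon M * q)" for M
    using symb_ordered_mult [OF v, of M] by (simp add: symb_def T_def V.Psi_mon)
  have "below (d + d') (T p - p * q)"
  proof (rule below_linop [of "\<lambda>p. T p - p * q"])
    show "linop (\<lambda>p. T p - p * q)" using T by (simp add: linop_def algebra_simps)
    show "below (d + d') (T (mon M) - mon M * q)" if "M \<in> Poly_Mapping.keys p" for M
      using Tm [of M] u that by (simp add: symb_def homog_def)
  qed
  moreover have "below (d + d') (T (V.Phi u - p))"
  proof (rule below_linop [OF T])
    fix M assume "M \<in> Poly_Mapping.keys (V.Phi u - p)"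
    then have M: "size M < d" using u by (simp add: symb_def below_def)
    have "below (d + d') (T (mon M) - mon M * q)" using below_mono [OF Tm] M by simp
    moreover have "homog (size M + d') (mon M * q)" using v by (intro homog_mult homog_mon) (simp add: symb_def)
    then have "below (d + d') (mon M * q)" by (rule homog_below) (use M in simp)
    ultimately show "below (d + d') (T (mon M))" using below_add by fastforce
  qed
  ultimately have "below (d + d') (T (V.Phi u) - p * q)"
    using below_add by (fastforce simp: linop_diff [OF T])
  then show ?thesis
    using u v by (auto simp: symb_def T_def Psi_Phi intro: generated_subalgebra.mult homog_mult)
qed

lemma symb_1: "symb 0 1 1"
  using symb_uscalar [of 1] by (simp add: uscalar_simps cst_simps)

lemma symb_power: "symb d u p \<Longrightarrow> symb (n * d) (u ^ n) (p ^ n)"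
  by (induction n) (simp_all add: symb_1 symb_mult)

lemma symb_embed: "x \<in> loops_neg \<Longrightarrow> symb 1 (uembed x) (V.lead x)"
  using symb_embed_mult [OF _ symb_1] by simp

lemma symb_ordered: "symb (size M) (V.ordered M) (mon M)"
  using symb_ordered_mult [OF symb_1, of M] by simp

text \<open>A map that behaves well on ordered monomials respects all symbols, because the part of
  \<open>u\<close> below degree \<open>d\<close> is a combination of shorter ordered monomials. It
  serves for the derivation and for the antipode.\<close>

lemma symb_linear:
  assumes u: "symb d u q" and T: "\<And>v w. T (v + w) = T v + T w" "\<And>c v. T (uscalar c * v) = uscalar c * T v"
    and T': "linop T'" and M: "\<And>M. symb (size M) (T (V.ordered M)) (T' (mon M))"
  shows "symb d (T u) (T' q)"
proof -
  define S where "S p = V.Phi (T (V.Psi p))" for p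
  have S: "linop S"
    by (simp add: linop_def S_def V.Psi_add V.Psi_scale T V.Phi_add V.Phi_uscalar_mult)
  have Sm: "below (size M) (S (mon M) - T' (mon M))" for M
    using M [of M] by (simp add: symb_def S_def V.Psi_mon)
  have Hm: "homog (size M) (T' (mon M))" for M
    using M [of M] by (simp add: symb_def)
  have q: "homog d q" using u by (simp add: symb_def)
  have "below d (S q - T' q)"
    by (rule below_linop [OF linop_minus [OF S T']]) (use Sm q in \<open>auto simp: homog_def\<close>)
  moreover have "below d (S (V.Phi u - q))"
  proof (rule below_linop [OF S])
    fix M assume "M \<in> Poly_Mapping.keys (V.Phi u - q)"
    then have M: "size M < d" using u by (simp add: symb_def below_def)
    have "below d (S (mon M) - T' (mon M))" using below_mono [OF Sm] M by simp
    moreover have "below d (T' (mon M))" using Hm M by (rule homog_below)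
    ultimately show "below d (S (mon M))" using below_add by fastforce
  qed
  ultimately have b: "below d (S (V.Phi u) - T' q)"
    using below_add by (fastforce simp: linop_diff [OF S])
  have h: "homog d (T' q)"
    by (rule homog_linop [OF T']) (use Hm q in \<open>auto simp: homog_def\<close>)
  have T0: "T 0 = 0" using T(1) [of 0 0] by simp
  have "T (sum f A) = (\<Sum>a\<in>A. T (f a))" for f and A :: "nat multiset set"
    by (induction A rule: infinite_finite_induct) (simp_all add: T0 T)
  then have "T (V.Psi (V.Phi u)) \<in> generated_subalgebra loops_neg"
    using M unfolding V.Psi_def
    by (simp add: T) (auto simp: symb_def intro!: generated_sum generated_subalgebra.mult generated_subalgebra.scalar)
  then show ?thesis using u b h by (simp add: symb_def S_def Psi_Phi)
qed

text \<open>The derivation D on letters: the factor is minus the mode of letter \<open>k\<close>,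
  and \<open>k + 14\<close> is the same basis vector one mode lower.\<close>

definition delta :: "nat mpoly \<Rightarrow> nat mpoly"
  where "delta = der (\<lambda>k. cst (of_nat (k div 14 + 1)) * var (k + 14))"

lemma affine_D_neg: "x \<in> loops_neg \<Longrightarrow> affine_D x \<in> loops_neg"
proof (rule loops_negI)
  fix r assume x: "x \<in> loops_neg" and "r \<in> Poly_Mapping.keys (loop_part (affine_D x))"
  then have "r \<in> Poly_Mapping.keys (\<Sum>s\<in>Poly_Mapping.keys (loop_part x).
    Poly_Mapping.single (s - 1) ((- of_int s) \<cdot> Poly_Mapping.lookup (loop_part x) s))"
    by (simp add: affine_D_def loop_D_def)
  then have "r \<in> (\<Union>s\<in>Poly_Mapping.keys (loop_part x).
    Poly_Mapping.keys (Poly_Mapping.single (s - 1) ((- of_int s) \<cdot> Poly_Mapping.lookup (loop_part x) s)))"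
    by (rule subsetD [OF Poly_Mapping.keys_sum])
  then obtain s where "s \<in> Poly_Mapping.keys (loop_part x)" "r = s - 1" by (auto split: if_splits)
  then show "r < 0" using loops_negD(1) [OF x] by force
qed (simp add: affine_D_def)

lemma uenv_D_generated: "u \<in> generated_subalgebra loops_neg \<Longrightarrow> uenv_D u \<in> generated_subalgebra loops_neg"
  by (induction rule: generated_subalgebra.induct)
    (auto simp: uenv_D_uembed uenv_D_uscalar uenv_D_add uenv_D_mult affine_D_neg
      intro: generated_subalgebra.intros generated_subalgebra.scalar [of 0, unfolded uscalar_simps])

lemma affine_D_ea: "affine_D (ea k) = of_nat (k div 14 + 1) \<cdot> ea (k + 14)"
proof -
  have "(k + 14) div 14 = k div 14 + 1" "(k + 14) mod 14 = k mod 14" by simp_all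
  then show ?thesis
    by (simp add: ea_def ltr_def affine_D_loop)
qed

lemma symb_D: "symb d u q \<Longrightarrow> symb d (uenv_D u) (delta q)"
proof (rule symb_linear [where T = uenv_D and T' = delta])
  show "uenv_D (uscalar c * v) = uscalar c * uenv_D v" for c v
    by (simp add: uenv_D_mult uenv_D_uscalar)
  show "symb (size M) (uenv_D (V.ordered M)) (delta (mon M))" for M
  proof (induction "size M" arbitrary: M rule: less_induct)
    case less
    show ?case
    proof (cases "M = {#}")
      case True
      then show ?thesis
        using uenv_D_uscalar [of 1] by (simp add: V.ordered_def mon_0 delta_def der_1 uscalar_simps symb_0)
    next
      case False
      obtain k N where M: "M = add_mset k N" and kN: "\<And>l. l \<in># N \<Longrightarrow> k \<le> l"
        using V.ex_add_Min [OF False] by blast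
      have N: "symb (size N) (uenv_D (V.ordered N)) (delta (mon N))" by (rule less) (simp add: M)
      have 1: "symb (Suc (size N)) (uembed (affine_D (ea k)) * V.ordered N) (V.lead (affine_D (ea k)) * mon N)"
        by (intro symb_embed_mult affine_D_neg ea_neg symb_ordered)
      show ?thesis
        using symb_add [OF 1 symb_embed_mult [OF ea_neg N, of k]]
        by (simp add: M V.ordered_add_mset [OF kN] uenv_D_mult uenv_D_uembed delta_def der_add_mset
            affine_D_ea V.lead_scale V.lead_e)
    qed
  qed
qed (simp_all add: uenv_D_add delta_def linop_der)

text \<open>The component of degree \<open>d\<close> of the equation
  \<open>V.act x (V.Phi u) = 0\<close>.\<close>

lemma symb_center:
  assumes "u \<in> feigin_frenkel_center" "symb d u q" "x \<in> loops_nonneg"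
  shows "der (\<lambda>k. V.lead (bracket x (ea k))) q = 0"
proof -
  have k: "0 \<le> r" if "r \<in> Poly_Mapping.keys (loop_part x)" for r
    using that assms(3) by (auto simp: loops_nonneg_def)
  have coa: "coa x = 0"
  proof (rule poly_mapping_eqI)
    fix k'
    have "Poly_Mapping.lookup (loop_part x) (- int (k' div 14) - 1) = 0"
      using k [of "- int (k' div 14) - 1"] by (auto simp: in_keys_iff)
    then show "Poly_Mapping.lookup (coa x) k' = Poly_Mapping.lookup 0 k'"
      by (simp add: lookup_coa cf_def crd_0)
  qed
  have "chia (bpa x) = 0" using assms(3) by (auto simp: chia_def central_bpa loops_nonneg_def)
  note D = V.act_derivation [OF coa this]
  let ?D = "der (\<lambda>k. V.lead (bracket x (ea k)))"
  have q: "homog d q" using assms(2) by (simp add: symb_def)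
  have hD: "homog (size M) (?D (mon M))" for M by (rule homog_der) (rule V.homog_lead)
  have "below d (V.act x q - ?D q)"
    by (rule below_linop [OF linop_minus [OF V.linop_act linop_der]]) (use D q in \<open>auto simp: homog_def\<close>)
  moreover have "below d (V.act x (V.Phi u - q))"
  proof (rule below_linop [OF V.linop_act])
    fix M assume "M \<in> Poly_Mapping.keys (V.Phi u - q)"
    then have M: "size M < d" using assms(2) by (simp add: symb_def below_def)
    have "below d (V.act x (mon M) - ?D (mon M))" using below_mono [OF D] M by simp
    moreover have "below d (?D (mon M))" using hD M by (rule homog_below)
    ultimately show "below d (V.act x (mon M))" using below_add by fastforce
  qed
  moreover have "V.act x (V.Phi u) = 0" by (rule ff_center_act) (use assms in auto)
  ultimately have "below d (- ?D q)"
    using below_add [of d "V.act x q - ?D q" "V.act x (V.Phi u - q)"] by (simp add: V.act_simps)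
  then have "below d (?D q)" using below_diff [of d 0 "- ?D q"] by simp
  moreover have "homog d (?D q)"
    by (rule homog_linop [OF linop_der]) (use hD q in \<open>auto simp: homog_def\<close>)
  ultimately show ?thesis by (rule homog_eq_0 [rotated])
qed

section \<open>Substitution homomorphisms\<close>

definition peval :: "('v \<Rightarrow> 'w mpoly) \<Rightarrow> 'v mpoly \<Rightarrow> 'w mpoly"
  where "peval f = lin (\<lambda>M. \<Prod>\<^sub># (image_mset f M))"

lemma linop_peval: "linop (peval f)" by (simp add: peval_def linop_lin)
lemmas peval_simps = linopD [OF linop_peval] linop_0 [OF linop_peval] linop_diff [OF linop_peval] linop_sum [OF linop_peval]

lemma peval_mon: "peval f (mon M) = (\<Prod>k\<in>#M. f k)" by (simp add: peval_def)
lemma peval_1: "peval f 1 = 1" using peval_mon [of f "{#}"] by (simp add: mon_0)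
lemma peval_var: "peval f (var k) = f k" by (simp add: peval_mon)
lemma peval_cst: "peval f (cst c) = cst c"
  using linopD(2) [OF linop_peval, of f c 1] by (simp add: peval_1)

lemma linop_mult_right: "linop (\<lambda>p. p * q)"
  by (simp add: linop_def distrib_right mult.assoc)

lemma peval_mult: "peval f (p * q) = peval f p * peval f q"
proof -
  have "peval f (mon M * q) = peval f (mon M) * peval f q" for M
    by (rule linop_eqI [of "\<lambda>q. peval f (mon M * q)" "\<lambda>q. peval f (mon M) * peval f q"])
      (simp_all add: linop_comp [OF linop_peval linop_mult] linop_comp [OF linop_mult linop_peval] peval_mon flip: mon_plus)
  then show ?thesis
    by (rule linop_eqI [OF linop_comp [OF linop_peval linop_mult_right] linop_comp [OF linop_mult_right linop_peval]])
qed

lemma peval_power: "peval f (p ^ n) = peval f p ^ n"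
  by (induction n) (simp_all add: peval_1 peval_mult)

lemma peval_prod_mset: "peval f (\<Prod>k\<in>#M. g k) = (\<Prod>k\<in>#M. peval f (g k))"
  by (induction M) (simp_all add: peval_1 peval_mult)

lemma peval_peval: "peval f (peval g p) = peval (\<lambda>k. peval f (g k)) p"
  by (rule linop_eqI [of "\<lambda>p. peval f (peval g p)"]) (simp_all add: linop_comp linop_peval peval_mon peval_prod_mset)

lemma peval_id: "peval var p = p"
proof -
  have prod: "(\<Prod>k\<in>#M. var k) = mon M" for M :: "'a multiset"
    by (induction M) (simp_all add: mon_0 flip: mon_add_mset)
  show ?thesis
    by (rule linop_eqI [of "peval var" "\<lambda>p. p"]) (simp_all add: linop_peval linop_id peval_mon prod)
qed

lemma peval_cong: "(\<And>k. f k = g k) \<Longrightarrow> peval f p = peval g p"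
  by (metis ext)

text \<open>Derivations related on the variables are related everywhere. This covers the translation
  to \<open>e\<close>, the restriction to the slice and the substitution of invariants into a
  polynomial.\<close>

lemma der_peval:
  assumes "\<And>k. der g (s k) = peval s (f k)"
  shows "der g (peval s p) = peval s (der f p)"
proof -
  have mon: "der g (peval s (mon M)) = peval s (der f (mon M))" for M
  proof (induction M)
    case empty
    then show ?case by (simp add: mon_0 peval_1 der_1 peval_simps)
  next
    case (add k M)
    have "der g (peval s (mon (add_mset k M))) = der g (s k * peval s (mon M))" by (simp add: peval_mon)
    also have "\<dots> = peval s (f k) * peval s (mon M) + peval s (var k) * peval s (der f (mon M))"
      by (simp add: der_mult assms add peval_var)
    finally show ?case by (simp add: der_add_mset peval_simps peval_mult)
  qed
  show ?thesis
    by (rule linop_eqI [of "\<lambda>p. der g (peval s p)" "\<lambda>p. peval s (der f p)"])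
      (simp_all add: linop_comp linop_der linop_peval mon)
qed

lemma peval_homog:
  assumes "\<And>v. homog (w v) (f v)"
  shows "homog (\<Sum>v\<in>#M. w v) (peval f (mon M))"
  by (induction M) (simp_all add: peval_mon assms homog_mult homog_cst [of 1, simplified cst_simps])

section \<open>The slice\<close>

text \<open>A polynomial in the letters is a function on arcs \<open>x(t)\<close> in the dual of the Lie algebra. The slice consists of
  the arcs \<open>e + a(t) f + b(t) g\<close>, where \<open>e\<close> is the principal nilpotent functional given by \<open>Q2\<close> and \<open>E21\<close>,
  and \<open>f\<close>, \<open>g\<close> are dual to \<open>E12\<close> and \<open>E13\<close>.\<close>

definition slice_idx :: "idx \<Rightarrow> bool" where "slice_idx i \<longleftrightarrow> i = E12 \<or> i = E13"
definition slice_ltr :: "nat \<Rightarrow> bool" where "slice_ltr k \<longleftrightarrow> slice_idx (idxs ! (k mod 14))"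
definition base_val :: "g2 \<Rightarrow> complex" where "base_val Y = crd Q2 Y + crd E21 Y"
text \<open>Letters 12 and 4 are Q2 and E21 in mode -1: the base point is a constant arc.\<close>

definition base_pt :: "nat \<Rightarrow> complex" where "base_pt k = (if k = 12 \<or> k = 4 then 1 else 0)"

definition shift :: "nat \<Rightarrow> nat mpoly" where "shift k = var k + cst (base_pt k)"

text \<open>\<open>Inl r\<close> and \<open>Inr r\<close> are the coefficients of t^r in a(t) and
  b(t).\<close>

definition slice_var :: "nat \<Rightarrow> nat + nat"
  where "slice_var k = (if idxs ! (k mod 14) = E12 then Inl (k div 14) else Inr (k div 14))"

definition restrict0 :: "nat \<Rightarrow> (nat + nat) mpoly"
  where "restrict0 k = (if slice_ltr k then var (slice_var k) else 0)"
definition slice_val :: "nat \<Rightarrow> (nat + nat) mpoly"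
  where "slice_val k = restrict0 k + cst (base_pt k)"

text \<open>The brackets with \<open>transversal i\<close> span the directions transversal to the slice.\<close>

primrec transversal :: "idx \<Rightarrow> g2" where
  "transversal H1 = (2/3) \<cdot> bas E21 + bas Q2"
| "transversal H2 = (1/3) \<cdot> bas E21 + bas Q2"
| "transversal E12 = 0"
| "transversal E13 = 0"
| "transversal E21 = (-2/3) \<cdot> bas H1 + (-1/3) \<cdot> bas H2"
| "transversal E23 = (-1/3) \<cdot> bas E31"
| "transversal E31 = (1/3) \<cdot> bas E23"
| "transversal E32 = (1/3) \<cdot> bas Q3"
| "transversal P1 = (-1/2) \<cdot> bas P3"
| "transversal P2 = (-1) \<cdot> bas Q1"
| "transversal P3 = (1/2) \<cdot> bas P1"
| "transversal Q1 = (-1/3) \<cdot> bas E12"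
| "transversal Q2 = (-1) \<cdot> bas H1 + (-1) \<cdot> bas H2"
| "transversal Q3 = (-1/3) \<cdot> bas E32"

text \<open>Infinitesimal transversality at \<open>e\<close>: the direction given by
  \<open>transversal i\<close> changes, among the twelve coordinates off the slice, precisely the
  coordinate \<open>i\<close>.\<close>

lemma base_val_transversal:
  "\<not> slice_idx i \<Longrightarrow> \<not> slice_idx j \<Longrightarrow> base_val (bracket (transversal i) (bas j)) = (if i = j then 1 else 0)"
  by (cases i; cases j; simp add: slice_idx_def base_val_def bracket_add_left bracket_cscale_left cmb_bracket
      crd_add crd_cscale crd_cmb crd_bas crd_0 del: bas.simps crd.simps)

lemma lead_loop_neg: "V.lead (loop Y (- int t - 1)) = (\<Sum>i<14. cst (crd (idxs ! i) Y) * var (14 * t + i))"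
proof -
  have "loop Y (- int t - 1) = (\<Sum>i\<leftarrow>idxs. crd i Y \<cdot> ltr t i)"
  proof -
    have l: "loop (X + Y) r = loop X r + loop Y r" "loop (c \<cdot> X) r = c \<cdot> loop X r" "loop 0 r = 0" for X Y r c
      by (simp_all add: loop_def plus_affine_def cscale_affine_def single_add zero_affine_def)
    have "loop (\<Sum>i\<leftarrow>is. crd i Y \<cdot> bas i) (- int t - 1) = (\<Sum>i\<leftarrow>is. crd i Y \<cdot> ltr t i)" for "is"
      by (induction "is") (simp_all add: l ltr_def)
    then show ?thesis using g2_expand [of Y] by metis
  qed
  also have "\<dots> = (\<Sum>i<14. crd (idxs ! i) Y \<cdot> ltr t (idxs ! i))"
    by (simp add: sum_list_sum_nth length_idxs atLeast0LessThan)
  also have "\<dots> = (\<Sum>i<14. crd (idxs ! i) Y \<cdot> ea (14 * t + i))"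
    by (rule sum.cong) (auto simp: ea_def)
  finally have "loop Y (- int t - 1) = (\<Sum>i<14. crd (idxs ! i) Y \<cdot> ea (14 * t + i))" .
  moreover have "V.lead (sum f A) = (\<Sum>a\<in>A. V.lead (f a))" for f and A :: "nat set"
    by (induction A rule: infinite_finite_induct) (simp_all add: V.lead_0 V.lead_add)
  ultimately show ?thesis by (simp add: V.lead_scale V.lead_e)
qed

lemma lead_eq_0: "(\<And>r. r < 0 \<Longrightarrow> Poly_Mapping.lookup (loop_part x) r = 0) \<Longrightarrow> V.lead x = 0"
proof -
  assume "\<And>r. r < 0 \<Longrightarrow> Poly_Mapping.lookup (loop_part x) r = 0"
  then have "coa x = 0" by (intro poly_mapping_eqI) (simp add: lookup_coa cf_def crd_0)
  then show ?thesis by (simp add: V.lead_def)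
qed

text \<open>The coadjoint vector field of X[r] on arcs, given by its values on the coordinate
  functions.\<close>

definition loop_field :: "g2 \<Rightarrow> nat \<Rightarrow> nat \<Rightarrow> nat mpoly"
  where "loop_field X r k = V.lead (bracket (loop X (int r)) (ea k))"

lemma loop_field_eq: "loop_field X r k = (if r \<le> k div 14
   then \<Sum>i<14. cst (crd (idxs ! i) (bracket X (bas (idxs ! (k mod 14))))) * var (14 * (k div 14 - r) + i) else 0)"
proof -
  let ?Y = "bracket X (bas (idxs ! (k mod 14)))"
  have c: "V.lead (c \<cdot> central) = 0" for c
    by (rule lead_eq_0) (simp add: central_def cscale_affine_def)
  have "loop_field X r k = V.lead (loop ?Y (int r + (- int (k div 14) - 1)))"
    by (simp add: loop_field_def ea_def ltr_def bracket_loop V.lead_add c)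
  also have "\<dots> = (if r \<le> k div 14 then V.lead (loop ?Y (- int (k div 14 - r) - 1)) else 0)"
  proof (cases "r \<le> k div 14")
    case True
    then have "int r + (- int (k div 14) - 1) = - int (k div 14 - r) - 1" by linarith
    then show ?thesis using True by (simp only: if_True)
  next
    case False
    then have "V.lead (loop ?Y (int r + (- int (k div 14) - 1))) = 0"
      by (intro lead_eq_0) (auto simp: affine_simps lookup_single when_def)
    then show ?thesis using False by simp
  qed
  finally show ?thesis by (simp only: lead_loop_neg)
qed

definition invariant :: "nat mpoly \<Rightarrow> bool"
  where "invariant q \<longleftrightarrow> (\<forall>X r. der (loop_field X r) q = 0)"

text \<open>What matters is 0 < 2 < 3. Replacing one letter by another lowers the weight by at most
  1 and deleting a slice letter lowers it by 2; only the deletion of a transversal letter lowers it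
  by 3.\<close>

definition wt :: "nat multiset \<Rightarrow> nat" where "wt M = (\<Sum>k\<in>#M. if slice_ltr k then 2 else 3)"

lemma keys_linear:
  fixes N :: "nat multiset" and g :: "nat \<Rightarrow> nat"
  assumes "K \<in> Poly_Mapping.keys ((\<Sum>i<n. cst (c i) * var (g i)) * mon N)"
  obtains i where "K = add_mset (g i) N"
proof -
  obtain A where A: "A \<in> Poly_Mapping.keys (\<Sum>i<n. cst (c i) * var (g i) :: nat mpoly)" "K = A + N"
    using assms keys_mult [of "\<Sum>i<n. cst (c i) * var (g i)" "mon N"] by (auto simp: mon_def)
  have "A \<in> (\<Union>i\<in>{..<n}. Poly_Mapping.keys (cst (c i) * var (g i) :: nat mpoly))"
    using A(1) Poly_Mapping.keys_sum [of "\<lambda>i. cst (c i) * var (g i) :: nat mpoly" "{..<n}"] by blast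
  then obtain i where "A = {#g i#}" using keys_cst_mult by (fastforce simp: mon_def)
  then show thesis using that A(2) by simp
qed

text \<open>In coordinates centered at \<open>e\<close> the linear field acquires a constant term.
  Since \<open>e\<close> is a constant arc, the term occurs only at letters whose mode is carried to
  -1 by X[r].\<close>

lemma shift_loop_field:
  "peval shift (loop_field X r k) = (if r \<le> k div 14
   then (\<Sum>i<14. cst (crd (idxs ! i) (bracket X (bas (idxs ! (k mod 14))))) * var (14 * (k div 14 - r) + i)) else 0)
   + cst (if r = k div 14 then base_val (bracket X (bas (idxs ! (k mod 14)))) else 0)"
proof -
  let ?Y = "bracket X (bas (idxs ! (k mod 14)))"
  have pt: "(\<Sum>i<14. cst (crd (idxs ! i) ?Y) * cst (base_pt (14 * t + i))) = cst (if t = 0 then base_val ?Y else 0)" for t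
  proof (cases "t = 0")
    case True
    have s: "{..<14} = {0,1,2,3,4,5,6,7,8,9,10,11,12,13::nat}"
      by (rule set_eqI) (simp, presburger)
    show ?thesis by (simp add: True s base_pt_def idxs_def base_val_def cst_simps del: crd.simps)
  next
    case False
    then have "base_pt (14 * t + i) = 0" if "i < 14" for i using that by (auto simp: base_pt_def)
    then show ?thesis using False by (simp add: cst_simps)
  qed
  note E = loop_field_eq peval_simps peval_mult peval_cst peval_var shift_def distrib_left sum.distrib
  consider "r = k div 14" | "r < k div 14" | "\<not> r \<le> k div 14" by linarith
  then show ?thesis
  proof cases
    case 1
    then show ?thesis using pt [of 0] by (simp add: E)
  next
    case 2
    then show ?thesis using pt [of "k div 14 - r"] by (simp add: E cst_simps)
  next
    case 3
    then show ?thesis by (simp add: E cst_simps)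
  qed
qed

lemma lookup_der_mon:
  "Poly_Mapping.lookup (der f (mon M)) K = (\<Sum>k\<in>#M. Poly_Mapping.lookup (f k * mon (M - {#k#})) K)"
proof -
  have "Poly_Mapping.lookup (\<Sum>k\<in>#M'. g k) K = (\<Sum>k\<in>#M'. Poly_Mapping.lookup (g k) K)" for g :: "'a \<Rightarrow> 'a mpoly" and M'
    by (induction M') (simp_all add: lookup_add)
  then show ?thesis by (simp add: der_def)
qed

lemma lookup_linop:
  "linop T \<Longrightarrow> Poly_Mapping.lookup (T p) K = (\<Sum>M\<in>Poly_Mapping.keys p. Poly_Mapping.lookup p M * Poly_Mapping.lookup (T (mon M)) K)"
  by (subst linop_expand) (simp_all add: lookup_sum)

text \<open>The field of \<open>transversal i\<close> in the mode of \<open>k\<close> acts in lowest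
  weight as the partial derivative with respect to \<open>k\<close>. The coefficient of
  \<open>M\<close> without one \<open>k\<close> in the derivative is therefore the coefficient of
  \<open>M\<close> times the multiplicity of \<open>k\<close>, and invariance makes it zero.\<close>

lemma invariant_no_transversal:
  assumes inv: "invariant q" and M: "M \<in> Poly_Mapping.keys (peval shift q)"
    and min: "\<And>N. N \<in> Poly_Mapping.keys (peval shift q) \<Longrightarrow> wt M \<le> wt N"
    and k: "k \<in># M" "\<not> slice_ltr k"
  shows False
proof -
  define i where "i = idxs ! (k mod 14)"
  define X where "X = transversal i"
  define r where "r = k div 14"
  define g where "g j = peval shift (loop_field X r j)" for j
  have dg: "der g (peval shift q) = 0"
  proof -
    have "der g (shift j) = peval shift (loop_field X r j)" for j
      by (simp add: shift_def der_simps der_var der_cst g_def)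
    then have "der g (peval shift q) = peval shift (der (loop_field X r) q)"
      by (rule der_peval)
    then show ?thesis using inv by (simp add: invariant_def peval_simps)
  qed
  define M0 where "M0 = M - {#k#}"
  have M0: "M = add_mset k M0" using k by (simp add: M0_def)
  have wM: "wt M = wt M0 + 3" using k(2) by (simp add: M0 wt_def)
  \<comment> \<open>The linear terms and the slice letters would require a monomial \<open>N\<close>
    of weight below the minimum; what is left is the constant term at \<open>k\<close>
    itself.\<close>
  have contribution: "Poly_Mapping.lookup (g j * mon (N - {#j#})) M0 = (if j = k \<and> N = M then 1 else 0)"
    if N: "N \<in> Poly_Mapping.keys (peval shift q)" and j: "j \<in># N" for N j
  proof -
    define Y where "Y = bracket X (bas (idxs ! (j mod 14)))"
    obtain N' where N': "N = add_mset j N'" using j by (metis insert_DiffM)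
    have wN: "wt N = wt N' + (if slice_ltr j then 2 else 3)" by (simp add: N' wt_def)
    define l where "l = (\<Sum>i<14. cst (crd (idxs ! i) Y) * var (14 * (j div 14 - r) + i) :: nat mpoly)"
    have "Poly_Mapping.lookup (l * mon N') M0 = 0"
    proof (rule ccontr)
      assume "Poly_Mapping.lookup (l * mon N') M0 \<noteq> 0"
      then have "M0 \<in> Poly_Mapping.keys (l * mon N')" by (simp add: in_keys_iff)
      then obtain i' where "M0 = add_mset (14 * (j div 14 - r) + i') N'"
        unfolding l_def by (rule keys_linear)
      then have "wt M0 \<ge> wt N' + 2" by (simp add: wt_def)
      then show False using min [OF N] wM wN by (simp split: if_splits)
    qed
    moreover have "g j = (if r \<le> j div 14 then l else 0) + cst (if r = j div 14 then base_val Y else 0)"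
      by (simp add: g_def shift_loop_field l_def Y_def)
    ultimately have "Poly_Mapping.lookup (g j * mon N') M0 =
        (if r = j div 14 then base_val Y else 0) * Poly_Mapping.lookup (mon N') M0"
      by (simp add: distrib_right lookup_add)
    also have "\<dots> = (if j = k \<and> N = M then 1 else 0)"
    proof (cases "N' = M0")
      case True
      \<comment> \<open>Otherwise \<open>N\<close> would have weight one less than
        \<open>M\<close>.\<close>
      have "\<not> slice_ltr j"
        using min [OF N] wM wN True by (simp split: if_splits)
      then have "base_val Y = (if i = idxs ! (j mod 14) then 1 else 0)"
        unfolding Y_def X_def using k(2) by (intro base_val_transversal) (simp_all add: i_def slice_ltr_def)
      moreover have "i = idxs ! (j mod 14) \<longleftrightarrow> k mod 14 = j mod 14"
        by (simp add: i_def nth_eq_iff_index_eq distinct_idxs length_idxs)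
      moreover have "j = k \<longleftrightarrow> k div 14 = j div 14 \<and> k mod 14 = j mod 14" by (metis div_mult_mod_eq)
      ultimately show ?thesis using True by (auto simp: r_def N' M0 mon_def lookup_single)
    next
      case False
      then show ?thesis by (auto simp: N' M0 mon_def lookup_single)
    qed
    finally show ?thesis by (simp add: N')
  qed
  have cnt: "(\<Sum>j\<in>#N. if j = k \<and> b then 1 else 0) = (if b then of_nat (count N k) else (0::complex))" for b N
    by (induction N) auto
  have "Poly_Mapping.lookup (der g (mon N)) M0 = (if N = M then of_nat (count M k) else 0)"
    if N: "N \<in> Poly_Mapping.keys (peval shift q)" for N
  proof -
    have "Poly_Mapping.lookup (der g (mon N)) M0 = (\<Sum>j\<in>#N. if j = k \<and> N = M then 1 else 0)"
      unfolding lookup_der_mon by (rule arg_cong [of _ _ sum_mset], rule image_mset_cong) (rule contribution [OF N])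
    also have "\<dots> = (if N = M then of_nat (count N k) else 0)"
      by (rule cnt)
    finally show ?thesis by auto
  qed
  then have "(\<Sum>N\<in>Poly_Mapping.keys (peval shift q). Poly_Mapping.lookup (peval shift q) N * Poly_Mapping.lookup (der g (mon N)) M0)
    = (\<Sum>N\<in>Poly_Mapping.keys (peval shift q). if N = M then Poly_Mapping.lookup (peval shift q) M * of_nat (count M k) else 0)"
    by (intro sum.cong) auto
  then have "Poly_Mapping.lookup (der g (peval shift q)) M0 = Poly_Mapping.lookup (peval shift q) M * of_nat (count M k)"
    using M by (subst lookup_linop [OF linop_der]) (simp only: sum.delta finite_keys if_True)
  then have "Poly_Mapping.lookup (peval shift q) M * of_nat (count M k) = 0" by (simp add: dg)
  moreover have "count M k \<noteq> 0" using k(1) by simp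
  ultimately show False using M by (simp add: in_keys_iff)
qed

lemma slice_var_inj: "slice_ltr k \<Longrightarrow> slice_ltr l \<Longrightarrow> slice_var k = slice_var l \<Longrightarrow> k = l"
proof -
  assume *: "slice_ltr k" "slice_ltr l" "slice_var k = slice_var l"
  then have "idxs ! (k mod 14) = idxs ! (l mod 14)" "k div 14 = l div 14"
    by (auto simp: slice_ltr_def slice_idx_def slice_var_def split: if_splits)
  then have "k mod 14 = l mod 14" by (simp add: nth_eq_iff_index_eq distinct_idxs length_idxs)
  with \<open>k div 14 = l div 14\<close> show "k = l" by (metis div_mult_mod_eq)
qed

lemma restrict0_mon:
  "peval restrict0 (mon M) = (if \<forall>k\<in>#M. slice_ltr k then mon (image_mset slice_var M) else 0)"
  by (induction M) (auto simp: peval_mon peval_1 restrict0_def mon_0 mon_add_mset [symmetric])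

lemma image_slice_var_inj:
  "\<forall>k\<in>#M. slice_ltr k \<Longrightarrow> \<forall>k\<in>#N. slice_ltr k \<Longrightarrow> image_mset slice_var M = image_mset slice_var N \<Longrightarrow> M = N"
proof (induction M arbitrary: N)
  case (add k M)
  then have "slice_var k \<in># image_mset slice_var N" by (metis image_mset_add_mset union_single_eq_member)
  then obtain l where l: "l \<in># N" "slice_var l = slice_var k" by auto
  then have "l = k" using add by (intro slice_var_inj) auto
  then obtain N' where N: "N = add_mset k N'" using l by (metis insert_DiffM)
  have "M = N'"
  proof (rule add.IH)
    show "\<forall>k\<in>#M. slice_ltr k" "\<forall>k\<in>#N'. slice_ltr k" using add.prems(1,2) by (simp_all add: N)
    show "image_mset slice_var M = image_mset slice_var N'" using add.prems(3) by (simp add: N)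
  qed
  then show ?case by (simp add: N)
qed auto

text \<open>A monomial of minimal weight contains slice letters only, and the restriction to the
  slice is injective on such monomials, so it would survive there.\<close>

theorem invariant_eq_0:
  assumes inv: "invariant q" and "peval slice_val q = 0"
  shows "q = 0"
proof -
  define p where "p = peval shift q"
  have "peval restrict0 p = peval slice_val q"
    unfolding p_def peval_peval by (rule peval_cong) (simp add: shift_def peval_simps peval_var peval_cst slice_val_def)
  then have r0: "peval restrict0 p = 0" using assms by simp
  have "p = 0"
  proof (rule ccontr)
    assume "p \<noteq> 0"
    then have "Poly_Mapping.keys p \<noteq> {}" by simp
    then obtain M where M: "M \<in> Poly_Mapping.keys p" and min: "\<And>N. N \<in> Poly_Mapping.keys p \<Longrightarrow> wt M \<le> wt N"
      using ex_min_if_finite [of "wt ` Poly_Mapping.keys p"] by (metis arg_min_if_finite(1) arg_min_least finite_keys)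
    have s: "\<forall>k\<in>#M. slice_ltr k"
      using invariant_no_transversal [OF inv, folded p_def, OF M min] by blast
    have "Poly_Mapping.lookup (peval restrict0 p) (image_mset slice_var M)
       = (\<Sum>N\<in>Poly_Mapping.keys p. if N = M then Poly_Mapping.lookup p M else 0)"
    proof (subst lookup_linop [OF linop_peval], rule sum.cong)
      fix N
      show "Poly_Mapping.lookup p N * Poly_Mapping.lookup (peval restrict0 (mon N)) (image_mset slice_var M)
        = (if N = M then Poly_Mapping.lookup p M else 0)"
      proof (cases "\<forall>k\<in>#N. slice_ltr k")
        case True
        then have "image_mset slice_var N = image_mset slice_var M \<longleftrightarrow> N = M"
          using s image_slice_var_inj by metis
        then show ?thesis using True by (simp add: restrict0_mon) (simp add: mon_def lookup_single when_def)
      next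
        case False
        then have "N \<noteq> M" using s by metis
        then show ?thesis using False by (simp only: restrict0_mon if_False lookup_zero mult_zero_right)
      qed
    qed simp
    also have "\<dots> = Poly_Mapping.lookup p M" using M by simp
    finally show False using M r0 by (simp add: in_keys_iff)
  qed
  have "q = peval (\<lambda>k. var k - cst (base_pt k)) p"
    unfolding p_def peval_peval by (simp add: shift_def peval_simps peval_var peval_cst peval_id)
  then show "q = 0" by (simp add: \<open>p = 0\<close> peval_simps)
qed

text \<open>The derivative of arcs on their Taylor coefficients; it corresponds to
  \<open>delta\<close> on the slice.\<close>

definition ddt :: "(nat + nat) mpoly \<Rightarrow> (nat + nat) mpoly"
  where "ddt = der (case_sum (\<lambda>k. cst (of_nat (k + 1)) * var (Inl (k + 1))) (\<lambda>k. cst (of_nat (k + 1)) * var (Inr (k + 1))))"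

lemma slice_delta: "peval slice_val (delta q) = ddt (peval slice_val q)"
  unfolding delta_def ddt_def
proof (rule der_peval [symmetric])
  fix k :: nat
  have "(k + 14) div 14 = k div 14 + 1" "(k + 14) mod 14 = k mod 14" by simp_all
  then show "der (case_sum (\<lambda>k. cst (of_nat (k + 1)) * var (Inl (k + 1))) (\<lambda>k. cst (of_nat (k + 1)) * var (Inr (k + 1)))) (slice_val k)
    = peval slice_val (cst (of_nat (k div 14 + 1)) * var (k + 14))"
    by (auto simp: slice_val_def restrict0_def der_simps der_cst der_var peval_simps peval_var base_pt_def slice_ltr_def slice_var_def cst_simps(1))
qed

lemma slice_delta_funpow: "peval slice_val ((delta ^^ n) q) = (ddt ^^ n) (peval slice_val q)"
  by (induction n) (simp_all add: slice_delta)

section \<open>Symbols of traces and their values on the slice\<close>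

definition lead_mat :: "int \<Rightarrow> nat mpoly^7^7"
  where "lead_mat r = (\<chi> j i. V.lead (loop (G i j) r))"

lemma symb_mat:
  "(\<And>r. r \<in> set rs \<Longrightarrow> r < 0) \<Longrightarrow>
    symb (length rs) (foldr (\<lambda>r M. Gseries r ** M) rs (mat 1) $ j $ i) (foldr (\<lambda>r M. lead_mat r ** M) rs (mat 1) $ j $ i)"
proof (induction rs arbitrary: j i)
  case Nil
  then show ?case by (simp add: mat_def symb_0 symb_1)
next
  case (Cons r rs)
  then show ?case
    by (auto simp: matrix_matrix_mult_def Gseries_def lead_mat_def intro!: symb_sum symb_embed_mult loop_neg)
qed

lemma symb_trG:
  "(\<And>r. r \<in> set rs \<Longrightarrow> r < 0) \<Longrightarrow> symb (length rs) (trG rs) (trace (foldr (\<lambda>r M. lead_mat r ** M) rs (mat 1)))"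
  unfolding trG_def trace_def by (intro symb_sum symb_mat) auto

definition lead_S2 :: "nat mpoly" where "lead_S2 = trace (foldr (\<lambda>r M. lead_mat r ** M) [-1, -1] (mat 1))"
definition lead_S6 :: "nat mpoly" where "lead_S6 = trace (foldr (\<lambda>r M. lead_mat r ** M) [-1, -1, -1, -1, -1, -1] (mat 1))"

lemma symb_S2: "symb 2 S2 lead_S2"
  using symb_trG [of "[-1, -1]"] by (simp add: S2_def lead_S2_def numeral_2_eq_2)

lemma symb_numeral: "symb 0 (numeral n) (cst (numeral n))"
  using symb_uscalar [of "numeral n"] by (simp add: uscalar_numeral)

lemma symb_lower: "(\<And>r. r \<in> set rs \<Longrightarrow> r < 0) \<Longrightarrow> length rs < 6 \<Longrightarrow> symb 6 (numeral n * trG rs) 0"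
  using symb_mult [OF symb_numeral symb_raise [OF symb_trG], of rs 6 n] by simp

text \<open>Only the first trace has six factors; the other six summands have fewer and contribute
  zero in degree 6.\<close>

lemma symb_S6: "symb 6 S6 lead_S6"
proof -
  have "symb 6 (trG [-1, -1, -1, -1, -1, -1]) lead_S6"
    using symb_trG [of "[-1, -1, -1, -1, -1, -1]"] by (simp add: lead_S6_def eval_nat_numeral)
  then have "symb 6 S6 (lead_S6 + 0 + 0 + 0 - 0 + 0 - 0)"
    unfolding S6_def by (intro symb_add symb_diff symb_lower) auto
  then show ?thesis by simp
qed

text \<open>The matrix G[-1] on the slice. Only the constant coefficients of a(t) and b(t) occur,
  since mode -1 reads off t^0.\<close>

definition slice_mat :: "(nat + nat) mpoly^7^7"
  where "slice_mat = (\<chi> j i. cst (base_val (G i j)) + cst (crd E12 (G i j)) * var (Inl 0) + cst (crd E13 (G i j)) * var (Inr 0))"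

lemma slice_lead: "peval slice_val (lead_mat (-1) $ j $ i) = slice_mat $ j $ i"
proof -
  have s: "{..<14} = {0,1,2,3,4,5,6,7,8,9,10,11,12,13::nat}"
    by (rule set_eqI) (simp, presburger)
  show ?thesis
    using lead_loop_neg [of "G i j" 0]
    by (simp add: lead_mat_def slice_mat_def s peval_simps peval_var slice_val_def restrict0_def slice_ltr_def
        slice_idx_def slice_var_def base_pt_def idxs_def base_val_def cst_simps distrib_right del: crd.simps)
qed

lemma peval_trace: "peval f (trace M) = trace (\<chi> j i. peval f (M $ j $ i))"
  by (simp add: trace_def peval_simps)

lemma peval_mat_mult: "(\<chi> j i. peval f ((M ** N) $ j $ i)) = (\<chi> j i. peval f (M $ j $ i)) ** (\<chi> j i. peval f (N $ j $ i))"
  by (simp add: vec_eq_iff matrix_matrix_mult_def peval_simps peval_mult)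

lemma peval_mat_1: "(\<chi> j i. peval f (mat 1 $ j $ i)) = mat 1"
  by (simp add: vec_eq_iff mat_def peval_1 peval_simps)

lemma slice_lead_mat: "(\<chi> j i. peval slice_val (lead_mat (-1) $ j $ i)) = slice_mat"
  by (simp add: vec_eq_iff slice_lead)

lemma slice_mat_entries:
  fixes a b :: "(nat + nat) mpoly"
  defines "a \<equiv> var (Inl 0)" and "b \<equiv> var (Inr 0)" and "s \<equiv> cst (complex_of_real (sqrt 2))"
  shows "slice_mat = (\<chi> j i.
    if (j, i) = (1, 2) then 1 else if (j, i) = (6, 7) then - 1 else if (j, i) = (7, 3) then 1 else if (j, i) = (5, 1) then - 1
    else if (j, i) = (2, 4) then - s else if (j, i) = (4, 6) then s else if (j, i) = (2, 1) then a else if (j, i) = (7, 6) then - a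
    else if (j, i) = (3, 1) then b else if (j, i) = (7, 5) then - b else 0)"
proof -
  have c: "crd k (c \<cdot> X) = c * crd k X" for k c X by (rule crd_cscale)
  have "(complex_of_real (sqrt 2)) * 2 / complex_of_real (sqrt 2) = 2" by simp
  have q: "2 / complex_of_real (sqrt 2) = complex_of_real (sqrt 2)"
    using sqrt2_facts by (simp add: field_simps)
  have "\<forall>j i. slice_mat $ j $ i = (
    if (j, i) = (1, 2) then 1 else if (j, i) = (6, 7) then - 1 else if (j, i) = (7, 3) then 1 else if (j, i) = (5, 1) then - 1
    else if (j, i) = (2, 4) then - s else if (j, i) = (4, 6) then s else if (j, i) = (2, 1) then a else if (j, i) = (7, 6) then - a
    else if (j, i) = (3, 1) then b else if (j, i) = (7, 5) then - b else 0)"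
    unfolding all_7
    by (intro conjI; simp add: slice_mat_def G_table base_val_def crd_cscale crd_cmb gam_def a_def b_def s_def cst_simps q del: crd.simps bas.simps cmb.simps)
  then show ?thesis by (simp add: vec_eq_iff)
qed

lemma slice_S2: "peval slice_val lead_S2 = 4 * var (Inl 0)"
proof -
  have "cst (complex_of_real (sqrt 2)) * cst (complex_of_real (sqrt 2)) = (2 :: (nat + nat) mpoly)"
    using cst_of_nat [of 2] by (simp add: sqrt2_facts flip: cst_simps)
  moreover have "peval slice_val lead_S2 = trace (slice_mat ** slice_mat)"
    by (simp add: lead_S2_def peval_trace peval_mat_mult peval_mat_1 slice_lead_mat matrix_mul_rid)
  ultimately show ?thesis
    by (simp add: trace_def matrix_matrix_mult_def sum_7 slice_mat_entries algebra_simps)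
qed

text \<open>The decisive feature is that \<open>b\<close> occurs linearly with a nonzero constant,
  so that it can be recovered from this value and the one of \<open>S2\<close>.\<close>

lemma slice_S6: "peval slice_val lead_S6 = 24 * var (Inr 0) + 4 * var (Inl 0) ^ 3"
proof -
  define a b :: "(nat + nat) mpoly" where "a = var (Inl 0)" and "b = var (Inr 0)"
  define s :: "(nat + nat) mpoly" where "s = cst (complex_of_real (sqrt 2))"
  have ss: "s * s = 2"
    using cst_of_nat [of 2] by (simp add: s_def sqrt2_facts flip: cst_simps)
  then have ss': "s * (s * x) = 2 * x" for x by (simp flip: mult.assoc)
  define M2 where "M2 = slice_mat ** slice_mat"
  define M3 where "M3 = slice_mat ** M2"
  have p: "(X ** Y) $ i $ j = X $ i $ 1 * Y $ 1 $ j + X $ i $ 2 * Y $ 2 $ j + X $ i $ 3 * Y $ 3 $ j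
      + X $ i $ 4 * Y $ 4 $ j + X $ i $ 5 * Y $ 5 $ j + X $ i $ 6 * Y $ 6 $ j + X $ i $ 7 * Y $ 7 $ j"
    for X Y :: "(nat + nat) mpoly^7^7" and i j
    by (simp add: matrix_matrix_mult_def sum_7)
  have "peval slice_val lead_S6 = trace (M3 ** M3)"
    by (simp add: lead_S6_def peval_trace peval_mat_mult peval_mat_1 slice_lead_mat matrix_mul_rid M3_def M2_def matrix_mul_assoc)
  also have "\<dots> = 24 * b + 4 * a ^ 3"
    by (simp add: trace_def sum_7 p M3_def M2_def slice_mat_entries [folded a_def b_def s_def] ss ss' algebra_simps power3_eq_cube)
  finally show ?thesis by (simp add: a_def b_def)
qed

section \<open>The invariants\<close>

definition fam :: "nat + nat \<Rightarrow> nat mpoly"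
  where "fam = case_sum (\<lambda>k. (delta ^^ k) lead_S2) (\<lambda>k. (delta ^^ k) lead_S6)"

definition weight :: "nat + nat \<Rightarrow> nat" where "weight = case_sum (\<lambda>_. 2) (\<lambda>_. 6)"

lemma ddt_Inl: "ddt (var (Inl k)) = cst (of_nat (k + 1)) * var (Inl (k + 1))"
  and ddt_Inr: "ddt (var (Inr k)) = cst (of_nat (k + 1)) * var (Inr (k + 1))"
  by (simp_all add: ddt_def der_var)

lemma linop_ddt: "linop ddt" by (simp add: ddt_def linop_der)

lemma ddt_funpow_add: "(ddt ^^ n) (p + q) = (ddt ^^ n) p + (ddt ^^ n) q"
  and ddt_funpow_cst: "(ddt ^^ n) (cst c * p) = cst c * (ddt ^^ n) p"
  by (induction n; simp add: linopD [OF linop_ddt])+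

lemma ddt_funpow_Inl: "(ddt ^^ n) (var (Inl 0)) = cst (fact n) * var (Inl n)"
  by (induction n) (simp_all add: cst_simps(2) linopD [OF linop_ddt] ddt_Inl cst_simps(4) [symmetric] algebra_simps flip: mult.assoc cst_simps(3))

lemma ddt_funpow_Inr: "(ddt ^^ n) (var (Inr 0)) = cst (fact n) * var (Inr n)"
  by (induction n) (simp_all add: cst_simps(2) linopD [OF linop_ddt] ddt_Inr cst_simps(4) [symmetric] algebra_simps flip: mult.assoc cst_simps(3))

lemma cst_numeral: "cst (numeral n) = numeral n"
  using cst_of_nat [of "numeral n"] by simp

definition slice_fam :: "nat + nat \<Rightarrow> (nat + nat) mpoly" where "slice_fam v = peval slice_val (fam v)"

definition cubic :: "nat \<Rightarrow> (nat + nat) mpoly" where "cubic n = (ddt ^^ n) (4 * var (Inl 0) ^ 3)"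

lemma slice_fam_Inl: "slice_fam (Inl n) = cst (4 * fact n) * var (Inl n)"
proof -
  have "peval slice_val lead_S2 = cst 4 * var (Inl 0)" by (simp add: slice_S2 cst_numeral)
  then show ?thesis
    by (simp add: slice_fam_def fam_def slice_delta_funpow ddt_funpow_cst ddt_funpow_Inl cst_simps)
qed

lemma slice_fam_Inr: "slice_fam (Inr n) = cst (24 * fact n) * var (Inr n) + cubic n"
proof -
  have "peval slice_val lead_S6 = cst 24 * var (Inr 0) + 4 * var (Inl 0) ^ 3"
    by (simp add: slice_S6 cst_numeral)
  then show ?thesis
    by (simp add: slice_fam_def fam_def slice_delta_funpow ddt_funpow_cst ddt_funpow_add ddt_funpow_Inr cst_simps cubic_def)
qed

definition only_Inl :: "nat + nat \<Rightarrow> (nat + nat) mpoly" where "only_Inl = case_sum (\<lambda>k. var (Inl k)) (\<lambda>_. 0)"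

text \<open>Expresses that \<open>cubic n\<close> contains no variable \<open>Inr k\<close>; being
  invariant under this substitution is the form that composes with others.\<close>

lemma only_Inl_cubic: "peval only_Inl (cubic n) = cubic n"
proof -
  have d: "peval only_Inl (ddt p) = ddt (peval only_Inl p)" for p
    unfolding ddt_def
    by (rule der_peval [symmetric])
      (auto simp: only_Inl_def der_var peval_simps peval_var der_simps split: sum.split)
  have "peval only_Inl ((ddt ^^ n) p) = (ddt ^^ n) (peval only_Inl p)" for p
    by (induction n) (simp_all add: d)
  moreover have "peval only_Inl (4 * var (Inl 0) ^ 3) = 4 * var (Inl 0) ^ 3"
    by (simp add: peval_mult peval_power peval_var only_Inl_def peval_cst flip: cst_numeral)
  ultimately show ?thesis
    by (simp add: cubic_def)
qed

text \<open>Because \<open>cubic n\<close> lives in the variables \<open>Inl k\<close>, it suffices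
  that the two substitutions cancel there.\<close>

lemma cubic_hom:
  assumes "\<And>k. peval f (g (Inl k)) = var (Inl k)" "\<And>k. g (Inr k) = 0"
  shows "peval f (peval g (cubic n)) = cubic n"
proof -
  have "peval f (peval g (cubic n)) = peval (\<lambda>v. peval f (peval g (only_Inl v))) (cubic n)"
    by (subst only_Inl_cubic [symmetric]) (simp add: peval_peval)
  also have "\<dots> = peval only_Inl (cubic n)"
    by (rule peval_cong) (auto simp: only_Inl_def peval_var peval_simps assms split: sum.split)
  finally show ?thesis by (simp add: only_Inl_cubic)
qed

definition unslice0 :: "nat + nat \<Rightarrow> (nat + nat) mpoly"
  where "unslice0 = case_sum (\<lambda>k. cst (1 / (4 * fact k)) * var (Inl k)) (\<lambda>_. 0)"

text \<open>The inverse of the triangular substitution \<open>slice_fam\<close>: the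
  \<open>Inl k\<close> are rescaled first and determine the cubic term, which is then subtracted to
  isolate \<open>Inr k\<close>.\<close>

definition unslice :: "nat + nat \<Rightarrow> (nat + nat) mpoly"
  where "unslice = case_sum (\<lambda>k. cst (1 / (4 * fact k)) * var (Inl k))
    (\<lambda>k. cst (1 / (24 * fact k)) * (var (Inr k) - peval unslice0 (cubic k)))"

lemma cst_cancel: "c \<noteq> 0 \<Longrightarrow> cst (1 / c) * (cst c * p) = p" "c \<noteq> 0 \<Longrightarrow> cst c * (cst (1 / c) * p) = p"
  by (simp_all add: cst_simps(2) flip: mult.assoc cst_simps(4))

lemma slice_fam_unslice: "peval slice_fam (unslice v) = var v"
proof (cases v)
  case (Inl k)
  have "(4 :: complex) * fact k \<noteq> 0" by simp
  then show ?thesis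
    by (simp add: Inl unslice_def peval_simps peval_var slice_fam_Inl cst_cancel del: mult_eq_0_iff)
next
  case (Inr k)
  have c: "(24 :: complex) * fact k \<noteq> 0" "(4 :: complex) * fact n \<noteq> 0" for n by simp_all
  have "peval slice_fam (peval unslice0 (cubic k)) = cubic k"
    by (rule cubic_hom)
      (simp_all add: unslice0_def peval_simps peval_var slice_fam_Inl cst_cancel c del: mult_eq_0_iff)
  then show ?thesis
    by (simp add: Inr unslice_def peval_simps peval_var slice_fam_Inr cst_cancel c del: mult_eq_0_iff)
qed

lemma unslice_slice_fam: "peval unslice (slice_fam v) = var v"
proof (cases v)
  case (Inl k)
  have "(4 :: complex) * fact k \<noteq> 0" by simp
  then show ?thesis
    by (simp add: Inl unslice_def peval_simps peval_var slice_fam_Inl cst_cancel del: mult_eq_0_iff)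
next
  case (Inr k)
  have c: "(24 :: complex) * fact k \<noteq> 0" by simp
  have "peval unslice (cubic k) = peval unslice (peval only_Inl (cubic k))" by (simp add: only_Inl_cubic)
  also have "\<dots> = peval unslice0 (cubic k)"
    unfolding peval_peval
    by (rule peval_cong) (auto simp: only_Inl_def peval_var peval_simps unslice_def unslice0_def split: sum.split)
  finally show ?thesis
    by (simp add: Inr peval_simps peval_var slice_fam_Inr cst_cancel(2) c unslice_def del: mult_eq_0_iff)
qed

lemma slice_peval_fam: "peval slice_val (peval fam F) = peval slice_fam F"
  unfolding peval_peval by (simp add: slice_fam_def [abs_def])

lemma fam_independent: "peval fam F = 0 \<Longrightarrow> F = 0"
proof -
  assume "peval fam F = 0"
  then have "peval unslice (peval slice_fam F) = 0"
    unfolding slice_peval_fam [symmetric] by (simp add: peval_simps)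
  then show "F = 0" unfolding peval_peval unslice_slice_fam by (simp add: peval_id)
qed

lemma invariant_center:
  assumes "u \<in> feigin_frenkel_center" "symb d u q"
  shows "invariant q"
proof -
  have "loop X (int r) \<in> loops_nonneg" for X r
    by (auto simp: loops_nonneg_def loop_def split: if_splits)
  from symb_center [OF assms this] show ?thesis
    by (simp add: invariant_def loop_field_def [abs_def])
qed

lemma invariant_peval:
  assumes "\<And>v. invariant (f v)"
  shows "invariant (peval f F)"
  unfolding invariant_def
proof (intro allI)
  fix X r
  have "der (loop_field X r) (peval f F) = peval f (der (\<lambda>_. 0) F)"
    by (rule der_peval) (use assms in \<open>simp add: invariant_def peval_simps\<close>)
  moreover have "der (\<lambda>_. 0) F = (0 :: 'a mpoly)"
    by (rule linop_eqI [of "der (\<lambda>_. 0)" "\<lambda>_. 0"]) (simp_all add: linop_der, simp_all add: linop_def der_def)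
  ultimately show "der (loop_field X r) (peval f F) = 0" by (simp add: peval_simps)
qed

section \<open>Closure properties of the center\<close>

lemma ff_center_lin:
  assumes "u \<in> feigin_frenkel_center"
  shows "v \<in> feigin_frenkel_center \<Longrightarrow> u + v \<in> feigin_frenkel_center"
    and "uscalar c * u \<in> feigin_frenkel_center"
    and "v \<in> feigin_frenkel_center \<Longrightarrow> u - v \<in> feigin_frenkel_center"
proof -
  have s: "uscalar c * u \<in> feigin_frenkel_center" if "u \<in> feigin_frenkel_center" for c u
    using that
    by (auto simp: ff_center_iff intro: generated_subalgebra.intros)
      (metis mult.assoc uscalar_commute vacuum_ideal.mult_left)
  then show "uscalar c * u \<in> feigin_frenkel_center" using assms by blast
  have a: "u + v \<in> feigin_frenkel_center" if "u \<in> feigin_frenkel_center" "v \<in> feigin_frenkel_center" for u v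
    using that by (auto simp: ff_center_iff distrib_left intro: generated_subalgebra.intros vacuum_ideal.intros)
  then show "v \<in> feigin_frenkel_center \<Longrightarrow> u + v \<in> feigin_frenkel_center" using assms by blast
  show "v \<in> feigin_frenkel_center \<Longrightarrow> u - v \<in> feigin_frenkel_center"
    using a [OF assms s [of v "- 1"]] by (simp add: uscalar_simps)
qed

lemma central_commutes: "uembed central * u = u * uembed central"
proof (induction u rule: uenv_induct)
  case (mult x u)
  have "uembed central * uembed x = uembed x * uembed central"
    using uembed_bracket [of central x] by (simp add: bracket_central uembed_0)
  then show ?case using mult by (metis mult.assoc)
qed (simp_all add: uscalar_commute distrib_left distrib_right)

text \<open>Right multiplication by an element of the center is an endomorphism of the vacuum
  module: the generators of the left ideal stay in it. Closure under products follows.\<close>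

lemma vacuum_ideal_mult_center:
  assumes "v \<in> feigin_frenkel_center"
  shows "w \<in> vacuum_ideal \<Longrightarrow> w * v \<in> vacuum_ideal"
proof (induction rule: vacuum_ideal.induct)
  case level
  have "12 * v = v * 12" using uscalar_commute [of 12 v] by (simp add: uscalar_numeral)
  then have "(uembed central + 12) * v = v * (uembed central + 12)"
    by (simp add: central_commutes distrib_left distrib_right)
  then show ?case by (simp add: vacuum_ideal.intros)
qed (use assms in \<open>auto simp: ff_center_iff distrib_right mult.assoc intro: vacuum_ideal.intros\<close>)

lemma ff_center_mult:
  "u \<in> feigin_frenkel_center \<Longrightarrow> v \<in> feigin_frenkel_center \<Longrightarrow> u * v \<in> feigin_frenkel_center"
  using vacuum_ideal_mult_center [of v]
  by (auto simp: ff_center_iff intro: generated_subalgebra.intros simp flip: mult.assoc)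

lemma ff_center_uscalar: "uscalar c \<in> feigin_frenkel_center"
  by (auto simp: ff_center_iff uscalar_commute [symmetric] intro: generated_subalgebra.intros vacuum_ideal.intros)

lemma affine_D_nonneg: "x \<in> loops_nonneg \<Longrightarrow> affine_D x \<in> loops_nonneg"
proof -
  assume x: "x \<in> loops_nonneg"
  have "0 \<le> r" if "r \<in> Poly_Mapping.keys (loop_D (loop_part x))" for r
  proof -
    have "r \<in> (\<Union>s\<in>Poly_Mapping.keys (loop_part x).
      Poly_Mapping.keys (Poly_Mapping.single (s - 1) ((- of_int s) \<cdot> Poly_Mapping.lookup (loop_part x) s)))"
      using that unfolding loop_D_def by (rule subsetD [OF Poly_Mapping.keys_sum])
    then obtain s where s: "s \<in> Poly_Mapping.keys (loop_part x)"
      "r \<in> Poly_Mapping.keys (Poly_Mapping.single (s - 1) ((- of_int s) \<cdot> Poly_Mapping.lookup (loop_part x) s))"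
      by blast
    then have "r = s - 1" "s \<noteq> 0" by (auto split: if_splits)
    moreover have "0 \<le> s" using s(1) x by (auto simp: loops_nonneg_def)
    ultimately show ?thesis by simp
  qed
  then show ?thesis by (auto simp: loops_nonneg_def affine_D_def)
qed

text \<open>-d/dt maps g[t] to itself and kills K, so it preserves the generators of the left
  ideal.\<close>

lemma uenv_D_vacuum_ideal: "u \<in> vacuum_ideal \<Longrightarrow> uenv_D u \<in> vacuum_ideal"
proof (induction rule: vacuum_ideal.induct)
  case level
  have "affine_D central = 0" by (simp add: affine_D_def central_def loop_D_def zero_affine_def)
  moreover have "uenv_D 12 = 0" using uenv_D_uscalar [of 12] by (simp add: uscalar_numeral)
  ultimately show ?case by (simp add: uenv_D_add uenv_D_uembed uembed_0 vacuum_ideal.zero)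
next
  case (annihilate x)
  then show ?case by (simp add: uenv_D_uembed affine_D_nonneg vacuum_ideal.annihilate)
next
  case zero
  then show ?case using uenv_D_uscalar [of 0] by (simp add: uscalar_simps vacuum_ideal.zero)
qed (auto simp: uenv_D_add uenv_D_mult intro: vacuum_ideal.intros)

lemma ff_center_D: "u \<in> feigin_frenkel_center \<Longrightarrow> uenv_D u \<in> feigin_frenkel_center"
proof -
  assume u: "u \<in> feigin_frenkel_center"
  have "uembed x * uenv_D u \<in> vacuum_ideal" if x: "x \<in> loops_nonneg" for x
  proof -
    have "uenv_D (uembed x * u) - uembed (affine_D x) * u \<in> vacuum_ideal"
      using u x affine_D_nonneg [OF x] by (intro vacuum_ideal_diff uenv_D_vacuum_ideal) (auto simp: ff_center_iff)
    then show ?thesis by (simp add: uenv_D_mult uenv_D_uembed)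
  qed
  then show ?thesis using u by (simp add: ff_center_iff uenv_D_generated)
qed

section \<open>The antipode\<close>

text \<open>Right multiplication by \<open>- uembed x\<close> is a representation, and its action on
  1 is the antipode. Well-definedness on the quotient is thus inherited from
  \<open>lie_rep\<close>.\<close>

interpretation antipode: lie_rep "\<lambda>c u. uscalar c * u" "\<lambda>x u. - (u * uembed x)"
proof
  fix x y :: "'a" and u v :: "'a uenv" and c d
  show "uscalar (c * d) * u = uscalar c * (uscalar d * u)" by (simp add: uscalar_simps mult.assoc)
  show "- (u * uembed (c \<cdot> x)) = uscalar c * - (u * uembed x)"
    by (simp add: uembed_cscale) (metis mult.assoc uscalar_commute)
qed (simp_all add: uscalar_simps distrib_left distrib_right mult.assoc uembed_add uembed_bracket algebra_simps)

definition antip :: "'a::complex_lie_algebra uenv \<Rightarrow> 'a uenv" where "antip u = antipode.uact u 1"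

lemma antip_add: "antip (u + v) = antip u + antip v"
  and antip_diff: "antip (u - v) = antip u - antip v"
  by (simp_all add: antip_def antipode.uact_add antipode.uact_diff)

lemma antip_scalar: "antip (uscalar c) = uscalar c"
  by (simp add: antip_def antipode.uact_scalar)

lemma antip_1: "antip 1 = 1"
  using antip_scalar [of 1] by (simp add: uscalar_simps)

lemma antip_embed: "antip (uembed x) = - uembed x"
  by (simp add: antip_def antipode.uact_embed)

lemma antipode_uact: "antipode.uact u v = v * antip u"
proof (induction u arbitrary: v rule: uenv_induct)
  case (scalar c)
  then show ?case by (simp add: antipode.uact_scalar antip_scalar) (rule uscalar_commute)
next
  case (mult x u)
  show ?case
    by (simp add: antip_def antipode.uact_mult antipode.uact_embed)
      (simp add: mult [of v] mult [of 1] mult.assoc flip: antip_def)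
next
  case (add u w)
  then show ?case by (simp add: antipode.uact_add antip_add distrib_left)
qed

lemma antip_mult: "antip (u * v) = antip v * antip u"
  by (simp add: antip_def antipode.uact_mult) (simp add: antipode_uact antip_def [symmetric])

lemma antip_D: "antip (uenv_D u) = uenv_D (antip u)"
proof (induction u rule: uenv_induct)
  case (scalar c)
  then show ?case using antip_scalar [of 0] by (simp add: uenv_D_uscalar antip_scalar uscalar_simps)
next
  case (mult x u)
  have neg: "uenv_D (- v) = - uenv_D v" for v
    using uenv_D_add [of v "- v"] uenv_D_uscalar [of 0] by (simp add: uscalar_simps eq_neg_iff_add_eq_0 add.commute)
  show ?case
    by (simp add: uenv_D_mult uenv_D_uembed antip_add antip_mult antip_embed mult neg)
qed (simp_all add: uenv_D_add antip_add)

text \<open>Each letter contributes a sign, and the reversed order is invisible in the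
  symbol.\<close>

lemma symb_antip: "symb d u q \<Longrightarrow> symb d (antip u) (cst ((- 1) ^ d) * q)"
proof -
  assume u: "symb d u q"
  define T' :: "nat mpoly \<Rightarrow> nat mpoly" where "T' = lin (\<lambda>M. cst ((- 1) ^ size M) * mon M)"
  have T'_mon: "T' (mon M) = cst ((- 1) ^ size M) * mon M" for M by (simp add: T'_def)
  have "symb d (antip u) (T' q)"
  proof (rule symb_linear [OF u, where T = antip])
    show "antip (uscalar c * v) = uscalar c * antip v" for c :: complex and v :: "affine uenv"
      by (simp add: antip_mult antip_scalar uscalar_commute)
    show "symb (size M) (antip (V.ordered M)) (T' (mon M))" for M
    proof (induction "size M" arbitrary: M rule: less_induct)
      case less
      show ?case
      proof (cases "M = {#}")
        case True
        then show ?thesis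
          unfolding T'_mon by (simp add: antip_1 V.ordered_def mon_0 cst_simps symb_1)
      next
        case False
        obtain k N where M: "M = add_mset k N" and kN: "\<And>l. l \<in># N \<Longrightarrow> k \<le> l"
          using V.ex_add_Min [OF False] by blast
        have "symb (size N) (antip (V.ordered N)) (T' (mon N))" by (rule less) (simp add: M)
        from symb_mult [OF this symb_uminus [OF symb_embed [OF ea_neg [of k]]]]
        show ?thesis
          unfolding T'_mon
          by (simp add: M V.ordered_add_mset [OF kN] antip_mult antip_embed V.lead_e mon_add_mset [of k N] cst_simps algebra_simps)
      qed
    qed
  qed (simp_all add: antip_add T'_def linop_lin)
  moreover have "T' q = cst ((- 1) ^ d) * q"
    by (rule linop_eqI [OF _ linop_mult]) (use u in \<open>simp_all add: T'_def linop_lin symb_def homog_def\<close>)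
  ultimately show ?thesis by simp
qed

section \<open>Verified normal ordering\<close>

datatype cmp = LT | EQ | GT

primrec idx_cmp :: "idx \<Rightarrow> idx \<Rightarrow> cmp" where
  "idx_cmp H1 j = (case j of H1 \<Rightarrow> EQ | _ \<Rightarrow> LT)"
| "idx_cmp H2 j = (case j of H1 \<Rightarrow> GT | H2 \<Rightarrow> EQ | _ \<Rightarrow> LT)"
| "idx_cmp E12 j = (case j of H1 \<Rightarrow> GT | H2 \<Rightarrow> GT | E12 \<Rightarrow> EQ | _ \<Rightarrow> LT)"
| "idx_cmp E13 j = (case j of H1 \<Rightarrow> GT | H2 \<Rightarrow> GT | E12 \<Rightarrow> GT | E13 \<Rightarrow> EQ | _ \<Rightarrow> LT)"
| "idx_cmp E21 j = (case j of H1 \<Rightarrow> GT | H2 \<Rightarrow> GT | E12 \<Rightarrow> GT | E13 \<Rightarrow> GT | E21 \<Rightarrow> EQ | _ \<Rightarrow> LT)"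
| "idx_cmp E23 j = (case j of H1 \<Rightarrow> GT | H2 \<Rightarrow> GT | E12 \<Rightarrow> GT | E13 \<Rightarrow> GT | E21 \<Rightarrow> GT | E23 \<Rightarrow> EQ | _ \<Rightarrow> LT)"
| "idx_cmp E31 j = (case j of H1 \<Rightarrow> GT | H2 \<Rightarrow> GT | E12 \<Rightarrow> GT | E13 \<Rightarrow> GT | E21 \<Rightarrow> GT | E23 \<Rightarrow> GT | E31 \<Rightarrow> EQ | _ \<Rightarrow> LT)"
| "idx_cmp E32 j = (case j of E32 \<Rightarrow> EQ | P1 \<Rightarrow> LT | P2 \<Rightarrow> LT | P3 \<Rightarrow> LT | Q1 \<Rightarrow> LT | Q2 \<Rightarrow> LT | Q3 \<Rightarrow> LT | _ \<Rightarrow> GT)"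
| "idx_cmp P1 j = (case j of P1 \<Rightarrow> EQ | P2 \<Rightarrow> LT | P3 \<Rightarrow> LT | Q1 \<Rightarrow> LT | Q2 \<Rightarrow> LT | Q3 \<Rightarrow> LT | _ \<Rightarrow> GT)"
| "idx_cmp P2 j = (case j of P2 \<Rightarrow> EQ | P3 \<Rightarrow> LT | Q1 \<Rightarrow> LT | Q2 \<Rightarrow> LT | Q3 \<Rightarrow> LT | _ \<Rightarrow> GT)"
| "idx_cmp P3 j = (case j of P3 \<Rightarrow> EQ | Q1 \<Rightarrow> LT | Q2 \<Rightarrow> LT | Q3 \<Rightarrow> LT | _ \<Rightarrow> GT)"
| "idx_cmp Q1 j = (case j of Q1 \<Rightarrow> EQ | Q2 \<Rightarrow> LT | Q3 \<Rightarrow> LT | _ \<Rightarrow> GT)"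
| "idx_cmp Q2 j = (case j of Q2 \<Rightarrow> EQ | Q3 \<Rightarrow> LT | _ \<Rightarrow> GT)"
| "idx_cmp Q3 j = (case j of Q3 \<Rightarrow> EQ | _ \<Rightarrow> GT)"

primrec nat_cmp :: "nat \<Rightarrow> nat \<Rightarrow> cmp" where
  "nat_cmp 0 s = (case s of 0 \<Rightarrow> EQ | Suc _ \<Rightarrow> LT)"
| "nat_cmp (Suc r) s = (case s of 0 \<Rightarrow> GT | Suc s' \<Rightarrow> nat_cmp r s')"

datatype letter = Ltr nat idx

fun letter_cmp :: "letter \<Rightarrow> letter \<Rightarrow> cmp" where
  "letter_cmp (Ltr r i) (Ltr s j) = (case nat_cmp r s of LT \<Rightarrow> LT | GT \<Rightarrow> GT | EQ \<Rightarrow> idx_cmp i j)"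

text \<open>\<open>Node c ks\<close> stands for the sum of \<open>c\<close> and all products \<open>x * t\<close> over the branches \<open>(x, t)\<close> of \<open>ks\<close>: a sum of ordered
  words that share their prefixes. Zero summands are removed, so zero is \<open>Node 0 Leaf\<close>.\<close>

datatype trie = Node int branches and branches = Leaf | Branch letter trie branches

function tadd :: "trie \<Rightarrow> trie \<Rightarrow> trie" and badd :: "branches \<Rightarrow> branches \<Rightarrow> branches" where
  "tadd (Node c ks) (Node d ls) = Node (c + d) (badd ks ls)"
| "badd Leaf ls = ls"
| "badd (Branch x s ks) Leaf = Branch x s ks"
| "badd (Branch x s ks) (Branch y t ls) = (case letter_cmp x y of
      LT \<Rightarrow> Branch x s (badd ks (Branch y t ls))
    | GT \<Rightarrow> Branch y t (badd (Branch x s ks) ls)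
    | EQ \<Rightarrow> let u = tadd s t in
        if u = Node 0 Leaf then badd ks ls else Branch x u (badd ks ls))"
  by pat_completeness auto
termination
  by (relation "Wellfounded.measure (\<lambda>p. case p of Inl (s, t) \<Rightarrow> size s + size t | Inr (ks, ls) \<Rightarrow> size ks + size ls)") auto

primrec tscale :: "int \<Rightarrow> trie \<Rightarrow> trie" and bscale :: "int \<Rightarrow> branches \<Rightarrow> branches" where
  "tscale c (Node d ks) = Node (c * d) (bscale c ks)"
| "bscale c Leaf = Leaf"
| "bscale c (Branch x t ks) = Branch x (tscale c t) (bscale c ks)"

definition tcons :: "letter \<Rightarrow> trie \<Rightarrow> trie"
  where "tcons x t = Node 0 (if t = Node 0 Leaf then Leaf else Branch x t Leaf)"

text \<open>Left multiplication by a letter: \<open>y\<close> passes each smaller first letter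
  \<open>x\<close> at the cost of [y, x] and is put in front of the rest. \<open>Ltr r i\<close> has
  mode -r-1, so the bracket of indices \<open>r\<close> and \<open>s\<close> has index r + s +
  1.\<close>

function tmul :: "letter \<Rightarrow> trie \<Rightarrow> trie" and bmul :: "letter \<Rightarrow> int \<Rightarrow> branches \<Rightarrow> trie"
  and cmul :: "nat \<Rightarrow> (idx \<times> int) list \<Rightarrow> trie \<Rightarrow> trie" where
  "tmul y (Node d ks) = bmul y d ks"
| "bmul y d Leaf = tcons y (Node d Leaf)"
| "bmul y d (Branch x t ks) = (case (y, x) of (Ltr r i, Ltr s j) \<Rightarrow>
    if letter_cmp x y = LT
    then tadd (tcons x (tmul y t)) (tadd (cmul (Suc (r + s)) (br i j) t) (bmul y d ks))
    else tcons y (Node d (Branch x t ks)))"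
| "cmul r [] t = Node 0 Leaf"
| "cmul r ((i, c) # es) t = tadd (tscale c (tmul (Ltr r i) t)) (cmul r es t)"
  by pat_completeness auto
termination
  \<comment> \<open>\<open>cmul\<close> passes its trie unchanged to \<open>tmul\<close>, so the
    second component has to decrease at that call.\<close>
  by (relation "measures [\<lambda>p. case p of Inl (y, t) \<Rightarrow> size t | Inr (Inl (y, d, ks)) \<Rightarrow> size ks | Inr (Inr (r, es, t)) \<Rightarrow> size t,
      \<lambda>p. case p of Inl _ \<Rightarrow> 0 | Inr (Inl _) \<Rightarrow> 0 | Inr (Inr (r, es, t)) \<Rightarrow> Suc (length es)]") auto

definition branch_aux :: "cmp \<Rightarrow> letter \<Rightarrow> trie \<Rightarrow> branches \<Rightarrow> letter \<Rightarrow> trie \<Rightarrow> branches \<Rightarrow> branches"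
  where "branch_aux c x s ks y t ls = (case c of
      LT \<Rightarrow> Branch x s (badd ks (Branch y t ls))
    | GT \<Rightarrow> Branch y t (badd (Branch x s ks) ls)
    | EQ \<Rightarrow> let u = tadd s t in
        if u = Node 0 Leaf then badd ks ls else Branch x u (badd ks ls))"

definition bcons :: "letter \<Rightarrow> trie \<Rightarrow> branches \<Rightarrow> branches"
  where "bcons x u ks = (if u = Node 0 Leaf then ks else Branch x u ks)"

definition mul_aux :: "cmp \<Rightarrow> letter \<Rightarrow> int \<Rightarrow> letter \<Rightarrow> trie \<Rightarrow> branches \<Rightarrow> trie"
  where "mul_aux c y d x t ks = (case (y, x) of (Ltr r i, Ltr s j) \<Rightarrow>
    if c = LT
    then tadd (tcons x (tmul y t)) (tadd (cmul (Suc (r + s)) (br i j) t) (bmul y d ks))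
    else tcons y (Node d (Branch x t ks)))"

text \<open>The program is run by the simplifier. Its equations are restated without conditions and without
  \<open>if\<close>, \<open>case\<close>, \<open>let\<close> around large data, because then the simplifier does not traverse evaluated arguments again.\<close>

lemma prog_cmp:
  "nat_cmp 0 0 = EQ" "nat_cmp 0 (Suc s) = LT" "nat_cmp (Suc r) 0 = GT" "nat_cmp (Suc r) (Suc s) = nat_cmp r s"
  by simp_all

definition lcmp_aux :: "cmp \<Rightarrow> idx \<Rightarrow> idx \<Rightarrow> cmp"
  where "lcmp_aux c i j = (case c of LT \<Rightarrow> LT | GT \<Rightarrow> GT | EQ \<Rightarrow> idx_cmp i j)"

lemma prog_letter_cmp:
  "letter_cmp (Ltr r i) (Ltr s j) = lcmp_aux (nat_cmp r s) i j"
  "lcmp_aux LT i j = LT" "lcmp_aux GT i j = GT" "lcmp_aux EQ i j = idx_cmp i j"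
  by (simp_all add: lcmp_aux_def)

lemma prog_tadd:
  "tadd (Node c ks) (Node d ls) = Node (c + d) (badd ks ls)"
  "badd Leaf ls = ls"
  "badd (Branch x s ks) Leaf = Branch x s ks"
  "badd (Branch x s ks) (Branch y t ls) = branch_aux (letter_cmp x y) x s ks y t ls"
  "branch_aux LT x s ks y t ls = Branch x s (badd ks (Branch y t ls))"
  "branch_aux GT x s ks y t ls = Branch y t (badd (Branch x s ks) ls)"
  "branch_aux EQ x s ks y t ls = bcons x (tadd s t) (badd ks ls)"
  by (simp_all add: branch_aux_def bcons_def Let_def)

lemma prog_bcons:
  "bcons x (Node 0 Leaf) ks = ks"
  "bcons x (Node 0 (Branch y t ls)) ks = Branch x (Node 0 (Branch y t ls)) ks"
  "bcons x (Node (Int.Pos n) ls) ks = Branch x (Node (Int.Pos n) ls) ks"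
  "bcons x (Node (Int.Neg n) ls) ks = Branch x (Node (Int.Neg n) ls) ks"
  by (simp_all add: bcons_def)

lemma tscale_1: "tscale 1 t = t" and "bscale 1 ks = ks"
  by (induction t and ks) auto

lemma prog_tscale:
  "tscale (Int.Pos num.One) t = t"
  "tscale (Int.Pos (num.Bit0 n)) (Node d ks) = Node (Int.Pos (num.Bit0 n) * d) (bscale (Int.Pos (num.Bit0 n)) ks)"
  "tscale (Int.Pos (num.Bit1 n)) (Node d ks) = Node (Int.Pos (num.Bit1 n) * d) (bscale (Int.Pos (num.Bit1 n)) ks)"
  "tscale (Int.Neg n) (Node d ks) = Node (Int.Neg n * d) (bscale (Int.Neg n) ks)"
  "bscale c Leaf = Leaf"
  "bscale c (Branch x t ks) = Branch x (tscale c t) (bscale c ks)"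
  by (simp_all add: tscale_1)

lemma prog_tcons:
  "tcons x (Node 0 Leaf) = Node 0 Leaf"
  "tcons x (Node 0 (Branch y t ls)) = Node 0 (Branch x (Node 0 (Branch y t ls)) Leaf)"
  "tcons x (Node (Int.Pos n) ls) = Node 0 (Branch x (Node (Int.Pos n) ls) Leaf)"
  "tcons x (Node (Int.Neg n) ls) = Node 0 (Branch x (Node (Int.Neg n) ls) Leaf)"
  by (simp_all add: tcons_def)

primrec nat_plus :: "nat \<Rightarrow> nat \<Rightarrow> nat" where
  "nat_plus 0 s = s"
| "nat_plus (Suc r) s = nat_plus r (Suc s)"

lemma nat_plus: "nat_plus r s = r + s"
  by (induction r arbitrary: s) auto

lemma prog_tmul:
  "tmul y (Node d ks) = bmul y d ks"
  "bmul y d Leaf = tcons y (Node d Leaf)"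
  "bmul y d (Branch x t ks) = mul_aux (letter_cmp x y) y d x t ks"
  "mul_aux EQ y d x t ks = Node 0 (Branch y (Node d (Branch x t ks)) Leaf)"
  "mul_aux GT y d x t ks = Node 0 (Branch y (Node d (Branch x t ks)) Leaf)"
  "mul_aux LT (Ltr r i) d (Ltr s j) t ks = tadd (tcons (Ltr s j) (tmul (Ltr r i) t))
     (tadd (cmul (nat_plus r (Suc s)) (br i j) t) (bmul (Ltr r i) d ks))"
  "cmul r [] t = Node 0 Leaf"
  "cmul r [(i, c)] t = tscale c (tmul (Ltr r i) t)"
  "cmul r ((i, c) # e # es) t = tadd (tscale c (tmul (Ltr r i) t)) (cmul r (e # es) t)"
proof -
  have "badd ks Leaf = ks" for ks by (cases ks) simp_all
  then have 1: "tadd t (Node 0 Leaf) = t" for t by (cases t) simp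
  show "tmul y (Node d ks) = bmul y d ks" "bmul y d Leaf = tcons y (Node d Leaf)" "cmul r [] t = Node 0 Leaf"
    "cmul r ((i, c) # e # es) t = tadd (tscale c (tmul (Ltr r i) t)) (cmul r (e # es) t)"
    "bmul y d (Branch x t ks) = mul_aux (letter_cmp x y) y d x t ks"
    by (simp_all only: tmul.simps bmul.simps cmul.simps mul_aux_def)
  show "cmul r [(i, c)] t = tscale c (tmul (Ltr r i) t)" by (simp only: cmul.simps 1)
  show "mul_aux EQ y d x t ks = Node 0 (Branch y (Node d (Branch x t ks)) Leaf)"
    "mul_aux GT y d x t ks = Node 0 (Branch y (Node d (Branch x t ks)) Leaf)"
    by (cases x; cases y; simp add: mul_aux_def tcons_def)+
  show "mul_aux LT (Ltr r i) d (Ltr s j) t ks = tadd (tcons (Ltr s j) (tmul (Ltr r i) t))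
     (tadd (cmul (nat_plus r (Suc s)) (br i j) t) (bmul (Ltr r i) d ks))"
    by (simp only: mul_aux_def nat_plus prod.case letter.case simp_thms if_True add_Suc_right)
qed

text \<open>Matrices are stored by columns: \<open>M ! i ! j\<close> is the entry in row \<open>j\<close> and column \<open>i\<close>, counted from zero. The sparse
  matrices \<open>G_rows\<close> and \<open>X_rows\<close> are stored by rows instead. The first contains the \<open>G i j\<close>, conjugated as in \<open>gg\<close> below,
  and the second their brackets with \<open>E12\<close>. The entries \<open>(c, l, m)\<close> of \<open>L_table\<close> are the terms \<open>c A\<^sub>l\<^sub>m\<close> of \<open>lowered (bas E12) 0\<close>.\<close>

definition G_rows :: "(nat \<times> (idx \<times> int) list) list list" where "G_rows =
   [[(0, [(H1, 1)]), (1, [(E21, 1)]), (2, [(E31, 1)]), (3, [(Q1, -1)]), (4, [(P2, -1)]), (5, [(P3, 1)])],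
    [(0, [(E12, 1)]), (1, [(H2, 1)]), (2, [(E32, 1)]), (3, [(Q2, -1)]), (4, [(P1, 1)]), (6, [(P3, -1)])],
    [(0, [(E13, 1)]), (1, [(E23, 1)]), (2, [(H1, -1), (H2, -1)]), (3, [(Q3, -1)]), (5, [(P1, -1)]), (6, [(P2, 1)])],
    [(0, [(P1, -2)]), (1, [(P2, -2)]), (2, [(P3, -2)]), (4, [(Q3, 2)]), (5, [(Q2, 2)]), (6, [(Q1, 2)])],
    [(0, [(Q2, -1)]), (1, [(Q1, 1)]), (3, [(P3, 1)]), (4, [(H1, 1), (H2, 1)]), (5, [(E32, -1)]), (6, [(E31, -1)])],
    [(0, [(Q3, 1)]), (2, [(Q1, -1)]), (3, [(P2, 1)]), (4, [(E23, -1)]), (5, [(H2, -1)]), (6, [(E21, -1)])],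
    [(1, [(Q3, -1)]), (2, [(Q2, 1)]), (3, [(P1, 1)]), (4, [(E13, -1)]), (5, [(E12, -1)]), (6, [(H1, -1)])]]"

definition X_rows :: "(nat \<times> (idx \<times> int) list) list list" where "X_rows =
   [[(0, [(E12, -3)]), (1, [(H1, 3), (H2, -3)]), (2, [(E32, -3)]), (3, [(Q2, 3)]), (4, [(P1, -3)])],
    [(1, [(E12, 3)])],
    [(1, [(E13, 3)]), (6, [(P1, 3)])],
    [(1, [(P1, -6)]), (6, [(Q2, -6)])],
    [(1, [(Q2, -3)]), (6, [(E32, 3)])],
    [(2, [(Q2, 3)]), (3, [(P1, 3)]), (4, [(E13, -3)]), (5, [(E12, -3)]), (6, [(H1, -3), (H2, 3)])],
    [(6, [(E12, 3)])]]"

definition L_table :: "(int \<times> nat \<times> nat) list list list" where "L_table =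
   [[[(9, 1, 0)], [], [], [], [], [(-9, 6, 0)], []],
    [[(-9, 0, 0), (-9, 1, 1), (-9, 2, 2), (-6, 3, 3), (-3, 4, 4)], [(9, 1, 0)], [(3, 6, 4)], [(-6, 1, 4), (12, 6, 3)], [(6, 1, 3), (9, 6, 2)], [(-6, 2, 3), (3, 3, 4), (-9, 5, 0), (9, 6, 1)], [(9, 6, 0)]],
    [[(3, 4, 5)], [], [(9, 1, 0), (-3, 6, 5)], [(6, 1, 5)], [], [(-3, 3, 5), (-9, 4, 0)], []],
    [[(3, 3, 5), (3, 4, 0)], [], [(-3, 6, 0)], [(6, 1, 0), (-6, 6, 5)], [(-3, 1, 5)], [(3, 2, 5), (-3, 3, 0)], []],
    [[(9, 2, 5), (-3, 3, 0)], [], [], [(6, 6, 0)], [(3, 1, 0), (-9, 6, 5)], [(-3, 2, 0)], []],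
    [[(9, 1, 5)], [], [], [], [], [(-9, 6, 5)], []],
    [[(9, 0, 5), (-9, 1, 6), (3, 3, 2), (-6, 4, 3)], [(-9, 1, 5)], [(-9, 1, 4), (6, 6, 3)], [(-12, 1, 3), (-6, 6, 2)], [(-3, 1, 2)], [(3, 2, 2), (6, 3, 3), (9, 4, 4), (9, 5, 5), (9, 6, 6)], [(-9, 6, 5)]]]"

primrec row_sum :: "nat \<Rightarrow> trie list \<Rightarrow> (nat \<times> (idx \<times> int) list) list \<Rightarrow> trie" where
  "row_sum r col [] = Node 0 Leaf"
| "row_sum r col (e # es) = tadd (cmul r (snd e) (col ! fst e)) (row_sum r col es)"

definition rows_mul :: "(nat \<times> (idx \<times> int) list) list list \<Rightarrow> nat \<Rightarrow> trie list list \<Rightarrow> trie list list"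
  where "rows_mul gs r = map (\<lambda>col. map (row_sum r col) gs)"

primrec table_sum :: "trie list list \<Rightarrow> (int \<times> nat \<times> nat) list \<Rightarrow> trie" where
  "table_sum M [] = Node 0 Leaf"
| "table_sum M (e # es) = tadd (tscale (fst e) (M ! snd (snd e) ! fst (snd e))) (table_sum M es)"

definition table_mul :: "trie list list \<Rightarrow> trie list list"
  where "table_mul M = map (map (table_sum M)) L_table"

fun list_add :: "trie list \<Rightarrow> trie list \<Rightarrow> trie list" where
  "list_add (s # ss) (t # ts) = tadd s t # list_add ss ts"
| "list_add _ _ = []"

fun mat_add :: "trie list list \<Rightarrow> trie list list \<Rightarrow> trie list list" where
  "mat_add (s # ss) (t # ts) = list_add s t # mat_add ss ts"
| "mat_add _ _ = []"

fun trace_mul :: "nat \<Rightarrow> (nat \<times> (idx \<times> int) list) list list \<Rightarrow> trie list list \<Rightarrow> trie" where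
  "trace_mul r (g # gs) (col # cols) = tadd (row_sum r col g) (trace_mul r gs cols)"
| "trace_mul r _ _ = Node 0 Leaf"

definition unit_mat :: "trie list list" where "unit_mat = (let e = Node 1 Leaf; z = Node 0 Leaf in
  [[e, z, z, z, z, z, z], [z, e, z, z, z, z, z], [z, z, e, z, z, z, z], [z, z, z, e, z, z, z],
   [z, z, z, z, e, z, z], [z, z, z, z, z, e, z], [z, z, z, z, z, z, e]])"
definition zero_mat :: "trie list list" where "zero_mat = (let z = Node 0 Leaf; r = [z, z, z, z, z, z, z] in [r, r, r, r, r, r, r])"
text \<open>The matrix of a word in the G[r], paired with a matrix that represents E12[1] times that
  word in the vacuum module.\<close>

type_synonym state = "trie list list \<times> trie list list"

fun lower :: "nat \<Rightarrow> trie list list \<Rightarrow> trie list list" where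
  "lower 0 M = table_mul M"
| "lower (Suc r) M = rows_mul X_rows r M"

fun step :: "nat \<Rightarrow> state \<Rightarrow> state" where
  "step r (W, B) = (rows_mul G_rows r W, mat_add (rows_mul G_rows r B) (lower r W))"

text \<open>From the state of \<open>rs\<close> to E12[1] times the trace of
  \<open>Suc r # rs\<close>. Only a trace is formed in the last step, so the full product matrix is
  never computed.\<close>

fun fin :: "nat \<Rightarrow> state \<Rightarrow> trie" where
  "fin r (W, B) = tadd (trace_mul (Suc r) G_rows B) (trace_mul r X_rows W)"

text \<open>On the diagonal, \<open>L_table\<close> adds up to 12 times the trace of the word
  against the matrix of E12, whose nonzero entries are 3 and -3. Hence two entries of the product
  with the last G[-1] suffice.\<close>

definition fin00_table :: "trie list list \<Rightarrow> trie"
  where "fin00_table W = tadd (tscale 36 (row_sum 0 (W ! 0) (G_rows ! 1))) (tscale (-36) (row_sum 0 (W ! 5) (G_rows ! 6)))"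

fun fin00 :: "state \<Rightarrow> trie" where
  "fin00 (W, B) = tadd (trace_mul 0 G_rows (mat_add (rows_mul G_rows 0 B) (table_mul W))) (fin00_table W)"

text \<open>The numbers are the coefficients of \<open>S6\<close>. The chain from
  \<open>chk0\<close> to \<open>chk5\<close> hands the states on as arguments, so that words with a
  common suffix share one computation.\<close>

definition chk4 :: "state \<Rightarrow> state \<Rightarrow> state \<Rightarrow> state \<Rightarrow> trie" where
  "chk4 s0 s1 s2 s3 = tadd (tadd (tscale 14 (fin 1 s3)) (tscale 31 (fin 0 (step 1 s2))))
     (tadd (tscale (-312) (fin 1 (step 1 s1)))
     (tadd (tscale 456 (fin 1 (step 2 s0))) (tscale (-639) (fin 0 (step 1 (step 1 s0))))))"
definition chk5 :: "trie \<Rightarrow> state \<Rightarrow> trie" where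
  "chk5 t s = tadd t (tadd (fin00 s) (tscale 5 (fin 0 s)))"
definition chk3 where "chk3 s0 s1 s2 s3 = chk5 (chk4 s0 s1 s2 s3) (step 0 s3)"
definition chk2 where "chk2 s0 s1 s2 = chk3 s0 s1 s2 (step 0 s2)"
definition chk1 where "chk1 s0 s1 = chk2 s0 s1 (step 0 s1)"
definition chk0 where "chk0 s0 = chk1 s0 (step 0 s0)"

text \<open>The antipode reverses words under the trace. The words of one repeated letter in
  \<open>S6\<close> are unchanged, so four differences remain, distributed over \<open>anti2\<close>
  and \<open>anti3\<close> to share suffixes.\<close>

definition anti3 :: "trie list list \<Rightarrow> trie list list \<Rightarrow> trie"
  where "anti3 w000 w001 = tadd (tscale 14 (trace_mul 2 G_rows w000)) (tscale 5 (tadd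
    (trace_mul 1 G_rows (rows_mul G_rows 0 w000)) (tscale (-1) (trace_mul 0 G_rows (rows_mul G_rows 0 w001)))))"
definition anti2 where "anti2 w00 w10 w01 w11 w02 w12 = tadd (anti3 (rows_mul G_rows 0 w00) (rows_mul G_rows 0 w01))
    (tadd (tscale (-14) (trace_mul 0 G_rows (rows_mul G_rows 0 w02)))
    (tadd (tscale 31 (tadd (trace_mul 1 G_rows (rows_mul G_rows 1 w00)) (tscale (-1) (trace_mul 0 G_rows (rows_mul G_rows 0 w11)))))
      (tscale (-312) (tadd (trace_mul 2 G_rows w10) (tscale (-1) (trace_mul 0 G_rows w12))))))"
definition anti1 where "anti1 w0 w1 w2 = anti2 (rows_mul G_rows 0 w0) (rows_mul G_rows 1 w0) (rows_mul G_rows 0 w1)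
  (rows_mul G_rows 1 w1) (rows_mul G_rows 0 w2) (rows_mul G_rows 1 w2)"
definition anti0 where "anti0 w = anti1 (rows_mul G_rows 0 w) (rows_mul G_rows 1 w) (rows_mul G_rows 2 w)"

text \<open>Coefficients become binary constructor terms and modes unary ones, so that all
  arithmetic is unconditional constructor rewriting.\<close>

lemma int_lits: "(1::int) = Int.Pos num.One" "(numeral n::int) = Int.Pos n" "- Int.Pos n = Int.Neg n"
  by simp_all
lemma nat_lits: "1 = Suc 0" "2 = Suc (Suc 0)" "3 = Suc (Suc (Suc 0))" "4 = Suc (Suc (Suc (Suc 0)))"
  "5 = Suc (Suc (Suc (Suc (Suc 0))))" "6 = Suc (Suc (Suc (Suc (Suc (Suc 0)))))"
  by simp_all
lemmas prog_int = int_lits(1,3) uminus_int_code plus_int_code minus_int_code times_int_code Int.sub_code Int.dup_code add_num_simps mult_num_simps BitM.simps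
lemmas prog_nth = nth_Cons_0 nth_Cons_Suc list.map fst_conv snd_conv

lemmas prog = prog_cmp prog_letter_cmp prog_tadd prog_bcons prog_tscale prog_tcons prog_tmul nat_plus.simps prog_int prog_nth
  row_sum.simps rows_mul_def table_sum.simps table_mul_def L_table_def[unfolded int_lits nat_lits] G_rows_def[unfolded int_lits nat_lits] X_rows_def[unfolded int_lits nat_lits]
  list_add.simps mat_add.simps trace_mul.simps lower.simps step.simps fin.simps fin00.simps fin00_table_def[unfolded int_lits nat_lits]
  chk4_def[unfolded int_lits nat_lits] chk5_def[unfolded int_lits nat_lits] chk3_def chk2_def chk1_def chk0_def anti3_def[unfolded int_lits nat_lits] anti2_def[unfolded int_lits nat_lits] anti1_def[unfolded nat_lits] anti0_def[unfolded nat_lits] unit_mat_def[unfolded Let_def int_lits] zero_mat_def[unfolded Let_def]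
  br.simps[unfolded int_lits nat_lits] idx_cmp.simps idx.case cmp.case

subsection \<open>Soundness\<close>

definition el :: "g2 \<Rightarrow> int \<Rightarrow> affine uenv" where "el X r = uembed (loop X r)"

lemma loop_add: "loop (X + Y) r = loop X r + loop Y r"
  and loop_cscale: "loop (c \<cdot> X) r = c \<cdot> loop X r"
  by (simp_all add: loop_def plus_affine_def cscale_affine_def single_add)

lemma el_add: "el (X + Y) r = el X r + el Y r"
  and el_cscale: "el (c \<cdot> X) r = uscalar c * el X r"
  by (simp_all add: el_def loop_add loop_cscale uembed_add uembed_cscale)
lemma el_0: "el 0 r = 0" using el_add [of 0 0 r] by simp
lemma el_diff: "el (X - Y) r = el X r - el Y r"
  using el_add [of "X - Y" Y r] by simp
lemma el_sum: "el (sum f A) r = (\<Sum>a\<in>A. el (f a) r)"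
  by (induction A rule: infinite_finite_induct) (simp_all add: el_0 el_add)

lemma el_commute: "el X r * el Y s = el Y s * el X r + el (bracket X Y) (r + s)
    + uscalar (of_int r * of_bool (r = - s) * g2_form X Y) * uembed central"
proof -
  have "el X r * el Y s = el Y s * el X r + uembed (bracket (loop X r) (loop Y s))"
    by (simp add: uembed_bracket el_def)
  then show ?thesis by (simp only: bracket_loop uembed_add uembed_cscale el_def add.assoc)
qed

lemma el_uscalar: "el X r * (uscalar c * v) = uscalar c * (el X r * v)"
  by (metis mult.assoc uscalar_commute)

primrec letter_val :: "letter \<Rightarrow> affine uenv" where "letter_val (Ltr r i) = el (bas i) (- int r - 1)"

primrec sem :: "trie \<Rightarrow> affine uenv" and bsem :: "branches \<Rightarrow> affine uenv" where
  "sem (Node c ks) = of_int c + bsem ks"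
| "bsem Leaf = 0"
| "bsem (Branch x t ks) = letter_val x * sem t + bsem ks"

lemma letter_cmp_EQ: "letter_cmp x y = EQ \<Longrightarrow> x = y"
proof -
  have "nat_cmp r s = EQ \<Longrightarrow> r = s" for r s
    by (induction r arbitrary: s) (auto split: nat.splits)
  moreover have "idx_cmp i j = EQ \<Longrightarrow> i = j" for i j by (cases i; cases j) simp_all
  ultimately show "letter_cmp x y = EQ \<Longrightarrow> x = y"
    by (cases x; cases y) (auto split: cmp.splits)
qed

text \<open>Soundness is an identity between sums for arbitrary tries. The order of the branches
  only serves to bring equal words together, so that they cancel.\<close>

lemma sem_tadd: "sem (tadd s t) = sem s + sem t"
  and bsem_badd: "bsem (badd ks ls) = bsem ks + bsem ls"
proof (induction s t and ks ls rule: tadd_badd.induct)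
  case (4 x s ks y t ls)
  show ?case
  proof (cases "letter_cmp x y")
    case EQ
    then have "y = x" using letter_cmp_EQ by blast
    moreover have "sem (Node 0 Leaf) = 0" by simp
    ultimately show ?thesis
      using 4 EQ by (auto simp: Let_def algebra_simps) (metis add.left_commute add.right_neutral distrib_left mult_zero_right)
  qed (use 4 in \<open>simp_all add: algebra_simps\<close>)
qed (simp_all add: algebra_simps)

lemma sem_tscale: "sem (tscale c t) = of_int c * sem t"
  and bsem_bscale: "bsem (bscale c ks) = of_int c * bsem ks"
proof (induction t and ks)
  case (Branch x t ks)
  then show ?case by (simp add: distrib_left) (metis mult.assoc mult_of_int_commute)
qed (simp_all add: distrib_left)

lemma sem_tcons: "sem (tcons x t) = letter_val x * sem t"
  by (simp add: tcons_def)

text \<open>Two negative modes never add up to zero, so no central term appears.\<close>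

lemma letter_val_commute: "letter_val (Ltr r i) * letter_val (Ltr s j) =
    letter_val (Ltr s j) * letter_val (Ltr r i) + el (cmb (br i j)) (- int (Suc (r + s)) - 1)"
proof -
  have z: "- int r - 1 \<noteq> - (- int s - 1)" "- int r - 1 + (- int s - 1) = - int (Suc (r + s)) - 1" by simp_all
  show ?thesis using el_commute [of "bas i" "- int r - 1" "bas j" "- int s - 1", unfolded z(2)] z(1)
    by (simp add: cmb_bracket uscalar_simps)
qed

lemma el_cmb_Cons: "el (cmb ((i, c) # es)) r = of_int c * el (bas i) r + el (cmb es) r"
  by (simp add: el_add el_cscale uscalar_of_int)

lemma sem_tmul: "sem (tmul y t) = letter_val y * sem t"
  and sem_bmul: "sem (bmul y d ks) = letter_val y * (of_int d + bsem ks)"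
  and sem_cmul: "sem (cmul r es t) = el (cmb es) (- int r - 1) * sem t"
proof (induction y t and y d ks and r es t rule: tmul_bmul_cmul.induct)
  case (3 y d x t ks)
  obtain r i s j where y: "y = Ltr r i" and x: "x = Ltr s j" by (metis letter.exhaust)
  have c: "letter_val y * letter_val x = letter_val x * letter_val y + el (cmb (br i j)) (- int (Suc (r + s)) - 1)"
    unfolding x y by (rule letter_val_commute)
  show ?case
  proof (cases "letter_cmp x y = LT")
    case True
    then have "sem (bmul y d (Branch x t ks)) = letter_val x * (letter_val y * sem t)
        + (el (cmb (br i j)) (- int (Suc (r + s)) - 1) * sem t + letter_val y * (of_int d + bsem ks))"
      by (simp add: 3(1) [OF refl y x True, unfolded y] 3(2) [OF refl y x True] 3(3) [OF refl y x True, unfolded y] True [unfolded x y] x y sem_tadd sem_tcons del: letter_val.simps letter_cmp.simps)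
    also have "\<dots> = (letter_val x * letter_val y + el (cmb (br i j)) (- int (Suc (r + s)) - 1)) * sem t
        + letter_val y * (of_int d + bsem ks)"
      by (simp add: distrib_right mult.assoc)
    also have "\<dots> = letter_val y * letter_val x * sem t + letter_val y * (of_int d + bsem ks)"
      by (simp only: c)
    finally show ?thesis by (simp add: distrib_left mult.assoc add.left_commute)
  next
    case False
    then show ?thesis by (simp add: x y sem_tcons)
  qed
next
  case (5 r i c es t)
  then show ?case by (simp only: cmul.simps sem_tadd sem_tscale el_cmb_Cons letter_val.simps distrib_right mult.assoc)
qed (simp_all add: sem_tcons el_0)

section \<open>Words in the conjugated matrices\<close>

definition ix :: "nat \<Rightarrow> 7" where "ix n = [1, 2, 3, 4, 5, 6, 7] ! n"

lemma ix_simps: "ix 0 = 1" "ix 1 = 2" "ix (Suc 0) = 2" "ix 2 = 3" "ix 3 = 4" "ix 4 = 5" "ix 5 = 6" "ix 6 = 7"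
  by (simp_all add: ix_def numeral_eq_Suc)

lemma all_less_7: "(\<forall>n<7. P n) \<longleftrightarrow> P 0 \<and> P 1 \<and> P 2 \<and> P 3 \<and> P 4 \<and> P 5 \<and> P (6::nat)"
proof -
  have "{..<7} = {0, 1, 2, 3, 4, 5, 6 :: nat}" by (rule set_eqI) (simp, presburger)
  moreover have "(\<forall>n<7. P n) \<longleftrightarrow> (\<forall>n\<in>{..<7}. P n)" by blast
  ultimately show ?thesis by simp
qed

lemma sum_less_7: "(\<Sum>n<7. f n) = f 0 + f 1 + f 2 + f 3 + f 4 + f 5 + f (6::nat)"
  by (simp add: numeral_eq_Suc)

lemma sum_ix: "(\<Sum>a\<in>UNIV. f a) = (\<Sum>n<7. f (ix n))"
  by (simp add: sum_7 sum_less_7 ix_simps)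

lemma gam_mult: "gam a b * gam b c = gam a c"
  using sqrt2_facts by (simp add: gam_def field_simps)

text \<open>Conjugation by the diagonal matrix \<open>diag(1, 1, 1, sqrt 2, 1, 1, 1)\<close> makes all entries rational
  and does not change the traces.\<close>

definition gg :: "nat \<Rightarrow> nat \<Rightarrow> g2" where "gg j l = gam (ix j) (ix l) \<cdot> G (ix l) (ix j)"
definition gm :: "g2 \<Rightarrow> nat \<Rightarrow> nat \<Rightarrow> complex" where "gm Y j l = gam (ix j) (ix l) * mat_of_g2 Y $ ix j $ ix l"

lemma gm_linear: "gm (X + Y) j l = gm X j l + gm Y j l" "gm (c \<cdot> X) j l = c * gm X j l" "gm 0 j l = 0"
  by (simp_all add: gm_def plus_g2.rep_eq cscale_g2.rep_eq zero_g2.rep_eq distrib_left)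

lemma form_gg: "g2_form (gg j l) Y = gm Y j l"
  by (simp add: gg_def gm_def g2_form_cscale_left form_G)

lemma cscale_sum_right: "c \<cdot> sum f A = (\<Sum>a\<in>A. c \<cdot> (f a :: 'b::complex_lie_algebra))"
  by (induction A rule: infinite_finite_induct) (simp_all add: cscale_add_right)

lemma bracket_gg: "bracket Y (gg j l) = (\<Sum>a<7. gm Y a l \<cdot> gg j a) - (\<Sum>a<7. gm Y j a \<cdot> gg a l)"
proof -
  have 1: "gm Y a l \<cdot> gg j a = gam (ix j) (ix l) \<cdot> mat_of_g2 Y $ ix a $ ix l \<cdot> G (ix a) (ix j)" for a
    by (simp add: gm_def gg_def cscale_cscale gam_mult [of "ix j" "ix a" "ix l", symmetric] mult_ac)
  have 2: "gm Y j a \<cdot> gg a l = gam (ix j) (ix l) \<cdot> mat_of_g2 Y $ ix j $ ix a \<cdot> G (ix l) (ix a)" for a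
    by (simp add: gm_def gg_def cscale_cscale gam_mult [of "ix j" "ix a" "ix l", symmetric] mult_ac)
  have "c \<cdot> (X - Z) = c \<cdot> X - c \<cdot> Z" for c and X Z :: g2
    using cscale_add_right [of c "X - Z" Z] by simp
  then show ?thesis
    unfolding 1 2 by (simp add: gg_def bracket_cscale_right bracket_G sum_ix cscale_sum_right)
qed

fun gword :: "nat list \<Rightarrow> nat \<Rightarrow> nat \<Rightarrow> affine uenv" where
  "gword [] j i = of_bool (j = i)"
| "gword (r # rs) j i = (\<Sum>l<7. el (gg j l) (- int r - 1) * gword rs l i)"

definition gtrace :: "nat list \<Rightarrow> affine uenv" where "gtrace rs = (\<Sum>i<7. gword rs i i)"

lemma trG_eq: "trG (map (\<lambda>r. - int r - 1) rs) = gtrace rs"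
proof -
  have "foldr (\<lambda>r M. Gseries r ** M) (map (\<lambda>r. - int r - 1) rs) (mat 1) $ ix j $ ix i
      = uscalar (gam (ix i) (ix j)) * gword rs j i" if "j < 7" "i < 7" for i j
    using that
  proof (induction rs arbitrary: j)
    case Nil
    have "\<forall>j<7. \<forall>i<7. ix j = ix i \<longleftrightarrow> j = i" by (simp add: all_less_7 ix_simps)
    then show ?case using Nil by (simp add: mat_def gam_def uscalar_simps)
  next
    case (Cons r rs)
    have "uembed (loop (G (ix l) (ix j)) s) * (uscalar (gam (ix i) (ix l)) * u) = uscalar (gam (ix i) (ix j)) * (el (gg j l) s * u)" for l s u
    proof -
      have "gam (ix l) (ix j) \<cdot> gg j l = G (ix l) (ix j)"
        by (simp add: gg_def cscale_cscale gam_mult) (simp add: gam_def cscale_one)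
      then have "el (G (ix l) (ix j)) s = uscalar (gam (ix l) (ix j)) * el (gg j l) s" by (metis el_cscale)
      moreover have "uscalar (gam (ix l) (ix j)) * (uscalar (gam (ix i) (ix l)) * v) = uscalar (gam (ix i) (ix j)) * v" for v :: "affine uenv"
        by (simp add: mult.commute [of "gam (ix l) (ix j)"] gam_mult flip: mult.assoc uscalar_simps(4))
      ultimately show ?thesis by (simp add: el_def [symmetric] el_uscalar mult.assoc)
    qed
    then show ?case using Cons by (simp add: matrix_matrix_mult_def Gseries_def sum_ix sum_distrib_left)
  qed
  from this show ?thesis
    by (simp add: trG_def trace_def sum_ix gtrace_def) (simp add: gam_def uscalar_simps)
qed

section \<open>The action of X[0] and X[1] on words in the vacuum module\<close>

lemma vc_add: "vacuum_class (u + v) = vacuum_class u + vacuum_class v"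
  and vc_diff: "vacuum_class (u - v) = vacuum_class u - vacuum_class v"
  by (transfer; simp add: vacuum_ideal.zero)+
lemma vc_0: "vacuum_class 0 = 0" using vc_add [of 0 0] by simp
lemma vc_uminus: "vacuum_class (- u) = - vacuum_class u" using vc_diff [of 0 u] by (simp add: vc_0)
lemma vc_sum: "vacuum_class (sum f A) = (\<Sum>a\<in>A. vacuum_class (f a))"
  by (induction A rule: infinite_finite_induct) (simp_all add: vc_0 vc_add)
lemma vc_cong: "vacuum_class u = vacuum_class v \<Longrightarrow> vacuum_class (a * u) = vacuum_class (a * v)"
  by (metis vacuum_act_class)
lemma vc_eq_0: "u \<in> vacuum_ideal \<Longrightarrow> vacuum_class u = 0"
  by (simp add: vacuum_class_eq_0_iff)

lemma loop_nonneg: "0 \<le> r \<Longrightarrow> loop X r \<in> loops_nonneg"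
  by (auto simp: loops_nonneg_def loop_def split: if_splits)

lemma vc_act_bool: "0 \<le> r \<Longrightarrow> vacuum_class (el X r * of_bool b) = 0"
  by (cases b) (simp_all add: vc_0 vc_eq_0 el_def vacuum_ideal.annihilate loop_nonneg)

text \<open>Entry (j, i) of the commutator W Y - Y W of the matrix of the word with the scalar
  matrix of \<open>Y\<close>.\<close>

definition twist :: "g2 \<Rightarrow> nat list \<Rightarrow> nat \<Rightarrow> nat \<Rightarrow> affine uenv"
  where "twist Y rs j i = (\<Sum>a<7. uscalar (gm Y a i) * gword rs j a - uscalar (gm Y j a) * gword rs a i)"

text \<open>By \<open>bracket_gg\<close> a letter matrix transforms by such a commutator; moving
  Y[0] through the word is the Leibniz rule, and at the right end it annihilates the vacuum.\<close>

lemma vc_loop_0: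
  assumes "j < 7" "i < 7"
  shows "vacuum_class (el Y 0 * gword rs j i) = vacuum_class (twist Y rs j i)"
  using assms
proof (induction rs arbitrary: j)
  case Nil
  have "twist Y [] j i = (\<Sum>a<7. (if a = j then uscalar (gm Y a i) else 0)) - (\<Sum>a<7. (if a = i then uscalar (gm Y j a) else 0))"
    unfolding twist_def sum_subtractf [symmetric] by (rule sum.cong) auto
  also have "\<dots> = 0" using Nil by simp
  finally show ?case using vc_act_bool [of 0 Y "j = i"] by (simp add: vc_0)
next
  case (Cons r rs)
  let ?z = "- int r - 1"
  let ?g = "\<lambda>j l. el (gg j l) ?z"
  have c: "el Y 0 * ?g j l = ?g j l * el Y 0 + (\<Sum>a<7. uscalar (gm Y a l) * ?g j a) - (\<Sum>a<7. uscalar (gm Y j a) * ?g a l)" for l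
    using el_commute [of Y 0 "gg j l" ?z]
    by (simp add: bracket_gg el_diff el_sum el_cscale uscalar_simps)
  have "vacuum_class (el Y 0 * gword (r # rs) j i) =
      vacuum_class (\<Sum>l<7. ((\<Sum>a<7. uscalar (gm Y a l) * ?g j a) - (\<Sum>a<7. uscalar (gm Y j a) * ?g a l)) * gword rs l i)
      + (\<Sum>l<7. vacuum_class (?g j l * (el Y 0 * gword rs l i)))"
    by (simp add: sum_distrib_left mult.assoc [symmetric] c distrib_right left_diff_distrib vc_sum vc_add vc_diff sum.distrib sum_subtractf)
  also have "(\<Sum>l<7. vacuum_class (?g j l * (el Y 0 * gword rs l i))) = (\<Sum>l<7. vacuum_class (?g j l * twist Y rs l i))"
    using Cons by (intro sum.cong refl vc_cong) simp
  also have "vacuum_class (\<Sum>l<7. ((\<Sum>a<7. uscalar (gm Y a l) * ?g j a) - (\<Sum>a<7. uscalar (gm Y j a) * ?g a l)) * gword rs l i)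
      + (\<Sum>l<7. vacuum_class (?g j l * twist Y rs l i)) =
      vacuum_class ((\<Sum>l<7. \<Sum>a<7. uscalar (gm Y a l) * (?g j a * gword rs l i)) - (\<Sum>l<7. \<Sum>a<7. uscalar (gm Y j a) * (?g a l * gword rs l i))
      + ((\<Sum>l<7. \<Sum>a<7. uscalar (gm Y a i) * (?g j l * gword rs l a)) - (\<Sum>l<7. \<Sum>a<7. uscalar (gm Y l a) * (?g j l * gword rs a i))))"
    by (simp add: vc_sum [symmetric] vc_add [symmetric] twist_def sum_distrib_left sum_distrib_right left_diff_distrib right_diff_distrib
        sum_subtractf mult.assoc el_uscalar)
  \<comment> \<open>The matrix of \<open>Y\<close> between the first letter and the rest occurs once
    from each side, with opposite signs.\<close>
  also have "(\<Sum>l<7. \<Sum>a<7. uscalar (gm Y l a) * (?g j l * gword rs a i)) = (\<Sum>l<7. \<Sum>a<7. uscalar (gm Y a l) * (?g j a * gword rs l i))"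
    by (rule sum.swap)
  also have "(\<Sum>l<7. \<Sum>a<7. uscalar (gm Y a i) * (?g j l * gword rs l a)) = (\<Sum>a<7. uscalar (gm Y a i) * gword (r # rs) j a)"
    by (subst sum.swap) (simp add: sum_distrib_left)
  also have "(\<Sum>l<7. \<Sum>a<7. uscalar (gm Y j a) * (?g a l * gword rs l i)) = (\<Sum>a<7. uscalar (gm Y j a) * gword (r # rs) a i)"
    by (subst sum.swap) (simp add: sum_distrib_left)
  finally show ?case by (simp add: twist_def sum_subtractf)
qed

text \<open>The trace of a commutator with a matrix of scalars vanishes.\<close>

lemma vc_gtrace_0: "vacuum_class (el Y 0 * gtrace rs) = 0"
proof -
  have "vacuum_class (el Y 0 * gtrace rs) = (\<Sum>i<7. vacuum_class (twist Y rs i i))"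
    by (simp add: gtrace_def sum_distrib_left vc_sum vc_loop_0)
  also have "\<dots> = vacuum_class ((\<Sum>i<7. \<Sum>a<7. uscalar (gm Y a i) * gword rs i a) - (\<Sum>i<7. \<Sum>a<7. uscalar (gm Y i a) * gword rs a i))"
    by (simp add: vc_sum [symmetric] twist_def sum_subtractf)
  also have "(\<Sum>i<7. \<Sum>a<7. uscalar (gm Y a i) * gword rs i a) = (\<Sum>i<7. \<Sum>a<7. uscalar (gm Y i a) * gword rs a i)"
    by (rule sum.swap)
  finally show ?thesis by (simp add: vc_0)
qed

text \<open>The correction terms when \<open>X[1]\<close> is moved past the first letter of a word. If that letter has mode \<open>-1\<close>, the bracket
  lies in \<open>g\<close> and acts on the rest of the word by \<open>vc_loop_0\<close>, and the central element contributes the critical level \<open>-12\<close>.\<close>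

fun lowered :: "g2 \<Rightarrow> nat \<Rightarrow> nat list \<Rightarrow> nat \<Rightarrow> nat \<Rightarrow> affine uenv" where
  "lowered X 0 rs j i = (\<Sum>l<7. twist (bracket X (gg j l)) rs l i - uscalar (12 * gm X j l) * gword rs l i)"
| "lowered X (Suc r) rs j i = (\<Sum>l<7. el (bracket X (gg j l)) (- int r - 1) * gword rs l i)"

lemma vc_central: "vacuum_class (uembed central * u) = vacuum_class (- uscalar 12 * u)"
proof -
  have "(uembed central + 12) * u = u * (uembed central + 12)"
    using uscalar_commute [of 12 u] by (simp add: central_commutes distrib_left distrib_right uscalar_numeral)
  then have "vacuum_class ((uembed central + 12) * u) = 0"
    by (simp add: vc_eq_0 vacuum_ideal.intros)
  then show ?thesis by (simp add: distrib_right vc_add vc_uminus uscalar_numeral eq_neg_iff_add_eq_0)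
qed

lemma vc_loop_1:
  assumes "j < 7" "i < 7" and u: "\<And>l. l < 7 \<Longrightarrow> vacuum_class (el X 1 * gword rs l i) = vacuum_class (u l)"
  shows "vacuum_class (el X 1 * gword (r # rs) j i) =
    vacuum_class ((\<Sum>l<7. el (gg j l) (- int r - 1) * u l) + lowered X r rs j i)"
proof -
  let ?z = "- int r - 1"
  let ?k = "\<lambda>l. el (bracket X (gg j l)) (1 + ?z) * gword rs l i + uscalar (of_bool (r = 0) * gm X j l) * (uembed central * gword rs l i)"
  \<comment> \<open>The central element enters only through letters of mode -1.\<close>
  have b: "of_bool (1 = - ?z) = (of_bool (r = 0) :: complex)" by auto
  have c: "el X 1 * (el (gg j l) ?z * v) = el (gg j l) ?z * (el X 1 * v) +
     (el (bracket X (gg j l)) (1 + ?z) * v + uscalar (of_bool (r = 0) * gm X j l) * (uembed central * v))" for l v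
  proof -
    have "el X 1 * (el (gg j l) ?z * v) = (el X 1 * el (gg j l) ?z) * v" by (simp add: mult.assoc)
    also have "\<dots> = (el (gg j l) ?z * el X 1 + el (bracket X (gg j l)) (1 + ?z)
        + uscalar (of_bool (r = 0) * gm X j l) * uembed central) * v"
      unfolding el_commute [of X 1] b using form_gg [of j l X] by (simp add: g2_form_commute)
    finally show ?thesis by (simp add: distrib_right mult.assoc)
  qed
  have "vacuum_class (el X 1 * gword (r # rs) j i) =
      (\<Sum>l<7. vacuum_class (el (gg j l) ?z * (el X 1 * gword rs l i))) + (\<Sum>l<7. vacuum_class (?k l))"
    by (simp only: gword.simps sum_distrib_left c vc_sum vc_add sum.distrib)
  also have "(\<Sum>l<7. vacuum_class (el (gg j l) ?z * (el X 1 * gword rs l i))) = (\<Sum>l<7. vacuum_class (el (gg j l) ?z * u l))"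
    by (intro sum.cong refl vc_cong) (simp add: u)
  also have "(\<Sum>l<7. vacuum_class (?k l)) = vacuum_class (lowered X r rs j i)"
  proof (cases r)
    case 0
    have "vacuum_class (?k l) = vacuum_class (twist (bracket X (gg j l)) rs l i - uscalar (12 * gm X j l) * gword rs l i)" if "l < 7" for l
    proof -
      have "vacuum_class (?k l) = vacuum_class (el (bracket X (gg j l)) 0 * gword rs l i)
          + vacuum_class (uscalar (gm X j l) * (uembed central * gword rs l i))"
        by (simp add: 0 vc_add)
      also have "vacuum_class (uscalar (gm X j l) * (uembed central * gword rs l i))
          = vacuum_class (uscalar (gm X j l) * (- uscalar 12 * gword rs l i))"
        by (rule vc_cong) (rule vc_central)
      also have "uscalar (gm X j l) * (- uscalar 12 * gword rs l i) = 0 - uscalar (12 * gm X j l) * gword rs l i"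
        by (simp add: uscalar_simps uscalar_commute [of 12] mult.assoc)
      finally show ?thesis using that assms by (simp add: vc_diff vc_uminus vc_loop_0 vc_0)
    qed
    then show ?thesis by (simp add: 0 vc_sum)
  next
    case (Suc r')
    then have z: "1 + ?z = - int r' - 1" by simp
    have "?k l = el (bracket X (gg j l)) (- int r' - 1) * gword rs l i" for l
      unfolding z by (simp add: Suc uscalar_simps)
    then show ?thesis by (simp only: Suc lowered.simps vc_sum)
  qed
  finally show ?thesis by (simp add: vc_add vc_sum)
qed

section \<open>Matrices of tries\<close>

text \<open>A column missing from a sparse row stands for the empty combination, whose value is
  zero.\<close>

definition ent :: "(nat \<times> (idx \<times> int) list) list list \<Rightarrow> nat \<Rightarrow> nat \<Rightarrow> (idx \<times> int) list"
  where "ent gs j l = (case map_of (gs ! j) l of None \<Rightarrow> [] | Some es \<Rightarrow> es)"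

definition good_rows :: "(nat \<times> (idx \<times> int) list) list list \<Rightarrow> bool"
  where "good_rows gs \<longleftrightarrow> length gs = 7 \<and> (\<forall>rw\<in>set gs. distinct (map fst rw) \<and> fst ` set rw \<subseteq> {..<7})"

definition square :: "'b list list \<Rightarrow> bool"
  where "square M \<longleftrightarrow> length M = 7 \<and> (\<forall>c\<in>set M. length c = 7)"

definition entry :: "trie list list \<Rightarrow> nat \<Rightarrow> nat \<Rightarrow> affine uenv" where "entry M j i = sem (M ! i ! j)"

lemma square_nth: "square M \<Longrightarrow> i < 7 \<Longrightarrow> length (M ! i) = 7" "square M \<Longrightarrow> length M = 7"
  by (auto simp: square_def)

lemma good_G_rows: "good_rows G_rows" and good_X_rows: "good_rows X_rows" and square_L_table: "square L_table"
  by (simp_all add: good_rows_def square_def G_rows_def X_rows_def L_table_def)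

lemma sum_map_of:
  fixes h :: "'e list \<Rightarrow> nat \<Rightarrow> 'b::ab_group_add"
  assumes "distinct (map fst rw)" "fst ` set rw \<subseteq> {..<k}" "\<And>n. h [] n = 0"
  shows "(\<Sum>n<k. h (case map_of rw n of None \<Rightarrow> [] | Some es \<Rightarrow> es) n) = (\<Sum>e\<leftarrow>rw. h (snd e) (fst e))"
  using assms(1,2)
proof (induction rw)
  case (Cons e rw)
  obtain l es where e: "e = (l, es)" by (cases e)
  have l: "map_of rw l = None" using Cons.prems by (auto simp: e map_of_eq_None_iff)
  have "(\<Sum>n<k. h (case map_of (e # rw) n of None \<Rightarrow> [] | Some es \<Rightarrow> es) n)
      = (\<Sum>n<k. h (case map_of rw n of None \<Rightarrow> [] | Some es \<Rightarrow> es) n + (if n = l then h es n else 0))"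
    by (rule sum.cong) (auto simp: e l assms(3))
  also have "\<dots> = (\<Sum>n<k. h (case map_of rw n of None \<Rightarrow> [] | Some es \<Rightarrow> es) n) + h es l"
    using Cons.prems by (simp add: sum.distrib e)
  finally show ?case using Cons by (simp add: e add.commute)
qed (simp add: assms(3))

lemma sem_row_sum: "sem (row_sum r col es) = (\<Sum>e\<leftarrow>es. el (cmb (snd e)) (- int r - 1) * sem (col ! fst e))"
  by (induction es) (simp_all add: sem_tadd sem_cmul)

lemma square_rows_mul: "good_rows gs \<Longrightarrow> square M \<Longrightarrow> square (rows_mul gs r M)"
  by (auto simp: good_rows_def square_def rows_mul_def)

lemma nth_rows_mul: "good_rows gs \<Longrightarrow> square M \<Longrightarrow> j < 7 \<Longrightarrow> i < 7 \<Longrightarrow> rows_mul gs r M ! i ! j = row_sum r (M ! i) (gs ! j)"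
  by (simp add: good_rows_def square_def rows_mul_def)

lemma entry_rows_mul:
  assumes "good_rows gs" "square M" "j < 7" "i < 7"
  shows "entry (rows_mul gs r M) j i = (\<Sum>l<7. el (cmb (ent gs j l)) (- int r - 1) * entry M l i)"
proof -
  have "gs ! j \<in> set gs" using assms by (simp add: good_rows_def)
  then have "distinct (map fst (gs ! j))" "fst ` set (gs ! j) \<subseteq> {..<7}"
    using assms(1) by (auto simp: good_rows_def)
  from sum_map_of [OF this, of "\<lambda>es l. el (cmb es) (- int r - 1) * entry M l i"]
  show ?thesis
    unfolding entry_def nth_rows_mul [OF assms] sem_row_sum ent_def by (simp add: el_0)
qed

lemma square_table_mul: "square (table_mul M)"
  using square_L_table by (auto simp: square_def table_mul_def)

lemma entry_table_mul:
  assumes "j < 7" "i < 7"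
  shows "entry (table_mul M) j i = (\<Sum>e\<leftarrow>L_table ! i ! j. of_int (fst e) * entry M (fst (snd e)) (snd (snd e)))"
proof -
  have "sem (table_sum M es) = (\<Sum>e\<leftarrow>es. of_int (fst e) * entry M (fst (snd e)) (snd (snd e)))" for es
    by (induction es) (simp_all add: sem_tadd sem_tscale entry_def)
  then show ?thesis using assms square_nth [OF square_L_table] by (simp add: entry_def table_mul_def)
qed

lemma list_add_zip: "list_add ss ts = map2 tadd ss ts"
  by (induction ss ts rule: list_add.induct) simp_all
lemma mat_add_zip: "mat_add M N = map2 list_add M N"
  by (induction M N rule: mat_add.induct) simp_all

lemma mat_add:
  assumes "square M" "square N"
  shows "square (mat_add M N)" "j < 7 \<Longrightarrow> i < 7 \<Longrightarrow> entry (mat_add M N) j i = entry M j i + entry N j i"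
  using assms square_nth [OF assms(1)] square_nth [OF assms(2)]
  by (auto simp: mat_add_zip list_add_zip square_def entry_def sem_tadd set_zip)

lemma sem_trace_mul:
  assumes "good_rows gs" "square M"
  shows "sem (trace_mul r gs M) = (\<Sum>i<7. entry (rows_mul gs r M) i i)"
proof -
  have "sem (trace_mul r fs cs) = (\<Sum>i<min (length fs) (length cs). sem (row_sum r (cs ! i) (fs ! i)))" for fs cs
    by (induction r fs cs rule: trace_mul.induct) (simp_all add: sem_tadd sum.lessThan_Suc_shift del: sum.lessThan_Suc)
  then show ?thesis
    using assms by (simp add: entry_def nth_rows_mul) (simp add: good_rows_def square_def)
qed

subsection \<open>The tables\<close>

lemma gg_table: "j < 7 \<Longrightarrow> l < 7 \<Longrightarrow> gg j l = cmb (ent G_rows j l)"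
proof -
  have self: "gam a a = 1" for a by (simp add: gam_def)
  have "\<forall>j<7. \<forall>l<7. gg j l = cmb (ent G_rows j l)"
    unfolding all_less_7 gg_def ix_simps G_table cscale_cscale gam_mult self cscale_one
    by (simp add: ent_def G_rows_def)
  then show "j < 7 \<Longrightarrow> l < 7 \<Longrightarrow> gg j l = cmb (ent G_rows j l)" by blast
qed

lemma bracket_cmb: "bracket (bas i) (cmb es) = (\<Sum>e\<leftarrow>es. of_int (snd e) \<cdot> cmb (br i (fst e)))"
  by (induction es) (simp_all add: bracket_add_right bracket_cscale_right cmb_bracket del: bas.simps)

lemma bracket_table: "j < 7 \<Longrightarrow> l < 7 \<Longrightarrow> bracket (bas E12) (gg j l) = cmb (ent X_rows j l)"
proof -
  have "\<forall>j<7. \<forall>l<7. bracket (bas E12) (cmb (ent G_rows j l)) = cmb (ent X_rows j l)"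
    unfolding all_less_7
    by (intro conjI; rule crd_eqI;
      simp add: ent_def G_rows_def X_rows_def bracket_cmb crd_add crd_cscale crd_cmb crd_0 del: cmb.simps bas.simps crd.simps)
  then show "j < 7 \<Longrightarrow> l < 7 \<Longrightarrow> bracket (bas E12) (gg j l) = cmb (ent X_rows j l)" by (simp add: gg_table del: bas.simps)
qed

primrec fo :: "idx \<Rightarrow> idx \<Rightarrow> int" where
  "fo H1 j = (case j of H1 \<Rightarrow> 2 | H2 \<Rightarrow> - 1 | _ \<Rightarrow> 0)"
| "fo H2 j = (case j of H1 \<Rightarrow> - 1 | H2 \<Rightarrow> 2 | _ \<Rightarrow> 0)"
| "fo E12 j = (case j of E21 \<Rightarrow> 3 | _ \<Rightarrow> 0)"
| "fo E13 j = (case j of E31 \<Rightarrow> 3 | _ \<Rightarrow> 0)"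
| "fo E21 j = (case j of E12 \<Rightarrow> 3 | _ \<Rightarrow> 0)"
| "fo E23 j = (case j of E32 \<Rightarrow> 3 | _ \<Rightarrow> 0)"
| "fo E31 j = (case j of E13 \<Rightarrow> 3 | _ \<Rightarrow> 0)"
| "fo E32 j = (case j of E23 \<Rightarrow> 3 | _ \<Rightarrow> 0)"
| "fo P1 j = (case j of Q1 \<Rightarrow> 1 | _ \<Rightarrow> 0)"
| "fo P2 j = (case j of Q2 \<Rightarrow> 1 | _ \<Rightarrow> 0)"
| "fo P3 j = (case j of Q3 \<Rightarrow> 1 | _ \<Rightarrow> 0)"
| "fo Q1 j = (case j of P1 \<Rightarrow> 1 | _ \<Rightarrow> 0)"
| "fo Q2 j = (case j of P2 \<Rightarrow> 1 | _ \<Rightarrow> 0)"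
| "fo Q3 j = (case j of P3 \<Rightarrow> 1 | _ \<Rightarrow> 0)"

lemma form_bas: "g2_form (bas i) (bas j) = of_int (fo i j)"
  by (cases i; cases j; simp add: form_G bas_core)

definition gi :: "idx \<Rightarrow> nat \<Rightarrow> nat \<Rightarrow> int" where "gi k a b = (\<Sum>e\<leftarrow>ent G_rows a b. snd e * fo (fst e) k)"
definition yi :: "nat \<Rightarrow> nat \<Rightarrow> nat \<Rightarrow> nat \<Rightarrow> int" where "yi j l a b = (\<Sum>e\<leftarrow>ent X_rows j l. snd e * gi (fst e) a b)"

lemma gm_bas: "a < 7 \<Longrightarrow> b < 7 \<Longrightarrow> gm (bas k) a b = of_int (gi k a b)"
proof -
  assume "a < 7" "b < 7"
  moreover have "g2_form (cmb es) (bas k) = of_int (\<Sum>e\<leftarrow>es. snd e * fo (fst e) k)" for es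
  proof (induction es)
    case Nil
    then show ?case using g2_form_cscale_left [of 0 0 "bas k"] by simp
  next
    case (Cons e es)
    then show ?case by (simp add: g2_form_add_left g2_form_cscale_left form_bas del: bas.simps)
  qed
  ultimately show ?thesis by (simp add: gg_table gi_def flip: form_gg del: bas.simps)
qed

lemma gm_bracket:
  assumes "j < 7" "l < 7" "a < 7" "b < 7"
  shows "gm (bracket (bas E12) (gg j l)) a b = of_int (yi j l a b)"
proof -
  have "gm (cmb es) a b = of_int (\<Sum>e\<leftarrow>es. snd e * gi (fst e) a b)" for es
    by (induction es) (simp_all add: gm_linear gm_bas assms del: bas.simps)
  then show ?thesis by (simp add: bracket_table assms yi_def del: bas.simps)
qed

text \<open>The coefficient of the entry (l, m) of the word in \<open>lowered (bas E12) 0\<close>.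
  The first term is multiplication from the right; for m = i it is joined by multiplication from the
  left, summed over the intermediate index, and by the critical level 12.\<close>

definition ci :: "nat \<Rightarrow> nat \<Rightarrow> nat \<Rightarrow> nat \<Rightarrow> int"
  where "ci j i l m = yi j l m i - (if m = i then (\<Sum>n\<leftarrow>[0..<7]. yi j n n l) + 12 * gi E12 j l else 0)"

lemma lowered_ci:
  assumes "j < 7" "i < 7"
  shows "lowered (bas E12) 0 rs j i = (\<Sum>l<7. \<Sum>m<7. of_int (ci j i l m) * gword rs l m)"
proof -
  have sn: "(\<Sum>n\<leftarrow>[0..<7]. f n) = (\<Sum>n<7. f n)" for f :: "nat \<Rightarrow> int"
    by (simp add: interv_sum_list_conv_sum_set_nat atLeast0LessThan)
  have "lowered (bas E12) 0 rs j i = (\<Sum>l<7. (\<Sum>a<7. of_int (yi j l a i) * gword rs l a)) - (\<Sum>l<7. \<Sum>a<7. of_int (yi j l l a) * gword rs a i)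
      - (\<Sum>l<7. of_int (12 * gi E12 j l) * gword rs l i)"
    by (simp add: twist_def assms gm_bracket gm_bas uscalar_of_int sum_subtractf uscalar_simps uscalar_numeral del: bas.simps)
  also have "(\<Sum>l<7. \<Sum>a<7. of_int (yi j l l a) * gword rs a i) = (\<Sum>l<7. of_int (\<Sum>n<7. yi j n n l) * gword rs l i)"
    by (subst sum.swap) (simp add: sum_distrib_right)
  finally have "lowered (bas E12) 0 rs j i = (\<Sum>l<7. (\<Sum>a<7. of_int (yi j l a i) * gword rs l a)
      - (of_int (\<Sum>n<7. yi j n n l) + of_int (12 * gi E12 j l)) * gword rs l i)"
    by (simp only: sum_subtractf distrib_right diff_diff_eq sum.distrib)
  also have "\<dots> = (\<Sum>l<7. \<Sum>m<7. of_int (yi j l m i) * gword rs l m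
      - (if m = i then (of_int (\<Sum>n<7. yi j n n l) + of_int (12 * gi E12 j l)) * gword rs l i else 0))"
    using assms by (simp only: sum_subtractf sum.delta finite_lessThan) simp
  also have "\<dots> = (\<Sum>l<7. \<Sum>m<7. of_int (ci j i l m) * gword rs l m)"
    by (intro sum.cong refl) (simp add: ci_def sn left_diff_distrib)
  finally show ?thesis .
qed

text \<open>Integer arithmetic over 7^4 index tuples; this is the justification of
  \<open>L_table\<close>.\<close>

lemma ci_table: "\<forall>j\<in>set [0..<7]. \<forall>i\<in>set [0..<7]. \<forall>l\<in>set [0..<7]. \<forall>m\<in>set [0..<7].
    ci j i l m = (\<Sum>e\<leftarrow>L_table ! i ! j. if snd e = (l, m) then fst e else 0)"
  by code_simp

lemma sum_table:
  fixes A :: "nat \<Rightarrow> nat \<Rightarrow> 'b::ring_1"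
  assumes "\<forall>e\<in>set es. fst (snd e) < k \<and> snd (snd e) < k"
  shows "(\<Sum>e\<leftarrow>es. of_int (fst e) * A (fst (snd e)) (snd (snd e)))
    = (\<Sum>l<k. \<Sum>m<k. of_int (\<Sum>e\<leftarrow>es. if snd e = (l, m) then fst e else 0) * A l m)"
  using assms
proof (induction es)
  case (Cons e es)
  obtain c a b where e: "e = (c, a, b)" by (cases e) auto
  have "(\<Sum>l<k. \<Sum>m<k. of_int (\<Sum>e\<leftarrow>e # es. if snd e = (l, m) then fst e else 0) * A l m)
      = (\<Sum>l<k. \<Sum>m<k. (if m = b then if l = a then of_int c * A a b else 0 else 0) + of_int (\<Sum>e\<leftarrow>es. if snd e = (l, m) then fst e else 0) * A l m)"
    by (intro sum.cong refl) (auto simp: e distrib_right)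
  also have "\<dots> = of_int c * A a b + (\<Sum>l<k. \<Sum>m<k. of_int (\<Sum>e\<leftarrow>es. if snd e = (l, m) then fst e else 0) * A l m)"
    using Cons.prems by (simp add: sum.distrib e)
  finally show ?case using Cons by (simp add: e)
qed simp

lemma lowered_table:
  assumes "j < 7" "i < 7"
  shows "lowered (bas E12) 0 rs j i = (\<Sum>e\<leftarrow>L_table ! i ! j. of_int (fst e) * gword rs (fst (snd e)) (snd (snd e)))"
proof -
  have "\<forall>i<7. \<forall>j<7. \<forall>e\<in>set (L_table ! i ! j). fst (snd e) < 7 \<and> snd (snd e) < 7"
    unfolding all_less_7 by (simp add: L_table_def)
  then show ?thesis
    unfolding lowered_ci [OF assms] using assms ci_table by (subst sum_table [where k = 7]) (auto intro!: sum.cong)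
qed

subsection \<open>Soundness of the check\<close>

definition word_ok :: "trie list list \<Rightarrow> nat list \<Rightarrow> bool"
  where "word_ok W rs \<longleftrightarrow> square W \<and> (\<forall>j<7. \<forall>i<7. entry W j i = gword rs j i)"

definition lower_ok :: "trie list list \<Rightarrow> nat list \<Rightarrow> bool"
  where "lower_ok B rs \<longleftrightarrow> square B \<and>
    (\<forall>j<7. \<forall>i<7. vacuum_class (el (bas E12) 1 * gword rs j i) = vacuum_class (entry B j i))"

lemma word_ok_unit: "word_ok unit_mat []"
proof -
  have "\<forall>j<7. \<forall>i<7. entry unit_mat j i = gword [] j i"
    unfolding all_less_7 by (simp add: entry_def unit_mat_def Let_def)
  then show ?thesis by (simp add: word_ok_def square_def unit_mat_def Let_def)
qed

lemma lower_ok_zero: "lower_ok zero_mat []"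
proof -
  have "\<forall>j<7. \<forall>i<7. entry zero_mat j i = 0"
    unfolding all_less_7 by (simp add: entry_def zero_mat_def Let_def)
  then show ?thesis using vc_act_bool [of 1 "bas E12"]
    by (simp add: lower_ok_def square_def zero_mat_def Let_def vc_0 del: bas.simps)
qed

lemma entry_G_rows:
  assumes "word_ok W rs" "j < 7" "i < 7"
  shows "entry (rows_mul G_rows r W) j i = gword (r # rs) j i"
  using assms by (simp add: word_ok_def entry_rows_mul good_G_rows gg_table)

lemma word_ok_step:
  assumes "word_ok W rs"
  shows "word_ok (rows_mul G_rows r W) (r # rs)"
  unfolding word_ok_def [of "rows_mul G_rows r W"]
  using entry_G_rows [OF assms] square_rows_mul [OF good_G_rows] assms word_ok_def by blast

lemma entry_lower:
  assumes "word_ok W rs" "j < 7" "i < 7"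
  shows "entry (lower r W) j i = lowered (bas E12) r rs j i" "square (lower r W)"
proof -
  have sq: "square W" and W: "\<And>j i. j < 7 \<Longrightarrow> i < 7 \<Longrightarrow> entry W j i = gword rs j i"
    using assms(1) by (auto simp: word_ok_def)
  have L: "\<forall>i<7. \<forall>j<7. \<forall>e\<in>set (L_table ! i ! j). fst (snd e) < 7 \<and> snd (snd e) < 7"
    unfolding all_less_7 by (simp add: L_table_def)
  show "entry (lower r W) j i = lowered (bas E12) r rs j i"
  proof (cases r)
    case 0
    have "entry (table_mul W) j i = (\<Sum>e\<leftarrow>L_table ! i ! j. of_int (fst e) * gword rs (fst (snd e)) (snd (snd e)))"
      unfolding entry_table_mul [OF assms(2,3)]
      by (rule arg_cong [where f = sum_list], rule map_cong) (use L assms W in auto)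
    then show ?thesis unfolding 0 lower.simps lowered_table [OF assms(2,3)] .
  next
    case (Suc r')
    show ?thesis
      unfolding Suc lower.simps lowered.simps entry_rows_mul [OF good_X_rows sq assms(2,3)]
      by (rule sum.cong) (use assms in \<open>simp_all add: bracket_table W del: bas.simps\<close>)
  qed
  show "square (lower r W)"
    by (cases r) (simp_all add: square_table_mul square_rows_mul good_X_rows sq)
qed

lemma lower_step:
  assumes "word_ok W rs" "lower_ok B rs" "j < 7" "i < 7"
  shows "vacuum_class (el (bas E12) 1 * gword (r # rs) j i) =
    vacuum_class (entry (rows_mul G_rows r B) j i + lowered (bas E12) r rs j i)"
proof -
  have "vacuum_class (el (bas E12) 1 * gword (r # rs) j i) =
      vacuum_class ((\<Sum>l<7. el (gg j l) (- int r - 1) * entry B l i) + lowered (bas E12) r rs j i)"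
    by (rule vc_loop_1) (use assms in \<open>auto simp: lower_ok_def\<close>)
  also have "(\<Sum>l<7. el (gg j l) (- int r - 1) * entry B l i) = entry (rows_mul G_rows r B) j i"
    using assms by (simp add: entry_rows_mul good_G_rows lower_ok_def gg_table)
  finally show ?thesis .
qed

fun state_ok :: "state \<Rightarrow> nat list \<Rightarrow> bool" where "state_ok (W, B) rs \<longleftrightarrow> word_ok W rs \<and> lower_ok B rs"

lemma state_ok_step: "state_ok s rs \<Longrightarrow> state_ok (step r s) (r # rs)"
proof (cases s)
  case (Pair W B)
  assume "state_ok s rs"
  then have ok: "word_ok W rs" "lower_ok B rs" by (simp_all add: Pair)
  have sq: "square (rows_mul G_rows r B)" "square (lower r W)"
    using ok entry_lower(2) [OF ok(1), of 0 0] by (simp_all add: square_rows_mul good_G_rows lower_ok_def)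
  have "lower_ok (mat_add (rows_mul G_rows r B) (lower r W)) (r # rs)"
    unfolding lower_ok_def by (simp add: mat_add [OF sq] lower_step [OF ok] entry_lower [OF ok(1)] del: gword.simps bas.simps)
  then show ?thesis using word_ok_step [OF ok(1)] by (simp add: Pair)
qed

lemma gtrace_act: "vacuum_class (el X 1 * gtrace rs) = (\<Sum>i<7. vacuum_class (el X 1 * gword rs i i))"
  by (simp add: gtrace_def sum_distrib_left vc_sum)

lemma sem_trace_word: "word_ok W rs \<Longrightarrow> sem (trace_mul r G_rows W) = gtrace (r # rs)"
  by (subst sem_trace_mul [OF good_G_rows]) (simp_all add: word_ok_def [of W] gtrace_def entry_G_rows [of W rs] word_ok_def del: gword.simps)

lemma fin_ok:
  assumes "state_ok s rs"
  shows "vacuum_class (el (bas E12) 1 * gtrace (Suc r # rs)) = vacuum_class (sem (fin r s))"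
proof (cases s)
  case (Pair W B)
  then have ok: "word_ok W rs" "lower_ok B rs" using assms by simp_all
  then have sq: "square W" "square B" by (simp_all add: word_ok_def lower_ok_def)
  have "sem (fin r s) = (\<Sum>i<7. entry (rows_mul G_rows (Suc r) B) i i + lowered (bas E12) (Suc r) rs i i)"
    unfolding Pair fin.simps sem_tadd sem_trace_mul [OF good_G_rows sq(2)] sem_trace_mul [OF good_X_rows sq(1)]
    using entry_lower(1) [OF ok(1), of _ _ "Suc r"] by (simp add: sum.distrib del: lowered.simps bas.simps)
  then show ?thesis by (simp add: gtrace_act lower_step [OF ok] vc_sum del: gword.simps lowered.simps bas.simps)
qed

lemma fin00_ok:
  assumes "state_ok s rs"
  shows "vacuum_class (el (bas E12) 1 * gtrace (0 # 0 # rs)) = vacuum_class (sem (fin00 s))"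
proof (cases s)
  case (Pair W B)
  then have ok: "word_ok W rs" "lower_ok B rs" using assms by simp_all
  define W' B' where "W' = rows_mul G_rows 0 W" and "B' = mat_add (rows_mul G_rows 0 B) (table_mul W)"
  have ok': "word_ok W' (0 # rs)" "lower_ok B' (0 # rs)"
    using state_ok_step [OF assms, of 0] by (simp_all add: Pair W'_def B'_def)
  have e: "entry W' j i = gword (0 # rs) j i" if "j < 7" "i < 7" for j i
    using ok' that by (simp add: word_ok_def)
  \<comment> \<open>The positive and the negative coefficients on the diagonal of
    \<open>L_table\<close> both sum to 36; the shape is the one in which the expanded sum appears
    below.\<close>
  have comb: "9 * a + (9 * a + (9 * a - 3 * b + (6 * a - 6 * b + (3 * a - 9 * b)))) - 9 * b - 9 * b = 36 * a - 36 * b"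
    for a b :: "affine uenv"
  proof -
    have "9 * a + (9 * a + (9 * a - 3 * b + (6 * a - 6 * b + (3 * a - 9 * b)))) - 9 * b - 9 * b
        = (9 + 9 + 9 + 6 + 3) * a - (3 + 6 + 9 + 9 + 9) * b"
      by (simp only: distrib_right) (simp add: algebra_simps)
    then show ?thesis by simp
  qed
  have sq: "square W" "square B'" using ok ok' by (simp_all add: word_ok_def lower_ok_def)
  have "(\<Sum>i<7. lowered (bas E12) 0 (0 # rs) i i)
      = (\<Sum>i<7. \<Sum>e\<leftarrow>L_table ! i ! i. of_int (fst e) * gword (0 # rs) (fst (snd e)) (snd (snd e)))"
    by (rule sum.cong) (simp_all only: lowered_table lessThan_iff)
  also have "\<dots> = 36 * gword (0 # rs) 1 0 - 36 * gword (0 # rs) 6 5"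
    using comb [of "gword (0 # rs) 1 0" "gword (0 # rs) 6 5"]
    by (simp add: sum_less_7 L_table_def add.assoc del: gword.simps)
  also have "\<dots> = sem (fin00_table W)"
    using nth_rows_mul [OF good_G_rows sq(1), of 1 0 0] nth_rows_mul [OF good_G_rows sq(1), of 6 5 0] e [of 1 0] e [of 6 5]
    by (simp add: fin00_table_def sem_tadd sem_tscale W'_def entry_def del: gword.simps)
  finally have "sem (fin00 s) = (\<Sum>i<7. entry (rows_mul G_rows 0 B') i i + lowered (bas E12) 0 (0 # rs) i i)"
    unfolding Pair fin00.simps sem_tadd B'_def [symmetric] sem_trace_mul [OF good_G_rows sq(2)]
    by (simp only: sum.distrib)
  then show ?thesis by (simp add: gtrace_act lower_step [OF ok'] vc_sum del: gword.simps lowered.simps bas.simps)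
qed

lemma state_ok_0: "state_ok (unit_mat, zero_mat) []"
  by (simp add: word_ok_unit lower_ok_zero)

definition gS6 :: "affine uenv" where "gS6 = gtrace [0, 0, 0, 0, 0, 0] + 5 * gtrace [1, 0, 0, 0, 0]
    + 14 * gtrace [2, 0, 0, 0] + 456 * gtrace [2, 2] - 639 * gtrace [1, 1, 1]
    + 31 * gtrace [1, 1, 0, 0] - 312 * gtrace [2, 1, 0]"

lemma S6_gtrace: "S6 = gS6" and S2_gtrace: "S2 = gtrace [0, 0]"
  unfolding S6_def gS6_def S2_def by (simp_all flip: trG_eq)

lemma chk0_sound: "vacuum_class (el (bas E12) 1 * S6) = vacuum_class (sem (chk0 (unit_mat, zero_mat)))"
proof -
  define s0 where "s0 = (unit_mat, zero_mat)"
  define s1 s2 s3 s4 where "s1 = step 0 s0" and "s2 = step 0 s1" and "s3 = step 0 s2" and "s4 = step 0 s3"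
  have s: "state_ok s0 []" "state_ok s1 [0]" "state_ok s2 [0, 0]" "state_ok s3 [0, 0, 0]" "state_ok s4 [0, 0, 0, 0]"
    unfolding s0_def s1_def s2_def s3_def s4_def by (intro state_ok_step state_ok_0)+
  note st = state_ok_step [OF s(1), of 1] state_ok_step [OF s(1), of 2] state_ok_step [OF s(2), of 1] state_ok_step [OF s(3), of 1]
  note st = st state_ok_step [OF st(1), of 1]
  let ?V = "\<lambda>rs. vacuum_class (el (bas E12) 1 * gtrace rs)"
  have f: "?V [0, 0, 0, 0, 0, 0] = vacuum_class (sem (fin00 s4))" "?V [1, 0, 0, 0, 0] = vacuum_class (sem (fin 0 s4))"
    "?V [2, 0, 0, 0] = vacuum_class (sem (fin 1 s3))" "?V [2, 2] = vacuum_class (sem (fin 1 (step 2 s0)))"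
    "?V [1, 1, 1] = vacuum_class (sem (fin 0 (step 1 (step 1 s0))))"
    "?V [1, 1, 0, 0] = vacuum_class (sem (fin 0 (step 1 s2)))" "?V [2, 1, 0] = vacuum_class (sem (fin 1 (step 1 s1)))"
    using fin00_ok [OF s(5)] fin_ok [OF s(5), of 0] fin_ok [OF s(4), of 1] fin_ok [OF st(2), of 1] fin_ok [OF st(5), of 0]
      fin_ok [OF st(4), of 0] fin_ok [OF st(3), of 1] by (simp_all add: numeral_2_eq_2 del: bas.simps)
  have n: "vacuum_class (a * (numeral k * u)) = vacuum_act (numeral k) (vacuum_class (a * u))" for a u k
    using mult_of_int_commute [of "numeral k" a] by (simp add: vacuum_act_class mult.assoc [symmetric])
  have m: "vacuum_class (numeral k * u) = vacuum_act (numeral k) (vacuum_class u)" for u k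
    by (simp add: vacuum_act_class)
  have "sem (chk0 s0) = (14 * sem (fin 1 s3) + 31 * sem (fin 0 (step 1 s2)) + (- 312 * sem (fin 1 (step 1 s1))
      + (456 * sem (fin 1 (step 2 s0)) + - 639 * sem (fin 0 (step 1 (step 1 s0)))))) + (sem (fin00 s4) + 5 * sem (fin 0 s4))"
    by (simp add: chk0_def chk1_def chk2_def chk3_def chk4_def chk5_def s1_def s2_def s3_def s4_def sem_tadd sem_tscale
      del: fin.simps fin00.simps step.simps)
  then show ?thesis
    unfolding S6_gtrace gS6_def s0_def [symmetric]
    by (simp only: distrib_left right_diff_distrib vc_add vc_diff n f mult_minus_left vc_uminus m) (simp add: algebra_simps)
qed

lemma fin00_check: "fin00 (unit_mat, zero_mat) = Node 0 Leaf"
  by (simp only: prog)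

lemma S2_lowered: "vacuum_class (el (bas E12) 1 * S2) = 0"
  unfolding S2_gtrace fin00_ok [OF state_ok_0] fin00_check by (simp add: vc_0)

subsection \<open>Membership in the center\<close>

text \<open>\<open>E12\<close> generates the adjoint module. Each basis vector is reached by a
  bracket that the table gives as a nonzero multiple of a single basis vector.\<close>

lemma subspace_eq_UNIV:
  assumes "bas E12 \<in> I" "\<And>X Y. X \<in> I \<Longrightarrow> bracket Y X \<in> I" "\<And>X Y. X \<in> I \<Longrightarrow> Y \<in> I \<Longrightarrow> X + Y \<in> I" "\<And>c X. X \<in> I \<Longrightarrow> c \<cdot> X \<in> I"
  shows "X \<in> I"
proof -
  have br: "cmb (br i j) \<in> I" if "bas i \<in> I" for i j
  proof -
    have "bracket (bas i) (bas j) = (- 1) \<cdot> bracket (bas j) (bas i)"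
      using bracket_antisym [of "bas i" "bas j"] by (simp add: cscale_uminus_left cscale_one)
    then show ?thesis using assms(2,4) that by (metis cmb_bracket)
  qed
  have one: "bas k \<in> I" if "bas i \<in> I" "br i j = [(k, c)]" "c \<noteq> 0" for i j k c
  proof -
    have "(1 / of_int c) \<cdot> cmb (br i j) \<in> I" using br assms(4) that by blast
    then show ?thesis using that by (simp add: cscale_cscale cscale_one)
  qed
  note E12 = assms(1)
  have E13: "bas E13 \<in> I" by (rule one [OF E12, of E23 E13 3]) simp_all
  have E32: "bas E32 \<in> I" by (rule one [OF E12, of E31 E32 "-3"]) simp_all
  have P1: "bas P1 \<in> I" by (rule one [OF E12, of P2 P1 3]) simp_all
  have Q2: "bas Q2 \<in> I" by (rule one [OF E12, of Q1 Q2 "-3"]) simp_all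
  have E23: "bas E23 \<in> I" by (rule one [OF E13, of E21 E23 "-3"]) simp_all
  have E31: "bas E31 \<in> I" by (rule one [OF E32, of E21 E31 3]) simp_all
  have E21: "bas E21 \<in> I" by (rule one [OF E23, of E31 E21 3]) simp_all
  have P3: "bas P3 \<in> I" by (rule one [OF P1, of E31 P3 "-3"]) simp_all
  have P2: "bas P2 \<in> I" by (rule one [OF P1, of E21 P2 "-3"]) simp_all
  have Q1: "bas Q1 \<in> I" by (rule one [OF Q2, of E21 Q1 3]) simp_all
  have Q3: "bas Q3 \<in> I" by (rule one [OF Q2, of E23 Q3 3]) simp_all
  have H1: "bas H1 \<in> I" by (rule one [OF P1, of Q1 H1 1]) simp_all
  have H2: "bas H2 \<in> I" by (rule one [OF P2, of Q2 H2 1]) simp_all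
  have b: "bas i \<in> I" for i
    by (cases i) (simp_all only: E12 E13 E32 P1 Q2 E23 E31 E21 P3 P2 Q1 Q3 H1 H2)
  have "0 \<in> I" using assms(4) [OF E12, of 0] by simp
  then have "(\<Sum>i\<leftarrow>is. crd i X \<cdot> bas i) \<in> I" for "is"
    by (induction "is") (simp_all add: assms(3,4) b del: bas.simps crd.simps)
  then show ?thesis by (subst g2_expand)
qed

text \<open>The annihilators of the class of \<open>S\<close> form a Lie algebra \<open>U\<close>.
  It contains g, hence with E12[r] all of g[r], and g[1] together with g[r] leads to g[r+1].\<close>

lemma center_criterion:
  assumes S: "S \<in> generated_subalgebra loops_neg" and S0: "\<And>Y. vacuum_class (el Y 0 * S) = 0" and S1: "vacuum_class (el (bas E12) 1 * S) = 0"
  shows "S \<in> feigin_frenkel_center"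
proof -
  define U where "U = {x. vacuum_class (uembed x * S) = 0}"
  have add: "x \<in> U \<Longrightarrow> y \<in> U \<Longrightarrow> x + y \<in> U" for x y by (simp add: U_def uembed_add distrib_right vc_add)
  have scale: "x \<in> U \<Longrightarrow> c \<cdot> x \<in> U" for c x
    using vc_cong [of "uembed x * S" 0 "uscalar c"] by (simp add: U_def uembed_cscale mult.assoc vc_0)
  have br: "bracket x y \<in> U" if "x \<in> U" "y \<in> U" for x y
    using that vc_cong [of "uembed x * S" 0 "uembed y"] vc_cong [of "uembed y * S" 0 "uembed x"]
    by (simp add: U_def uembed_bracket left_diff_distrib mult.assoc vc_diff vc_0)
  have U0: "loop Y 0 \<in> U" for Y using S0 [of Y] by (simp add: U_def el_def)
  \<comment> \<open>Brackets with the Y[0] make the set of such \<open>X\<close> a submodule of the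
    adjoint module.\<close>
  have all: "loop X r \<in> U" if "loop (bas E12) r \<in> U" for X r
  proof -
    have "X \<in> {X. loop X r \<in> U}"
    proof (rule subspace_eq_UNIV)
      show "bracket Y X \<in> {X. loop X r \<in> U}" if "X \<in> {X. loop X r \<in> U}" for X Y
        using br [OF U0 [of Y], of "loop X r"] that by (simp add: bracket_loop)
    qed (use that add scale in \<open>simp_all add: loop_add loop_cscale\<close>)
    then show ?thesis by simp
  qed
  have "loop X (int r) \<in> U" for X r
  proof (induction r arbitrary: X)
    case 0
    then show ?case using U0 by simp
  next
    case (Suc r)
    have U1: "loop Y 1 \<in> U" for Y using all S1 by (simp add: U_def el_def)
    have "bracket (bas H1) (bas E12) = 3 \<cdot> bas E12" by (simp only: cmb_bracket) simp
    then have e: "bas E12 = bracket ((1 / 3) \<cdot> bas H1) (bas E12)"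
      by (simp add: bracket_cscale_left cscale_cscale cscale_one del: bas.simps)
    have "bracket (loop ((1 / 3) \<cdot> bas H1) 1) (loop (bas E12) (int r)) \<in> U" by (rule br [OF U1 Suc])
    then have "loop (bas E12) (1 + int r) \<in> U" by (simp only: bracket_loop e [symmetric]) simp
    then show ?case using all by simp
  qed
  then have U: "loop X r \<in> U" if "0 \<le> r" for X r using that by (metis nat_0_le)
  have "x \<in> U" if "x \<in> loops_nonneg" for x
  proof -
    obtain p where x: "x = Affine p 0" and p: "\<And>r. r \<in> Poly_Mapping.keys p \<Longrightarrow> 0 \<le> r"
      using \<open>x \<in> loops_nonneg\<close> by (auto simp: loops_nonneg_def)
    have U_0: "0 \<in> U" by (simp add: U_def uembed_0 vc_0)
    have fin: "(\<Sum>r\<in>A. loop (Poly_Mapping.lookup p r) r) \<in> U" if "finite A" "A \<subseteq> Poly_Mapping.keys p" for A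
      using that by (induction A) (auto simp: U_0 add U p)
    have lp: "loop_part (sum f A) = (\<Sum>a\<in>A. loop_part (f a))" "central_part (sum f A) = (\<Sum>a\<in>A. central_part (f a))" for f :: "int \<Rightarrow> affine" and A
      by (induction A rule: infinite_finite_induct) (simp_all add: affine_simps)
    have "x = (\<Sum>r\<in>Poly_Mapping.keys p. loop (Poly_Mapping.lookup p r) r)"
    proof (rule affine.expand, intro conjI)
      show "loop_part x = loop_part (\<Sum>r\<in>Poly_Mapping.keys p. loop (Poly_Mapping.lookup p r) r)"
        by (rule poly_mapping_eqI) (auto simp: x lp loop_def lookup_sum lookup_single when_def in_keys_iff)
      show "central_part x = central_part (\<Sum>r\<in>Poly_Mapping.keys p. loop (Poly_Mapping.lookup p r) r)"
        by (simp add: x lp loop_def)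
    qed
    then show ?thesis using fin [of "Poly_Mapping.keys p"] by simp
  qed
  then show ?thesis using S by (simp add: ff_center_iff U_def vacuum_class_eq_0_iff)
qed

lemma vc_S2_0: "vacuum_class (el Y 0 * S2) = 0" by (simp add: S2_gtrace vc_gtrace_0)

lemma vc_S6_0: "vacuum_class (el Y 0 * S6) = 0"
proof -
  have n: "vacuum_class (a * (numeral k * gtrace rs)) = vacuum_class (numeral k * (a * gtrace rs))" for a k rs
    using mult_of_int_commute [of "numeral k" a] by (simp add: mult.assoc [symmetric])
  have "vacuum_class (numeral k * (el Y 0 * gtrace rs)) = 0" for k rs
    using vc_cong [of "el Y 0 * gtrace rs" 0 "numeral k"] by (simp add: vc_gtrace_0 vc_0)
  then show ?thesis
    by (simp add: S6_gtrace gS6_def distrib_left right_diff_distrib vc_add vc_diff n vc_gtrace_0)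
qed

lemma S2_center: "S2 \<in> feigin_frenkel_center"
  using center_criterion symb_S2 vc_S2_0 S2_lowered by (simp add: symb_def)

subsection \<open>Reversal of words\<close>

definition Gword :: "int list \<Rightarrow> affine uenv^7^7"
  where "Gword zs = foldr (\<lambda>r M. Gseries r ** M) zs (mat 1)"

lemma Gword_append: "Gword (zs @ [z]) = Gword zs ** Gseries z"
  by (induction zs) (simp_all add: Gword_def matrix_mul_assoc [symmetric])

lemma G_skew: "G i j = (- 1) \<cdot> G (8 - j) (8 - i)"
proof (rule g2_form_nondegenerate)
  fix Z
  have "mat_of_g2 Z $ j $ i = - mat_of_g2 Z $ (8 - i) $ (8 - j)"
    using g2_entries_mat [of Z] by (intro skew_entriesD) (simp add: g2_entries_def)
  then show "g2_form (G i j) Z = g2_form ((- 1) \<cdot> G (8 - j) (8 - i)) Z"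
    by (simp add: g2_form_cscale_left form_G)
qed

lemma antip_sum: "antip (sum f A) = (\<Sum>a\<in>A. antip (f a))"
  using antip_scalar [of 0] by (induction A rule: infinite_finite_induct) (simp_all add: uscalar_simps antip_add)

text \<open>The antipode reverses the factors and changes each sign; the skew symmetry of the
  \<open>G i j\<close> absorbs the signs and reflects the matrix in its antidiagonal.\<close>

lemma antip_Gword: "antip (Gword zs $ j $ i) = Gword (rev zs) $ (8 - i) $ (8 - j)"
proof (induction zs arbitrary: j)
  case Nil
  have "antip 0 = (0 :: affine uenv)" using antip_scalar [of 0, where 'a = affine] by (simp add: uscalar_simps)
  then show ?case by (simp add: Gword_def mat_def antip_1)
next
  case (Cons z zs)
  have "antip (Gword (z # zs) $ j $ i) = (\<Sum>l\<in>UNIV. antip (Gword zs $ l $ i) * - el (G l j) z)"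
    by (simp add: Gword_def matrix_matrix_mult_def Gseries_def antip_sum antip_mult antip_embed el_def)
  also have "\<dots> = (\<Sum>l\<in>UNIV. Gword (rev zs) $ (8 - i) $ (8 - l) * el (G (8 - j) (8 - l)) z)"
    by (rule sum.cong) (simp_all only: Cons, simp add: G_skew [of _ j] el_cscale uscalar_simps)
  also have "\<dots> = (\<Sum>l\<in>UNIV. Gword (rev zs) $ (8 - i) $ l * el (G (8 - j) l) z)"
    by (rule sum.reindex_bij_witness [of _ "\<lambda>l. 8 - l" "\<lambda>l. 8 - l"]) simp_all
  also have "\<dots> = Gword (rev (z # zs)) $ (8 - i) $ (8 - j)"
    by (simp add: Gword_append matrix_matrix_mult_def Gseries_def el_def)
  finally show ?case .
qed

lemma antip_trG: "antip (trG zs) = trG (rev zs)"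
proof -
  have "antip (trG zs) = (\<Sum>i\<in>UNIV. Gword (rev zs) $ (8 - i) $ (8 - i))"
    by (simp add: trG_def trace_def antip_sum antip_Gword flip: Gword_def)
  also have "\<dots> = (\<Sum>i\<in>UNIV. Gword (rev zs) $ i $ i)"
    by (rule sum.reindex_bij_witness [of _ "\<lambda>l. 8 - l" "\<lambda>l. 8 - l"]) simp_all
  finally show ?thesis by (simp add: trG_def trace_def Gword_def)
qed

lemma antip_gtrace: "antip (gtrace rs) = gtrace (rev rs)"
  unfolding trG_eq [symmetric] antip_trG rev_map ..

lemma antip_numeral: "antip (numeral k * u) = numeral k * antip (u :: affine uenv)"
proof -
  have n: "antip (numeral k) = (numeral k :: affine uenv)"
    using antip_scalar [of "numeral k", where 'a = affine] by (simp only: uscalar_numeral)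
  show ?thesis
    using uscalar_commute [of "numeral k" "antip u"] by (simp only: antip_mult n uscalar_numeral)
qed

lemma antip_S2: "antip S2 = S2"
  by (simp add: S2_gtrace antip_gtrace)

lemma sem_anti0: "sem (anti0 unit_mat) = S6 - antip S6"
proof -
  let ?R = "rows_mul G_rows"
  note w0 = word_ok_unit
  note w1 = word_ok_step [OF w0, of 0] word_ok_step [OF w0, of 1] word_ok_step [OF w0, of 2]
  note w2 = word_ok_step [OF w1(1), of 0] word_ok_step [OF w1(1), of 1] word_ok_step [OF w1(2), of 0]
    word_ok_step [OF w1(2), of 1] word_ok_step [OF w1(3), of 0] word_ok_step [OF w1(3), of 1]
  note w3 = word_ok_step [OF w2(1), of 0] word_ok_step [OF w2(3), of 0] word_ok_step [OF w2(5), of 0]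
    word_ok_step [OF w2(1), of 1] word_ok_step [OF w2(4), of 0]
  note w4 = word_ok_step [OF w3(1), of 0] word_ok_step [OF w3(2), of 0]
  note t = sem_trace_word [OF w3(1), of 2] sem_trace_word [OF w4(1), of 1] sem_trace_word [OF w4(2), of 0]
    sem_trace_word [OF w3(3), of 0] sem_trace_word [OF w3(4), of 1] sem_trace_word [OF w3(5), of 0]
    sem_trace_word [OF w2(2), of 2] sem_trace_word [OF w2(6), of 0]
  have "sem (anti0 unit_mat) = 14 * gtrace [2, 0, 0, 0] + 5 * (gtrace [1, 0, 0, 0, 0] + - gtrace [0, 0, 0, 0, 1])
      + (- 14 * gtrace [0, 0, 0, 2] + (31 * (gtrace [1, 1, 0, 0] + - gtrace [0, 0, 1, 1]) + - 312 * (gtrace [2, 1, 0] + - gtrace [0, 1, 2])))"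
    by (simp only: anti0_def anti1_def anti2_def anti3_def sem_tadd sem_tscale t of_int_numeral of_int_minus of_int_1 mult_minus1 mult_1)
  then show ?thesis
    by (simp add: S6_gtrace gS6_def antip_add antip_diff antip_numeral antip_gtrace distrib_left right_diff_distrib algebra_simps)
qed

text \<open>All ordered words in E12[1] times \<open>S6\<close> cancel; by \<open>chk0_sound\<close>
  this is the annihilation required in \<open>center_criterion\<close>.\<close>

lemma S6_check: "chk0 (unit_mat, zero_mat) = Node 0 Leaf"
  by (simp only: prog)

lemma anti_check: "anti0 unit_mat = Node 0 Leaf"
  by (simp only: prog)

lemma antip_S6: "antip S6 = S6"
  using sem_anti0 by (simp add: anti_check)

lemma S6_center: "S6 \<in> feigin_frenkel_center"
proof (rule center_criterion)
  show "S6 \<in> generated_subalgebra loops_neg" using symb_S6 by (simp add: symb_def)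
  show "vacuum_class (el (bas E12) 1 * S6) = 0"
    unfolding chk0_sound S6_check by (simp add: vc_0)
qed (rule vc_S6_0)

section \<open>Invariants as polynomials in the symbols, and commutativity\<close>

lemma symb_family: "symb (weight v) (sugawara_family v) (fam v)"
proof -
  have "symb 2 ((uenv_D ^^ k) S2) ((delta ^^ k) lead_S2)" "symb 6 ((uenv_D ^^ k) S6) ((delta ^^ k) lead_S6)" for k
    by (induction k) (simp_all add: symb_S2 symb_S6 symb_D)
  then show ?thesis by (simp add: weight_def sugawara_family_def fam_def split: sum.split)
qed

lemma family_center: "sugawara_family v \<in> feigin_frenkel_center"
proof -
  have "(uenv_D ^^ k) S2 \<in> feigin_frenkel_center" "(uenv_D ^^ k) S6 \<in> feigin_frenkel_center" for k
    by (induction k) (simp_all add: S2_center S6_center ff_center_D)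
  then show ?thesis by (simp add: sugawara_family_def split: sum.split)
qed

lemma antip_family: "antip (sugawara_family v) = sugawara_family v"
proof -
  have "antip ((uenv_D ^^ k) S2) = (uenv_D ^^ k) S2" "antip ((uenv_D ^^ k) S6) = (uenv_D ^^ k) S6" for k
    by (induction k) (simp_all add: antip_S2 antip_S6 antip_D)
  then show ?thesis by (simp add: sugawara_family_def split: sum.split)
qed

lemma homog_fam: "homog (weight v) (fam v)"
  using symb_family by (simp add: symb_def)

lemma invariant_fam: "invariant (fam v)"
  using invariant_center family_center symb_family .

lemma invariant_diff: "invariant p \<Longrightarrow> invariant q \<Longrightarrow> invariant (p - q)"
  by (simp add: invariant_def linop_diff [OF linop_der])

lemma lookup_mon: "Poly_Mapping.lookup (mon M) N = of_bool (M = N)"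
  by (simp add: mon_def lookup_single when_def)

lemma hc_homog:
  assumes "homog d p"
  shows "hc d' p = (if d = d' then p else 0)"
proof -
  have "hc d' p = (\<Sum>M\<in>Poly_Mapping.keys p. cst (Poly_Mapping.lookup p M) * hc d' (mon M))"
    by (rule linop_expand [OF linop_hc])
  also have "\<dots> = (\<Sum>M\<in>Poly_Mapping.keys p. cst (Poly_Mapping.lookup p M) * (if d = d' then mon M else 0))"
    by (rule sum.cong) (use assms in \<open>auto simp: hc_mon homog_def\<close>)
  also have "\<dots> = (if d = d' then p else 0)"
    using linop_expand [OF linop_id, of p] by simp
  finally show ?thesis .
qed

abbreviation total_weight :: "(nat + nat) multiset \<Rightarrow> nat" where "total_weight M \<equiv> \<Sum>v\<in>#M. weight v"

lemma homog_invariant: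
  assumes "invariant q" "homog d q"
  obtains F where "q = peval fam F" "\<And>M. M \<in> Poly_Mapping.keys F \<Longrightarrow> total_weight M = d"
proof -
  \<comment> \<open>Restricted to the slice, \<open>q\<close> is rewritten in the restrictions of
    the family. The two invariants agree there, hence everywhere.\<close>
  define F where "F = peval unslice (peval slice_val q)"
  have "peval slice_val (peval fam F) = peval slice_val q"
    unfolding slice_peval_fam F_def peval_peval [of slice_fam] slice_fam_unslice by (simp add: peval_id)
  then have "q - peval fam F = 0"
    by (intro invariant_eq_0 invariant_diff assms invariant_peval invariant_fam) (simp add: peval_simps)
  then have q: "q = peval fam F" by simp
  \<comment> \<open>Since \<open>fam v\<close> is homogeneous of degree \<open>weight v\<close>,
    discarding the other total weights in \<open>F\<close> corresponds to taking the component of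
    degree \<open>d\<close>.\<close>
  define cut :: "(nat + nat) mpoly \<Rightarrow> (nat + nat) mpoly" where "cut = lin (\<lambda>M. if total_weight M = d then mon M else 0)"
  have "peval fam (cut p) = hc d (peval fam p)" for p
  proof (rule linop_eqI [of "\<lambda>p. peval fam (cut p)" "\<lambda>p. hc d (peval fam p)"])
    show "linop (\<lambda>p. peval fam (cut p))"
      using linop_comp [OF linop_peval linop_lin] by (simp add: cut_def)
    show "linop (\<lambda>p. hc d (peval fam p))" by (rule linop_comp [OF linop_hc linop_peval])
    show "peval fam (cut (mon M)) = hc d (peval fam (mon M))" for M
      using hc_homog [OF peval_homog [OF homog_fam, where M = M], of d] by (simp add: cut_def peval_simps)
  qed
  then have "q = peval fam (cut F)" using hc_homog [OF assms(2), of d] q by simp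
  moreover have "total_weight M = d" if "M \<in> Poly_Mapping.keys (cut F)" for M
  proof -
    have "Poly_Mapping.lookup (cut F) M = (\<Sum>N\<in>Poly_Mapping.keys F. Poly_Mapping.lookup (cst (Poly_Mapping.lookup F N) * (if total_weight N = d then mon N else 0)) M)"
      unfolding cut_def lin_def by (simp add: lookup_sum)
    also have "\<dots> = 0" if "total_weight M \<noteq> d"
      by (rule sum.neutral) (use that in \<open>auto simp: lookup_mon\<close>)
    finally show ?thesis using that by (auto simp: in_keys_iff)
  qed
  ultimately show thesis by (rule that)
qed

lemma odd_invariant:
  assumes "invariant q" "homog d q" "odd d"
  shows "q = 0"
proof -
  obtain F where q: "q = peval fam F" and F: "\<And>M. M \<in> Poly_Mapping.keys F \<Longrightarrow> total_weight M = d"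
    using homog_invariant [OF assms(1,2)] by blast
  have "even (total_weight M)" for M by (induction M) (simp_all add: weight_def split: sum.split)
  then have "Poly_Mapping.keys F = {}" using F assms(3) by blast
  then show ?thesis using q by (simp add: peval_simps)
qed

lemma symb_down: "symb (Suc d) u 0 \<Longrightarrow> \<exists>q. symb d u q"
  using symb_ex [of u d] by (auto simp: symb_def below_iff_bdd)

lemma symb_below_0: "symb 0 u 0 \<Longrightarrow> u = 0"
  using below_zero_eq [of "V.Phi u"] Psi_Phi [of u] by (auto simp: symb_def V.Psi_0)

lemma symb_exists: "u \<in> feigin_frenkel_center \<Longrightarrow> \<exists>d q. symb d u q"
  using ex_bdd [of "V.Phi u"] symb_ex [of u] by (auto simp: ff_center_iff)

lemma neg_eq_0: "- q = q \<Longrightarrow> q = 0" for q :: "'v mpoly"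
proof (rule poly_mapping_eqI)
  fix M assume "- q = q"
  then have "- Poly_Mapping.lookup q M = Poly_Mapping.lookup q M" by (metis lookup_uminus)
  then show "Poly_Mapping.lookup q M = Poly_Mapping.lookup 0 M" by simp
qed

text \<open>A vector on which the antipode acts by \<open>-1\<close> would have a symbol of odd degree, but the invariants live in even degrees.\<close>

lemma antip_odd_eq_0:
  assumes "u \<in> feigin_frenkel_center" "antip u = - u"
  shows "u = 0"
proof -
  have "symb d u q \<Longrightarrow> u = 0" for d q
  proof (induction d arbitrary: q)
    case d: 0
    then have "- q = q" using symb_unique [OF symb_uminus [OF d] symb_antip [OF d, unfolded assms(2)]] by (simp add: cst_simps)
    then show ?case using d symb_below_0 neg_eq_0 by metis
  next
    case (Suc d)
    have "q = 0"
    \<comment> \<open>In even degree the antipode fixes the symbol, which it negates by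
      assumption.\<close>
    proof (cases "even (Suc d)")
      case True
      then have "- q = q"
        using symb_unique [OF symb_uminus [OF Suc.prems] symb_antip [OF Suc.prems, unfolded assms(2)]] by (simp add: cst_simps)
      then show ?thesis by (rule neg_eq_0)
    next
      case False
      then show ?thesis
        using odd_invariant invariant_center [OF assms(1) Suc.prems] Suc.prems by (auto simp: symb_def)
    qed
    then show ?case using symb_down [of d u] Suc by blast
  qed
  then show ?thesis using symb_exists [OF assms(1)] by blast
qed

lemma family_commute: "sugawara_family v * sugawara_family w = sugawara_family w * sugawara_family v"
proof -
  let ?u = "sugawara_family v * sugawara_family w - sugawara_family w * sugawara_family v"
  have "?u = 0"
    by (rule antip_odd_eq_0)
      (simp_all add: ff_center_lin ff_center_mult family_center antip_diff antip_mult antip_family)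
  then show ?thesis by simp
qed

section \<open>Independence and generation\<close>

text \<open>Translates the exponents of \<open>polynomial_eval\<close> into the multisets on which
  symbols are built.\<close>

definition exponent_mset :: "('v \<Rightarrow>\<^sub>0 nat) \<Rightarrow> 'v multiset"
  where "exponent_mset m = Abs_multiset (Poly_Mapping.lookup m)"

lemma count_exponent_mset: "count (exponent_mset m) v = Poly_Mapping.lookup m v"
proof -
  have "{v. 0 < Poly_Mapping.lookup m v} = Poly_Mapping.keys m" by (auto simp: in_keys_iff)
  then show ?thesis unfolding exponent_mset_def by (simp add: Abs_multiset_inverse)
qed

lemma set_exponent_mset: "set_mset (exponent_mset m) = Poly_Mapping.keys m"
  by (auto simp: count_exponent_mset in_keys_iff simp flip: count_greater_zero_iff)

lemma exponent_mset_inject: "exponent_mset m = exponent_mset m' \<longleftrightarrow> m = m'"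
  by (metis count_exponent_mset poly_mapping_eqI)

lemma sum_mset_count:
  fixes w :: "'v \<Rightarrow> nat"
  assumes "finite A" "set_mset M \<subseteq> A"
  shows "(\<Sum>v\<in>#M. w v) = (\<Sum>v\<in>A. count M v * w v)"
  using assms(2)
proof (induction M)
  case (add x M)
  have "(\<Sum>v\<in>A. count (add_mset x M) v * w v) = (\<Sum>v\<in>A. count M v * w v + (if v = x then w v else 0))"
    by (rule sum.cong) auto
  also have "\<dots> = (\<Sum>v\<in>A. count M v * w v) + w x"
    using add.prems assms(1) by (simp add: sum.distrib)
  finally show ?case using add by simp
qed simp

lemma exponent_mset_surj: "\<exists>m. exponent_mset m = M"
proof -
  have "{v. count M v \<noteq> 0} = set_mset M" by (auto simp: count_eq_zero_iff)
  then have "Poly_Mapping.lookup (Abs_poly_mapping (count M)) = count M"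
    using finite_set_mset [of M] by (intro Abs_poly_mapping_inverse) simp
  then have "count (exponent_mset (Abs_poly_mapping (count M))) v = count M v" for v
    by (simp only: count_exponent_mset)
  then have "exponent_mset (Abs_poly_mapping (count M)) = M" by (rule multiset_eqI)
  then show ?thesis ..
qed

text \<open>The fold can be evaluated only for commuting factors, so \<open>family_commute\<close>
  comes first; then symbols multiply.\<close>

lemma monomial_eval_family:
  "monomial_eval sugawara_family m \<in> feigin_frenkel_center \<and>
   symb (total_weight (exponent_mset m)) (monomial_eval sugawara_family m) (peval fam (mon (exponent_mset m)))"
proof -
  let ?n = "Poly_Mapping.lookup m"
  let ?f = "\<lambda>v u. sugawara_family v ^ ?n v * u"
  have c: "sugawara_family v ^ a * sugawara_family w ^ b = sugawara_family w ^ b * sugawara_family v ^ a" for v w a b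
    by (metis family_commute power_commuting_commutes)
  interpret comp_fun_commute ?f
    by standard (auto simp: fun_eq_iff c simp flip: mult.assoc)
  have p: "u ^ n \<in> feigin_frenkel_center" if "u \<in> feigin_frenkel_center" for u n
    using that ff_center_uscalar [of 1] by (induction n) (simp_all add: uscalar_simps ff_center_mult)
  have *: "Finite_Set.fold ?f 1 A \<in> feigin_frenkel_center \<and>
      symb (\<Sum>v\<in>A. ?n v * weight v) (Finite_Set.fold ?f 1 A) (\<Prod>v\<in>A. fam v ^ ?n v)" if "finite A" for A
    using that
  proof (induction A)
    case empty
    then show ?case using ff_center_uscalar [of 1] by (simp add: uscalar_simps symb_1)
  next
    case (insert v A)
    then show ?case by (simp add: ff_center_mult p family_center symb_mult symb_power symb_family)
  qed
  have "(\<Sum>v\<in>Poly_Mapping.keys m. ?n v * weight v) = total_weight (exponent_mset m)"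
    by (subst sum_mset_count [of "Poly_Mapping.keys m"]) (simp_all add: set_exponent_mset count_exponent_mset)
  moreover have "(\<Prod>v\<in>Poly_Mapping.keys m. fam v ^ ?n v) = peval fam (mon (exponent_mset m))"
    by (simp add: peval_mon image_prod_mset_multiplicity set_exponent_mset count_exponent_mset)
  ultimately show ?thesis using * [of "Poly_Mapping.keys m"] by (simp add: monomial_eval_def)
qed

lemma polynomial_eval_add: "polynomial_eval f (P + Q) = polynomial_eval f P + polynomial_eval f Q"
  unfolding polynomial_eval_def
  by (rule setsum_keys_plus_distrib) (simp_all add: uscalar_simps distrib_right)

lemma polynomial_eval_single: "polynomial_eval f (Poly_Mapping.single m c) = uscalar c * monomial_eval f m"
  by (simp add: polynomial_eval_def uscalar_simps)

lemma polynomial_eval_sum: "polynomial_eval f (sum P A) = (\<Sum>a\<in>A. polynomial_eval f (P a))"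
  by (induction A rule: infinite_finite_induct) (simp_all add: polynomial_eval_add, simp_all add: polynomial_eval_def)

text \<open>The part of largest total weight would give a relation between the symbols, which
  \<open>fam_independent\<close> excludes.\<close>

lemma family_independent:
  assumes "polynomial_eval sugawara_family P = 0"
  shows "P = 0"
proof (rule ccontr)
  assume "P \<noteq> 0"
  then have ne: "Poly_Mapping.keys P \<noteq> {}" by simp
  define T where "T = (\<lambda>m. total_weight (exponent_mset m)) ` Poly_Mapping.keys P"
  define d where "d = Max T"
  have "d \<in> T" using ne by (simp add: d_def T_def)
  then obtain m0 where m0: "m0 \<in> Poly_Mapping.keys P" "total_weight (exponent_mset m0) = d" by (auto simp: T_def)
  \<comment> \<open>Monomials of smaller weight have zero symbol in degree \<open>d\<close>.\<close>
  define F where "F = (\<Sum>m\<in>Poly_Mapping.keys P. cst (Poly_Mapping.lookup P m) *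
    (if total_weight (exponent_mset m) = d then mon (exponent_mset m) else 0))"
  have "symb d (monomial_eval sugawara_family m) (peval fam (if total_weight (exponent_mset m) = d then mon (exponent_mset m) else 0))"
    if "m \<in> Poly_Mapping.keys P" for m
  proof (cases "total_weight (exponent_mset m) = d")
    case False
    moreover have "total_weight (exponent_mset m) \<le> d" using that by (auto simp: d_def T_def)
    ultimately show ?thesis using symb_raise [of "total_weight (exponent_mset m)" _ _ d] monomial_eval_family [of m]
      by (auto simp: peval_simps)
  qed (use monomial_eval_family [of m] in auto)
  then have "symb d (polynomial_eval sugawara_family P) (peval fam F)"
    unfolding polynomial_eval_def F_def peval_simps by (intro symb_sum symb_cscale) auto
  then have "peval fam F = 0" using symb_unique symb_0 assms by metis
  then have "F = 0" by (rule fam_independent)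
  moreover have "Poly_Mapping.lookup F (exponent_mset m0) =
      (\<Sum>m\<in>Poly_Mapping.keys P. if m = m0 then Poly_Mapping.lookup P m else 0)"
    unfolding F_def lookup_sum
    by (rule sum.cong) (use m0 in \<open>auto simp: lookup_cst_mult lookup_mon exponent_mset_inject\<close>)
  ultimately show False using m0 by (simp add: in_keys_iff)
qed

text \<open>The symbol of \<open>u\<close> is a polynomial in the \<open>fam v\<close>; subtracting
  the same polynomial in the family stays in the center and lowers the degree.\<close>

lemma family_generates:
  assumes "u \<in> feigin_frenkel_center"
  shows "\<exists>P. u = polynomial_eval sugawara_family P"
proof -
  have P: "\<exists>P. polynomial_eval sugawara_family P \<in> feigin_frenkel_center \<and> symb d (polynomial_eval sugawara_family P) q"
    if inv: "invariant q" "homog d q" for d q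
  proof -
    obtain F where q: "q = peval fam F" and F: "\<And>M. M \<in> Poly_Mapping.keys F \<Longrightarrow> total_weight M = d"
      using homog_invariant [OF inv] by blast
    obtain m where m: "\<And>M. exponent_mset (m M) = (M :: (nat + nat) multiset)" using choice [of "\<lambda>M m. exponent_mset m = M"] exponent_mset_surj by blast
    let ?u = "\<lambda>M. uscalar (Poly_Mapping.lookup F M) * monomial_eval sugawara_family (m M)"
    have e: "polynomial_eval sugawara_family (\<Sum>M\<in>Poly_Mapping.keys F. Poly_Mapping.single (m M) (Poly_Mapping.lookup F M))
        = (\<Sum>M\<in>Poly_Mapping.keys F. ?u M)"
      by (simp add: polynomial_eval_sum polynomial_eval_single)
    have c: "(\<Sum>M\<in>A. ?u M) \<in> feigin_frenkel_center" for A
      using ff_center_uscalar [of 0] monomial_eval_family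
      by (induction A rule: infinite_finite_induct) (simp_all add: uscalar_simps ff_center_lin)
    have s: "symb d (\<Sum>M\<in>Poly_Mapping.keys F. ?u M) (\<Sum>M\<in>Poly_Mapping.keys F. cst (Poly_Mapping.lookup F M) * peval fam (mon M))"
      using monomial_eval_family [of "m M" for M] by (intro symb_sum symb_cscale) (metis F m)
    have "(\<Sum>M\<in>Poly_Mapping.keys F. cst (Poly_Mapping.lookup F M) * peval fam (mon M)) = q"
      unfolding q by (rule linop_expand [OF linop_peval, symmetric])
    from s [unfolded this] c [of "Poly_Mapping.keys F"] show ?thesis unfolding e [symmetric] by blast
  qed
  have "u \<in> feigin_frenkel_center \<Longrightarrow> symb d u q \<Longrightarrow> \<exists>P. u = polynomial_eval sugawara_family P" for d q u
  proof (induction d arbitrary: q u)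
    case 0
    then obtain P where "polynomial_eval sugawara_family P \<in> feigin_frenkel_center" "symb 0 (polynomial_eval sugawara_family P) q"
      using P [of q 0] invariant_center [OF 0] by (auto simp: symb_def)
    then have "symb 0 (u - polynomial_eval sugawara_family P) 0" using symb_diff [OF 0(2)] by force
    from symb_below_0 [OF this] show ?case by auto
  next
    case (Suc d)
    then obtain P where P: "polynomial_eval sugawara_family P \<in> feigin_frenkel_center" "symb (Suc d) (polynomial_eval sugawara_family P) q"
      using P [of q "Suc d"] invariant_center [OF Suc.prems] by (auto simp: symb_def)
    then have "symb (Suc d) (u - polynomial_eval sugawara_family P) 0" using symb_diff [OF Suc.prems(2)] by force
    then obtain q' where "symb d (u - polynomial_eval sugawara_family P) q'" using symb_down by blast
    from Suc.IH [OF ff_center_lin(3) [OF Suc.prems(1) P(1)] this]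
    obtain Q where "u - polynomial_eval sugawara_family P = polynomial_eval sugawara_family Q" ..
    then have "u = polynomial_eval sugawara_family (Q + P)" by (simp add: polynomial_eval_add algebra_simps)
    then show ?case ..
  qed
  then show ?thesis using symb_exists [OF assms] assms by blast
qed

theorem theoremA:
  shows "S2 \<in> feigin_frenkel_center \<and> S6 \<in> feigin_frenkel_center \<and>
    alg_independent sugawara_family \<and>
    (\<forall>u\<in>feigin_frenkel_center. \<exists>P. u = polynomial_eval sugawara_family P)"
  using S2_center S6_center family_commute family_independent family_generates
  unfolding alg_independent_def by blast

end
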